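(* Let $\mathscr{T}$ be a hierarchical T-mesh (of $2\times 2$ division) with level $n$, having $V^+$ crossing-vertices, $V^b$ boundary vertices and $E$ interior l-edges. For $1\leqslant i\leqslant n$ let $\delta_{1i}$ be the number of connected components of $T_i$ that divide only one interior cell of $\mathscr{T}^{i-1}$ (i.e. components whose l-edges divide exactly one cell of $\mathscr{T}^{i-1}$, this cell being an interior cell). Put $\delta_1=\sum_{i=1}^n\delta_{1i}$. Then $$\dim \mathbf{S}^2(\mathscr{T})=2V^b+V^+-E+\delta_1+1 .$$
   Context: A (regular) T-mesh is a finite set of axis-aligned rectangles (cells) whose union $\Omega$ is a rectangle and such that any two distinct cells meet, if at all, only in boundary points. Vertices are the corner points of cells; an edge is a segment of a grid line joining two consecutive vertices. A vertex on $\partial\Omega$ is a boundary vertex (the four corners of $\Omega$ included), any other is an interior vertex; an interior vertex is a crossing-vertex if it has valence 4 and a T-junction otherwise. An edge on $\partial\Omega$ is a boundary edge, otherwise an interior edge. A cell is an interior cell if all its edges are interior edges, otherwise a boundary cell. An interior l-edge is a longest possible line segment made of connected collinear interior edges; its two end points are T-junctions or boundary vertices. Hierarchical T-mesh of $2\times2$ division: start from a tensor-product mesh $\mathscr{T}^0$ (level 0); given $\mathscr{T}^{k}$, some cells of level $k$ are each divided equally into $2\times 2$ subcells, giving $\mathscr{T}^{k+1}$; the new vertices, edges and cells have level $k+1$. The final mesh is $\mathscr{T}=\mathscr{T}^n$, where $n$ is the maximal level number that appears. All edges of an interior l-edge are introduced at the same level, which is the level of the l-edge. $T_i$ is the set of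 all level $i$ l-edges and all level $i$ vertices of $\mathscr{T}$. For $i\geqslant1$, the connected components of $T_i$ are the parts into which $T_i$ splits so that l-edges of different parts do not intersect (and no part can be split further). A component divides a cell of $\mathscr{T}^{i-1}$ if its l-edges subdivide that cell. Spline space: $\mathbf{S}^d(\mathscr{T})=\{f\in C^{d-1,d-1}(\Omega): f|_\phi\in\mathbb{P}_{dd}\text{ for every cell }\phi\text{ of }\mathscr{T}\}$, where $\mathbb{P}_{dd}$ is the space of polynomials of bi-degree $(d,d)$ and $C^{d-1,d-1}$ denotes functions continuous of order $d-1$ in the $x$-direction and of order $d-1$ in the $y$-direction (i.e. $\partial_x^a\partial_y^b f$ continuous for $0\leqslant a,b\leqslant d-1$). *)

theory Defs
  imports "HOL-Analysis.Analysis" "HOL-Library.Function_Algebras"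
begin

type_synonym point = "real \<times> real"

(* A cell is given by its lower left and its upper right corner. *)
type_synonym cell = "point \<times> point"

definition region :: "cell \<Rightarrow> point set" where
  "region \<phi> = cbox (fst \<phi>) (snd \<phi>)"

fun corners :: "cell \<Rightarrow> point set" where
  "corners ((a, c), (b, d)) = {a, b} \<times> {c, d}"

fun quarters :: "cell \<Rightarrow> cell set" where
  "quarters ((a, c), (b, d)) =
    (let m = (a + b) / 2; k = (c + d) / 2 in
     {((a, c), (m, k)), ((m, c), (b, k)), ((a, k), (m, d)), ((m, k), (b, d))})"


section \<open>Vertices, edges and l-edges of a mesh\<close>

definition mesh_domain :: "cell set \<Rightarrow> point set" where
  "mesh_domain M = (\<Union>\<phi>\<in>M. region \<phi>)"

definition skeleton :: "cell set \<Rightarrow> point set" where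
  "skeleton M = (\<Union>\<phi>\<in>M. frontier (region \<phi>))"

definition mesh_vertices :: "cell set \<Rightarrow> point set" where
  "mesh_vertices M = (\<Union>\<phi>\<in>M. corners \<phi>)"

definition mesh_edges :: "cell set \<Rightarrow> point set set" where
  "mesh_edges M = {closed_segment v w | v w.
     v \<in> mesh_vertices M \<and> w \<in> mesh_vertices M \<and> v \<noteq> w \<and>
     (fst v = fst w \<or> snd v = snd w) \<and>
     closed_segment v w \<subseteq> skeleton M \<and>
     open_segment v w \<inter> mesh_vertices M = {}}"

definition boundary_vertices :: "cell set \<Rightarrow> point set" where
  "boundary_vertices M = {v \<in> mesh_vertices M. v \<in> frontier (mesh_domain M)}"

definition interior_vertices :: "cell set \<Rightarrow> point set" where
  "interior_vertices M = mesh_vertices M - boundary_vertices M"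

definition valence :: "cell set \<Rightarrow> point \<Rightarrow> nat" where
  "valence M v = card {e \<in> mesh_edges M. v \<in> e}"

definition crossing_vertices :: "cell set \<Rightarrow> point set" where
  "crossing_vertices M = {v \<in> interior_vertices M. valence M v = 4}"

definition boundary_edges :: "cell set \<Rightarrow> point set set" where
  "boundary_edges M = {e \<in> mesh_edges M. e \<subseteq> frontier (mesh_domain M)}"

definition interior_edges :: "cell set \<Rightarrow> point set set" where
  "interior_edges M = mesh_edges M - boundary_edges M"

definition interior_cells :: "cell set \<Rightarrow> cell set" where
  "interior_cells M =
    {\<phi> \<in> M. \<forall>e\<in>mesh_edges M. e \<subseteq> frontier (region \<phi>) \<longrightarrow> e \<in> interior_edges M}"

(* The edges in F are automatically connected and collinear, since their union is a segment. *)
definition interior_line :: "cell set \<Rightarrow> point set \<Rightarrow> bool" where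
  "interior_line M l \<longleftrightarrow>
    (\<exists>a b F. F \<noteq> {} \<and> F \<subseteq> interior_edges M \<and> l = closed_segment a b \<and> l = \<Union>F)"

definition interior_ledges :: "cell set \<Rightarrow> point set set" where
  "interior_ledges M =
    {l. interior_line M l \<and> (\<forall>l'. interior_line M l' \<and> l \<subseteq> l' \<longrightarrow> l' = l)}"


section \<open>Hierarchical T-meshes\<close>

definition tensor_product_mesh :: "cell set \<Rightarrow> bool" where
  "tensor_product_mesh M \<longleftrightarrow>
    (\<exists>xs ys. sorted_wrt (<) xs \<and> sorted_wrt (<) ys \<and> 2 \<le> length xs \<and> 2 \<le> length ys \<and>
       M = {((xs ! i, ys ! j), (xs ! Suc i, ys ! Suc j)) | i j.
              Suc i < length xs \<and> Suc j < length ys})"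

(* A hierarchical mesh is given by the sequence T 0, T 1, ..., T n of its intermediate meshes;
   the mesh itself is T n. *)

fun level_cells :: "(nat \<Rightarrow> cell set) \<Rightarrow> nat \<Rightarrow> cell set" where
  "level_cells T 0 = T 0"
| "level_cells T (Suc k) = T (Suc k) - T k"

(* At least one cell is divided in every step, so that n is the maximal level that appears. *)
definition hierarchical_mesh :: "(nat \<Rightarrow> cell set) \<Rightarrow> nat \<Rightarrow> bool" where
  "hierarchical_mesh T n \<longleftrightarrow>
    tensor_product_mesh (T 0) \<and>
    (\<forall>k<n. \<exists>D. D \<noteq> {} \<and> D \<subseteq> level_cells T k \<and>
              T (Suc k) = (T k - D) \<union> (\<Union>\<phi>\<in>D. quarters \<phi>))"

definition vertex_level :: "(nat \<Rightarrow> cell set) \<Rightarrow> point \<Rightarrow> nat" where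
  "vertex_level T v = (LEAST k. v \<in> mesh_vertices (T k))"

(* The level of an edge is the level at which its points become part of the grid; an edge that
   is cut by a vertex of a later level leaves two edges of the original level. *)
definition edge_level :: "(nat \<Rightarrow> cell set) \<Rightarrow> point set \<Rightarrow> nat" where
  "edge_level T e = (LEAST k. e \<subseteq> skeleton (T k))"

definition level_ledges :: "(nat \<Rightarrow> cell set) \<Rightarrow> nat \<Rightarrow> nat \<Rightarrow> point set set" where
  "level_ledges T n i =
    {l \<in> interior_ledges (T n). \<forall>e\<in>mesh_edges (T n). e \<subseteq> l \<longrightarrow> edge_level T e = i}"

(* The set T_i of the level i l-edges and the level i vertices; a vertex v is represented by {v},
   so that incidence of vertices and l-edges is intersection of point sets. *)
definition level_part :: "(nat \<Rightarrow> cell set) \<Rightarrow> nat \<Rightarrow> nat \<Rightarrow> point set set" where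
  "level_part T n i =
    level_ledges T n i \<union> {{v} | v. v \<in> mesh_vertices (T n) \<and> vertex_level T v = i}"

definition meet_rel :: "point set set \<Rightarrow> (point set \<times> point set) set" where
  "meet_rel A = {(s, t). s \<in> A \<and> t \<in> A \<and> s \<inter> t \<noteq> {}}"

definition level_components :: "(nat \<Rightarrow> cell set) \<Rightarrow> nat \<Rightarrow> nat \<Rightarrow> point set set set" where
  "level_components T n i = level_part T n i // (meet_rel (level_part T n i))\<^sup>+"

definition divided_cells ::
  "(nat \<Rightarrow> cell set) \<Rightarrow> nat \<Rightarrow> nat \<Rightarrow> point set set \<Rightarrow> cell set" where
  "divided_cells T n i K =
    {\<phi> \<in> T (i - 1). \<exists>l \<in> K \<inter> level_ledges T n i. l \<inter> interior (region \<phi>) \<noteq> {}}"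

definition delta1_level :: "(nat \<Rightarrow> cell set) \<Rightarrow> nat \<Rightarrow> nat \<Rightarrow> nat" where
  "delta1_level T n i = card {K \<in> level_components T n i.
     \<exists>\<phi> \<in> interior_cells (T (i - 1)). divided_cells T n i K = {\<phi>}}"

definition delta1 :: "(nat \<Rightarrow> cell set) \<Rightarrow> nat \<Rightarrow> nat" where
  "delta1 T n = (\<Sum>i=1..n. delta1_level T n i)"


section \<open>Spline spaces\<close>

(* g a b is the partial derivative of f taken b times in y and then a times in x; on the
   boundary of S derivatives are one-sided, i.e. taken within S. *)
definition C_mixed :: "nat \<Rightarrow> point set \<Rightarrow> (point \<Rightarrow> real) \<Rightarrow> bool" where
  "C_mixed r S f \<longleftrightarrow>
    (\<exists>g :: nat \<Rightarrow> nat \<Rightarrow> point \<Rightarrow> real.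
      (\<forall>p\<in>S. g 0 0 p = f p) \<and>
      (\<forall>b<r. \<forall>(x, y)\<in>S.
         ((\<lambda>t. g 0 b (x, t)) has_real_derivative g 0 (Suc b) (x, y))
           (at y within {t. (x, t) \<in> S})) \<and>
      (\<forall>a<r. \<forall>b\<le>r. \<forall>(x, y)\<in>S.
         ((\<lambda>s. g a b (s, y)) has_real_derivative g (Suc a) b (x, y))
           (at x within {s. (s, y) \<in> S})) \<and>
      (\<forall>a\<le>r. \<forall>b\<le>r. continuous_on S (g a b)))"

definition bidegree_poly_on :: "nat \<Rightarrow> point set \<Rightarrow> (point \<Rightarrow> real) \<Rightarrow> bool" where
  "bidegree_poly_on d S f \<longleftrightarrow>
    (\<exists>c :: nat \<Rightarrow> nat \<Rightarrow> real. \<forall>(x, y)\<in>S. f (x, y) = (\<Sum>i\<le>d. \<Sum>j\<le>d. c i j * x ^ i * y ^ j))"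

(* Functions on the domain are represented by functions on the plane that vanish outside of it;
   d >= 1 is intended. *)
definition spline_space :: "nat \<Rightarrow> cell set \<Rightarrow> (point \<Rightarrow> real) set" where
  "spline_space d M =
    {f. (\<forall>p. p \<notin> mesh_domain M \<longrightarrow> f p = 0) \<and>
        C_mixed (d - 1) (mesh_domain M) f \<and>
        (\<forall>\<phi>\<in>M. bidegree_poly_on d (region \<phi>) f)}"

definition fscale :: "real \<Rightarrow> (point \<Rightarrow> real) \<Rightarrow> point \<Rightarrow> real" where
  "fscale c f = (\<lambda>p. c * f p)"

interpretation fun_space: vector_space fscale
  by unfold_locales (auto simp: fscale_def fun_eq_iff algebra_simps)

end

theory Submission
  imports Defs
begin

text \<open>
  Refine the mesh to the tensor-product grid of all lines of level \<open>n\<close>. A \<open>C\<^sup>1\<close> biquadratic spline on this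
  grid belongs to the space iff its smoothing cofactors, which are quadratic splines along the grid lines,
  vanish on the segments that are not in the mesh. Such a spline is determined by the piecewise constant
  function \<open>f\<^sub>x\<^sub>x\<^sub>y\<^sub>y\<close>, one value for each cell of the mesh, by the values and slopes of the cofactors
  at the end points of the new segments in the divided cells, and by boundary data; the cofactor of a new
  segment is compatible with these data iff two moment conditions hold, for each divided cell and each of the
  two directions. All dependencies between these conditions come from divided interior cells without a
  divided neighbour in the same level, one for each of them: there the two families of conditions, weighted
  with the partial derivatives of a bubble function, have the same sum. These isolated cells are exactly
  the ones counted by \<open>\<delta>\<^sub>1\<close>, and the dimension then follows by counting vertices and l-edges level by level.
\<close>

section \<open>Linear algebra\<close>

text \<open>The obstacle is the exact rank. Constraints of all levels share the same jumps, so
  independence cannot be seen cell by cell. A supposed relation is tested from the coarsest level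
  upwards. The indicator of a quarter of a divided cell is invisible to all other constraints of the
  same or a finer level, which kills the coefficients of the weight 1 and ties the remaining
  vertical coefficient to the horizontal one. A unit value or slope at an end point shared with a
  neighbour then kills these as well, because the two cells have different midpoints. Only a cell
  without such end points escapes. There the bubble \<open>P(x) R(Y)\<close> explains why:
  integration by parts turns the vertical sum with weights \<open>P R'\<close> and the horizontal
  one with weights \<open>P' R\<close> into the same integral of \<open>h P' R'\<close>, and
  isolation removes the boundary terms.

  Conditions come in pairs because \<open>q''\<close> determines \<open>q\<close> up to a value and
  a slope. Every line of the finest grid that is not in the initial mesh is the midline of one
  column of one level, read off from the 2-adic valuation of its index, so incidence becomes
  arithmetic. Horizontal statements are vertical ones with the axes exchanged.\<close>

context vector_space
begin

text \<open>Functionals are added one at a time. The new one, reduced by the earlier ones, is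
  nonzero somewhere on \<open>V\<close>; such a point yields its dual vector, and the earlier dual
  vectors are then corrected by multiples of it.\<close>

lemma dual_family:
  fixes lam :: "'j \<Rightarrow> 'b \<Rightarrow> 'a"
  assumes V: "subspace V" and J: "finite J"
    and add: "\<And>j x y. j \<in> J \<Longrightarrow> lam j (x + y) = lam j x + lam j y"
    and scl: "\<And>j c x. j \<in> J \<Longrightarrow> lam j (c *s x) = c * lam j x"
    and ind: "\<And>w. (\<And>z. z \<in> V \<Longrightarrow> (\<Sum>j\<in>J. w j * lam j z) = 0) \<Longrightarrow> (\<And>j. j \<in> J \<Longrightarrow> w j = 0)"
  shows "\<exists>e. \<forall>j\<in>J. e j \<in> V \<and> (\<forall>i\<in>J. lam i (e j) = (if i = j then 1 else 0))"
  using J add scl ind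
proof (induction J rule: finite_induct)
  case empty
  then show ?case by simp
next
  case (insert k J)
  have "\<exists>e. \<forall>j\<in>J. e j \<in> V \<and> (\<forall>i\<in>J. lam i (e j) = (if i = j then 1 else 0))"
  proof (rule insert.IH)
    fix w j
    assume w: "\<And>z. z \<in> V \<Longrightarrow> (\<Sum>j\<in>J. w j * lam j z) = 0" and j: "j \<in> J"
    \<comment> \<open>A relation among the functionals in \<open>J\<close> becomes one among
      \<open>insert k J\<close> by giving \<open>k\<close> the coefficient 0.\<close>
    have "(w(k := 0)) j = 0"
    proof (rule insert.prems(3)[where w = "w(k := 0)"])
      fix z
      assume "z \<in> V"
      have "(\<Sum>j\<in>J. (w(k := 0)) j * lam j z) = (\<Sum>j\<in>J. w j * lam j z)"
        using insert.hyps by (intro sum.cong) auto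
      then show "(\<Sum>j\<in>insert k J. (w(k := 0)) j * lam j z) = 0"
        using insert.hyps w[OF \<open>z \<in> V\<close>] by simp
    qed (use j in auto)
    then show "w j = 0" using insert.hyps j by (auto split: if_splits)
  qed (use insert.prems in auto)
  then obtain e where eV: "\<And>j. j \<in> J \<Longrightarrow> e j \<in> V"
    and e: "\<And>i j. i \<in> J \<Longrightarrow> j \<in> J \<Longrightarrow> lam i (e j) = (if i = j then 1 else 0)" by metis
  have lin: "lam j (x - y) = lam j x - lam j y" if "j \<in> insert k J" for j x y
    using insert.prems(1)[OF that, of "x - y" y] by simp
  have lsum: "lam j (\<Sum>i\<in>A. g i) = (\<Sum>i\<in>A. lam j (g i))" if "j \<in> insert k J" for j A and g :: "'j \<Rightarrow> 'b"
  proof (cases "finite A")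
    case True
    then show ?thesis
    proof (induction A rule: finite_induct)
      case empty
      show ?case using lin[OF that, of 0 0] by simp
    qed (use insert.prems(1)[OF that] in simp)
  next
    case False
    then show ?thesis using lin[OF that, of 0 0] by simp
  qed
  \<comment> \<open>\<open>B\<close> is \<open>lam k\<close> with its expansion in the earlier
    functionals removed. It vanishes at all earlier \<open>e j\<close>, and independence forbids
    that it vanishes on all of \<open>V\<close>.\<close>
  define B where "B z = lam k z - (\<Sum>j\<in>J. lam k (e j) * lam j z)" for z
  have "\<exists>z\<in>V. B z \<noteq> 0"
  proof (rule ccontr)
    assume "\<not> ?thesis"
    then have B0: "B z = 0" if "z \<in> V" for z using that by auto
    define w where "w j = (if j = k then 1 else - lam k (e j))" for j
    have "w k = (0::'a)"
    proof (rule insert.prems(3)[where w = w])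
      fix z
      assume "z \<in> V"
      have "(\<Sum>j\<in>J. w j * lam j z)
          = (\<Sum>j\<in>J. - (lam k (e j) * lam j z))"
        using insert.hyps by (intro sum.cong) (auto simp: w_def)
      then show "(\<Sum>j\<in>insert k J. w j * lam j z) = 0"
        using insert.hyps B0[OF \<open>z \<in> V\<close>] by (simp add: B_def sum_negf w_def)
    qed auto
    then show False by (simp add: w_def)
  qed
  then obtain z where z: "z \<in> V" "B z \<noteq> 0" by blast
  define ek where "ek = (1 / B z) *s (z - (\<Sum>j\<in>J. lam j z *s e j))"
  have ekV: "ek \<in> V" unfolding ek_def
    by (intro subspace_scale subspace_diff subspace_sum V z eV)
  have ek_J: "lam i ek = 0" if "i \<in> J" for i
  proof -
    have "(\<Sum>j\<in>J. lam j z * lam i (e j)) = (\<Sum>j\<in>J. if j = i then lam i z else 0)"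
      using that by (intro sum.cong) (auto simp: e)
    then show ?thesis
      using that insert.hyps insert.prems(2)[of i]
      by (simp add: ek_def lin lsum)
  qed
  have ek_k: "lam k ek = 1"
    using z insert.prems(2)[of k]
    by (simp add: ek_def lin lsum) (simp add: B_def mult.commute)
  define e' where "e' j = (if j = k then ek else e j - lam k (e j) *s ek)" for j
  show ?case
  proof (intro exI[of _ e'] ballI conjI)
    fix j
    assume j: "j \<in> insert k J"
    show "e' j \<in> V"
      using j by (auto simp: e'_def ekV eV intro!: subspace_scale subspace_diff V)
    fix i
    assume i: "i \<in> insert k J"
    show "lam i (e' j) = (if i = j then 1 else 0)"
      using i j insert.hyps insert.prems(2)[of i] ek_J ek_k
      by (auto simp: e'_def lin e)
  qed
qed

text \<open>Subtracting \<open>\<Sum>j\<in>J. lam j z *s e j\<close> with a dual family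
  \<open>e\<close> moves \<open>z\<close> into the common kernel, so a basis of the kernel together
  with the dual vectors is a basis of \<open>V\<close>. The finite set \<open>W\<close> makes these
  bases finite.\<close>

lemma dim_common_kernel:
  fixes lam :: "'j \<Rightarrow> 'b \<Rightarrow> 'a"
  assumes V: "subspace V" and J: "finite J" and W: "finite W" "V \<subseteq> span W"
    and add: "\<And>j x y. j \<in> J \<Longrightarrow> lam j (x + y) = lam j x + lam j y"
    and scl: "\<And>j c x. j \<in> J \<Longrightarrow> lam j (c *s x) = c * lam j x"
    and ind: "\<And>w. (\<And>z. z \<in> V \<Longrightarrow> (\<Sum>j\<in>J. w j * lam j z) = 0) \<Longrightarrow> (\<And>j. j \<in> J \<Longrightarrow> w j = 0)"
  shows "dim {z \<in> V. \<forall>j\<in>J. lam j z = 0} + card J = dim V"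
proof -
  obtain e where eV: "\<And>j. j \<in> J \<Longrightarrow> e j \<in> V"
    and e: "\<And>i j. i \<in> J \<Longrightarrow> j \<in> J \<Longrightarrow> lam i (e j) = (if i = j then 1 else 0)"
  proof -
    have "\<exists>e. \<forall>j\<in>J. e j \<in> V \<and> (\<forall>i\<in>J. lam i (e j) = (if i = j then 1 else 0))"
    proof (rule dual_family[where lam = lam])
      fix w j
      assume "\<And>z. z \<in> V \<Longrightarrow> (\<Sum>j\<in>J. w j * lam j z) = 0" "j \<in> J"
      then show "w j = 0" by (rule ind[where w = w])
    qed (use V J add scl in auto)
    then show ?thesis using that by blast
  qed
  define K where "K = {z \<in> V. \<forall>j\<in>J. lam j z = 0}"
  have lin: "lam j (x - y) = lam j x - lam j y" if "j \<in> J" for j x y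
    using add[OF that, of "x - y" y] by simp
  have lsum: "lam j (\<Sum>i\<in>A. g i) = (\<Sum>i\<in>A. lam j (g i))" if "j \<in> J" for j A and g :: "'c \<Rightarrow> 'b"
  proof (cases "finite A")
    case True
    then show ?thesis
    proof (induction A rule: finite_induct)
      case empty
      show ?case using lin[OF that, of 0 0] by simp
    qed (use add[OF that] in simp)
  next
    case False
    then show ?thesis using lin[OF that, of 0 0] by simp
  qed
  obtain B where B: "B \<subseteq> K" "independent B" "K \<subseteq> span B" "card B = dim K"
    by (rule basis_exists)
  have "B \<subseteq> span W" using B(1) W(2) by (auto simp: K_def)
  then have finB: "finite B" using independent_span_bound[OF W(1) B(2)] by simp
  have inj: "inj_on e J"
  proof (rule inj_onI)
    fix i j
    assume ij: "i \<in> J" "j \<in> J" and "e i = e j"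
    then have "lam i (e i) = lam i (e j)" by simp
    then show "i = j" using ij by (simp add: e split: if_splits)
  qed
  have disj: "B \<inter> e ` J = {}"
  proof -
    have False if "j \<in> J" "e j \<in> B" for j
      using that B(1) e[of j j] by (auto simp: K_def)
    then show ?thesis by auto
  qed
  have ind': "independent (B \<union> e ` J)"
  proof (rule independent_if_scalars_zero)
    show "finite (B \<union> e ` J)" using finB J by simp
    fix f x
    assume s: "(\<Sum>x\<in>B \<union> e ` J. f x *s x) = 0" and x: "x \<in> B \<union> e ` J"
    have s': "(\<Sum>x\<in>B. f x *s x) + (\<Sum>j\<in>J. f (e j) *s e j) = 0"
      using s finB J disj by (simp add: sum.union_disjoint sum.reindex[OF inj])
    have fe: "f (e i) = 0" if i: "i \<in> J" for i
    proof -
      have 1: "lam i (\<Sum>x\<in>B. f x *s x) = 0"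
        unfolding lsum[OF i] scl[OF i] using B(1) i by (intro sum.neutral) (auto simp: K_def)
      have "lam i (\<Sum>j\<in>J. f (e j) *s e j) = (\<Sum>j\<in>J. if j = i then f (e i) else 0)"
        unfolding lsum[OF i] scl[OF i] using i by (intro sum.cong) (auto simp: e)
      also have "\<dots> = f (e i)" using i J by simp
      finally have "lam i ((\<Sum>x\<in>B. f x *s x) + (\<Sum>j\<in>J. f (e j) *s e j)) = f (e i)"
        by (simp add: add[OF i] 1)
      then show ?thesis using s' lin[OF i, of 0 0] by simp
    qed
    have "(\<Sum>x\<in>B. f x *s x) = 0" using s' fe by simp
    then have "\<forall>x\<in>B. f x = 0" using B(2) finB by (simp add: independent_explicit_module)
    then show "f x = 0" using x fe by auto
  qed
  have sp: "V \<subseteq> span (B \<union> e ` J)"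
  proof
    fix z
    assume z: "z \<in> V"
    define s where "s = (\<Sum>j\<in>J. lam j z *s e j)"
    have "lam i s = lam i z" if i: "i \<in> J" for i
    proof -
      have "lam i s = (\<Sum>j\<in>J. if j = i then lam i z else 0)"
        unfolding s_def lsum[OF i] scl[OF i] using i by (intro sum.cong) (auto simp: e)
      then show ?thesis using i J by simp
    qed
    moreover have "s \<in> V" unfolding s_def by (intro subspace_sum subspace_scale V eV)
    ultimately have "z - s \<in> K" using z by (auto simp: K_def lin intro: subspace_diff V)
    then have "z - s \<in> span (B \<union> e ` J)" using B(3) span_mono[of B "B \<union> e ` J"] by auto
    moreover have "s \<in> span (B \<union> e ` J)"
      unfolding s_def by (intro span_sum span_scale span_base) auto
    ultimately show "z \<in> span (B \<union> e ` J)" using span_add[of "z - s" _ s] by simp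
  qed
  have "B \<union> e ` J \<subseteq> V" using B(1) eV by (auto simp: K_def)
  then have "dim V = card (B \<union> e ` J)" using dim_unique[OF _ sp ind' refl] by simp
  also have "\<dots> = dim K + card J"
    using finB J disj B(4) by (simp add: card_Un_disjoint card_image[OF inj])
  finally show ?thesis by (simp add: K_def)
qed

end

lemma (in vector_space_pair) dim_image_inj:
  assumes f: "Vector_Spaces.linear s1 s2 f" and S: "vs1.subspace S" and inj: "inj_on f S"
  shows "vs2.dim (f ` S) = vs1.dim S"
proof -
  obtain B where B: "B \<subseteq> S" "vs1.independent B" "S \<subseteq> vs1.span B" "card B = vs1.dim S"
    by (rule vs1.basis_exists)
  have sB: "vs1.span B = S" using B S by (metis vs1.span_minimal subset_antisym)
  show ?thesis
  proof (rule vs2.dim_unique)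
    show "f ` B \<subseteq> f ` S" using B by blast
    show "f ` S \<subseteq> vs2.span (f ` B)" using sB linear_span_image[OF f, of B] by simp
    show "vs2.independent (f ` B)"
      using linear_independent_injective_image[OF f B(2)] inj sB by simp
    show "card (f ` B) = vs1.dim S"
      using card_image[of f B] inj_on_subset[OF inj B(1)] B(4) by simp
  qed
qed

section \<open>Coordinate spaces over a finite index set\<close>

definition rscale :: "real \<Rightarrow> ('i \<Rightarrow> real) \<Rightarrow> 'i \<Rightarrow> real" where
  "rscale c z = (\<lambda>i. c * z i)"

definition supported :: "'i set \<Rightarrow> ('i \<Rightarrow> real) set" where
  "supported I = {z. \<forall>i. i \<notin> I \<longrightarrow> z i = 0}"

interpretation rfun: vector_space rscale
  by unfold_locales (auto simp: rscale_def fun_eq_iff algebra_simps)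

lemma subspace_supported: "rfun.subspace (supported I)"
  by (auto simp: rfun.subspace_def supported_def rscale_def)

definition unit_fun :: "'i \<Rightarrow> 'i \<Rightarrow> real" where
  "unit_fun i = (\<lambda>j. if j = i then 1 else 0)"

lemma sum_fun_eval: "(\<Sum>i\<in>A. g i) x = (\<Sum>i\<in>A. g i x)"
  for g :: "'a \<Rightarrow> 'i \<Rightarrow> real"
  by (induction A rule: infinite_finite_induct) auto

lemma supported_span: "finite I \<Longrightarrow> supported I \<subseteq> rfun.span (unit_fun ` I)"
  for I :: "'i set"
proof
  fix z :: "'i \<Rightarrow> real"
  assume I: "finite I" and z: "z \<in> supported I"
  have "z = (\<Sum>i\<in>I. rscale (z i) (unit_fun i))"
  proof
    fix j
    have "(\<Sum>i\<in>I. rscale (z i) (unit_fun i)) j = (\<Sum>i\<in>I. if i = j then z j else 0)"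
      unfolding sum_fun_eval by (intro sum.cong) (auto simp: rscale_def unit_fun_def)
    then show "z j = (\<Sum>i\<in>I. rscale (z i) (unit_fun i)) j"
      using I z by (auto simp: supported_def)
  qed
  also have "\<dots> \<in> rfun.span (unit_fun ` I)"
    by (intro rfun.span_sum rfun.span_scale rfun.span_base) auto
  finally show "z \<in> rfun.span (unit_fun ` I)" .
qed

lemma dim_supported:
  assumes I: "finite I"
  shows "rfun.dim (supported I) = card I"
proof (rule rfun.dim_unique[OF _ supported_span[OF I]])
  show "unit_fun ` I \<subseteq> supported I" by (auto simp: unit_fun_def supported_def)
  have inj: "inj_on unit_fun I"
  proof (rule inj_onI)
    fix i j :: 'a
    assume "unit_fun i = unit_fun j"
    then have "unit_fun i i = unit_fun j i" by simp
    then show "i = j" by (simp add: unit_fun_def split: if_splits)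
  qed
  then show "card (unit_fun ` I) = card I" by (rule card_image)
  show "rfun.independent (unit_fun ` I)"
  proof (rule rfun.independent_if_scalars_zero)
    show "finite (unit_fun ` I)" using I by simp
    fix f x
    assume s: "(\<Sum>x\<in>unit_fun ` I. rscale (f x) x) = 0" and x: "x \<in> unit_fun ` I"
    then obtain j where j: "j \<in> I" "x = unit_fun j" by blast
    have "(\<Sum>x\<in>unit_fun ` I. rscale (f x) x) j = (\<Sum>i\<in>I. rscale (f (unit_fun i)) (unit_fun i) j)"
      by (simp add: sum_fun_eval sum.reindex[OF inj])
    also have "\<dots> = (\<Sum>i\<in>I. if i = j then f x else 0)"
      using j by (intro sum.cong) (auto simp: rscale_def unit_fun_def)
    also have "\<dots> = f x" using I j by simp
    finally show "f x = 0" using s by simp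
  qed
qed

section \<open>Quadratic splines in one variable\<close>

text \<open>The truncated square, halved so that its second derivative jumps by 1 at
  \<open>c\<close>.\<close>

definition tpow :: "real \<Rightarrow> real \<Rightarrow> real" where
  "tpow c x = (max 0 (x - c))\<^sup>2 / 2"

text \<open>The truncated power basis: value and slope at \<open>t 0\<close>, then one function per
  knot. The coefficient with index \<open>p + 2\<close> is the jump of the second derivative at
  \<open>t p\<close>; for \<open>p = 0\<close> it is the second derivative on the first
  interval.\<close>

fun sb :: "(nat \<Rightarrow> real) \<Rightarrow> nat \<Rightarrow> real \<Rightarrow> real" where
  "sb t 0 x = 1"
| "sb t (Suc 0) x = x - t 0"
| "sb t (Suc (Suc p)) x = tpow (t p) x"

fun sb' :: "(nat \<Rightarrow> real) \<Rightarrow> nat \<Rightarrow> real \<Rightarrow> real" where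
  "sb' t 0 x = 0"
| "sb' t (Suc 0) x = 1"
| "sb' t (Suc (Suc p)) x = max 0 (x - t p)"

lemma deriv_unique_Icc:
  fixes f :: "real \<Rightarrow> real"
  assumes "(f has_real_derivative d) (at x within {a..b})" "(f has_real_derivative e) (at x within {a..b})"
    "a < b" "x \<in> {a..b}"
  shows "d = e"
proof (rule has_field_derivative_unique[OF assms(1,2)])
  show "at x within {a..b} \<noteq> bot" using assms(3,4) by (simp add: trivial_limit_within)
qed

text \<open>Away from \<open>c\<close> the function is locally a polynomial. At \<open>c\<close> the
  difference quotient for the increment \<open>h\<close> is at most \<open>\<bar>h\<bar>\<close> in
  absolute value.\<close>

lemma tpow_deriv: "(tpow c has_real_derivative max 0 (x - c)) (at x)"
proof -
  consider "x < c" | "x > c" | "x = c" by linarith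
  then show ?thesis
  proof cases
    case 1
    have "((\<lambda>_. 0) has_real_derivative 0) (at x)" by simp
    then have "(tpow c has_real_derivative 0) (at x)"
      by (rule DERIV_cong_ev[THEN iffD1, rotated 3])
        (use 1 in \<open>auto simp: tpow_def eventually_nhds intro!: exI[of _ "{..<c}"]\<close>)
    then show ?thesis using 1 by simp
  next
    case 2
    have "((\<lambda>x. (x - c)\<^sup>2 / 2) has_real_derivative (x - c)) (at x)"
      by (auto intro!: derivative_eq_intros)
    then have "(tpow c has_real_derivative (x - c)) (at x)"
      by (rule DERIV_cong_ev[THEN iffD1, rotated 3])
        (use 2 in \<open>auto simp: tpow_def eventually_nhds intro!: exI[of _ "{c<..}"]\<close>)
    then show ?thesis using 2 by simp
  next
    case 3
    have "((\<lambda>h. tpow c (c + h) / h) \<longlongrightarrow> 0) (at 0)"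
    proof (rule Lim_null_comparison)
      have "\<bar>tpow c (c + h) / h\<bar> \<le> \<bar>h\<bar>" for h :: real
        by (cases "h = 0"; cases "h > 0") (auto simp: tpow_def power2_eq_square abs_mult)
      then show "\<forall>\<^sub>F h in at 0. norm (tpow c (c + h) / h) \<le> \<bar>h\<bar>" by simp
      show "((\<lambda>h::real. \<bar>h\<bar>) \<longlongrightarrow> 0) (at 0)" by (rule tendsto_rabs_zero) simp
    qed
    then show ?thesis using 3 by (simp add: DERIV_def tpow_def)
  qed
qed

lemma sb_deriv: "(sb t a has_real_derivative sb' t a x) (at x within S)"
proof (cases "(t, a, x)" rule: sb.cases)
  case (1 t x)
  have "sb t 0 = (\<lambda>_. 1)" by auto
  then show ?thesis using 1 by simp
next
  case (2 t x)
  have "sb t (Suc 0) = (\<lambda>x. x - t 0)" by auto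
  then show ?thesis using 2 by (auto intro!: derivative_eq_intros)
next
  case (3 t p x)
  have "sb t (Suc (Suc p)) = tpow (t p)" by auto
  then show ?thesis using 3 tpow_deriv by (simp add: has_field_derivative_at_within)
qed

lemma continuous_sb: "continuous_on S (sb t a)"
  by (rule DERIV_continuous_on[where D = "sb' t a"]) (rule sb_deriv)

lemma continuous_sb': "continuous_on S (sb' t a)"
proof (cases "(t, a, 0::real)" rule: sb'.cases)
  case (1 t x)
  have "sb' t 0 = (\<lambda>_. 0)" by auto
  then show ?thesis using 1 by simp
next
  case (2 t x)
  have "sb' t (Suc 0) = (\<lambda>_. 1)" by auto
  then show ?thesis using 2 by simp
next
  case (3 t p x)
  have "sb' t (Suc (Suc p)) = (\<lambda>x. max 0 (x - t p))" by auto
  then show ?thesis using 3 by (auto intro!: continuous_intros)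
qed

text \<open>Smoothness is encoded as mere differentiability on the whole interval, one-sided at its
  ends: for piecewise quadratics this already makes the slopes match at the knots.\<close>

definition qspline :: "(nat \<Rightarrow> real) \<Rightarrow> nat \<Rightarrow> (real \<Rightarrow> real) \<Rightarrow> bool" where
  "qspline t P g \<longleftrightarrow>
    (\<forall>p<P. \<exists>c0 c1 c2. \<forall>x\<in>{t p..t (Suc p)}. g x = c0 + c1 * x + c2 * x\<^sup>2) \<and>
    (\<forall>x\<in>{t 0..t P}. \<exists>d. (g has_real_derivative d) (at x within {t 0..t P}))"

lemma qspline_lincomb:
  assumes "qspline t P g1" "qspline t P g2" "qspline t P g3"
  shows "qspline t P (\<lambda>x. a1 * g1 x + a2 * g2 x + a3 * g3 x)"
  unfolding qspline_def
proof (intro conjI allI impI ballI)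
  fix p
  assume "p < P"
  then obtain c0 c1 c2 d0 d1 d2 e0 e1 e2 where
    "\<forall>x\<in>{t p..t (Suc p)}. g1 x = c0 + c1 * x + c2 * x\<^sup>2"
    "\<forall>x\<in>{t p..t (Suc p)}. g2 x = d0 + d1 * x + d2 * x\<^sup>2"
    "\<forall>x\<in>{t p..t (Suc p)}. g3 x = e0 + e1 * x + e2 * x\<^sup>2"
    using assms unfolding qspline_def by meson
  then have "\<forall>x\<in>{t p..t (Suc p)}. a1 * g1 x + a2 * g2 x + a3 * g3 x =
     (a1 * c0 + a2 * d0 + a3 * e0) + (a1 * c1 + a2 * d1 + a3 * e1) * x
      + (a1 * c2 + a2 * d2 + a3 * e2) * x\<^sup>2"
    by (auto simp: algebra_simps)
  then show "\<exists>c0 c1 c2. \<forall>x\<in>{t p..t (Suc p)}.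
      a1 * g1 x + a2 * g2 x + a3 * g3 x = c0 + c1 * x + c2 * x\<^sup>2" by blast
next
  fix x
  assume "x \<in> {t 0..t P}"
  then obtain d1 d2 d3 where "(g1 has_real_derivative d1) (at x within {t 0..t P})"
    "(g2 has_real_derivative d2) (at x within {t 0..t P})"
    "(g3 has_real_derivative d3) (at x within {t 0..t P})"
    using assms unfolding qspline_def by meson
  then have "((\<lambda>x. a1 * g1 x + a2 * g2 x + a3 * g3 x) has_real_derivative
      a1 * d1 + a2 * d2 + a3 * d3) (at x within {t 0..t P})"
    by (auto intro!: derivative_eq_intros)
  then show "\<exists>d. ((\<lambda>x. a1 * g1 x + a2 * g2 x + a3 * g3 x) has_real_derivative d)
      (at x within {t 0..t P})" by blast
qed

text \<open>The second difference over the end points and the midpoint, scaled so that it gives the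
  second derivative of a quadratic.\<close>

definition sdiff :: "(nat \<Rightarrow> real) \<Rightarrow> nat \<Rightarrow> (real \<Rightarrow> real) \<Rightarrow> real" where
  "sdiff t p g = 4 * (g (t p) - 2 * g ((t p + t (Suc p)) / 2) + g (t (Suc p))) / (t (Suc p) - t p)\<^sup>2"

text \<open>The coefficients in the basis \<open>sb\<close> as finite combinations of point values.
  Since no derivative occurs, they can be applied to one variable of a bivariate spline and the
  result is still a spline in the other. Entry 1 is the slope at \<open>t 0\<close> of the
  interpolating quadratic.\<close>

fun cf :: "(nat \<Rightarrow> real) \<Rightarrow> nat \<Rightarrow> (real \<Rightarrow> real) \<Rightarrow> real" where
  "cf t 0 g = g (t 0)"
| "cf t (Suc 0) g = (4 * g ((t 0 + t 1) / 2) - 3 * g (t 0) - g (t 1)) / (t 1 - t 0)"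
| "cf t (Suc (Suc 0)) g = sdiff t 0 g"
| "cf t (Suc (Suc (Suc p))) g = sdiff t (Suc p) g - sdiff t p g"

lemma sdiff_quadratic:
  assumes "t p < t (Suc p)" "\<And>x. x \<in> {t p..t (Suc p)} \<Longrightarrow> g x = c0 + c1 * x + c2 * x\<^sup>2"
  shows "sdiff t p g = 2 * c2"
proof -
  have "g (t p) = c0 + c1 * t p + c2 * (t p)\<^sup>2"
    "g ((t p + t (Suc p)) / 2) = c0 + c1 * ((t p + t (Suc p)) / 2) + c2 * ((t p + t (Suc p)) / 2)\<^sup>2"
    "g (t (Suc p)) = c0 + c1 * t (Suc p) + c2 * (t (Suc p))\<^sup>2"
    using assms(1) by (intro assms(2); simp)+
  then have "4 * (g (t p) - 2 * g ((t p + t (Suc p)) / 2) + g (t (Suc p)))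
      = 2 * c2 * (t (Suc p) - t p)\<^sup>2"
    by (simp add: power2_eq_square field_simps)
  then show ?thesis using assms by (simp add: sdiff_def)
qed

locale knots =
  fixes t :: "nat \<Rightarrow> real" and P :: nat
  assumes P: "0 < P" and t_Suc: "p < P \<Longrightarrow> t p < t (Suc p)"
begin

lemma t_mono: "p \<le> q \<Longrightarrow> q \<le> P \<Longrightarrow> t p \<le> t q"
proof (induction q rule: dec_induct)
  case (step q)
  then show ?case using t_Suc[of q] by simp
qed simp

lemma t_less: "p < q \<Longrightarrow> q \<le> P \<Longrightarrow> t p < t q"
  using t_Suc[of p] t_mono[of "Suc p" q] by simp

lemma t_le_iff: "p \<le> P \<Longrightarrow> q \<le> P \<Longrightarrow> t p \<le> t q \<longleftrightarrow> p \<le> q"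
  using t_mono[of p q] t_less[of q p] by (cases "p \<le> q") auto

lemma t_less_iff: "p \<le> P \<Longrightarrow> q \<le> P \<Longrightarrow> t p < t q \<longleftrightarrow> p < q"
  using t_le_iff[of q p] by linarith

lemma t_eq_iff: "p \<le> P \<Longrightarrow> q \<le> P \<Longrightarrow> t p = t q \<longleftrightarrow> p = q"
  using t_less[of p q] t_less[of q p] by (cases p q rule: linorder_cases) simp_all

lemma t_interval: "x \<in> {t 0..t P} \<Longrightarrow> \<exists>p<P. x \<in> {t p..t (Suc p)}"
proof -
  assume x: "x \<in> {t 0..t P}"
  have "\<exists>p<m. x \<in> {t p..t (Suc p)}" if "0 < m" "m \<le> P" "x \<le> t m" for m
    using that
  proof (induction m)
    case (Suc m)
    show ?case
    proof (cases "0 < m \<and> x \<le> t m")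
      case True
      then show ?thesis using Suc by (meson less_Suc_eq Suc_leD)
    next
      case False
      then show ?thesis using x Suc by (intro exI[of _ m]) auto
    qed
  qed simp
  then show ?thesis using x P by auto
qed

definition Q :: "(nat \<Rightarrow> real) \<Rightarrow> real \<Rightarrow> real" where
  "Q c x = (\<Sum>a<P + 2. c a * sb t a x)"

definition Q' :: "(nat \<Rightarrow> real) \<Rightarrow> real \<Rightarrow> real" where
  "Q' c x = (\<Sum>a<P + 2. c a * sb' t a x)"

lemma Q_deriv: "(Q c has_real_derivative Q' c x) (at x within S)"
  unfolding Q_def[abs_def] Q'_def by (intro DERIV_sum DERIV_cmult sb_deriv)

lemma sum_split2: "(\<Sum>a<P + 2. f a) = f 0 + f 1 + (\<Sum>p<P. f (p + 2))" for f :: "nat \<Rightarrow> real"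
  by (simp add: sum.lessThan_Suc_shift del: sum.lessThan_Suc)

text \<open>The second derivative of \<open>Q c\<close> on the interval \<open>j\<close>: the sum of
  the jumps up to its left end.\<close>

definition second :: "(nat \<Rightarrow> real) \<Rightarrow> nat \<Rightarrow> real" where
  "second c j = (\<Sum>s\<le>j. c (s + 2))"

lemma sum_le_if: "j < P \<Longrightarrow> (\<Sum>s<P. if s \<le> j then f s else 0) = (\<Sum>s\<le>j. f s)"
  for f :: "nat \<Rightarrow> real"
proof -
  assume "j < P"
  then have "{..<P} \<inter> {s. s \<le> j} = {..j}" by auto
  then show ?thesis by (simp add: sum.If_cases)
qed

text \<open>Taylor expansion at \<open>t j\<close>. No jump occurs strictly between
  \<open>t j\<close> and \<open>t k\<close>, so the spline is a single quadratic there; truncated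
  powers with knots from \<open>t k\<close> on still vanish, and those with knots up to
  \<open>t j\<close> are already polynomials.\<close>

lemma Q_transport_gen:
  assumes "j < k" "k \<le> P" "x \<in> {t j..t k}" "\<And>s. j < s \<Longrightarrow> s < k \<Longrightarrow> c (s + 2) = 0"
  shows "Q' c x = Q' c (t j) + second c j * (x - t j)"
    and "Q c x = Q c (t j) + Q' c (t j) * (x - t j) + second c j * (x - t j)\<^sup>2 / 2"
proof -
  have "c (s + 2) * sb' t (s + 2) x
      = c (s + 2) * sb' t (s + 2) (t j) + (if s \<le> j then c (s + 2) * (x - t j) else 0)" if "s < P" for s
  proof (cases "j < s \<and> s < k")
    case False
    then show ?thesis
      using assms that t_mono[of s j] t_mono[of k s] t_mono[of j s] by (auto simp: max_def algebra_simps)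
  qed (use assms(4) in auto)
  then have "(\<Sum>s<P. c (s + 2) * sb' t (s + 2) x)
      = (\<Sum>s<P. c (s + 2) * sb' t (s + 2) (t j) + (if s \<le> j then c (s + 2) * (x - t j) else 0))"
    by (intro sum.cong) auto
  also have "\<dots> = (\<Sum>s<P. c (s + 2) * sb' t (s + 2) (t j)) + second c j * (x - t j)"
    using assms by (simp add: sum.distrib sum_le_if second_def sum_distrib_right)
  finally show "Q' c x = Q' c (t j) + second c j * (x - t j)" unfolding Q'_def sum_split2 by simp
  have "c (s + 2) * sb t (s + 2) x = c (s + 2) * sb t (s + 2) (t j) + c (s + 2) * sb' t (s + 2) (t j) * (x - t j)
      + (if s \<le> j then c (s + 2) * ((x - t j)\<^sup>2 / 2) else 0)" if "s < P" for s
  proof (cases "j < s \<and> s < k")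
    case False
    then consider "s \<le> j" | "j < s" "k \<le> s" by linarith
    then show ?thesis
    proof cases
      case 1
      then have "t s \<le> t j" "t s \<le> x" using assms t_mono[of s j] by auto
      then have "tpow (t s) x = tpow (t s) (t j) + (t j - t s) * (x - t j) + (x - t j)\<^sup>2 / 2"
        by (simp add: tpow_def power2_eq_square field_simps)
      then have "sb t (s + 2) x = sb t (s + 2) (t j) + sb' t (s + 2) (t j) * (x - t j) + (x - t j)\<^sup>2 / 2"
        using \<open>t s \<le> t j\<close> by simp
      then show ?thesis using 1 by (simp only: if_True distrib_left mult.assoc)
    next
      case 2
      then have "t j \<le> t s" "x \<le> t s" using assms that t_mono[of k s] t_mono[of j s] by auto
      then show ?thesis using 2 by (simp add: tpow_def)
    qed
  qed (use assms(4) in auto)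
  then have "(\<Sum>s<P. c (s + 2) * sb t (s + 2) x)
      = (\<Sum>s<P. c (s + 2) * sb t (s + 2) (t j) + c (s + 2) * sb' t (s + 2) (t j) * (x - t j)
          + (if s \<le> j then c (s + 2) * ((x - t j)\<^sup>2 / 2) else 0))"
    by (intro sum.cong) auto
  also have "\<dots> = (\<Sum>s<P. c (s + 2) * sb t (s + 2) (t j))
      + (\<Sum>s<P. c (s + 2) * sb' t (s + 2) (t j)) * (x - t j) + second c j * ((x - t j)\<^sup>2 / 2)"
    using assms by (simp add: sum.distrib sum_le_if second_def sum_distrib_right)
  finally show "Q c x = Q c (t j) + Q' c (t j) * (x - t j) + second c j * (x - t j)\<^sup>2 / 2"
    unfolding Q_def Q'_def sum_split2 by (simp add: algebra_simps)
qed

lemma Q_transport: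
  assumes "j < P" "x \<in> {t j..t (Suc j)}"
  shows "Q' c x = Q' c (t j) + second c j * (x - t j)"
    and "Q c x = Q c (t j) + Q' c (t j) * (x - t j) + second c j * (x - t j)\<^sup>2 / 2"
  using Q_transport_gen[of j "Suc j" x c] assms by simp_all

lemma Q_0: "Q c (t 0) = c 0" and Q'_0: "Q' c (t 0) = c 1"
proof -
  have "sb t (s + 2) (t 0) = 0" "sb' t (s + 2) (t 0) = 0" if "s < P" for s
    using that t_mono[of 0 s] by (auto simp: tpow_def max_def)
  then show "Q c (t 0) = c 0" "Q' c (t 0) = c 1"
    unfolding Q_def Q'_def sum_split2 by auto
qed

lemma quadratic_zero:
  assumes "l > 0" "\<And>x. x \<in> {s..s + l} \<Longrightarrow> a + b * (x - s) + e * (x - s)\<^sup>2 / 2 = (0::real)"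
  shows "a = 0" "b = 0" "e = 0"
proof -
  show a: "a = 0" using assms(2)[of s] assms(1) by simp
  have 1: "b * l + e * l\<^sup>2 / 2 = 0" using assms(2)[of "s + l"] assms(1) a by simp
  have 2: "b * (l / 2) + e * (l / 2)\<^sup>2 / 2 = 0" using assms(2)[of "s + l / 2"] assms(1) a by simp
  have "(b * l) * 2 + e * l\<^sup>2 = 0" using 1 by (simp add: power2_eq_square field_simps)
  moreover have "(b * l) * 4 + e * l\<^sup>2 = 0" using 2 by (simp add: power2_eq_square field_simps)
  ultimately have "e * l\<^sup>2 = 0" by linarith
  then show "e = 0" using assms(1) by simp
  then show "b = 0" using 1 assms(1) by simp
qed

lemma Q_zero_interval:
  assumes "j < P" "\<And>x. x \<in> {t j..t (Suc j)} \<Longrightarrow> Q c x = 0"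
  shows "Q' c (t j) = 0" "second c j = 0" "Q' c (t (Suc j)) = 0"
proof -
  have l: "t (Suc j) - t j > 0" using t_Suc[OF assms(1)] by simp
  have *: "Q c (t j) + Q' c (t j) * (x - t j) + second c j * (x - t j)\<^sup>2 / 2 = 0"
    if "x \<in> {t j..t j + (t (Suc j) - t j)}" for x
    using assms(2)[of x] Q_transport(2)[OF assms(1), of x c] that by simp
  show "Q' c (t j) = 0" "second c j = 0" using quadratic_zero[OF l *] by auto
  then show "Q' c (t (Suc j)) = 0" using Q_transport(1)[OF assms(1), of "t (Suc j)" c] l by simp
qed

lemma second_0: "second c 0 = c 2" and second_Suc: "second c (Suc j) = second c j + c (j + 3)"
  by (simp_all add: second_def numeral_2_eq_2 numeral_3_eq_3)

text \<open>On each interval the expansion at the left end forces the second derivative to vanish,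
  and the jump coefficients are the differences of these second derivatives.\<close>

lemma Q_unique:
  assumes "\<And>x. x \<in> {t 0..t P} \<Longrightarrow> Q c x = 0" "a < P + 2"
  shows "c a = 0"
proof -
  have sub: "x \<in> {t 0..t P}" if "j < P" "x \<in> {t j..t (Suc j)}" for j x
    using that t_mono[of 0 j] t_mono[of "Suc j" P] by auto
  have s: "second c j = 0" if "j < P" for j
    using Q_zero_interval(2)[OF that] assms(1) sub[OF that] by blast
  have "c 1 = 0" using Q_zero_interval(1)[OF P] assms(1) sub[OF P] Q'_0 by metis
  moreover have "c 0 = 0" using assms(1)[of "t 0"] Q_0 t_mono[of 0 P] by simp
  moreover have "c (p + 2) = 0" if "p < P" for p
    using s[OF that] s[of "p - 1"] that second_0[of c] second_Suc[of c "p - 1"]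
    by (cases p) (auto simp: numeral_2_eq_2 numeral_3_eq_3)
  ultimately show ?thesis
    using assms(2) by (cases a; cases "a - 1") (auto simp: numeral_2_eq_2)
qed

lemma second_cf: "second (\<lambda>a. cf t a g) j = sdiff t j g"
  by (induction j) (auto simp: second_0 second_Suc numeral_2_eq_2 numeral_3_eq_3)

text \<open>Induction over the intervals. On a new interval \<open>g\<close> and \<open>Q\<close>
  agree in the value at the left end and in the second derivative, so they differ by a linear term;
  it is removed by differentiability at the knot, and on the first interval by the choice of entry 1
  of \<open>cf\<close>.\<close>

lemma qspline_rep:
  assumes g: "qspline t P g" and x: "x \<in> {t 0..t P}"
  shows "g x = Q (\<lambda>a. cf t a g) x"
proof -
  define c where "c = (\<lambda>a. cf t a g)"
  have "\<forall>x\<in>{t 0..t m}. g x = Q c x" if "m \<le> P" for m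
    using that
  proof (induction m)
    case 0
    show ?case by (simp add: Q_0) (simp add: c_def)
  next
    case (Suc m)
    have m: "m < P" using Suc by simp
    have IH: "g x = Q c x" if "x \<in> {t 0..t m}" for x using Suc that by simp
    define l where "l = t (Suc m) - t m"
    have l: "l > 0" using t_Suc[OF m] by (simp add: l_def)
    obtain c0 c1 c2 where q: "\<And>x. x \<in> {t m..t (Suc m)} \<Longrightarrow> g x = c0 + c1 * x + c2 * x\<^sup>2"
      using g m unfolding qspline_def by meson
    have sd: "sdiff t m g = 2 * c2" by (rule sdiff_quadratic[OF t_Suc[OF m] q])
    have tm: "t 0 \<le> t m" "t (Suc m) \<le> t P" using m t_mono[of 0 m] t_mono[of "Suc m" P] by auto
    define b where "b = c1 + 2 * c2 * t m"
    have gm: "g (t m) = Q c (t m)" using IH[of "t m"] tm by simp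
    have e: "g x - Q c x = (b - Q' c (t m)) * (x - t m)" if "x \<in> {t m..t (Suc m)}" for x
    proof -
      have "g x = g (t m) + b * (x - t m) + sdiff t m g * (x - t m)\<^sup>2 / 2"
        using q[OF that] q[of "t m"] l by (simp add: l_def sd b_def power2_eq_square field_simps)
      then show ?thesis
        using Q_transport(2)[OF m that, of c] gm second_cf[of g m]
        by (simp add: c_def algebra_simps)
    qed
    have "b = Q' c (t m)"
    proof (cases m)
      case 0
      have "c 1 * l = 4 * g ((t 0 + t 1) / 2) - 3 * g (t 0) - g (t 1)"
        using l 0 by (simp add: c_def l_def)
      also have "\<dots> = b * l"
        using q[of "t 0"] q[of "t 1"] q[of "(t 0 + t 1) / 2"] l 0
        by (simp add: l_def b_def power2_eq_square field_simps)
      finally show ?thesis using l 0 by (simp add: Q'_0)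
    next
      case (Suc m')
      have tm': "t m' < t m" using t_Suc[of m'] Suc m by simp
      have t0m': "t 0 \<le> t m'" using t_mono[of 0 m'] Suc m by simp
      have "t m \<in> {t 0..t P}" using tm l by (simp add: l_def)
      then obtain d where "(g has_real_derivative d) (at (t m) within {t 0..t P})"
        using g unfolding qspline_def by blast
      \<comment> \<open>To the left of \<open>t m\<close> the difference is identically 0, to the
        right it is linear. A single derivative at \<open>t m\<close> has to serve both
        sides.\<close>
      then have D: "((\<lambda>x. g x - Q c x) has_real_derivative d - Q' c (t m)) (at (t m) within {t 0..t P})"
        by (intro derivative_intros Q_deriv)
      have "((\<lambda>x. g x - Q c x) has_real_derivative d - Q' c (t m)) (at (t m) within {t m'..t m})"
        by (rule DERIV_subset[OF D]) (use tm tm' t0m' l in \<open>auto simp: l_def\<close>)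
      then have 1: "((\<lambda>x. 0) has_real_derivative d - Q' c (t m)) (at (t m) within {t m'..t m})"
        by (rule has_field_derivative_transform_within[where d = 1]) (use IH tm' t0m' in auto)
      have d0: "d - Q' c (t m) = 0"
        by (rule deriv_unique_Icc[OF 1 _ tm']) (use tm' in auto)
      have "((\<lambda>x. g x - Q c x) has_real_derivative 0) (at (t m) within {t m..t (Suc m)})"
        using DERIV_subset[OF D, of "{t m..t (Suc m)}"] d0 tm by auto
      then have 2: "((\<lambda>x. (b - Q' c (t m)) * (x - t m)) has_real_derivative 0) (at (t m) within {t m..t (Suc m)})"
        by (rule has_field_derivative_transform_within[where d = 1]) (use e l in \<open>auto simp: l_def\<close>)
      have 3: "((\<lambda>x. (b - Q' c (t m)) * (x - t m)) has_real_derivative b - Q' c (t m)) (at (t m) within {t m..t (Suc m)})"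
        by (auto intro!: derivative_eq_intros)
      show ?thesis using deriv_unique_Icc[OF 2 3] l by (simp add: l_def)
    qed
    then have "g x = Q c x" if "x \<in> {t m..t (Suc m)}" for x using e[OF that] by simp
    moreover have "x \<in> {t 0..t m} \<or> x \<in> {t m..t (Suc m)}" if "x \<in> {t 0..t (Suc m)}" for x
      using that by auto
    ultimately show ?case using IH by blast
  qed
  from this[of P] show ?thesis using x by (simp add: c_def)
qed

end

section \<open>Tensor product quadratic splines\<close>

definition quadratic_on :: "real set \<Rightarrow> (real \<Rightarrow> real) \<Rightarrow> bool" where
  "quadratic_on S g \<longleftrightarrow> (\<exists>c0 c1 c2. \<forall>x\<in>S. g x = c0 + c1 * x + c2 * x\<^sup>2)"

text \<open>The weights \<open>l\<close> are chosen before \<open>g\<close>, so that one set of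
  weights serves all sections of a bivariate function.\<close>

lemma quadratic_interpolation:
  fixes a b :: real
  assumes "a < b"
  shows "\<exists>l. \<forall>g. quadratic_on {a..b} g \<longrightarrow> (\<forall>x\<in>{a..b}.
    g x = (\<Sum>i\<le>2. (l i 0 * g a + l i 1 * g ((a + b) / 2) + l i (2::nat) * g b) * x ^ i))"
proof -
  define L where "L = b - a"
  have L: "L > 0" using assms by (simp add: L_def)
  \<comment> \<open>From the values at \<open>a\<close>, the midpoint and \<open>b\<close>, the
    weights \<open>s\<close> recover the leading coefficient, \<open>r\<close> the slope at
    \<open>a\<close> and \<open>e\<close> the value at \<open>a\<close>; \<open>l\<close> rewrites
    the expansion at \<open>a\<close> in powers of \<open>x\<close>.\<close>
  define s where "s k = (if k = 0 then 2 else if k = 1 then - 4 else 2) / L\<^sup>2" for k :: nat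
  define r where "r k = (if k = 0 then - 3 else if k = 1 then 4 else - 1) / L" for k :: nat
  define e where "e k = (if k = 0 then 1 else 0 :: real)" for k :: nat
  define l where "l i k = (if i = 0 then e k - r k * a + s k * a\<^sup>2
    else if i = 1 then r k - 2 * a * s k else s k)" for i k :: nat
  show ?thesis
  proof (intro exI[of _ l] allI impI ballI)
    fix g x
    assume "quadratic_on {a..b} g" and x: "x \<in> {a..b}"
    then obtain c0 c1 c2 where g: "\<forall>x\<in>{a..b}. g x = c0 + c1 * x + c2 * x\<^sup>2"
      unfolding quadratic_on_def by blast
    have gv: "g a = c0 + c1 * a + c2 * a\<^sup>2"
      "g ((a + b) / 2) = c0 + c1 * (a + L / 2) + c2 * (a + L / 2)\<^sup>2"
      "g b = c0 + c1 * (a + L) + c2 * (a + L)\<^sup>2" "g x = c0 + c1 * x + c2 * x\<^sup>2"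
      using g x assms by (auto simp: L_def field_simps)
    have S: "s 0 * g a + s 1 * g ((a + b) / 2) + s 2 * g b = c2"
    proof -
      have "s 0 * g a + s 1 * g ((a + b) / 2) + s 2 * g b = (2 * g a - 4 * g ((a + b) / 2) + 2 * g b) / L\<^sup>2"
        by (simp add: s_def diff_divide_distrib add_divide_distrib)
      also have "2 * g a - 4 * g ((a + b) / 2) + 2 * g b = c2 * L\<^sup>2"
        unfolding gv by (simp add: power2_eq_square field_simps)
      finally show ?thesis using L by simp
    qed
    have R: "r 0 * g a + r 1 * g ((a + b) / 2) + r 2 * g b = c1 + 2 * c2 * a"
    proof -
      have "r 0 * g a + r 1 * g ((a + b) / 2) + r 2 * g b = (4 * g ((a + b) / 2) - 3 * g a - g b) / L"
        by (simp add: r_def diff_divide_distrib)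
      also have "4 * g ((a + b) / 2) - 3 * g a - g b = (c1 + 2 * c2 * a) * L"
        unfolding gv by (simp add: power2_eq_square field_simps)
      finally show ?thesis using L by simp
    qed
    have "l 2 0 * g a + l 2 1 * g ((a + b) / 2) + l 2 2 * g b = c2"
      using S by (simp add: l_def)
    moreover have "l 1 0 * g a + l 1 1 * g ((a + b) / 2) + l 1 2 * g b
        = (r 0 * g a + r 1 * g ((a + b) / 2) + r 2 * g b)
          - 2 * a * (s 0 * g a + s 1 * g ((a + b) / 2) + s 2 * g b)"
      by (simp add: l_def algebra_simps)
    moreover have "l 0 0 * g a + l 0 1 * g ((a + b) / 2) + l 0 2 * g b
        = g a - a * (r 0 * g a + r 1 * g ((a + b) / 2) + r 2 * g b)
          + a\<^sup>2 * (s 0 * g a + s 1 * g ((a + b) / 2) + s 2 * g b)"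
      by (simp add: l_def e_def algebra_simps)
    ultimately show "g x = (\<Sum>i\<le>2. (l i 0 * g a + l i 1 * g ((a + b) / 2) + l i 2 * g b) * x ^ i)"
      unfolding S R by (simp add: numeral_2_eq_2) (simp add: gv power2_eq_square algebra_simps)
  qed
qed

text \<open>Interpolation in \<open>x\<close> expresses \<open>f\<close> through its three vertical
  sections over \<open>a\<close>, the midpoint and \<open>b\<close>, each of which is quadratic in
  \<open>y\<close>.\<close>

lemma bidegree_from_sections:
  assumes ab: "a < b"
    and 1: "\<And>y. y \<in> {c..d} \<Longrightarrow> quadratic_on {a..b} (\<lambda>x. f (x, y))"
    and 2: "\<And>x. x \<in> {a..b} \<Longrightarrow> quadratic_on {c..d} (\<lambda>y. f (x, y))"
  shows "bidegree_poly_on 2 ({a..b} \<times> {c..d}) f"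
proof -
  obtain l where l: "\<And>g x. quadratic_on {a..b} g \<Longrightarrow> x \<in> {a..b} \<Longrightarrow>
      g x = (\<Sum>i\<le>2. (l i 0 * g a + l i 1 * g ((a + b) / 2) + l i (2::nat) * g b) * x ^ i)"
    using quadratic_interpolation[OF ab] by blast
  have "\<exists>e. \<forall>y\<in>{c..d}. f (x, y) = (\<Sum>j\<le>2. e j * y ^ j)" if x: "x \<in> {a..b}" for x
  proof -
    obtain c0 c1 c2 where "\<forall>y\<in>{c..d}. f (x, y) = c0 + c1 * y + c2 * y\<^sup>2"
      using 2[OF x] unfolding quadratic_on_def by blast
    then show ?thesis
      by (intro exI[of _ "\<lambda>j. if j = 0 then c0 else if j = 1 then c1 else c2"])
        (simp add: numeral_2_eq_2 power2_eq_square)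
  qed
  then obtain e where e: "\<And>x y. x \<in> {a..b} \<Longrightarrow> y \<in> {c..d} \<Longrightarrow> f (x, y) = (\<Sum>j\<le>2. e x j * y ^ j)"
    by metis
  define C where "C i j = l i 0 * e a j + l i 1 * e ((a + b) / 2) j + l i 2 * e b j" for i j
  have "f (x, y) = (\<Sum>i\<le>2. \<Sum>j\<le>2. C i j * x ^ i * y ^ j)" if x: "x \<in> {a..b}" and y: "y \<in> {c..d}" for x y
  proof -
    have "f (x, y) = (\<Sum>i\<le>2. (l i 0 * f (a, y) + l i 1 * f ((a + b) / 2, y) + l i 2 * f (b, y)) * x ^ i)"
      using l[OF 1[OF y] x] by simp
    also have "\<dots> = (\<Sum>i\<le>2. \<Sum>j\<le>2. C i j * x ^ i * y ^ j)"
    proof (rule sum.cong[OF refl])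
      fix i :: nat
      have "l i 0 * f (a, y) + l i 1 * f ((a + b) / 2, y) + l i 2 * f (b, y) = (\<Sum>j\<le>2. C i j * y ^ j)"
        using e[of a y] e[of b y] e[of "(a + b) / 2" y] ab y
        by (simp add: C_def sum_distrib_left sum.distrib algebra_simps)
      then show "(l i 0 * f (a, y) + l i 1 * f ((a + b) / 2, y) + l i 2 * f (b, y)) * x ^ i
          = (\<Sum>j\<le>2. C i j * x ^ i * y ^ j)"
        by (simp only: sum_distrib_right) (simp add: mult_ac)
    qed
    finally show ?thesis .
  qed
  then show ?thesis unfolding bidegree_poly_on_def by (intro exI[of _ C]) auto
qed

lemma sections_of_bidegree:
  assumes "bidegree_poly_on 2 (A \<times> B) f"
  shows "y \<in> B \<Longrightarrow> quadratic_on A (\<lambda>x. f (x, y))" and "x \<in> A \<Longrightarrow> quadratic_on B (\<lambda>y. f (x, y))"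
proof -
  obtain c where c: "\<And>x y. x \<in> A \<Longrightarrow> y \<in> B \<Longrightarrow> f (x, y) = (\<Sum>i\<le>2. \<Sum>j\<le>2. c i j * x ^ i * y ^ j)"
    using assms unfolding bidegree_poly_on_def by auto
  show "quadratic_on A (\<lambda>x. f (x, y))" if "y \<in> B"
    unfolding quadratic_on_def
    by (intro exI[of _ "\<Sum>j\<le>2. c 0 j * y ^ j"] exI[of _ "\<Sum>j\<le>2. c 1 j * y ^ j"]
        exI[of _ "\<Sum>j\<le>2. c 2 j * y ^ j"])
      (use c that in \<open>auto simp: numeral_2_eq_2 algebra_simps\<close>)
  show "quadratic_on B (\<lambda>y. f (x, y))" if "x \<in> A"
    unfolding quadratic_on_def
    by (intro exI[of _ "\<Sum>i\<le>2. c i 0 * x ^ i"] exI[of _ "\<Sum>i\<le>2. c i 1 * x ^ i"]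
        exI[of _ "\<Sum>i\<le>2. c i 2 * x ^ i"])
      (use c that in \<open>auto simp: numeral_2_eq_2 algebra_simps\<close>)
qed

context knots
begin

text \<open>Both directions pass through the second derivatives on the single intervals: these are
  equal exactly when the jumps between them vanish.\<close>

lemma Q_quadratic_iff:
  assumes ij: "i < j" "j \<le> P"
  shows "quadratic_on {t i..t j} (Q c) \<longleftrightarrow> (\<forall>p. i < p \<longrightarrow> p < j \<longrightarrow> c (p + 2) = 0)"
proof
  assume q: "quadratic_on {t i..t j} (Q c)"
  then obtain c0 c1 c2 where Q: "\<And>x. x \<in> {t i..t j} \<Longrightarrow> Q c x = c0 + c1 * x + c2 * x\<^sup>2"
    unfolding quadratic_on_def by blast
  have s: "second c p = 2 * c2" if "i \<le> p" "p < j" for p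
  proof -
    have sub: "{t p..t (Suc p)} \<subseteq> {t i..t j}"
      using that ij t_mono[of i p] t_mono[of "Suc p" j] by auto
    have p: "p < P" using that ij by simp
    have "sdiff t p (Q c) = 2 * c2" by (rule sdiff_quadratic[OF t_Suc[OF p] Q]) (use sub in blast)
    moreover have "sdiff t p (Q c) = 2 * (second c p / 2)"
    proof (rule sdiff_quadratic[OF t_Suc[OF p]])
      fix x
      assume "x \<in> {t p..t (Suc p)}"
      then show "Q c x = (Q c (t p) - Q' c (t p) * t p + second c p * (t p)\<^sup>2 / 2)
          + (Q' c (t p) - second c p * t p) * x + (second c p / 2) * x\<^sup>2"
        using Q_transport(2)[OF p, of x c] by (simp add: power2_eq_square field_simps)
    qed
    ultimately show ?thesis by simp
  qed
  show "\<forall>p. i < p \<longrightarrow> p < j \<longrightarrow> c (p + 2) = 0"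
  proof (intro allI impI)
    fix p
    assume "i < p" "p < j"
    then show "c (p + 2) = 0"
      using s[of p] s[of "p - 1"] second_Suc[of c "p - 1"] by (cases p) (auto simp: numeral_2_eq_2 numeral_3_eq_3)
  qed
next
  assume "\<forall>p. i < p \<longrightarrow> p < j \<longrightarrow> c (p + 2) = 0"
  then have "Q c x = Q c (t i) + Q' c (t i) * (x - t i) + second c i * (x - t i)\<^sup>2 / 2"
    if "x \<in> {t i..t j}" for x
    using Q_transport_gen(2)[OF ij that, of c] by simp
  then show "quadratic_on {t i..t j} (Q c)"
    unfolding quadratic_on_def
    by (intro exI[of _ "Q c (t i) - Q' c (t i) * t i + second c i * (t i)\<^sup>2 / 2"]
        exI[of _ "Q' c (t i) - second c i * t i"] exI[of _ "second c i / 2"])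
      (auto simp: power2_eq_square field_simps)
qed

end

text \<open>Each coefficient functional is a finite combination of point values, hence produces a
  combination of the splines \<open>f s\<close>.\<close>

lemma qspline_cf:
  assumes "\<And>s. s \<in> {x 0..x P} \<Longrightarrow> qspline y R (f s)" "knots x P" "a < P + 2"
  shows "qspline y R (\<lambda>Y. cf x a (\<lambda>s. f s Y))"
proof -
  interpret knots x P by fact
  have mem: "x p \<in> {x 0..x P}" if "p \<le> P" for p
    using that t_mono[of 0 p] t_mono[of p P] by simp
  have mid: "(x p + x (Suc p)) / 2 \<in> {x 0..x P}" if "p < P" for p
    using mem[of p] mem[of "Suc p"] that by simp
  have sd: "qspline y R (\<lambda>Y. sdiff x p (\<lambda>s. f s Y))" if "p < P" for p
  proof -
    have eq: "(\<lambda>Y. sdiff x p (\<lambda>s. f s Y)) = (\<lambda>Y. (4 / (x (Suc p) - x p)\<^sup>2) * f (x p) Y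
        + (- 8 / (x (Suc p) - x p)\<^sup>2) * f ((x p + x (Suc p)) / 2) Y
        + (4 / (x (Suc p) - x p)\<^sup>2) * f (x (Suc p)) Y)"
      by (auto simp: sdiff_def diff_divide_distrib add_divide_distrib algebra_simps)
    show ?thesis unfolding eq using that mem[of p] mem[of "Suc p"] mid[of p]
      by (intro qspline_lincomb assms(1)) auto
  qed
  consider "a = 0" | "a = 1" | "a = 2" | p where "a = Suc (Suc (Suc p))"
    by (metis One_nat_def Suc_1 not0_implies_Suc)
  then show ?thesis
  proof cases
    case 1
    then show ?thesis using assms(1) mem[of 0] by simp
  next
    case 2
    have eq: "(\<lambda>Y. cf x a (\<lambda>s. f s Y)) = (\<lambda>Y. (4 / (x 1 - x 0)) * f ((x 0 + x 1) / 2) Y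
        + (- 3 / (x 1 - x 0)) * f (x 0) Y + (- 1 / (x 1 - x 0)) * f (x 1) Y)"
      using 2 by (auto simp: diff_divide_distrib)
    show ?thesis unfolding eq using P mem[of 0] mem[of 1] mid[of 0]
      by (intro qspline_lincomb assms(1)) auto
  next
    case 3
    then show ?thesis using sd[of 0] P by (simp add: numeral_2_eq_2)
  next
    case (4 p)
    then have p: "Suc p < P" "p < P" using assms(3) by auto
    have "qspline y R (\<lambda>Y. 1 * sdiff x (Suc p) (\<lambda>s. f s Y) + (- 1) * sdiff x p (\<lambda>s. f s Y)
        + 0 * sdiff x p (\<lambda>s. f s Y))"
      by (intro qspline_lincomb sd p)
    then show ?thesis using 4 by simp
  qed
qed

locale bknots = X: knots x P + Y: knots y R for x y :: "nat \<Rightarrow> real" and P R :: nat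
begin

definition box2 :: "point set" where "box2 = {x 0..x P} \<times> {y 0..y R}"

text \<open>Extended by 0 outside of the box, as \<open>spline_space\<close> demands of functions on
  the domain.\<close>

definition F :: "(nat \<Rightarrow> nat \<Rightarrow> real) \<Rightarrow> point \<Rightarrow> real" where
  "F C p = (if p \<in> box2 then \<Sum>a<P + 2. \<Sum>b<R + 2. C a b * sb x a (fst p) * sb y b (snd p) else 0)"

text \<open>For \<open>0 < p\<close> this exhibits \<open>Y.Q (C (p + 2))\<close> as the jump of the
  second \<open>x\<close>-derivative across the line \<open>x p\<close>, that is, as the smoothing
  cofactor along that line.\<close>

lemma F_row: "(X, Y) \<in> box2 \<Longrightarrow> F C (X, Y) = X.Q (\<lambda>a. Y.Q (C a) Y) X"
  by (simp add: F_def X.Q_def Y.Q_def sum_distrib_left sum_distrib_right mult_ac del: sum.lessThan_Suc)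

lemma F_col: "(X, Y) \<in> box2 \<Longrightarrow> F C (X, Y) = Y.Q (\<lambda>b. X.Q (\<lambda>a. C a b) X) Y"
  unfolding F_def Y.Q_def X.Q_def
  by (simp add: sum_distrib_left sum_distrib_right mult_ac del: sum.lessThan_Suc) (rule sum.swap)

lemma F_unique:
  assumes "\<And>p. p \<in> box2 \<Longrightarrow> F C p = 0" "a < P + 2" "b < R + 2"
  shows "C a b = 0"
proof -
  have "Y.Q (C a) Y = 0" if "Y \<in> {y 0..y R}" for Y
  proof (rule X.Q_unique[OF _ assms(2)])
    fix X
    assume "X \<in> {x 0..x P}"
    then show "X.Q (\<lambda>a. Y.Q (C a) Y) X = 0"
      using that assms(1)[of "(X, Y)"] F_row[of X Y C] by (simp add: box2_def)
  qed
  then show ?thesis using Y.Q_unique[OF _ assms(3)] by blast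
qed

text \<open>The one-variable representation is used twice: the coefficients of the horizontal
  sections are themselves splines in \<open>Y\<close>.\<close>

lemma F_rep:
  assumes "\<And>Y. Y \<in> {y 0..y R} \<Longrightarrow> qspline x P (\<lambda>X. f (X, Y))"
    and "\<And>X. X \<in> {x 0..x P} \<Longrightarrow> qspline y R (\<lambda>Y. f (X, Y))"
    and "\<And>p. p \<notin> box2 \<Longrightarrow> f p = 0"
  shows "\<exists>C. f = F C"
proof -
  define C where "C a b = cf y b (\<lambda>Y. cf x a (\<lambda>s. f (s, Y)))" for a b
  have "f (X, Y) = F C (X, Y)" for X Y
  proof (cases "(X, Y) \<in> box2")
    case True
    then have XY: "X \<in> {x 0..x P}" "Y \<in> {y 0..y R}" by (auto simp: box2_def)
    have "f (X, Y) = X.Q (\<lambda>a. cf x a (\<lambda>s. f (s, Y))) X"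
      using X.qspline_rep[OF assms(1)[OF XY(2)] XY(1)] by simp
    also have "\<dots> = X.Q (\<lambda>a. Y.Q (C a) Y) X"
      unfolding X.Q_def
    proof (rule sum.cong[OF refl])
      fix a
      assume "a \<in> {..<P + 2}"
      then have "qspline y R (\<lambda>Y. cf x a (\<lambda>s. f (s, Y)))"
        by (intro qspline_cf assms(2)) (auto intro: X.knots_axioms)
      from Y.qspline_rep[OF this XY(2)]
      show "cf x a (\<lambda>s. f (s, Y)) * sb x a X = Y.Q (C a) Y * sb x a X"
        by (simp add: C_def[abs_def])
    qed
    finally show ?thesis using F_row[OF True] by simp
  qed (use assms(3) in \<open>auto simp: F_def\<close>)
  then show ?thesis by (intro exI[of _ C]) auto
qed

text \<open>A function that is quadratic in each variable separately is biquadratic, and for the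
  sections this is a condition on the jumps at the grid lines strictly inside the rectangle.\<close>

lemma F_bidegree_iff:
  assumes i: "i0 < i1" "i1 \<le> P" and j: "j0 < j1" "j1 \<le> R"
  shows "bidegree_poly_on 2 ({x i0..x i1} \<times> {y j0..y j1}) (F C) \<longleftrightarrow>
    (\<forall>p Y. i0 < p \<longrightarrow> p < i1 \<longrightarrow> Y \<in> {y j0..y j1} \<longrightarrow> Y.Q (C (p + 2)) Y = 0) \<and>
    (\<forall>s X. j0 < s \<longrightarrow> s < j1 \<longrightarrow> X \<in> {x i0..x i1} \<longrightarrow> X.Q (\<lambda>a. C a (s + 2)) X = 0)"
proof -
  have sub: "{x i0..x i1} \<subseteq> {x 0..x P}" "{y j0..y j1} \<subseteq> {y 0..y R}"
    using i j X.t_mono[of 0 i0] X.t_mono[of i1 P] Y.t_mono[of 0 j0] Y.t_mono[of j1 R] by auto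
  have row: "quadratic_on {x i0..x i1} (\<lambda>X. F C (X, Y)) \<longleftrightarrow>
      (\<forall>p. i0 < p \<longrightarrow> p < i1 \<longrightarrow> Y.Q (C (p + 2)) Y = 0)" if "Y \<in> {y j0..y j1}" for Y
  proof -
    have "quadratic_on {x i0..x i1} (\<lambda>X. F C (X, Y)) \<longleftrightarrow>
        quadratic_on {x i0..x i1} (X.Q (\<lambda>a. Y.Q (C a) Y))"
      unfolding quadratic_on_def using sub that by (intro ex_cong1 ball_cong refl) (auto simp: F_row box2_def)
    then show ?thesis using X.Q_quadratic_iff[OF i] by simp
  qed
  have col: "quadratic_on {y j0..y j1} (\<lambda>Y. F C (X, Y)) \<longleftrightarrow>
      (\<forall>s. j0 < s \<longrightarrow> s < j1 \<longrightarrow> X.Q (\<lambda>a. C a (s + 2)) X = 0)" if "X \<in> {x i0..x i1}" for X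
  proof -
    have "quadratic_on {y j0..y j1} (\<lambda>Y. F C (X, Y)) \<longleftrightarrow>
        quadratic_on {y j0..y j1} (Y.Q (\<lambda>b. X.Q (\<lambda>a. C a b) X))"
      unfolding quadratic_on_def using sub that by (intro ex_cong1 ball_cong refl) (auto simp: F_col box2_def)
    then show ?thesis using Y.Q_quadratic_iff[OF j] by simp
  qed
  have "x i0 < x i1" using X.t_less i by simp
  then show ?thesis
    using bidegree_from_sections[of "x i0" "x i1" "y j0" "y j1" "F C"]
      sections_of_bidegree[of "{x i0..x i1}" "{y j0..y j1}" "F C"] row col by blast
qed

lemma F_C_mixed: "C_mixed 1 box2 (F C)"
proof -
  define dx where "dx a = (if a = (0::nat) then sb x else sb' x)" for a
  define dy where "dy b = (if b = (0::nat) then sb y else sb' y)" for b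
  define g where "g a b p = (\<Sum>i<P + 2. \<Sum>j<R + 2. C i j * dx a i (fst p) * dy b j (snd p))"
    for a b :: nat and p :: point
  have cx: "continuous_on S (dx a i)" and cy: "continuous_on S (dy a i)" for S a i
    by (auto simp: dx_def dy_def continuous_sb continuous_sb')
  have "continuous_on S (g a b)" for S a b
    unfolding g_def
    by (intro continuous_intros continuous_on_compose2[OF cx] continuous_on_compose2[OF cy]) auto
  moreover have "((\<lambda>t. g 0 0 (X, t)) has_real_derivative g 0 1 (X, Y)) (at Y within S)" for X Y S
    unfolding g_def fst_conv snd_conv dy_def
    by (simp del: sum.lessThan_Suc) (intro DERIV_sum DERIV_cmult sb_deriv)
  moreover have "((\<lambda>s. g 0 b (s, Y)) has_real_derivative g 1 b (X, Y)) (at X within S)" for X Y S b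
    unfolding g_def fst_conv snd_conv dx_def
    by (simp del: sum.lessThan_Suc) (intro DERIV_sum DERIV_cmult_right DERIV_cmult sb_deriv)
  moreover have "g 0 0 p = F C p" if "p \<in> box2" for p
    using that by (simp add: g_def F_def dx_def dy_def)
  ultimately show ?thesis unfolding C_mixed_def by (intro exI[of _ g]) auto
qed

lemma C_mixed_sections:
  assumes "C_mixed 1 box2 f" "(X, Y) \<in> box2"
  shows "\<exists>d. ((\<lambda>s. f (s, Y)) has_real_derivative d) (at X within {x 0..x P})"
    and "\<exists>d. ((\<lambda>t. f (X, t)) has_real_derivative d) (at Y within {y 0..y R})"
proof -
  obtain g where g: "\<forall>p\<in>box2. g 0 0 p = f p"
    and gy: "\<forall>b<1. \<forall>(x, y)\<in>box2. ((\<lambda>t. g 0 b (x, t)) has_real_derivative g 0 (Suc b) (x, y))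
           (at y within {t. (x, t) \<in> box2})"
    and gx: "\<forall>a<1. \<forall>b\<le>1. \<forall>(x, y)\<in>box2. ((\<lambda>s. g a b (s, y)) has_real_derivative g (Suc a) b (x, y))
           (at x within {s. (s, y) \<in> box2})"
    using assms(1) unfolding C_mixed_def by (elim exE conjE) (rule that)
  have e: "{t. (X, t) \<in> box2} = {y 0..y R}" "{s. (s, Y) \<in> box2} = {x 0..x P}"
    using assms(2) by (auto simp: box2_def)
  have "((\<lambda>t. g 0 0 (X, t)) has_real_derivative g 0 (Suc 0) (X, Y)) (at Y within {y 0..y R})"
    using gy[rule_format, of 0 "(X, Y)"] assms(2) e by simp
  then have "((\<lambda>t. f (X, t)) has_real_derivative g 0 (Suc 0) (X, Y)) (at Y within {y 0..y R})"
    by (rule has_field_derivative_transform_within[where d = 1]) (use g assms(2) in \<open>auto simp: box2_def\<close>)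
  then show "\<exists>d. ((\<lambda>t. f (X, t)) has_real_derivative d) (at Y within {y 0..y R})" by blast
  have "((\<lambda>s. g 0 0 (s, Y)) has_real_derivative g (Suc 0) 0 (X, Y)) (at X within {x 0..x P})"
    using gx[rule_format, of 0 0 "(X, Y)"] assms(2) e by simp
  then have "((\<lambda>s. f (s, Y)) has_real_derivative g (Suc 0) 0 (X, Y)) (at X within {x 0..x P})"
    by (rule has_field_derivative_transform_within[where d = 1]) (use g assms(2) in \<open>auto simp: box2_def\<close>)
  then show "\<exists>d. ((\<lambda>s. f (s, Y)) has_real_derivative d) (at X within {x 0..x P})" by blast
qed

text \<open>\<open>B\<close> lists the cells as index rectangles. Since they cover every fine cell,
  all sections of a spline in the space are splines on the full grid, so it has the form
  \<open>F C\<close>; membership then becomes the cofactor condition of each cell.\<close>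

lemma spline_space_iff:
  assumes dom: "mesh_domain M = box2"
    and M: "region ` M = (\<lambda>(i0, i1, j0, j1). {x i0..x i1} \<times> {y j0..y j1}) ` B"
    and B: "\<And>i0 i1 j0 j1. (i0, i1, j0, j1) \<in> B \<Longrightarrow> i0 < i1 \<and> i1 \<le> P \<and> j0 < j1 \<and> j1 \<le> R"
    and cov: "\<And>i j. i < P \<Longrightarrow> j < R \<Longrightarrow>
      \<exists>i0 i1 j0 j1. (i0, i1, j0, j1) \<in> B \<and> i0 \<le> i \<and> i < i1 \<and> j0 \<le> j \<and> j < j1"
  shows "f \<in> spline_space 2 M \<longleftrightarrow> (\<exists>C. f = F C \<and> (\<forall>(i0, i1, j0, j1)\<in>B.
    (\<forall>p Y. i0 < p \<longrightarrow> p < i1 \<longrightarrow> Y \<in> {y j0..y j1} \<longrightarrow> Y.Q (C (p + 2)) Y = 0) \<and>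
    (\<forall>s X. j0 < s \<longrightarrow> s < j1 \<longrightarrow> X \<in> {x i0..x i1} \<longrightarrow> X.Q (\<lambda>a. C a (s + 2)) X = 0)))"
    (is "_ \<longleftrightarrow> (\<exists>C. f = F C \<and> ?A C)")
proof -
  have A: "?A C \<longleftrightarrow> (\<forall>\<phi>\<in>M. bidegree_poly_on 2 (region \<phi>) (F C))" for C
  proof -
    have "(\<forall>\<phi>\<in>M. bidegree_poly_on 2 (region \<phi>) (F C)) \<longleftrightarrow>
        (\<forall>r\<in>region ` M. bidegree_poly_on 2 r (F C))" by blast
    also have "\<dots> \<longleftrightarrow> (\<forall>(i0, i1, j0, j1)\<in>B. bidegree_poly_on 2 ({x i0..x i1} \<times> {y j0..y j1}) (F C))"
      unfolding M by fastforce
    also have "\<dots> \<longleftrightarrow> ?A C"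
    proof (rule ball_cong[OF refl])
      fix q
      assume "q \<in> B"
      then show "(case q of (i0, i1, j0, j1) \<Rightarrow>
          bidegree_poly_on 2 ({x i0..x i1} \<times> {y j0..y j1}) (F C)) = (case q of (i0, i1, j0, j1) \<Rightarrow>
        (\<forall>p Y. i0 < p \<longrightarrow> p < i1 \<longrightarrow> Y \<in> {y j0..y j1} \<longrightarrow> Y.Q (C (p + 2)) Y = 0) \<and>
        (\<forall>s X. j0 < s \<longrightarrow> s < j1 \<longrightarrow> X \<in> {x i0..x i1} \<longrightarrow> X.Q (\<lambda>a. C a (s + 2)) X = 0))"
        using B F_bidegree_iff by (cases q) auto
    qed
    finally show ?thesis by simp
  qed
  have ex: "\<exists>C. f = F C" if f: "f \<in> spline_space 2 M"
  proof (rule F_rep)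
    have f0: "\<And>p. p \<notin> box2 \<Longrightarrow> f p = 0" and fC: "C_mixed 1 box2 f"
      and fp: "\<And>\<phi>. \<phi> \<in> M \<Longrightarrow> bidegree_poly_on 2 (region \<phi>) f"
      using f by (auto simp: spline_space_def dom)
    show "f p = 0" if "p \<notin> box2" for p using f0[OF that] .
    have fine: "bidegree_poly_on 2 ({x i..x (Suc i)} \<times> {y j..y (Suc j)}) f" if ij: "i < P" "j < R" for i j
    proof -
      obtain i0 i1 j0 j1 where b: "(i0, i1, j0, j1) \<in> B" "i0 \<le> i" "i < i1" "j0 \<le> j" "j < j1"
        using cov[OF ij] by blast
      then have le: "i1 \<le> P" "j1 \<le> R" using B by auto
      have "{x i0..x i1} \<times> {y j0..y j1} \<in> region ` M" using b(1) unfolding M by force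
      then obtain \<phi> where \<phi>: "\<phi> \<in> M" "region \<phi> = {x i0..x i1} \<times> {y j0..y j1}" by force
      obtain c where c: "\<forall>(X, Y)\<in>{x i0..x i1} \<times> {y j0..y j1}. f (X, Y) = (\<Sum>i\<le>2. \<Sum>j\<le>2. c i j * X ^ i * Y ^ j)"
        using fp[OF \<phi>(1)] unfolding \<phi>(2) bidegree_poly_on_def by (elim exE) (rule that)
      have "{x i..x (Suc i)} \<times> {y j..y (Suc j)} \<subseteq> {x i0..x i1} \<times> {y j0..y j1}"
        using b le X.t_mono[of i0 i] X.t_mono[of "Suc i" i1] Y.t_mono[of j0 j] Y.t_mono[of "Suc j" j1] by auto
      then show ?thesis using c unfolding bidegree_poly_on_def by (intro exI[of _ c]) blast
    qed
    show "qspline x P (\<lambda>X. f (X, Y))" if Y: "Y \<in> {y 0..y R}" for Y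
      unfolding qspline_def
    proof (intro conjI allI impI ballI)
      fix p
      assume p: "p < P"
      obtain j where j: "j < R" "Y \<in> {y j..y (Suc j)}" using Y.t_interval[OF Y] by blast
      show "\<exists>c0 c1 c2. \<forall>X\<in>{x p..x (Suc p)}. f (X, Y) = c0 + c1 * X + c2 * X\<^sup>2"
        using sections_of_bidegree(1)[OF fine[OF p j(1)] j(2)] unfolding quadratic_on_def .
    next
      fix X
      assume "X \<in> {x 0..x P}"
      then show "\<exists>d. ((\<lambda>X. f (X, Y)) has_real_derivative d) (at X within {x 0..x P})"
        using C_mixed_sections(1)[OF fC] Y by (simp add: box2_def)
    qed
    show "qspline y R (\<lambda>Y. f (X, Y))" if X: "X \<in> {x 0..x P}" for X
      unfolding qspline_def
    proof (intro conjI allI impI ballI)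
      fix q
      assume q: "q < R"
      obtain i where i: "i < P" "X \<in> {x i..x (Suc i)}" using X.t_interval[OF X] by blast
      show "\<exists>c0 c1 c2. \<forall>Y\<in>{y q..y (Suc q)}. f (X, Y) = c0 + c1 * Y + c2 * Y\<^sup>2"
        using sections_of_bidegree(2)[OF fine[OF i(1) q] i(2)] unfolding quadratic_on_def .
    next
      fix Y
      assume "Y \<in> {y 0..y R}"
      then show "\<exists>d. ((\<lambda>Y. f (X, Y)) has_real_derivative d) (at Y within {y 0..y R})"
        using C_mixed_sections(2)[OF fC] X by (simp add: box2_def)
    qed
  qed
  have mem: "F C \<in> spline_space 2 M \<longleftrightarrow> ?A C" for C
    unfolding A spline_space_def dom using F_C_mixed by (auto simp: F_def)
  show ?thesis
  proof
    assume f: "f \<in> spline_space 2 M"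
    then obtain C where C: "f = F C" using ex by blast
    then have "F C \<in> spline_space 2 M" using f by simp
    from iffD1[OF mem this] C show "\<exists>C. f = F C \<and> ?A C" by (intro exI[of _ C] conjI)
  next
    assume "\<exists>C. f = F C \<and> ?A C"
    then obtain C where C: "f = F C" "?A C" by (elim exE conjE)
    from iffD2[OF mem C(2)] C(1) show "f \<in> spline_space 2 M" by simp
  qed
qed

end

section \<open>Dyadic subdivision of an index grid\<close>

text \<open>The column of level \<open>k\<close> that contains the column \<open>i\<close> of the
  finest grid, which has level \<open>n\<close>; likewise for rows.\<close>

definition anc :: "nat \<Rightarrow> nat \<Rightarrow> nat \<Rightarrow> nat" where
  "anc n k i = i div 2 ^ (n - k)"

text \<open>The index, in the finest grid, of the line halving the column \<open>a\<close> of level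
  \<open>k\<close>. Its 2-adic valuation \<open>n - Suc k\<close> encodes the level.\<close>

definition mid :: "nat \<Rightarrow> nat \<Rightarrow> nat \<Rightarrow> nat" where
  "mid n k a = (2 * a + 1) * 2 ^ (n - Suc k)"

text \<open>Exchange of the axes. Statements about vertical lines are interpreted a second time for
  \<open>swp D\<close> to obtain the horizontal ones.\<close>

definition swp :: "(nat \<Rightarrow> (nat \<times> nat) set) \<Rightarrow> nat \<Rightarrow> (nat \<times> nat) set" where
  "swp D k = {(b, a). (a, b) \<in> D k}"

lemma swp_iff [simp]: "(b, a) \<in> swp D k \<longleftrightarrow> (a, b) \<in> D k"
  by (simp add: swp_def)

lemma swp_swp [simp]: "swp (swp D) = D"
  by (auto simp: swp_def fun_eq_iff)

lemma pow_split: "k < n \<Longrightarrow> (2::nat) ^ (n - k) = 2 * 2 ^ (n - Suc k)"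
  by (metis Suc_diff_Suc power_Suc)

lemma anc_Suc: "k < n \<Longrightarrow> anc n k i = anc n (Suc k) i div 2"
  by (simp add: anc_def pow_split div_mult2_eq[symmetric] mult.commute)

lemma anc_anc: "k' \<le> k \<Longrightarrow> k \<le> n \<Longrightarrow> anc n k' i = anc n k i div 2 ^ (k - k')"
proof -
  assume "k' \<le> k" "k \<le> n"
  then have "(2::nat) ^ (n - k') = 2 ^ (n - k) * 2 ^ (k - k')"
    by (simp add: power_add[symmetric])
  then show ?thesis by (simp add: anc_def div_mult2_eq)
qed

lemma anc_eq_iff: "anc n k i = a \<longleftrightarrow> a * 2 ^ (n - k) \<le> i \<and> i < (a + 1) * 2 ^ (n - k)"
proof
  assume "anc n k i = a"
  then show "a * 2 ^ (n - k) \<le> i \<and> i < (a + 1) * 2 ^ (n - k)"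
    using dividend_less_div_times[of "2 ^ (n - k)" i] times_div_less_eq_dividend[of "2 ^ (n - k)" i]
    by (auto simp: anc_def mult.commute)
next
  assume "a * 2 ^ (n - k) \<le> i \<and> i < (a + 1) * 2 ^ (n - k)"
  then show "anc n k i = a"
    unfolding anc_def by (intro div_nat_eqI) (auto simp: mult.commute)
qed

text \<open>The fine column to the left of the line \<open>p\<close> is \<open>p - 1\<close>. It
  lies in another block of width \<open>m\<close> than the column \<open>p\<close> exactly when the
  line separates two blocks.\<close>

lemma div_pred: "0 < m \<Longrightarrow> 0 < p \<Longrightarrow> (p - 1) div m = (if m dvd p then p div m - 1 else p div m)"
  for p m :: nat
proof (cases "m dvd p")
  case True
  assume m: "0 < m" and p: "0 < p"
  from True obtain q where q: "p = m * q" by blast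
  then have "0 < q" using p by (cases q) auto
  then have "(p - 1) div m = q - 1"
    using m q by (intro div_nat_eqI) (auto simp: algebra_simps diff_mult_distrib2)
  then show ?thesis using True m q by simp
next
  case False
  assume m: "0 < m" and p: "0 < p"
  define q r where "q = p div m" "r = p mod m"
  have "p = m * q + r" "0 < r" "r < m" using False m by (auto simp: q_r_def mod_greater_zero_iff_not_dvd)
  then have "(p - 1) div m = q" by (intro div_nat_eqI) auto
  then have "(p - 1) div m = p div m" by (simp add: q_r_def)
  then show ?thesis using False by simp
qed

lemma mid_pos [simp]: "0 < mid n k a"
  by (simp add: mid_def)

lemma anc_mid_Suc: "k < n \<Longrightarrow> anc n (Suc k) (mid n k a) = 2 * a + 1"
  by (simp add: anc_def mid_def)

lemma anc_mid: "k < n \<Longrightarrow> anc n k (mid n k a) = a"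
  by (simp add: anc_Suc anc_mid_Suc)

lemma anc_mid_pred_Suc: "k < n \<Longrightarrow> anc n (Suc k) (mid n k a - 1) = 2 * a"
  unfolding anc_def by (subst div_pred) (auto simp: mid_def)

lemma anc_mid_pred: "k < n \<Longrightarrow> anc n k (mid n k a - 1) = a"
  using anc_mid_pred_Suc[of k n a] by (simp add: anc_Suc)

lemma mid_dvd: "k < k' \<Longrightarrow> k' < n \<Longrightarrow> \<not> 2 ^ (n - Suc k) dvd mid n k' a"
proof
  assume k: "k < k'" "k' < n" and d: "2 ^ (n - Suc k) dvd mid n k' a"
  have "(2::nat) ^ (n - k') dvd 2 ^ (n - Suc k)" using k by (intro le_imp_power_dvd) simp
  then have "2 * 2 ^ (n - Suc k') dvd (2 * a + 1) * (2::nat) ^ (n - Suc k')"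
    using d k(2) unfolding mid_def by (metis pow_split dvd_trans)
  then show False by (subst (asm) dvd_times_right_cancel_iff) auto
qed

text \<open>The power of two in the index determines the level, and the odd part then determines the
  column.\<close>

lemma mid_inj: "mid n k a = mid n k' a' \<Longrightarrow> k < n \<Longrightarrow> k' < n \<Longrightarrow> k = k' \<and> a = a'"
proof -
  assume e: "mid n k a = mid n k' a'" and k: "k < n" "k' < n"
  have "\<not> k < k'" using mid_dvd[of k k' n a'] k e[symmetric] by (auto simp: mid_def)
  moreover have "\<not> k' < k" using mid_dvd[of k' k n a] k e by (auto simp: mid_def)
  ultimately have "k = k'" by simp
  then show ?thesis using e by (simp add: mid_def)
qed

lemma mid_exists: "0 < p \<Longrightarrow> \<not> 2 ^ n dvd p \<Longrightarrow> \<exists>k<n. \<exists>a. p = mid n k a"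
proof (induction n arbitrary: p)
  case (Suc n)
  show ?case
  proof (cases "even p")
    case True
    then obtain q where q: "p = 2 * q" by blast
    then have "0 < q" "\<not> 2 ^ n dvd q" using Suc.prems by auto
    then obtain k a where "k < n" "q = mid n k a" using Suc.IH by blast
    then show ?thesis using q
      by (intro exI[of _ k] conjI exI[of _ a]) (auto simp: mid_def pow_split[of k n] Suc_diff_le)
  next
    case False
    then obtain a where "p = 2 * a + 1" by (elim oddE)
    then show ?thesis by (intro exI[of _ n] conjI exI[of _ a]) (auto simp: mid_def)
  qed
qed simp

text \<open>Every line strictly inside a block of width \<open>2 ^ m\<close> is the midline of
  exactly one dyadic subcolumn. In the induction the odd indices form the last level, and the even
  ones are the previous case doubled.\<close>

lemma mid_sum:
  fixes g :: "nat \<Rightarrow> real"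
  shows "(\<Sum>p\<in>{1..<2 ^ m}. g p) = (\<Sum>i<m. \<Sum>c<2 ^ i. g ((2 * c + 1) * 2 ^ (m - Suc i)))"
proof (induction m arbitrary: g)
  case (Suc m)
  have split: "{1..<(2::nat) ^ Suc m} = (\<lambda>p. 2 * p) ` {1..<2 ^ m} \<union> (\<lambda>c. 2 * c + 1) ` {..<2 ^ m}"
    (is "?A = ?B \<union> ?C") for m :: nat
  proof
    show "?A \<subseteq> ?B \<union> ?C"
    proof
      fix p :: nat
      assume p: "p \<in> {1..<2 ^ Suc m}"
      show "p \<in> ?B \<union> ?C"
      proof (cases "even p")
        case True
        then obtain q where "p = 2 * q" by blast
        then show ?thesis using p by auto
      next
        case False
        then obtain q where "p = 2 * q + 1" by (elim oddE)
        then show ?thesis using p by auto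
      qed
    qed
    show "?B \<union> ?C \<subseteq> ?A" by auto
  qed
  have disj: "(\<lambda>p. 2 * p) ` {1..<2 ^ m} \<inter> (\<lambda>c. 2 * c + 1) ` {..<(2::nat) ^ m} = {}"
  proof -
    have "2 * p \<noteq> 2 * c + 1" for p c :: nat by presburger
    then show ?thesis by blast
  qed
  have "(\<Sum>p\<in>{1..<2 ^ Suc m}. g p) = (\<Sum>p\<in>{1..<2 ^ m}. g (2 * p)) + (\<Sum>c<2 ^ m. g (2 * c + 1))"
    unfolding split by (subst sum.union_disjoint[OF _ _ disj]) (auto simp: sum.reindex inj_on_def)
  also have "(\<Sum>p\<in>{1..<2 ^ m}. g (2 * p)) = (\<Sum>i<m. \<Sum>c<2 ^ i. g ((2 * c + 1) * 2 ^ (Suc m - Suc i)))"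
    unfolding Suc.IH[of "\<lambda>p. g (2 * p)"]
  proof (intro sum.cong refl)
    fix i c
    assume "i \<in> {..<m}"
    then have "2 * ((2 * c + 1) * 2 ^ (m - Suc i)) = (2 * c + 1) * (2::nat) ^ (Suc m - Suc i)"
      using pow_split[of i m] by simp
    then show "g (2 * ((2 * c + 1) * 2 ^ (m - Suc i))) = g ((2 * c + 1) * 2 ^ (Suc m - Suc i))"
      by (simp only:)
  qed
  finally show ?case by simp
qed simp

section \<open>Divided cells and the leaves of the subdivision tree\<close>

fun lcells :: "nat \<Rightarrow> nat \<Rightarrow> (nat \<Rightarrow> (nat \<times> nat) set) \<Rightarrow> nat \<Rightarrow> (nat \<times> nat) set" where
  "lcells N M D 0 = {..<N} \<times> {..<M}"
| "lcells N M D (Suc k) = {(a, b). (a div 2, b div 2) \<in> D k}"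

text \<open>The points on the midline of column \<open>a\<close>, at the lower side of row
  \<open>b\<close>, where the cofactor may be nonzero: an undivided cell next to the point would
  force it to vanish there. At \<open>b = 0\<close> and \<open>b = M * 2 ^ k\<close> only one cell
  is adjacent.\<close>

definition act :: "nat \<Rightarrow> (nat \<Rightarrow> (nat \<times> nat) set) \<Rightarrow> nat \<Rightarrow> (nat \<times> nat) set" where
  "act M D k = {(a, b). b \<le> M * 2 ^ k \<and> (0 < b \<longrightarrow> (a, b - 1) \<in> D k) \<and> (b < M * 2 ^ k \<longrightarrow> (a, b) \<in> D k)}"

text \<open>\<open>(a, b) \<in> D k\<close> means that the cell in column \<open>a\<close> and row
  \<open>b\<close> of level \<open>k\<close> is divided; this can happen only if its parent is
  divided.\<close>

locale dyadic =
  fixes N M n :: nat and D :: "nat \<Rightarrow> (nat \<times> nat) set"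
  assumes N: "0 < N" and M: "0 < M"
    and D_0: "D 0 \<subseteq> {..<N} \<times> {..<M}"
    and D_Suc: "(a, b) \<in> D (Suc k) \<Longrightarrow> (a div 2, b div 2) \<in> D k"
    and D_n: "n \<le> k \<Longrightarrow> D k = {}"
begin

abbreviation "L \<equiv> lcells N M D"

lemma dyadic_swp: "dyadic M N n (swp D)"
  using N M D_0 D_Suc D_n by unfold_locales (auto simp: swp_def)

lemma D_L: "D k \<subseteq> L k"
  using D_0 D_Suc by (cases k) auto

lemma L_range: "(a, b) \<in> L k \<Longrightarrow> a < N * 2 ^ k \<and> b < M * 2 ^ k"
proof (induction k arbitrary: a b)
  case (Suc k)
  then have "(a div 2, b div 2) \<in> L k" using D_L by auto
  from Suc.IH[OF this] show ?case by auto
qed simp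

lemma D_range: "(a, b) \<in> D k \<Longrightarrow> a < N * 2 ^ k \<and> b < M * 2 ^ k"
  using D_L L_range by blast

lemma finite_D: "finite (D k)"
  by (rule finite_subset[of _ "{..<N * 2 ^ k} \<times> {..<M * 2 ^ k}"]) (use D_range in auto)

lemma finite_L: "finite (L k)"
  by (rule finite_subset[of _ "{..<N * 2 ^ k} \<times> {..<M * 2 ^ k}"]) (use L_range in auto)

lemma D_less_n: "(a, b) \<in> D k \<Longrightarrow> k < n"
  using D_n[of k] by (cases "k < n") auto

lemma D_anc: "(a, b) \<in> D (k + i) \<Longrightarrow> (a div 2 ^ i, b div 2 ^ i) \<in> D k"
proof (induction i arbitrary: a b)
  case (Suc i)
  then have "(a div 2, b div 2) \<in> D (k + i)" using D_Suc by simp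
  from Suc.IH[OF this] show ?case by (simp add: div_mult2_eq[symmetric] mult.commute)
qed simp

lemma D_anc': "(a, b) \<in> D k \<Longrightarrow> k' \<le> k \<Longrightarrow> (a div 2 ^ (k - k'), b div 2 ^ (k - k')) \<in> D k'"
  using D_anc[of a b k' "k - k'"] by simp

lemma L_anc: "(a, b) \<in> L k \<Longrightarrow> k' < k \<Longrightarrow> (a div 2 ^ (k - k'), b div 2 ^ (k - k')) \<in> D k'"
proof -
  assume ab: "(a, b) \<in> L k" and "k' < k"
  then obtain j where j: "k = Suc j" "k' \<le> j" by (cases k) auto
  then have "(a div 2, b div 2) \<in> D j" using ab by simp
  from D_anc'[OF this j(2)] show ?thesis
    using j by (simp add: Suc_diff_le div_mult2_eq[symmetric] mult.commute)
qed

text \<open>The level of the cell of the final mesh that contains the cell \<open>(i, j)\<close> of the finest grid.\<close>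

definition ll :: "nat \<Rightarrow> nat \<Rightarrow> nat" where
  "ll i j = (LEAST k. (anc n k i, anc n k j) \<notin> D k)"

definition lf :: "nat \<Rightarrow> nat \<Rightarrow> nat \<times> nat \<times> nat" where
  "lf i j = (ll i j, anc n (ll i j) i, anc n (ll i j) j)"

definition leaves :: "(nat \<times> nat \<times> nat) set" where
  "leaves = {(k, a, b). k \<le> n \<and> (a, b) \<in> L k - D k}"

lemma ll_notin: "(anc n (ll i j) i, anc n (ll i j) j) \<notin> D (ll i j)"
  unfolding ll_def by (rule LeastI[of _ n]) (simp add: D_n)

lemma ll_le: "(anc n k i, anc n k j) \<notin> D k \<Longrightarrow> ll i j \<le> k"
  unfolding ll_def by (rule Least_le)

lemma ll_le_n: "ll i j \<le> n"
  by (rule ll_le) (simp add: D_n)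

lemma ll_less: "k < ll i j \<Longrightarrow> (anc n k i, anc n k j) \<in> D k"
  using ll_le[of k i j] by auto

lemma lf_leaves: "i < N * 2 ^ n \<Longrightarrow> j < M * 2 ^ n \<Longrightarrow> lf i j \<in> leaves"
proof -
  assume ij: "i < N * 2 ^ n" "j < M * 2 ^ n"
  have "(anc n (ll i j) i, anc n (ll i j) j) \<in> L (ll i j)"
  proof (cases "ll i j")
    case 0
    then show ?thesis using ij by (simp add: anc_def less_mult_imp_div_less)
  next
    case (Suc k)
    then show ?thesis using ll_less[of k i j] ll_le_n[of i j] anc_Suc[of k n] by simp
  qed
  then show ?thesis using ll_notin ll_le_n by (simp add: leaves_def lf_def)
qed

lemma lf_unique: "(k, a, b) \<in> leaves \<Longrightarrow> anc n k i = a \<Longrightarrow> anc n k j = b \<Longrightarrow> lf i j = (k, a, b)"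
proof -
  assume l: "(k, a, b) \<in> leaves" and e: "anc n k i = a" "anc n k j = b"
  then have kn: "k \<le> n" by (simp add: leaves_def)
  have "ll i j = k" unfolding ll_def
  proof (rule Least_equality)
    show "(anc n k i, anc n k j) \<notin> D k" using l e by (simp add: leaves_def)
    fix k'
    assume "(anc n k' i, anc n k' j) \<notin> D k'"
    then show "k \<le> k'"
      using L_anc[of a b k k'] l e kn anc_anc[of k' k n] by (force simp: leaves_def not_le[symmetric])
  qed
  then show ?thesis using e by (simp add: lf_def)
qed

lemma ll_ge: "(anc n k i, anc n k j) \<in> L k \<Longrightarrow> k \<le> n \<Longrightarrow> k \<le> ll i j"
proof (rule ccontr)
  assume L: "(anc n k i, anc n k j) \<in> L k" "k \<le> n" and "\<not> k \<le> ll i j"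
  then have "ll i j < k" by simp
  from L_anc[OF L(1) this] show False
    using ll_notin[of i j] anc_anc[of "ll i j" k n] \<open>ll i j < k\<close> L(2) by simp
qed

text \<open>Where the midline does not divide a cell, its two sides belong to the same final cell:
  the level of that cell is at most \<open>k\<close>, and up to level \<open>k\<close> the ancestors
  on the two sides coincide.\<close>

lemma lf_pred_mid:
  assumes "k < n" "(a, anc n k j) \<notin> D k"
  shows "lf (mid n k a - 1) j = lf (mid n k a) j"
proof -
  define q where "q = mid n k a - 1"
  have le: "ll (mid n k a) j \<le> k"
    using assms by (intro ll_le) (simp add: anc_mid)
  have e: "anc n k' (q) = anc n k' (mid n k a)" if "k' \<le> k" for k'
    using that assms(1) anc_mid_pred[of k n a, folded q_def] by (simp add: anc_anc[of k' k] anc_mid)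
  have le': "ll (q) j \<le> k"
    using assms anc_mid_pred[of k n a, folded q_def] by (intro ll_le) simp
  have "ll (q) j = ll (mid n k a) j"
  proof (rule antisym)
    show "ll (q) j \<le> ll (mid n k a) j"
      using ll_notin[of "mid n k a" j] le by (intro ll_le) (simp add: e)
    show "ll (mid n k a) j \<le> ll (q) j"
      using ll_notin[of "q" j] le' by (intro ll_le) (simp add: e)
  qed
  then show ?thesis using le unfolding q_def[symmetric] by (simp add: lf_def e)
qed

text \<open>By its valuation the line is a midline of some level at least \<open>k\<close>. If the
  cell halved there were divided, then so would be its ancestor, the leaf.\<close>

lemma mid_in_leaf:
  assumes l: "(k, a, b) \<in> leaves" and p: "a * 2 ^ (n - k) < p" "p < (a + 1) * 2 ^ (n - k)"
    and j: "anc n k j = b"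
  shows "\<exists>k' a'. k' < n \<and> p = mid n k' a' \<and> (a', anc n k' j) \<notin> D k' \<and> a' < N * 2 ^ k'"
proof -
  have kn: "k \<le> n" using l by (simp add: leaves_def)
  have ap: "anc n k p = a" using p by (simp add: anc_eq_iff)
  have nd: "\<not> 2 ^ (n - k) dvd p"
  proof
    assume "2 ^ (n - k) dvd p"
    then obtain q where "p = 2 ^ (n - k) * q" by blast
    with p have "a * 2 ^ (n - k) < q * 2 ^ (n - k)" "q * 2 ^ (n - k) < (a + 1) * 2 ^ (n - k)"
      by (simp_all only: mult.commute)
    then have "a < q" "q < a + 1" by (simp_all only: mult_less_cancel2)
    then show False by simp
  qed
  have "\<not> 2 ^ n dvd p" using nd dvd_trans[of "2 ^ (n - k)" "2 ^ n" p] by (auto simp: le_imp_power_dvd)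
  then obtain k' a' where k': "k' < n" "p = mid n k' a'" using mid_exists[of p n] p by auto
  have "k \<le> k'"
  proof (rule ccontr)
    assume "\<not> k \<le> k'"
    then have "(2::nat) ^ (n - k) dvd 2 ^ (n - Suc k')" by (intro le_imp_power_dvd) simp
    then show False using nd k' by (auto simp: mid_def)
  qed
  have an: "a = a' div 2 ^ (k' - k)"
    using anc_anc[OF \<open>k \<le> k'\<close>, of n p] k' ap anc_mid[of k' n a'] by simp
  have "(a', anc n k' j) \<notin> D k'"
    using D_anc'[of a' "anc n k' j" k' k] \<open>k \<le> k'\<close> l j an anc_anc[of k k' n j] k'(1)
    by (auto simp: leaves_def)
  moreover have "a' < N * 2 ^ k'"
  proof -
    have "a < N * 2 ^ k" using l L_range by (auto simp: leaves_def)
    then have "a' div 2 ^ (k' - k) < N * 2 ^ k" using an by simp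
    then have "a' < N * 2 ^ k * 2 ^ (k' - k)" by (simp add: div_less_iff_less_mult)
    moreover have "(2::nat) ^ k * 2 ^ (k' - k) = 2 ^ k'"
      using \<open>k \<le> k'\<close> by (simp add: power_add[symmetric])
    ultimately show ?thesis by (simp only: mult.assoc)
  qed
  ultimately show ?thesis using k' by blast
qed

text \<open>The leaf contains the fine columns on both sides of the line, so the line cannot be one
  of its sides.\<close>

lemma mid_strict_leaf:
  assumes "k < n" "(a, anc n k j) \<notin> D k" "lf (mid n k a) j = (k0, a0, b0)"
  shows "a0 * 2 ^ (n - k0) < mid n k a" "mid n k a < (a0 + 1) * 2 ^ (n - k0)"
proof -
  have "anc n k0 (mid n k a) = a0" "anc n k0 (mid n k a - 1) = a0"
    using assms(3) lf_pred_mid[OF assms(1,2)] by (auto simp: lf_def)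
  then have "mid n k a < (a0 + 1) * 2 ^ (n - k0)" "a0 * 2 ^ (n - k0) \<le> mid n k a - 1"
    unfolding anc_eq_iff by auto
  then show "a0 * 2 ^ (n - k0) < mid n k a" "mid n k a < (a0 + 1) * 2 ^ (n - k0)"
    using mid_pos[of n k a] by linarith+
qed

lemma mid_less: "k < n \<Longrightarrow> a < N * 2 ^ k \<Longrightarrow> mid n k a < N * 2 ^ n"
proof -
  assume k: "k < n" and "a < N * 2 ^ k"
  then have "2 * a + 1 < 2 * (N * 2 ^ k)" by linarith
  then have "mid n k a < 2 * (N * 2 ^ k) * 2 ^ (n - Suc k)"
    unfolding mid_def by (intro mult_strict_right_mono) auto
  also have "\<dots> = N * (2 ^ k * (2 * 2 ^ (n - Suc k)))" by simp
  also have "\<dots> = N * 2 ^ n" using k by (simp add: pow_split[symmetric] power_add[symmetric])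
  finally show ?thesis .
qed

text \<open>Only neighbours across a side count: the new segments of a cell end at the midpoints of
  its sides, which a diagonal neighbour does not touch.\<close>

definition iso :: "nat \<Rightarrow> (nat \<times> nat) set" where
  "iso k = {(a, b) \<in> D k. 0 < a \<and> a + 1 < N * 2 ^ k \<and> 0 < b \<and> b + 1 < M * 2 ^ k \<and>
    (a - 1, b) \<notin> D k \<and> (a + 1, b) \<notin> D k \<and> (a, b - 1) \<notin> D k \<and> (a, b + 1) \<notin> D k}"

lemma finite_act: "finite (act M D k)"
proof (rule finite_subset)
  show "act M D k \<subseteq> {..<N * 2 ^ k} \<times> {..M * 2 ^ k}"
  proof
    fix q
    assume "q \<in> act M D k"
    then obtain a b where q: "q = (a, b)" "b \<le> M * 2 ^ k" "0 < b \<longrightarrow> (a, b - 1) \<in> D k"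
      "b < M * 2 ^ k \<longrightarrow> (a, b) \<in> D k" by (auto simp: act_def)
    have "(a, b - 1) \<in> D k \<or> (a, b) \<in> D k" using q M by (cases "0 < b") auto
    then show "q \<in> {..<N * 2 ^ k} \<times> {..M * 2 ^ k}" using q D_range by auto
  qed
qed simp

end

lemma (in dyadic) swp_leaf:
  "dyadic.ll n (swp D) j i = ll i j" "dyadic.lf n (swp D) j i = (case lf i j of (k, a, b) \<Rightarrow> (k, b, a))"
  "(k, b, a) \<in> dyadic.leaves M N n (swp D) \<longleftrightarrow> (k, a, b) \<in> leaves"
  "(b, a) \<in> dyadic.iso M N (swp D) k \<longleftrightarrow> (a, b) \<in> iso k"
proof -
  interpret S: dyadic M N n "swp D" by (rule dyadic_swp)
  show 1: "S.ll j i = ll i j" by (simp add: ll_def S.ll_def)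
  show "S.lf j i = (case lf i j of (k, a, b) \<Rightarrow> (k, b, a))" by (simp add: lf_def S.lf_def 1)
  have "(b, a) \<in> S.L k \<longleftrightarrow> (a, b) \<in> L k" by (cases k) auto
  then show "(k, b, a) \<in> S.leaves \<longleftrightarrow> (k, a, b) \<in> leaves" by (auto simp: leaves_def S.leaves_def)
  show "(b, a) \<in> S.iso k \<longleftrightarrow> (a, b) \<in> iso k" by (auto simp: iso_def S.iso_def)
qed

section \<open>The smoothness constraints\<close>

definition prim :: "real \<Rightarrow> real \<Rightarrow> real \<Rightarrow> real" where
  "prim w0 w1 Y = w0 * Y + w1 * Y\<^sup>2 / 2"

text \<open>If \<open>q\<close> is the smoothing cofactor along the line of index \<open>mid n k a\<close>, with values and derivatives
  recorded in \<open>s\<close>, then \<open>q''\<close> is the jump of \<open>h\<close>. The constraint is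
  \<open>w q' - w' q = \<integral> w q''\<close> on the part of the line inside the cell \<open>(a, b)\<close> of level \<open>k\<close>,
  for the affine weight \<open>w Y = w0 + w1 * Y\<close>.\<close>

definition lam :: "(nat \<Rightarrow> real) \<Rightarrow> nat \<Rightarrow> (nat \<Rightarrow> nat \<Rightarrow> real) \<Rightarrow> (nat \<Rightarrow> nat \<Rightarrow> nat \<Rightarrow> bool \<Rightarrow> real) \<Rightarrow>
    nat \<Rightarrow> nat \<Rightarrow> nat \<Rightarrow> real \<Rightarrow> real \<Rightarrow> real" where
  "lam y n h s k a b w0 w1 =
    ((w0 + w1 * y ((b + 1) * 2 ^ (n - k))) * s k a (b + 1) True - w1 * s k a (b + 1) False)
    - ((w0 + w1 * y (b * 2 ^ (n - k))) * s k a b True - w1 * s k a b False)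
    - (\<Sum>j\<in>{b * 2 ^ (n - k)..<(b + 1) * 2 ^ (n - k)}. (h (mid n k a) j - h (mid n k a - 1) j) *
        (prim w0 w1 (y (j + 1)) - prim w0 w1 (y j)))"

text \<open>All terms are linear in the weight, and
  \<open>w0 + w1 * Y = (w0 + w1 * m) + w1 * (Y - m)\<close>. So the two weights \<open>1\<close> and
  \<open>Y - m\<close> control all constraints of a cell.\<close>

lemma lam_weights: "lam y n h s k a b w0 w1 = (w0 + w1 * m) * lam y n h s k a b 1 0 + w1 * lam y n h s k a b (- m) 1"
proof -
  define S where "S w0 w1 = (\<Sum>j\<in>{b * 2 ^ (n - k)..<(b + 1) * 2 ^ (n - k)}. (h (mid n k a) j - h (mid n k a - 1) j) *
        (prim w0 w1 (y (j + 1)) - prim w0 w1 (y j)))" for w0 w1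
  have "S w0 w1 = (w0 + w1 * m) * S 1 0 + w1 * S (- m) 1"
    unfolding S_def sum_distrib_left sum.distrib[symmetric]
    by (intro sum.cong) (auto simp: prim_def algebra_simps diff_divide_distrib)
  then show ?thesis
    unfolding lam_def S_def[symmetric] by (simp add: algebra_simps)
qed

lemma lam_cong:
  assumes "\<And>j. j \<in> {b * 2 ^ (n - k)..<(b + 1) * 2 ^ (n - k)} \<Longrightarrow>
      h (mid n k a) j - h (mid n k a - 1) j = h' (mid n k a) j - h' (mid n k a - 1) j"
    and "\<And>r. s k a b r = s' k a b r" "\<And>r. s k a (b + 1) r = s' k a (b + 1) r"
  shows "lam y n h s k a b w0 w1 = lam y n h' s' k a b w0 w1"
  unfolding lam_def using assms by (auto intro!: sum.cong)

lemma lam_add: "lam y n (\<lambda>i j. h i j + h' i j) (\<lambda>k a b r. s k a b r + s' k a b r) k a b w0 w1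
    = lam y n h s k a b w0 w1 + lam y n h' s' k a b w0 w1"
proof -
  have eq: "(\<Sum>j\<in>S. (h p j + h' p j - (h q j + h' q j)) * g j)
      = (\<Sum>j\<in>S. (h p j - h q j) * g j) + (\<Sum>j\<in>S. (h' p j - h' q j) * g j)" for S p q g
    unfolding sum.distrib[symmetric] by (intro sum.cong) (auto simp: algebra_simps)
  have alg: "(u * (a + a') - v * (b + b')) - (u' * (c + c') - v * (d + d')) - (S + S')
      = ((u * a - v * b) - (u' * c - v * d) - S) + ((u * a' - v * b') - (u' * c' - v * d') - S')"
    for u v u' a a' b b' c c' d d' S S' :: real
    by (simp add: algebra_simps)
  show ?thesis unfolding lam_def eq by (rule alg)
qed

lemma lam_scale: "lam y n (\<lambda>i j. c * h i j) (\<lambda>k a b r. c * s k a b r) k a b w0 w1 = c * lam y n h s k a b w0 w1"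
proof -
  have eq: "(\<Sum>j\<in>S. (c * h p j - c * h q j) * g j) = c * (\<Sum>j\<in>S. (h p j - h q j) * g j)" for S p q g
    unfolding sum_distrib_left by (intro sum.cong) (auto simp: algebra_simps)
  have alg: "(u * (e * a) - v * (e * b)) - (u' * (e * c) - v * (e * d)) - e * S
      = e * ((u * a - v * b) - (u' * c - v * d) - S)"
    for u v u' a b c d e S :: real
    by (simp add: algebra_simps)
  show ?thesis unfolding lam_def eq by (rule alg)
qed

context knots
begin

text \<open>For an affine weight, \<open>w q''\<close> is the derivative of
  \<open>w q' - w' q\<close>; the contributions of the intervals telescope.\<close>

lemma Q_moment:
  assumes "j0 \<le> j1" "j1 \<le> P"
  shows "((w0 + w1 * t j1) * Q' c (t j1) - w1 * Q c (t j1)) - ((w0 + w1 * t j0) * Q' c (t j0) - w1 * Q c (t j0))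
    = (\<Sum>j\<in>{j0..<j1}. second c j * (prim w0 w1 (t (j + 1)) - prim w0 w1 (t j)))"
  using assms
proof (induction j1 rule: dec_induct)
  case (step j)
  have j: "j < P" "t (Suc j) \<in> {t j..t (Suc j)}" using step t_Suc[of j] by auto
  have "((w0 + w1 * t (Suc j)) * Q' c (t (Suc j)) - w1 * Q c (t (Suc j)))
      - ((w0 + w1 * t j) * Q' c (t j) - w1 * Q c (t j))
      = second c j * (prim w0 w1 (t (j + 1)) - prim w0 w1 (t j))"
    unfolding Q_transport[OF j] by (simp add: prim_def power2_eq_square field_simps)
  then show ?case using step by simp
qed simp

lemma Q_zero_range:
  assumes "Q c (t j0) = 0" "Q' c (t j0) = 0" "j0 < j1" "j1 \<le> P" "\<And>j. j0 \<le> j \<Longrightarrow> j < j1 \<Longrightarrow> second c j = 0"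
    "Y \<in> {t j0..t j1}"
  shows "Q c Y = 0"
proof -
  have "c (s + 2) = 0" if "j0 < s" "s < j1" for s
    using that assms(5)[of s] assms(5)[of "s - 1"] second_Suc[of c "s - 1"]
    by (cases s) (auto simp: numeral_2_eq_2 numeral_3_eq_3)
  then show ?thesis
    using Q_transport_gen(2)[OF assms(3,4,6), of c] assms by simp
qed

end

locale dmesh = dyadic N M n D + X: knots x "N * 2 ^ n" + Y: knots y "M * 2 ^ n"
  for N M n :: nat and D :: "nat \<Rightarrow> (nat \<times> nat) set" and x y :: "nat \<Rightarrow> real" +
  assumes x_mid: "k < n \<Longrightarrow> a < N * 2 ^ k \<Longrightarrow> x (mid n k a) = (x (a * 2 ^ (n - k)) + x ((a + 1) * 2 ^ (n - k))) / 2"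
    and y_mid: "k < n \<Longrightarrow> b < M * 2 ^ k \<Longrightarrow> y (mid n k b) = (y (b * 2 ^ (n - k)) + y ((b + 1) * 2 ^ (n - k))) / 2"
begin

lemma dmesh_swp: "dmesh M N n (swp D) y x"
proof -
  interpret S: dyadic M N n "swp D" by (rule dyadic_swp)
  show ?thesis using x_mid y_mid by unfold_locales auto
qed

text \<open>\<open>h i j\<close> stands for \<open>f\<^sub>x\<^sub>x\<^sub>y\<^sub>y\<close> on the
  fine cell \<open>(i, j)\<close>, which has to be constant on the cells of the final mesh.\<close>

definition good :: "(nat \<Rightarrow> nat \<Rightarrow> real) \<Rightarrow> bool" where
  "good h \<longleftrightarrow> (\<forall>i<N * 2 ^ n. \<forall>j<M * 2 ^ n. \<forall>i'<N * 2 ^ n. \<forall>j'<M * 2 ^ n. lf i j = lf i' j' \<longrightarrow> h i j = h i' j')"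

definition inact :: "(nat \<Rightarrow> nat \<Rightarrow> nat \<Rightarrow> bool \<Rightarrow> real) \<Rightarrow> bool" where
  "inact s \<longleftrightarrow> (\<forall>k a b r. (k < n \<longrightarrow> (a, b) \<notin> act M D k) \<longrightarrow> s k a b r = 0)"

lemma row_range: "k \<le> n \<Longrightarrow> b < M * 2 ^ k \<Longrightarrow> (b + 1) * 2 ^ (n - k) \<le> M * 2 ^ n"
proof -
  assume "k \<le> n" "b < M * 2 ^ k"
  then have "(b + 1) * 2 ^ (n - k) \<le> (M * 2 ^ k) * 2 ^ (n - k)" by (intro mult_right_mono) auto
  also have "\<dots> = M * (2 ^ k * 2 ^ (n - k))" by simp
  also have "(2::nat) ^ k * 2 ^ (n - k) = 2 ^ n" using \<open>k \<le> n\<close> by (simp add: power_add[symmetric])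
  finally show ?thesis .
qed

lemma jump_zero:
  assumes "good h" "k < n" "a < N * 2 ^ k" "j < M * 2 ^ n" "(a, anc n k j) \<notin> D k"
  shows "h (mid n k a) j = h (mid n k a - 1) j"
proof -
  have "mid n k a - 1 < N * 2 ^ n" using mid_less[OF assms(2,3)] by simp
  from assms(1)[unfolded good_def, rule_format, OF mid_less[OF assms(2,3)] assms(4) this assms(4)
    lf_pred_mid[OF assms(2,5), symmetric]]
  show ?thesis .
qed

text \<open>Nothing jumps across the midline of an undivided cell, and both ends of that midline are
  inactive, so every term is 0.\<close>

lemma lam_trivial:
  assumes "good h" "inact s" "k < n" "a < N * 2 ^ k" "b < M * 2 ^ k" "(a, b) \<notin> D k"
  shows "lam y n h s k a b w0 w1 = 0"
proof -
  have "s k a b r = 0" "s k a (b + 1) r = 0" for r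
    using assms(2,5,6) by (auto simp: inact_def act_def)
  moreover have "h (mid n k a) j = h (mid n k a - 1) j" if "j \<in> {b * 2 ^ (n - k)..<(b + 1) * 2 ^ (n - k)}" for j
  proof (rule jump_zero[OF assms(1,3,4)])
    have "anc n k j = b" using that by (simp add: anc_eq_iff)
    then show "(a, anc n k j) \<notin> D k" using assms(6) by simp
    show "j < M * 2 ^ n" using that row_range[of k b] assms by simp
  qed
  ultimately show ?thesis by (simp add: lam_def)
qed

lemma lam_of_cofactor:
  assumes "k < n" "b < M * 2 ^ k"
    and "\<And>j. j < M * 2 ^ n \<Longrightarrow> Y.second c j = h (mid n k a) j - h (mid n k a - 1) j"
  shows "lam y n h (\<lambda>k a b r. if r then Y.Q' c (y (b * 2 ^ (n - k))) else Y.Q c (y (b * 2 ^ (n - k)))) k a b w0 w1 = 0"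
proof -
  have r: "b * 2 ^ (n - k) \<le> (b + 1) * 2 ^ (n - k)" "(b + 1) * 2 ^ (n - k) \<le> M * 2 ^ n"
    using row_range[of k b] assms by auto
  have "(\<Sum>j\<in>{b * 2 ^ (n - k)..<(b + 1) * 2 ^ (n - k)}. Y.second c j * (prim w0 w1 (y (j + 1)) - prim w0 w1 (y j)))
      = (\<Sum>j\<in>{b * 2 ^ (n - k)..<(b + 1) * 2 ^ (n - k)}. (h (mid n k a) j - h (mid n k a - 1) j) *
        (prim w0 w1 (y (j + 1)) - prim w0 w1 (y j)))"
    using assms(3) r by (intro sum.cong) auto
  then show ?thesis
    using Y.Q_moment[OF r, of w0 w1 c] unfolding lam_def by simp
qed

text \<open>Starting from the lower boundary, the two constraints of each cell carry the slope and
  the value to its upper end. Hence compatible data are those of an actual cofactor.\<close>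

lemma states_match:
  assumes "k < n"
    and sec: "\<And>j. j < M * 2 ^ n \<Longrightarrow> Y.second c j = h (mid n k a) j - h (mid n k a - 1) j"
    and s0: "s k a 0 False = c 0" "s k a 0 True = c 1"
    and lam0: "\<And>b w0 w1. b < M * 2 ^ k \<Longrightarrow> lam y n h s k a b w0 w1 = 0"
  shows "b \<le> M * 2 ^ k \<Longrightarrow> s k a b False = Y.Q c (y (b * 2 ^ (n - k))) \<and> s k a b True = Y.Q' c (y (b * 2 ^ (n - k)))"
proof (induction b)
  case 0
  then show ?case using s0 by (simp add: Y.Q_0 Y.Q'_0)
next
  case (Suc b)
  then have b: "b < M * 2 ^ k" by simp
  define s' where "s' k a b r = (if r then Y.Q' c (y (b * 2 ^ (n - k))) else Y.Q c (y (b * 2 ^ (n - k))))" for k a b :: nat and r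
  have l: "lam y n h s' k a b w0 w1 = 0" for w0 w1
    unfolding s'_def by (rule lam_of_cofactor[OF assms(1) b sec])
  have IH: "s k a b r = s' k a b r" for r using Suc b by (cases r) (auto simp: s'_def)
  \<comment> \<open>The weight \<open>1\<close> yields the slope (\<open>True\<close>). It comes
    first, because the weight \<open>Y\<close> involves the slope together with the value
    (\<open>False\<close>).\<close>
  have T: "s k a (Suc b) True = s' k a (Suc b) True"
    using l[of 1 0] lam0[OF b, of 1 0] by (simp add: lam_def IH)
  have "s k a (Suc b) False = s' k a (Suc b) False"
    using l[of 0 1] lam0[OF b, of 0 1] by (simp add: lam_def IH T)
  then show ?case using T by (simp add: s'_def)
qed

definition block :: "nat \<Rightarrow> nat \<Rightarrow> nat \<Rightarrow> nat \<Rightarrow> nat \<Rightarrow> real" where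
  "block k a b i j = (if anc n k i = a \<and> anc n k j = b then 1 else 0)"

text \<open>A midline of a level above \<open>k\<close> has both of its sides in the same column of
  level \<open>Suc k\<close>, so it sees no jump. A midline of level \<open>k\<close> sees one only
  in column \<open>a\<close>, and only in the rows of the block; the sign tells on which side the
  block lies.\<close>

lemma lam_block:
  assumes k: "k < n" "k \<le> k'" "k' < n" and e: "e \<le> 1" "f \<le> 1" and ab: "(a, b) \<in> D k"
  shows "lam y n (block (Suc k) (2 * a + e) (2 * b + f)) (\<lambda>_ _ _ _. 0) k' a' b' w0 w1 =
    (if k' = k \<and> a' = a \<and> b' = b then (if e = 1 then - 1 else 1) *
      (prim w0 w1 (y ((2 * b + f + 1) * 2 ^ (n - Suc k))) - prim w0 w1 (y ((2 * b + f) * 2 ^ (n - Suc k)))) else 0)"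
proof (cases "k' = k \<and> a' = a")
  case False
  have "anc n (Suc k) (mid n k' a') = 2 * a + e \<longleftrightarrow> anc n (Suc k) (mid n k' a' - 1) = 2 * a + e"
  proof (cases "k' = k")
    case True
    then have "a' \<noteq> a" using False by simp
    then have "2 * a' + 1 \<noteq> 2 * a + e" "2 * a' \<noteq> 2 * a + e" using e by presburger+
    then show ?thesis
      using True k anc_mid_Suc[of k n a'] anc_mid_pred_Suc[of k n a'] by simp
  next
    case F: False
    then have "k < k'" using k by simp
    then have "anc n (Suc k) (mid n k' a' - 1) = anc n (Suc k) (mid n k' a')"
      unfolding anc_def by (subst div_pred) (use mid_dvd[of k k' n a'] k in auto)
    then show ?thesis by simp
  qed
  then show ?thesis using False by (auto simp: lam_def block_def intro!: sum.neutral)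
next
  case True
  define J where "J = {b' * 2 ^ (n - k)..<(b' + 1) * 2 ^ (n - k)}"
  define J' where "J' = {(2 * b + f) * 2 ^ (n - Suc k)..<(2 * b + f + 1) * 2 ^ (n - Suc k)}"
  define g where "g j = prim w0 w1 (y (j + 1)) - prim w0 w1 (y j)" for j
  define sg :: real where "sg = (if e = 1 then 1 else - 1)"
  have J: "j \<in> J \<longleftrightarrow> anc n k j = b'" for j by (auto simp: J_def anc_eq_iff)
  have J': "j \<in> J' \<longleftrightarrow> anc n (Suc k) j = 2 * b + f" for j by (auto simp: J'_def anc_eq_iff)
  have jump: "block (Suc k) (2 * a + e) (2 * b + f) (mid n k a) j - block (Suc k) (2 * a + e) (2 * b + f) (mid n k a - 1) j
      = (if j \<in> J' then sg else 0)" for j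
    using e k anc_mid_Suc[of k n a] anc_mid_pred_Suc[of k n a]
    by (cases "e = 0") (auto simp: block_def J' sg_def le_Suc_eq)
  have fin: "finite J" "finite J'" by (auto simp: J_def J'_def)
  have "(\<Sum>j\<in>J. (block (Suc k) (2 * a + e) (2 * b + f) (mid n k a) j
      - block (Suc k) (2 * a + e) (2 * b + f) (mid n k a - 1) j) * g j) = (\<Sum>j\<in>J. if j \<in> J' then sg * g j else 0)"
    unfolding jump by (intro sum.cong) auto
  then have "lam y n (block (Suc k) (2 * a + e) (2 * b + f)) (\<lambda>_ _ _ _. 0) k' a' b' w0 w1
      = - (\<Sum>j\<in>J. if j \<in> J' then sg * g j else 0)"
    using True unfolding lam_def J_def g_def by simp
  also have "(\<Sum>j\<in>J. if j \<in> J' then sg * g j else 0) = (\<Sum>j\<in>J \<inter> J'. sg * g j)"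
    using fin by (simp add: sum.inter_restrict)
  also have "J \<inter> J' = (if b' = b then J' else {})"
  proof -
    have "anc n k j = b" if "j \<in> J'" for j
      using that e J'[of j] k anc_Suc[of k n j] by (auto simp: le_Suc_eq)
    then show ?thesis using J by auto
  qed
  also have "(\<Sum>j\<in>(if b' = b then J' else {}). sg * g j) = (if b' = b then sg * (\<Sum>j\<in>J'. g j) else 0)"
    by (simp add: sum_distrib_left)
  also have "(\<Sum>j\<in>J'. g j) = prim w0 w1 (y ((2 * b + f + 1) * 2 ^ (n - Suc k))) - prim w0 w1 (y ((2 * b + f) * 2 ^ (n - Suc k)))"
    unfolding J'_def g_def using sum_Suc_diff'[of "(2 * b + f) * 2 ^ (n - Suc k)" "(2 * b + f + 1) * 2 ^ (n - Suc k)" "\<lambda>j. prim w0 w1 (y j)"]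
    by simp
  finally show ?thesis using True by (auto simp: sg_def)
qed

text \<open>With the weights \<open>P(x) Q'(Y)\<close> on the vertical lines inside a cell \<open>[A, B] \<times> [C, E]\<close>, where
  \<open>P(x) = (x - A)(B - x)\<close> and \<open>Q(Y) = (Y - C)(E - Y)\<close>, the constraints add up to an expression that is
  symmetric in the two coordinates. This gives the linear relation between the constraints inside an
  isolated cell.\<close>

lemma bubble_sum:
  assumes h: "good h" and s: "inact s" and ab: "(a, b) \<in> iso k"
  defines "m \<equiv> n - k"
  defines "A \<equiv> x (a * 2 ^ m)" and "B \<equiv> x ((a + 1) * 2 ^ m)" and "C \<equiv> y (b * 2 ^ m)" and "E \<equiv> y ((b + 1) * 2 ^ m)"
  defines "P \<equiv> (\<lambda>u. (u - A) * (B - u))" and "R \<equiv> (\<lambda>u. (u - C) * (E - u))"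
  shows "(\<Sum>i<m. \<Sum>c<2 ^ i. \<Sum>e<2 ^ i. lam y n h s (k + i) (a * 2 ^ i + c) (b * 2 ^ i + e)
      (P (x (mid n (k + i) (a * 2 ^ i + c))) * (C + E)) (- 2 * P (x (mid n (k + i) (a * 2 ^ i + c)))))
    = (\<Sum>i\<in>{a * 2 ^ m..<(a + 1) * 2 ^ m}. \<Sum>j\<in>{b * 2 ^ m..<(b + 1) * 2 ^ m}.
        h i j * (P (x (i + 1)) - P (x i)) * (R (y (j + 1)) - R (y j)))"
proof -
  have abD: "(a, b) \<in> D k" using ab by (simp add: iso_def)
  then have k: "k < n" by (rule D_less_n)
  define rows where "rows = {b * 2 ^ m..<(b + 1) * 2 ^ m}"
  define g where "g p = (\<Sum>j\<in>rows. (h p j - h (p - 1) j) * P (x p) * (R (y (j + 1)) - R (y j)))" for p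
  have line: "(\<Sum>e<2 ^ i. lam y n h s (k + i) (a * 2 ^ i + c) (b * 2 ^ i + e) (P (x (mid n (k + i) (a * 2 ^ i + c))) * (C + E))
        (- 2 * P (x (mid n (k + i) (a * 2 ^ i + c))))) = - g (mid n (k + i) (a * 2 ^ i + c))"
    if i: "i < m" and c: "c < 2 ^ i" for i c
  proof -
    define k' a' p where "k' = k + i" and "a' = a * 2 ^ i + c" and "p = mid n k' a'"
    have k': "k' < n" using i by (simp add: k'_def m_def)
    have nk: "n - k' = m - i" using i by (simp add: k'_def m_def)
    define w0 w1 where "w0 = P (x p) * (C + E)" and "w1 = - 2 * P (x p)"
    define S where "S b' = (w0 + w1 * y (b' * 2 ^ (n - k'))) * s k' a' b' True - w1 * s k' a' b' False" for b'
    define G where "G j = (h p j - h (p - 1) j) * P (x p) * (R (y (j + 1)) - R (y j))" for j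
    \<comment> \<open>The chosen weight is \<open>P (x p)\<close> times the derivative of
      \<open>R\<close>, so its primitive is \<open>P (x p) * R\<close> up to a constant.\<close>
    have pr: "prim w0 w1 u - prim w0 w1 v = P (x p) * (R u - R v)" for u v
      by (simp add: prim_def w0_def w1_def R_def power2_eq_square algebra_simps)
    have lamS: "lam y n h s k' a' b' w0 w1 = (S (Suc b') - S b') - (\<Sum>j\<in>{b' * 2 ^ (n - k')..<Suc b' * 2 ^ (n - k')}. G j)" for b'
      unfolding lam_def p_def[symmetric] pr S_def G_def by (simp add: mult.assoc)
    have i2: "(2::nat) ^ i * 2 ^ (n - k') = 2 ^ m" using i nk by (simp add: power_add[symmetric])
    have adiv: "a' div 2 ^ i = a" using c by (simp add: a'_def)
    \<comment> \<open>Isolation enters here and in \<open>st1\<close>: the cells below and above are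
      undivided, so the states at both ends of the line vanish and nothing is left of the
      telescoping sum.\<close>
    have st0: "s k' a' (b * 2 ^ i) r = 0" for r
    proof -
      have b0: "0 < b" "(a, b - 1) \<notin> D k" using ab by (auto simp: iso_def)
      have "(b * 2 ^ i - 1) div 2 ^ i = b - 1" using b0 by (subst div_pred) auto
      then have "(a', b * 2 ^ i - 1) \<notin> D k'" using D_anc[of a' "b * 2 ^ i - 1" k i] b0 adiv by (auto simp: k'_def)
      then have "(a', b * 2 ^ i) \<notin> act M D k'" using b0 by (simp add: act_def)
      then show ?thesis using s unfolding inact_def by blast
    qed
    have st1: "s k' a' ((b + 1) * 2 ^ i) r = 0" for r
    proof -
      have b0: "b + 1 < M * 2 ^ k" "(a, b + 1) \<notin> D k" using ab by (auto simp: iso_def)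
      have "((b + 1) * 2 ^ i) div 2 ^ i = b + 1" by simp
      then have "(a', (b + 1) * 2 ^ i) \<notin> D k'" using D_anc[of a' "(b + 1) * 2 ^ i" k i] b0 adiv by (auto simp: k'_def)
      moreover have "(b + 1) * 2 ^ i < M * 2 ^ k'"
      proof -
        have "(b + 1) * 2 ^ i < (M * 2 ^ k) * 2 ^ i" using b0 by (intro mult_strict_right_mono) auto
        then show ?thesis by (simp add: k'_def power_add mult.assoc)
      qed
      ultimately have "(a', (b + 1) * 2 ^ i) \<notin> act M D k'" by (simp only: act_def mem_Collect_eq case_prod_conv) simp
      then show ?thesis using s unfolding inact_def by blast
    qed
    have "(\<Sum>e<2 ^ i. lam y n h s k' a' (b * 2 ^ i + e) w0 w1)
        = (\<Sum>e<2 ^ i. S (Suc (b * 2 ^ i + e)) - S (b * 2 ^ i + e))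
          - (\<Sum>e<2 ^ i. \<Sum>j\<in>{(b * 2 ^ i + e) * 2 ^ (n - k')..<Suc (b * 2 ^ i + e) * 2 ^ (n - k')}. G j)"
      unfolding lamS sum_subtractf ..
    also have "(\<Sum>e<2 ^ i. S (Suc (b * 2 ^ i + e)) - S (b * 2 ^ i + e)) = S (b * 2 ^ i + 2 ^ i) - S (b * 2 ^ i)"
      using sum_lessThan_telescope[of "\<lambda>e. S (b * 2 ^ i + e)" "2 ^ i"] by simp
    also have "\<dots> = 0" using st0 st1 by (simp add: S_def add.commute)
    also have "(\<Sum>e<q. \<Sum>j\<in>{(b * 2 ^ i + e) * 2 ^ (n - k')..<Suc (b * 2 ^ i + e) * 2 ^ (n - k')}. G j)
        = (\<Sum>j\<in>{(b * 2 ^ i) * 2 ^ (n - k')..<(b * 2 ^ i + q) * 2 ^ (n - k')}. G j)" for q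
    proof (induction q)
      case (Suc q)
      have "{(b * 2 ^ i) * 2 ^ (n - k')..<(b * 2 ^ i + Suc q) * 2 ^ (n - k')}
         = {(b * 2 ^ i) * 2 ^ (n - k')..<(b * 2 ^ i + q) * 2 ^ (n - k')}
           \<union> {(b * 2 ^ i + q) * 2 ^ (n - k')..<Suc (b * 2 ^ i + q) * 2 ^ (n - k')}"
        by (subst ivl_disj_un_two(3)) (auto simp: algebra_simps)
      then show ?case using Suc by (simp add: sum.union_disjoint)
    qed simp
    also have "{(b * 2 ^ i) * 2 ^ (n - k')..<(b * 2 ^ i + 2 ^ i) * 2 ^ (n - k')} = rows"
    proof -
      have "(b * 2 ^ i) * 2 ^ (n - k') = b * 2 ^ m" "(b * 2 ^ i + 2 ^ i) * 2 ^ (n - k') = (b + 1) * 2 ^ m"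
        using i2 by (simp_all only: mult.assoc add_mult_distrib mult_1)
      then show ?thesis by (simp only: rows_def)
    qed
    finally show ?thesis
      unfolding k'_def[symmetric] a'_def[symmetric] p_def[symmetric] w0_def[symmetric] w1_def[symmetric]
      by (simp add: g_def G_def)
  qed
  have midp: "mid n (k + i) (a * 2 ^ i + c) = a * 2 ^ m + (2 * c + 1) * 2 ^ (m - Suc i)" if "i < m" for i c
  proof -
    have "(2::nat) ^ m = 2 ^ i * (2 * 2 ^ (m - Suc i))" using that by (simp add: pow_split[symmetric] power_add[symmetric])
    moreover have "n - Suc (k + i) = m - Suc i" by (simp add: m_def)
    ultimately show ?thesis by (simp add: mid_def algebra_simps)
  qed
  define c0 where "c0 = a * 2 ^ m"
  have "(\<Sum>i<m. \<Sum>c<2 ^ i. \<Sum>e<2 ^ i. lam y n h s (k + i) (a * 2 ^ i + c) (b * 2 ^ i + e)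
      (P (x (mid n (k + i) (a * 2 ^ i + c))) * (C + E)) (- 2 * P (x (mid n (k + i) (a * 2 ^ i + c)))))
    = (\<Sum>i<m. \<Sum>c<2 ^ i. - g (c0 + (2 * c + 1) * 2 ^ (m - Suc i)))"
    by (intro sum.cong refl, subst line) (simp_all add: midp c0_def)
  \<comment> \<open>Levels and columns together run through every fine line strictly inside the cell
    exactly once.\<close>
  also have "\<dots> = - (\<Sum>p\<in>{1..<2 ^ m}. g (c0 + p))"
    unfolding mid_sum[of "\<lambda>p. g (c0 + p)"] by (simp add: sum_negf)
  also have "\<dots> = (\<Sum>i<2 ^ m. \<Sum>j\<in>rows. h (c0 + i) j * (P (x (c0 + i + 1)) - P (x (c0 + i))) * (R (y (j + 1)) - R (y j)))"
  proof -
    define H where "H i = (\<Sum>j\<in>rows. h (c0 + i) j * (R (y (j + 1)) - R (y j)))" for i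
    define p where "p i = P (x (c0 + i))" for i
    have g: "g (c0 + i) = (H i - H (i - 1)) * p i" if "i \<in> {1..<2 ^ m}" for i
    proof -
      have "c0 + i - 1 = c0 + (i - 1)" using that by simp
      then show ?thesis
        unfolding g_def H_def p_def sum_subtractf[symmetric] sum_distrib_right
        by (intro sum.cong) (auto simp: algebra_simps)
    qed
    \<comment> \<open>Summation by parts moves the difference from \<open>h\<close> to
      \<open>P\<close>; the boundary terms disappear because \<open>P\<close> vanishes on the two
      vertical sides of the cell.\<close>
    have parts: "- (\<Sum>i\<in>{1..<Suc q}. (H i - H (i - 1)) * p i) = (\<Sum>i<Suc q. H i * (p (i + 1) - p i)) + H 0 * p 0 - H q * p (Suc q)" for q
      by (induction q) (simp_all add: algebra_simps)
    have p0: "p 0 = 0" "p (2 ^ m) = 0" by (auto simp: p_def P_def A_def B_def c0_def add.commute)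
    obtain q where q: "(2::nat) ^ m = Suc q" by (metis not0_implies_Suc power_not_zero zero_neq_numeral)
    have "- (\<Sum>p\<in>{1..<2 ^ m}. g (c0 + p)) = - (\<Sum>i\<in>{1..<2 ^ m}. (H i - H (i - 1)) * p i)"
      using g by simp
    also have "\<dots> = (\<Sum>i<2 ^ m. H i * (p (i + 1) - p i))" using parts[of q] p0 q by simp
    also have "\<dots> = (\<Sum>i<2 ^ m. \<Sum>j\<in>rows. h (c0 + i) j * (P (x (c0 + i + 1)) - P (x (c0 + i))) * (R (y (j + 1)) - R (y j)))"
      unfolding H_def p_def sum_distrib_right by (intro sum.cong refl) (simp add: add.assoc mult_ac)
    finally show ?thesis .
  qed
  also have "\<dots> = (\<Sum>i\<in>{c0..<c0 + 2 ^ m}. \<Sum>j\<in>rows. h i j * (P (x (i + 1)) - P (x i)) * (R (y (j + 1)) - R (y j)))"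
    by (rule sum.reindex_bij_witness[of _ "\<lambda>i. i - c0" "\<lambda>i. c0 + i"]) auto
  also have "{c0..<c0 + 2 ^ m} = {a * 2 ^ m..<(a + 1) * 2 ^ m}" by (auto simp: c0_def)
  finally show ?thesis unfolding rows_def .
qed

end

section \<open>Rank of the constraints\<close>

lemma lam_zero_weight: "lam y n h s k a b 0 0 = 0"
  using lam_weights[of y n h s k a b 0 0 0] by simp

lemma lam_zero: "lam y n (\<lambda>_ _. 0) (\<lambda>_ _ _ _. 0) k a b w0 w1 = 0"
  by (simp add: lam_def)

context dmesh
begin

definition K :: "(nat \<times> nat \<times> nat) set" where
  "K = {(k, a, b). (a, b) \<in> D k}"

lemma K_Sigma: "K = (SIGMA k:{..<n}. D k)"
  using D_less_n by (auto simp: K_def)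

lemma finite_K: "finite K"
  unfolding K_Sigma using finite_D by auto

text \<open>A linear relation among the constraints of both directions. \<open>A\<close> and
  \<open>B\<close> multiply the vertical constraints with weights \<open>1\<close> and
  \<open>Y - m\<close>, where \<open>m\<close> is the ordinate of the centre of the cell;
  \<open>A'\<close> and \<open>B'\<close> multiply the horizontal ones. All data are quantified, so
  any of them may serve as a test.\<close>

definition rel :: "(nat \<Rightarrow> nat \<Rightarrow> nat \<Rightarrow> real) \<Rightarrow> (nat \<Rightarrow> nat \<Rightarrow> nat \<Rightarrow> real) \<Rightarrow>
    (nat \<Rightarrow> nat \<Rightarrow> nat \<Rightarrow> real) \<Rightarrow> (nat \<Rightarrow> nat \<Rightarrow> nat \<Rightarrow> real) \<Rightarrow> bool" where
  "rel A B A' B' \<longleftrightarrow> (\<forall>h s s'. good h \<longrightarrow> inact s \<longrightarrow> dmesh.inact N n (swp D) s' \<longrightarrow>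
    (\<Sum>(k, a, b)\<in>K. lam y n h s k a b (A k a b - B k a b * y (mid n k b)) (B k a b)
      + lam x n (\<lambda>i j. h j i) s' k b a (A' k a b - B' k a b * x (mid n k a)) (B' k a b)) = 0)"

lemma good_swp: "dmesh.good M N n (swp D) (\<lambda>i j. h j i) \<longleftrightarrow> good h"
proof -
  interpret S: dmesh M N n "swp D" y x by (rule dmesh_swp)
  have "S.lf j i = S.lf j' i' \<longleftrightarrow> lf i j = lf i' j'" for i j i' j'
    unfolding swp_leaf(2) by (auto split: prod.splits)
  then show ?thesis unfolding good_def S.good_def by blast
qed

lemma rel_swp:
  assumes "rel A B A' B'"
  shows "dmesh.rel M N n (swp D) y x (\<lambda>k b a. A' k a b) (\<lambda>k b a. B' k a b) (\<lambda>k b a. A k a b) (\<lambda>k b a. B k a b)"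
proof -
  interpret S: dmesh M N n "swp D" y x by (rule dmesh_swp)
  show ?thesis unfolding S.rel_def
  proof (intro allI impI)
    fix h s s'
    assume h: "S.good h" and s: "S.inact s" and s': "dmesh.inact M n (swp (swp D)) s'"
    have "good (\<lambda>i j. h j i)" using h good_swp[of "\<lambda>i j. h j i"] by simp
    then have "(\<Sum>(k, a, b)\<in>K. lam y n (\<lambda>i j. h j i) s' k a b (A k a b - B k a b * y (mid n k b)) (B k a b)
      + lam x n h s k b a (A' k a b - B' k a b * x (mid n k a)) (B' k a b)) = 0"
      using assms s s' unfolding rel_def by simp
    moreover have "(\<Sum>(k, a, b)\<in>S.K. lam x n h s k a b (A' k b a - B' k b a * x (mid n k b)) (B' k b a)
      + lam y n (\<lambda>i j. h j i) s' k b a (A k b a - B k b a * y (mid n k a)) (B k b a))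
      = (\<Sum>(k, a, b)\<in>K. lam y n (\<lambda>i j. h j i) s' k a b (A k a b - B k a b * y (mid n k b)) (B k a b)
      + lam x n h s k b a (A' k a b - B' k a b * x (mid n k a)) (B' k a b))"
      by (rule sum.reindex_bij_witness[of _ "\<lambda>(k, a, b). (k, b, a)" "\<lambda>(k, a, b). (k, b, a)"])
        (auto simp: K_def S.K_def)
    ultimately show "(\<Sum>(k, a, b)\<in>S.K. lam x n h s k a b (A' k b a - B' k b a * x (mid n k b)) (B' k b a)
      + lam y n (\<lambda>i j. h j i) s' k b a (A k b a - B k b a * y (mid n k a)) (B k b a)) = 0" by simp
  qed
qed

lemma good_zero: "good (\<lambda>_ _. 0)" and inact_zero: "inact (\<lambda>_ _ _ _. 0)"
  by (auto simp: good_def inact_def)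

text \<open>A leaf that meets a cell of the subdivision tree of level at least that of the leaf's
  ancestors lies inside it: no leaf is strictly coarser, since all proper ancestors of the cell are
  divided.\<close>

lemma good_block:
  assumes "(a, b) \<in> L k" "k \<le> n"
  shows "good (block k a b)"
proof -
  have *: "block k a b i j = (case lf i j of (l, c, d) \<Rightarrow>
      if k \<le> l \<and> c div 2 ^ (l - k) = a \<and> d div 2 ^ (l - k) = b then 1 else 0)" for i j
  proof (cases "k \<le> ll i j")
    case True
    then show ?thesis using ll_le_n[of i j] by (simp add: block_def lf_def anc_anc[OF True])
  next
    case False
    then show ?thesis using ll_ge[of k i j] assms by (auto simp: block_def lf_def)
  qed
  show ?thesis unfolding good_def * by simp
qed

lemma rows_order:
  assumes "k < n" "b < M * 2 ^ k"
  shows "y (b * 2 ^ (n - k)) < y (mid n k b)" "y (mid n k b) < y ((b + 1) * 2 ^ (n - k))"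
    "y ((b + 1) * 2 ^ (n - k)) - y (mid n k b) = y (mid n k b) - y (b * 2 ^ (n - k))"
proof -
  have "y (b * 2 ^ (n - k)) < y ((b + 1) * 2 ^ (n - k))"
    using row_range[of k b] assms by (intro Y.t_less) auto
  then show "y (b * 2 ^ (n - k)) < y (mid n k b)" "y (mid n k b) < y ((b + 1) * 2 ^ (n - k))"
    "y ((b + 1) * 2 ^ (n - k)) - y (mid n k b) = y (mid n k b) - y (b * 2 ^ (n - k))"
    using y_mid[OF assms] by (simp_all add: field_simps)
qed

lemma lam_block_mid:
  assumes "(a, b) \<in> D k" "e \<le> 1" "f \<le> 1"
  defines "l \<equiv> y (mid n k b) - y (b * 2 ^ (n - k))"
  shows "lam y n (block (Suc k) (2 * a + e) (2 * b + f)) (\<lambda>_ _ _ _. 0) k a b (\<alpha> - \<beta> * y (mid n k b)) \<beta> =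
    (if e = 1 then - 1 else 1) * (\<alpha> * l + (if f = 1 then 1 else - 1) * \<beta> * l\<^sup>2 / 2)"
proof -
  have k: "k < n" using D_less_n assms by blast
  have b: "b < M * 2 ^ k" using D_range assms by blast
  define c m d where "c = y (b * 2 ^ (n - k))" and "m = y (mid n k b)" and "d = y ((b + 1) * 2 ^ (n - k))"
  have d: "d = m + l" "c = m - l" using rows_order[OF k b] by (simp_all add: c_def m_def d_def l_def)
  have e1: "(2 * b) * 2 ^ (n - Suc k) = b * 2 ^ (n - k)" "(2 * b + 1 + 1) * 2 ^ (n - Suc k) = (b + 1) * 2 ^ (n - k)"
    using pow_split[OF k] by simp_all
  have e2: "(2 * b + 1) * 2 ^ (n - Suc k) = mid n k b" by (simp add: mid_def)
  have "prim (\<alpha> - \<beta> * m) \<beta> (y ((2 * b + f + 1) * 2 ^ (n - Suc k))) - prim (\<alpha> - \<beta> * m) \<beta> (y ((2 * b + f) * 2 ^ (n - Suc k)))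
    = \<alpha> * l + (if f = 1 then 1 else - 1) * \<beta> * l\<^sup>2 / 2"
  proof (cases "f = 1")
    case True
    have "prim (\<alpha> - \<beta> * m) \<beta> d - prim (\<alpha> - \<beta> * m) \<beta> m = \<alpha> * l + \<beta> * l\<^sup>2 / 2"
      unfolding d prim_def by (simp add: power2_eq_square field_simps)
    then show ?thesis unfolding True e1 e2 m_def d_def by simp
  next
    case False
    then have f: "f = 0" using assms by simp
    have "prim (\<alpha> - \<beta> * m) \<beta> m - prim (\<alpha> - \<beta> * m) \<beta> c = \<alpha> * l - \<beta> * l\<^sup>2 / 2"
      unfolding d prim_def by (simp add: power2_eq_square field_simps)
    then show ?thesis unfolding f add_0_right e1 e2 m_def c_def by simp
  qed
  then show ?thesis
    using lam_block[OF k order.refl k assms(2,3,1), of a b "\<alpha> - \<beta> * m" \<beta>] by (simp add: m_def)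
qed

text \<open>Tested with the indicators of the four quarters of the cell. Coarser levels drop out by
  assumption, all other cells by \<open>lam_block\<close>. The four sign patterns isolate the two
  coefficients of the weight \<open>1\<close>, and leave just one equation between the other two,
  which is the trace of the bubble relation.\<close>

lemma rel_block:
  assumes rel: "rel A B A' B'" and ab: "(a, b) \<in> D k"
    and low: "\<And>k' a' b'. k' < k \<Longrightarrow> (a', b') \<in> D k' \<Longrightarrow> A k' a' b' = 0 \<and> B k' a' b' = 0 \<and> A' k' a' b' = 0 \<and> B' k' a' b' = 0"
  shows "A k a b = 0" "A' k a b = 0" "B k a b = 0 \<longleftrightarrow> B' k a b = 0"
proof -
  interpret S: dmesh M N n "swp D" y x by (rule dmesh_swp)
  have k: "k < n" using D_less_n ab by blast
  have r: "b < M * 2 ^ k" "a < N * 2 ^ k" using D_range ab by blast+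
  define l where "l = y (mid n k b) - y (b * 2 ^ (n - k))"
  define l' where "l' = x (mid n k a) - x (a * 2 ^ (n - k))"
  have pos: "l > 0" "l' > 0" using rows_order[OF k r(1)] S.rows_order[OF k r(2)] by (auto simp: l_def l'_def)
  have main: "(if e = 1 then - 1 else 1) * (A k a b * l + (if f = 1 then 1 else - 1) * B k a b * l\<^sup>2 / 2)
      + (if f = 1 then - 1 else 1) * (A' k a b * l' + (if e = 1 then 1 else - 1) * B' k a b * l'\<^sup>2 / 2) = 0"
    if ef: "e \<le> 1" "f \<le> 1" for e f :: nat
  proof -
    define h where "h = block (Suc k) (2 * a + e) (2 * b + f)"
    have h': "(\<lambda>i j. h j i) = S.block (Suc k) (2 * b + f) (2 * a + e)"
      by (auto simp: h_def block_def S.block_def fun_eq_iff)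
    have "good h" unfolding h_def using ab ef k by (intro good_block) auto
    then have "(\<Sum>(k, a, b)\<in>K. lam y n h (\<lambda>_ _ _ _. 0) k a b (A k a b - B k a b * y (mid n k b)) (B k a b)
      + lam x n (\<lambda>i j. h j i) (\<lambda>_ _ _ _. 0) k b a (A' k a b - B' k a b * x (mid n k a)) (B' k a b)) = 0"
      using rel inact_zero S.inact_zero unfolding rel_def by blast
    also have "(\<Sum>(k, a, b)\<in>K. lam y n h (\<lambda>_ _ _ _. 0) k a b (A k a b - B k a b * y (mid n k b)) (B k a b)
      + lam x n (\<lambda>i j. h j i) (\<lambda>_ _ _ _. 0) k b a (A' k a b - B' k a b * x (mid n k a)) (B' k a b))
     = (\<Sum>(k, a, b)\<in>{(k, a, b)}. lam y n h (\<lambda>_ _ _ _. 0) k a b (A k a b - B k a b * y (mid n k b)) (B k a b)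
      + lam x n (\<lambda>i j. h j i) (\<lambda>_ _ _ _. 0) k b a (A' k a b - B' k a b * x (mid n k a)) (B' k a b))"
    proof (rule sum.mono_neutral_right[OF finite_K])
      show "{(k, a, b)} \<subseteq> K" using ab by (simp add: K_def)
      show "\<forall>q\<in>K - {(k, a, b)}. (case q of (k, a, b) \<Rightarrow> lam y n h (\<lambda>_ _ _ _. 0) k a b (A k a b - B k a b * y (mid n k b)) (B k a b)
      + lam x n (\<lambda>i j. h j i) (\<lambda>_ _ _ _. 0) k b a (A' k a b - B' k a b * x (mid n k a)) (B' k a b)) = 0"
      proof
        fix q
        assume q: "q \<in> K - {(k, a, b)}"
        obtain k' a' b' where qe: "q = (k', a', b')" by (cases q)
        have D': "(a', b') \<in> D k'" and ne: "\<not> (k' = k \<and> a' = a \<and> b' = b)" using q by (auto simp: qe K_def)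
        have k': "k' < n" using D' D_less_n by blast
        show "(case q of (k, a, b) \<Rightarrow> lam y n h (\<lambda>_ _ _ _. 0) k a b (A k a b - B k a b * y (mid n k b)) (B k a b)
      + lam x n (\<lambda>i j. h j i) (\<lambda>_ _ _ _. 0) k b a (A' k a b - B' k a b * x (mid n k a)) (B' k a b)) = 0"
        proof (cases "k' < k")
          case True
          then show ?thesis using low[OF True D'] by (simp add: qe lam_zero_weight)
        next
          case False
          then have kk: "k \<le> k'" by simp
          have ab': "(b, a) \<in> swp D k" using ab by simp
          show ?thesis
            using lam_block[OF k kk k' ef ab, of a' b'] S.lam_block[OF k kk k' ef(2,1) ab', of b' a'] ne
            unfolding h'[symmetric] h_def[symmetric] by (auto simp: qe)
        qed
      qed
    qed
    finally show ?thesis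
      using lam_block_mid[OF ab ef, of "A k a b" "B k a b"] S.lam_block_mid[of b a k f e "A' k a b" "B' k a b"] ab ef
      unfolding h'[symmetric] h_def[symmetric] l_def[symmetric] l'_def[symmetric] by simp
  qed
  define u v where "u = B k a b * l\<^sup>2" and "v = B' k a b * l'\<^sup>2"
  have m: "A k a b * l - u / 2 + (A' k a b * l' - v / 2) = 0" "- (A k a b * l - u / 2) + (A' k a b * l' + v / 2) = 0"
    "(A k a b * l + u / 2) - (A' k a b * l' - v / 2) = 0" "- (A k a b * l + u / 2) - (A' k a b * l' + v / 2) = 0"
    using main[of 0 0] main[of 1 0] main[of 0 1] main[of 1 1] by (simp_all add: u_def v_def)
  have "A k a b * l = 0" "A' k a b * l' = 0" "u = - v" using m by linarith+
  then show "A k a b = 0" "A' k a b = 0" "B k a b = 0 \<longleftrightarrow> B' k a b = 0"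
    using pos by (auto simp: u_def v_def)
qed

definition unit_state :: "nat \<Rightarrow> nat \<Rightarrow> nat \<Rightarrow> bool \<Rightarrow> nat \<Rightarrow> nat \<Rightarrow> nat \<Rightarrow> bool \<Rightarrow> real" where
  "unit_state k a b r = (\<lambda>k' a' b' r'. if k' = k \<and> a' = a \<and> b' = b \<and> r' = r then 1 else 0)"

text \<open>A unit value or slope at one active point occurs only in the constraints of the cell
  below it, as its upper end, and of the cell above it, as its lower end, with opposite signs. Each
  sum has at most one term, and is empty where the point lies on the domain boundary and no cell
  follows.\<close>

lemma rel_states:
  assumes rel: "rel A B A' B'" and e: "(a, e) \<in> act M D k" and k: "k < n"
  shows "(\<Sum>b\<in>{b. (a, b) \<in> D k \<and> b + 1 = e}. B k a b) = (\<Sum>b\<in>{b. (a, b) \<in> D k \<and> b = e}. B k a b)" (is ?A)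
    and "(\<Sum>b\<in>{b. (a, b) \<in> D k \<and> b + 1 = e}. A k a b + B k a b * (y (e * 2 ^ (n - k)) - y (mid n k b)))
      = (\<Sum>b\<in>{b. (a, b) \<in> D k \<and> b = e}. A k a b + B k a b * (y (e * 2 ^ (n - k)) - y (mid n k b)))" (is ?B)
proof -
  interpret S: dmesh M N n "swp D" y x by (rule dmesh_swp)
  define g where "g r b = (if r then A k a b + B k a b * (y (e * 2 ^ (n - k)) - y (mid n k b)) else - B k a b)" for r b
  have fin: "finite {b. (a, b) \<in> D k \<and> Q b}" for Q
    by (rule finite_subset[of _ "{..<M * 2 ^ k}"]) (use D_range in auto)
  have "(\<Sum>b\<in>{b. (a, b) \<in> D k \<and> b + 1 = e}. g r b) - (\<Sum>b\<in>{b. (a, b) \<in> D k \<and> b = e}. g r b) = 0" for r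
  proof -
    have "inact (unit_state k a e r)" using e k by (auto simp: inact_def unit_state_def)
    then have "(\<Sum>(k', a', b')\<in>K. lam y n (\<lambda>_ _. 0) (unit_state k a e r) k' a' b' (A k' a' b' - B k' a' b' * y (mid n k' b')) (B k' a' b')
      + lam x n (\<lambda>_ _. 0) (\<lambda>_ _ _ _. 0) k' b' a' (A' k' a' b' - B' k' a' b' * x (mid n k' a')) (B' k' a' b')) = 0"
      using rel good_zero S.inact_zero unfolding rel_def by blast
    moreover have "lam y n (\<lambda>_ _. 0) (unit_state k a e r) k' a' b' (A k' a' b' - B k' a' b' * y (mid n k' b')) (B k' a' b')
       = (if k' = k \<and> a' = a \<and> b' + 1 = e then g r b' else 0) - (if k' = k \<and> a' = a \<and> b' = e then g r b' else 0)" for k' a' b'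
      by (auto simp: lam_def unit_state_def g_def algebra_simps)
    ultimately have "(\<Sum>(k', a', b')\<in>K. (if k' = k \<and> a' = a \<and> b' + 1 = e then g r b' else 0) - (if k' = k \<and> a' = a \<and> b' = e then g r b' else 0)) = 0"
      by (simp add: lam_zero)
    then have "(\<Sum>(k', a', b')\<in>K. if k' = k \<and> a' = a \<and> b' + 1 = e then g r b' else 0) - (\<Sum>(k', a', b')\<in>K. if k' = k \<and> a' = a \<and> b' = e then g r b' else 0) = 0"
      by (simp add: sum_subtractf[symmetric] case_prod_beta)
    moreover have "(\<Sum>(k', a', b')\<in>K. if k' = k \<and> a' = a \<and> Q b' then g r b' else 0) = (\<Sum>b\<in>{b. (a, b) \<in> D k \<and> Q b}. g r b)" for Q
    proof -
      have "(\<Sum>(k', a', b')\<in>K. if k' = k \<and> a' = a \<and> Q b' then g r b' else 0)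
          = (\<Sum>(k', a', b')\<in>{(k', a', b')\<in>K. k' = k \<and> a' = a \<and> Q b'}. g r b')"
        by (rule sum.mono_neutral_cong_right[OF finite_K]) (auto split: if_splits)
      also have "\<dots> = (\<Sum>b\<in>{b. (a, b) \<in> D k \<and> Q b}. g r b)"
        by (rule sum.reindex_bij_witness[of _ "\<lambda>b. (k, a, b)" "\<lambda>(k, a, b). b"]) (auto simp: K_def)
      finally show ?thesis .
    qed
    ultimately show ?thesis by simp
  qed
  from this[of False] this[of True] show ?A ?B by (simp_all add: g_def sum_negf)
qed

text \<open>At an end point shared with a neighbour the two coefficients \<open>B\<close> agree, and
  so do their products with the distances to the two centres, which differ; hence they vanish. On
  the domain boundary no second cell can compensate, so \<open>B\<close> is 0 at once.\<close>

lemma rel_neighbour: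
  assumes rel: "rel A B A' B'" and ab: "(a, b) \<in> D k"
    and A0: "\<And>b. (a, b) \<in> D k \<Longrightarrow> A k a b = 0"
    and nb: "b = 0 \<or> b + 1 = M * 2 ^ k \<or> (a, b - 1) \<in> D k \<or> (a, b + 1) \<in> D k"
  shows "B k a b = 0"
proof -
  have k: "k < n" using D_less_n ab by blast
  have r: "b < M * 2 ^ k" using D_range ab by blast
  have adj: "B k a b = 0 \<and> B k a (b + 1) = 0" if D': "(a, b) \<in> D k" "(a, b + 1) \<in> D k" for b
  proof -
    have r': "b + 1 < M * 2 ^ k" using D_range D' by blast
    have "(a, b + 1) \<in> act M D k" using D' r' by (simp add: act_def)
    note R = rel_states[OF rel this k]
    have s: "{b'. (a, b') \<in> D k \<and> b' + 1 = b + 1} = {b}" "{b'. (a, b') \<in> D k \<and> b' = b + 1} = {b + 1}"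
      using D' by auto
    have eq: "B k a b = B k a (b + 1)" using R(1) unfolding s by simp
    have "B k a b * (y ((b + 1) * 2 ^ (n - k)) - y (mid n k b)) = B k a (b + 1) * (y ((b + 1) * 2 ^ (n - k)) - y (mid n k (b + 1)))"
      using R(2) A0 D' unfolding s by simp
    then have "B k a b * (y (mid n k (b + 1)) - y (mid n k b)) = 0" unfolding eq by (simp add: algebra_simps)
    moreover have "y (mid n k b) < y (mid n k (b + 1))"
      using rows_order[OF k, of b] rows_order[OF k, of "b + 1"] r' by simp
    ultimately show ?thesis using eq by simp
  qed
  from nb consider "b = 0" | "b + 1 = M * 2 ^ k" | "0 < b" "(a, b - 1) \<in> D k" | "(a, b + 1) \<in> D k" by blast
  then show ?thesis
  proof cases
    case 1
    have "(a, 0) \<in> act M D k" using ab 1 by (simp add: act_def)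
    note R = rel_states(1)[OF rel this k]
    have "{b'. (a, b') \<in> D k \<and> b' = 0} = {b}" using 1 ab by auto
    then show ?thesis using R by simp
  next
    case 2
    have "(a, b + 1) \<in> act M D k" unfolding act_def using ab by (simp add: 2[symmetric])
    note R = rel_states(1)[OF rel this k]
    have e: "{b'. (a, b') \<in> D k \<and> b' + 1 = b + 1} = {b}" "{b'. (a, b') \<in> D k \<and> b' = b + 1} = {}"
      using 2 ab D_range by fastforce+
    show ?thesis using R unfolding e by simp
  next
    case 3
    then show ?thesis using adj[of "b - 1"] ab by simp
  next
    case 4
    then show ?thesis using adj[of b] ab by simp
  qed
qed

text \<open>Induction from coarse to fine. By \<open>rel_block\<close> it suffices that one of
  \<open>B\<close> and \<open>B'\<close> vanishes: a cell that is not isolated has a divided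
  neighbour or the domain boundary in one of the two directions, and an isolated one is settled by
  hypothesis.\<close>

lemma rel_trivial:
  assumes rel: "rel A B A' B'" and iso: "\<And>k a b. (a, b) \<in> iso k \<Longrightarrow> B k a b = 0"
  shows "(a, b) \<in> D k \<Longrightarrow> A k a b = 0 \<and> B k a b = 0 \<and> A' k a b = 0 \<and> B' k a b = 0"
proof (induction k arbitrary: a b rule: less_induct)
  case (less k)
  interpret S: dmesh M N n "swp D" y x by (rule dmesh_swp)
  have z: "A k a' b' = 0 \<and> A' k a' b' = 0 \<and> (B k a' b' = 0 \<longleftrightarrow> B' k a' b' = 0)" if "(a', b') \<in> D k" for a' b'
    using rel_block[OF rel that] less.IH by blast
  have "B k a b = 0 \<or> B' k a b = 0"
  proof (cases "(a, b) \<in> iso k")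
    case True
    then show ?thesis using iso by blast
  next
    case False
    have "(b = 0 \<or> b + 1 = M * 2 ^ k \<or> (a, b - 1) \<in> D k \<or> (a, b + 1) \<in> D k)
        \<or> (a = 0 \<or> a + 1 = N * 2 ^ k \<or> (a - 1, b) \<in> D k \<or> (a + 1, b) \<in> D k)"
    proof (rule ccontr)
      assume "\<not> ?thesis"
      then have "(a, b) \<in> iso k" using less.prems D_range[OF less.prems] by (auto simp: iso_def)
      then show False using False by blast
    qed
    then show ?thesis
      using rel_neighbour[OF rel less.prems] S.rel_neighbour[OF rel_swp[OF rel], of b a k] z less.prems by auto
  qed
  then show ?case using z[OF less.prems] by blast
qed

text \<open>Downward induction on the level: once all constraints of higher level hold, the relation
  \<open>bubble_sum\<close> leaves only the omitted constraint of the isolated cell.\<close>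

lemma omitted_constraint:
  assumes h: "good h" and s: "inact s" and s': "dmesh.inact N n (swp D) s'"
    and H: "\<And>k a b w0 w1. (a, b) \<in> D k \<Longrightarrow> lam x n (\<lambda>i j. h j i) s' k b a w0 w1 = 0"
    and V0: "\<And>k a b. (a, b) \<in> D k \<Longrightarrow> lam y n h s k a b 1 0 = 0"
    and V1: "\<And>k a b. (a, b) \<in> D k \<Longrightarrow> (a, b) \<notin> iso k \<Longrightarrow> lam y n h s k a b (- y (mid n k b)) 1 = 0"
  shows "(a, b) \<in> D k \<Longrightarrow> lam y n h s k a b w0 w1 = 0"
proof (induction "n - k" arbitrary: k a b w0 w1 rule: less_induct)
  case less
  interpret S: dmesh M N n "swp D" y x by (rule dmesh_swp)
  have k: "k < n" using D_less_n less.prems by blast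
  have "lam y n h s k a b (- y (mid n k b)) 1 = 0"
  proof (cases "(a, b) \<in> iso k")
    case False
    then show ?thesis using V1 less.prems by blast
  next
    case True
    have True': "(b, a) \<in> S.iso k" using True swp_leaf(4) by simp
    have r: "b < M * 2 ^ k" "a < N * 2 ^ k" using D_range less.prems by blast+
    define m where "m = n - k"
    have m: "0 < m" using k by (simp add: m_def)
    define AA BB CC EE where "AA = x (a * 2 ^ m)" and "BB = x ((a + 1) * 2 ^ m)"
      and "CC = y (b * 2 ^ m)" and "EE = y ((b + 1) * 2 ^ m)"
    define P where "P = (\<lambda>u. (u - AA) * (BB - u))"
    define R where "R = (\<lambda>u. (u - CC) * (EE - u))"
    have rng: "a * 2 ^ i + c < N * 2 ^ (k + i)" "b * 2 ^ i + c < M * 2 ^ (k + i)" if "c < 2 ^ i" for i c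
    proof -
      have "a * 2 ^ i + c < (a + 1) * 2 ^ i" "b * 2 ^ i + c < (b + 1) * 2 ^ i" using that by auto
      moreover have "(a + 1) * 2 ^ i \<le> (N * 2 ^ k) * 2 ^ i" "(b + 1) * 2 ^ i \<le> (M * 2 ^ k) * 2 ^ i"
        by (intro mult_right_mono; use r in simp)+
      ultimately show "a * 2 ^ i + c < N * 2 ^ (k + i)" "b * 2 ^ i + c < M * 2 ^ (k + i)"
        unfolding power_add mult.assoc[symmetric] by linarith+
    qed
    have Hz: "lam x n (\<lambda>i j. h j i) s' (k + i) (b * 2 ^ i + c) (a * 2 ^ i + e) u v = 0"
      if "i < m" "c < 2 ^ i" "e < 2 ^ i" for i c e u v
    proof (cases "(a * 2 ^ i + e, b * 2 ^ i + c) \<in> D (k + i)")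
      case True
      then show ?thesis by (rule H)
    next
      case False
      then show ?thesis using that h s' rng[OF that(2)] rng[OF that(3)]
        by (intro S.lam_trivial) (auto simp: m_def good_swp)
    qed
    have Vz: "lam y n h s (k + i) (a * 2 ^ i + c) (b * 2 ^ i + e) u v = 0"
      if "0 < i" "i < m" "c < 2 ^ i" "e < 2 ^ i" for i c e u v
    proof (cases "(a * 2 ^ i + c, b * 2 ^ i + e) \<in> D (k + i)")
      case True
      then show ?thesis using that by (intro less.hyps) (auto simp: m_def)
    next
      case False
      then show ?thesis using that h s rng[OF that(3)] rng[OF that(4)]
        by (intro lam_trivial) (auto simp: m_def)
    qed
    have "(\<Sum>i<m. \<Sum>c<2 ^ i. \<Sum>e<2 ^ i. lam x n (\<lambda>i j. h j i) s' (k + i) (b * 2 ^ i + c) (a * 2 ^ i + e)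
      (R (y (mid n (k + i) (b * 2 ^ i + c))) * (AA + BB)) (- 2 * R (y (mid n (k + i) (b * 2 ^ i + c))))) = 0"
      by (intro sum.neutral ballI Hz) auto
    then have "(\<Sum>i\<in>{b * 2 ^ m..<(b + 1) * 2 ^ m}. \<Sum>j\<in>{a * 2 ^ m..<(a + 1) * 2 ^ m}.
        h j i * (R (y (i + 1)) - R (y i)) * (P (x (j + 1)) - P (x j))) = 0"
      using S.bubble_sum[of "\<lambda>i j. h j i" s' b a k] h s' True' good_swp
      unfolding m_def P_def R_def AA_def BB_def CC_def EE_def by simp
    then have "(\<Sum>i\<in>{a * 2 ^ m..<(a + 1) * 2 ^ m}. \<Sum>j\<in>{b * 2 ^ m..<(b + 1) * 2 ^ m}.
        h i j * (P (x (i + 1)) - P (x i)) * (R (y (j + 1)) - R (y j))) = 0"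
      by (subst sum.swap) (simp add: mult_ac)
    \<comment> \<open>All horizontal constraints hold, so their bubble sum is 0. The vertical bubble
      sum is the same expression in \<open>h\<close>.\<close>
    then have "(\<Sum>i<m. \<Sum>c<2 ^ i. \<Sum>e<2 ^ i. lam y n h s (k + i) (a * 2 ^ i + c) (b * 2 ^ i + e)
      (P (x (mid n (k + i) (a * 2 ^ i + c))) * (CC + EE)) (- 2 * P (x (mid n (k + i) (a * 2 ^ i + c))))) = 0"
      using bubble_sum[OF h s True]
      unfolding m_def P_def R_def AA_def BB_def CC_def EE_def by simp
    also have "(\<Sum>i<m. \<Sum>c<2 ^ i. \<Sum>e<2 ^ i. lam y n h s (k + i) (a * 2 ^ i + c) (b * 2 ^ i + e)
      (P (x (mid n (k + i) (a * 2 ^ i + c))) * (CC + EE)) (- 2 * P (x (mid n (k + i) (a * 2 ^ i + c)))))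
      = (\<Sum>i\<in>{0}. \<Sum>c<2 ^ i. \<Sum>e<2 ^ i. lam y n h s (k + i) (a * 2 ^ i + c) (b * 2 ^ i + e)
      (P (x (mid n (k + i) (a * 2 ^ i + c))) * (CC + EE)) (- 2 * P (x (mid n (k + i) (a * 2 ^ i + c)))))"
      using m by (intro sum.mono_neutral_right ballI sum.neutral Vz) auto
    \<comment> \<open>Finer levels contribute 0 by the induction hypothesis. The remaining weight
      \<open>P * (CC + EE - 2 * Y)\<close> is a nonzero multiple of \<open>Y - m\<close>, with
      \<open>m\<close> the ordinate of the centre.\<close>
    finally have "lam y n h s k a b (P (x (mid n k a)) * (CC + EE)) (- 2 * P (x (mid n k a))) = 0" by simp
    moreover have "CC + EE = 2 * y (mid n k b)" using y_mid[OF k r(1)] by (simp add: CC_def EE_def m_def)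
    moreover have "P (x (mid n k a)) \<noteq> 0"
      using S.rows_order[OF k r(2)] by (simp add: P_def AA_def BB_def m_def)
    ultimately show ?thesis
      using lam_weights[of y n h s k a b "P (x (mid n k a)) * (CC + EE)" "- 2 * P (x (mid n k a))" "y (mid n k b)"]
      by simp
  qed
  then show ?case
    using lam_weights[of y n h s k a b w0 w1 "y (mid n k b)"] V0[OF less.prems] by simp
qed

end

section \<open>Splines and solutions of the constraints\<close>

lemma not_dvd_mid: "k < n \<Longrightarrow> \<not> 2 ^ n dvd mid n k a"
proof
  assume k: "k < n" and d: "2 ^ n dvd mid n k a"
  have "(2::nat) ^ (n - k) dvd 2 ^ n" by (intro le_imp_power_dvd) simp
  then have "2 * 2 ^ (n - Suc k) dvd (2 * a + 1) * (2::nat) ^ (n - Suc k)"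
    using d k unfolding mid_def by (metis pow_split dvd_trans)
  then show False by (subst (asm) dvd_times_right_cancel_iff) auto
qed

definition lev :: "nat \<Rightarrow> nat \<Rightarrow> nat \<times> nat" where
  "lev n p = (SOME q. fst q < n \<and> p = mid n (fst q) (snd q))"

lemma lev_mid: "k < n \<Longrightarrow> lev n (mid n k a) = (k, a)"
  unfolding lev_def by (rule some_equality) (auto dest: mid_inj)

text \<open>The jump of the second derivative at the lower boundary, or of its derivative, across the line of
  index \<open>p\<close>. It is a free parameter for a line of the initial mesh and a state otherwise.\<close>

definition jmp :: "nat \<Rightarrow> (nat \<Rightarrow> bool \<Rightarrow> real) \<Rightarrow> (nat \<Rightarrow> nat \<Rightarrow> nat \<Rightarrow> bool \<Rightarrow> real) \<Rightarrow> nat \<Rightarrow> bool \<Rightarrow> real" where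
  "jmp n vb vs p r = (if 2 ^ n dvd p then vb (p div 2 ^ n) r else vs (fst (lev n p)) (snd (lev n p)) 0 r)"

lemma jmp_mid: "k < n \<Longrightarrow> jmp n vb vs (mid n k a) r = vs k a 0 r"
  by (simp add: jmp_def not_dvd_mid lev_mid)

text \<open>Left of the grid \<open>h\<close> counts as 0, in accordance with the basis
  \<open>sb\<close>, whose coefficient at the first knot is the full second derivative and not a
  jump.\<close>

definition hdiff :: "(nat \<Rightarrow> nat \<Rightarrow> real) \<Rightarrow> nat \<Rightarrow> nat \<Rightarrow> real" where
  "hdiff h p s = h p s - (if p = 0 then 0 else h (p - 1) s)"

definition mdiff :: "(nat \<Rightarrow> nat \<Rightarrow> real) \<Rightarrow> nat \<Rightarrow> nat \<Rightarrow> real" where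
  "mdiff h p s = hdiff h p s - (if s = 0 then 0 else hdiff h p (s - 1))"

lemma mdiff_swap: "mdiff (\<lambda>i j. h j i) s p = mdiff h p s"
  by (simp add: mdiff_def hdiff_def)

text \<open>The parameters of a spline: \<open>Cl\<close> for
  \<open>f\<^sub>x\<^sub>x\<^sub>y\<^sub>y\<close> on a leaf; \<open>VS\<close> and
  \<open>HS\<close> for value (\<open>False\<close>) or slope (\<open>True\<close>) of a vertical or
  horizontal cofactor at an active point; \<open>VB\<close> and \<open>HB\<close> for the initial
  data of the lines of the initial mesh; \<open>KB\<close> for value, slopes and mixed derivative of
  \<open>f\<close> at the lower left corner.\<close>

datatype idx = Cl nat nat nat | VS nat nat nat bool | HS nat nat nat bool
  | VB nat bool | HB nat bool | KB bool bool

context dmesh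
begin

sublocale B: bknots x y "N * 2 ^ n" "M * 2 ^ n"
  by unfold_locales

text \<open>\<open>VC C\<close> says that the cofactors of the spline with coefficients \<open>C\<close> vanish on those parts of the
  vertical lines that are not in the mesh.\<close>

definition VC :: "(nat \<Rightarrow> nat \<Rightarrow> real) \<Rightarrow> bool" where
  "VC C \<longleftrightarrow> (\<forall>k<n. \<forall>a<N * 2 ^ k. \<forall>b<M * 2 ^ k. (a, b) \<notin> D k \<longrightarrow>
    (\<forall>Y\<in>{y (b * 2 ^ (n - k))..y ((b + 1) * 2 ^ (n - k))}. Y.Q (C (mid n k a + 2)) Y = 0))"

lemma fine_in_row:
  assumes "k \<le> n" "b < M * 2 ^ k" "Y \<in> {y (b * 2 ^ (n - k))..y ((b + 1) * 2 ^ (n - k))}"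
  shows "\<exists>j<M * 2 ^ n. anc n k j = b \<and> Y \<in> {y j..y (Suc j)}"
proof -
  have r: "(b + 1) * 2 ^ (n - k) \<le> M * 2 ^ n" using row_range assms by blast
  have *: "\<exists>j. b * 2 ^ (n - k) \<le> j \<and> j < q \<and> Y \<in> {y j..y (Suc j)}"
    if "b * 2 ^ (n - k) < q" "Y \<le> y q" for q
    using that
  proof (induction q)
    case (Suc q)
    show ?case
    proof (cases "b * 2 ^ (n - k) < q \<and> Y \<le> y q")
      case True
      then obtain j where "b * 2 ^ (n - k) \<le> j" "j < q" "Y \<in> {y j..y (Suc j)}" using Suc.IH by blast
      then show ?thesis by (intro exI[of _ j]) auto
    next
      case False
      have "y q \<le> Y"
      proof (cases "b * 2 ^ (n - k) < q")
        case False
        then have "q = b * 2 ^ (n - k)" using Suc.prems by simp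
        then show ?thesis using assms by simp
      qed (use False in auto)
      then show ?thesis using Suc.prems by (intro exI[of _ q]) auto
    qed
  qed simp
  have "b * 2 ^ (n - k) < (b + 1) * 2 ^ (n - k)" by simp
  from *[OF this] obtain j where "b * 2 ^ (n - k) \<le> j" "j < (b + 1) * 2 ^ (n - k)" "Y \<in> {y j..y (Suc j)}"
    using assms by auto
  then show ?thesis using r by (intro exI[of _ j]) (auto simp: anc_eq_iff)
qed

lemma row_subset:
  assumes "k \<le> n" "anc n k j = b" "j < M * 2 ^ n"
  shows "{y j..y (Suc j)} \<subseteq> {y (b * 2 ^ (n - k))..y ((b + 1) * 2 ^ (n - k))}"
    and "b < M * 2 ^ k"
proof -
  have j: "b * 2 ^ (n - k) \<le> j" "j < (b + 1) * 2 ^ (n - k)" using assms(2) by (auto simp: anc_eq_iff)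
  have "M * 2 ^ n = (M * 2 ^ k) * 2 ^ (n - k)" using assms(1) by (simp add: power_add[symmetric])
  then show b: "b < M * 2 ^ k" using assms(2,3) by (auto simp: anc_def less_mult_imp_div_less)
  show "{y j..y (Suc j)} \<subseteq> {y (b * 2 ^ (n - k))..y ((b + 1) * 2 ^ (n - k))}"
    using Y.t_mono[OF j(1)] Y.t_mono[of "Suc j" "(b + 1) * 2 ^ (n - k)"] j row_range[OF assms(1) b] assms(3)
    by auto
qed

text \<open>\<open>VC\<close> speaks of the midlines at positions without a divided cell, the spline
  condition of the lines inside leaves. On each fine interval these are the same lines, by
  \<open>mid_in_leaf\<close> and \<open>mid_strict_leaf\<close>.\<close>

lemma VC_leaves: "VC C \<longleftrightarrow> (\<forall>(k, a, b)\<in>leaves. \<forall>p Y. a * 2 ^ (n - k) < p \<longrightarrow> p < (a + 1) * 2 ^ (n - k) \<longrightarrow>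
    Y \<in> {y (b * 2 ^ (n - k))..y ((b + 1) * 2 ^ (n - k))} \<longrightarrow> Y.Q (C (p + 2)) Y = 0)" (is "_ \<longleftrightarrow> ?R")
proof
  assume V: "VC C"
  have "Y.Q (C (p + 2)) Y = 0" if l: "(k, a, b) \<in> leaves" and p: "a * 2 ^ (n - k) < p" "p < (a + 1) * 2 ^ (n - k)"
    and Y: "Y \<in> {y (b * 2 ^ (n - k))..y ((b + 1) * 2 ^ (n - k))}" for k a b p Y
  proof -
    have kb: "k \<le> n" "b < M * 2 ^ k" using l L_range by (auto simp: leaves_def)
    obtain j where j: "j < M * 2 ^ n" "anc n k j = b" "Y \<in> {y j..y (Suc j)}" using fine_in_row[OF kb Y] by blast
    obtain k' a' where k': "k' < n" "p = mid n k' a'" "(a', anc n k' j) \<notin> D k'" "a' < N * 2 ^ k'"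
      using mid_in_leaf[OF l p j(2)] by blast
    have "k' \<le> n" using k' by simp
    note R = row_subset[OF this refl j(1)]
    show ?thesis using V k' R j(3) unfolding VC_def by blast
  qed
  then show ?R by blast
next
  assume R: ?R
  show "VC C" unfolding VC_def
  proof (intro allI impI ballI)
    fix k a b Y
    assume k: "k < n" "a < N * 2 ^ k" "b < M * 2 ^ k" "(a, b) \<notin> D k"
      and Y: "Y \<in> {y (b * 2 ^ (n - k))..y ((b + 1) * 2 ^ (n - k))}"
    obtain j where j: "j < M * 2 ^ n" "anc n k j = b" "Y \<in> {y j..y (Suc j)}"
      using fine_in_row[OF _ k(3) Y] k(1) by auto
    obtain k0 a0 b0 where l: "lf (mid n k a) j = (k0, a0, b0)" by (metis prod_cases3)
    have n: "(a, anc n k j) \<notin> D k" using k j by simp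
    have L: "(k0, a0, b0) \<in> leaves" using lf_leaves[OF mid_less[OF k(1,2)] j(1)] l by simp
    have k0: "k0 \<le> n" "anc n k0 j = b0" using L l by (auto simp: leaves_def lf_def)
    show "Y.Q (C (mid n k a + 2)) Y = 0"
      using R L mid_strict_leaf[OF k(1) n l] row_subset(1)[OF k0 j(1)] j(3) by blast
  qed
qed

text \<open>At the lower end of an undivided cell the point is inactive, so the cofactor starts with
  value and slope 0, and inside the cell \<open>h\<close> does not jump; hence the cofactor stays
  0.\<close>

lemma VC_of:
  assumes h: "good h" and s: "inact s"
    and lam0: "\<And>k a b w0 w1. (a, b) \<in> D k \<Longrightarrow> lam y n h s k a b w0 w1 = 0"
    and sec: "\<And>k a j. k < n \<Longrightarrow> a < N * 2 ^ k \<Longrightarrow> j < M * 2 ^ n \<Longrightarrow>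
        Y.second (C (mid n k a + 2)) j = h (mid n k a) j - h (mid n k a - 1) j"
    and init: "\<And>k a. k < n \<Longrightarrow> a < N * 2 ^ k \<Longrightarrow> s k a 0 False = C (mid n k a + 2) 0 \<and> s k a 0 True = C (mid n k a + 2) 1"
  shows "VC C"
    and "\<And>k a b. k < n \<Longrightarrow> a < N * 2 ^ k \<Longrightarrow> b \<le> M * 2 ^ k \<Longrightarrow> s k a b False = Y.Q (C (mid n k a + 2)) (y (b * 2 ^ (n - k)))
      \<and> s k a b True = Y.Q' (C (mid n k a + 2)) (y (b * 2 ^ (n - k)))"
proof -
  show st: "s k a b False = Y.Q (C (mid n k a + 2)) (y (b * 2 ^ (n - k)))
      \<and> s k a b True = Y.Q' (C (mid n k a + 2)) (y (b * 2 ^ (n - k)))"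
    if k: "k < n" "a < N * 2 ^ k" and b: "b \<le> M * 2 ^ k" for k a b
  proof (rule states_match[OF k(1) sec[OF k] _ _ _ b])
    show "s k a 0 False = C (mid n k a + 2) 0" "s k a 0 True = C (mid n k a + 2) 1" using init[OF k] by auto
    show "lam y n h s k a b w0 w1 = 0" if "b < M * 2 ^ k" for b w0 w1
      using lam0 lam_trivial[OF h s k that] by (cases "(a, b) \<in> D k") auto
  qed
  show "VC C" unfolding VC_def
  proof (intro allI impI ballI)
    fix k a b Y
    assume k: "k < n" "a < N * 2 ^ k" and b: "b < M * 2 ^ k" "(a, b) \<notin> D k"
      and Y: "Y \<in> {y (b * 2 ^ (n - k))..y ((b + 1) * 2 ^ (n - k))}"
    have "(a, b) \<notin> act M D k" using b by (simp add: act_def)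
    then have "s k a b r = 0" for r using s unfolding inact_def by blast
    then have 0: "Y.Q (C (mid n k a + 2)) (y (b * 2 ^ (n - k))) = 0" "Y.Q' (C (mid n k a + 2)) (y (b * 2 ^ (n - k))) = 0"
      using st[OF k, of b] b by auto
    show "Y.Q (C (mid n k a + 2)) Y = 0"
    proof (rule Y.Q_zero_range[OF 0 _ _ _ Y])
      show "(b + 1) * 2 ^ (n - k) \<le> M * 2 ^ n" using row_range b k by simp
      fix j
      assume j: "b * 2 ^ (n - k) \<le> j" "j < (b + 1) * 2 ^ (n - k)"
      then have "anc n k j = b" by (simp add: anc_eq_iff)
      moreover have "j < M * 2 ^ n" using j row_range[of k b] b k by simp
      ultimately show "Y.second (C (mid n k a + 2)) j = 0" using sec[OF k] jump_zero[OF h k] b by simp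
    qed simp
  qed
qed

text \<open>Summing the jumps in both directions recovers
  \<open>f\<^sub>x\<^sub>x\<^sub>y\<^sub>y\<close> on the fine cell \<open>(i, j)\<close>.\<close>

definition Hc :: "(nat \<Rightarrow> nat \<Rightarrow> real) \<Rightarrow> nat \<Rightarrow> nat \<Rightarrow> real" where
  "Hc C i j = (\<Sum>p\<le>i. \<Sum>s\<le>j. C (p + 2) (s + 2))"

lemma hdiff_Hc: "hdiff (Hc C) p j = Y.second (C (p + 2)) j"
  by (cases p) (simp_all add: hdiff_def Hc_def Y.second_def)

lemma mdiff_Hc: "mdiff (Hc C) p s = C (p + 2) (s + 2)"
  unfolding mdiff_def hdiff_Hc by (cases s) (simp_all add: Y.second_0 Y.second_Suc numeral_2_eq_2 numeral_3_eq_3)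

lemma VC_second:
  assumes V: "VC C" and k: "k < n" "a < N * 2 ^ k" and j: "j < M * 2 ^ n" "(a, anc n k j) \<notin> D k"
  shows "Y.second (C (mid n k a + 2)) j = 0"
proof (rule Y.Q_zero_interval(2)[OF j(1)])
  fix Y
  assume "Y \<in> {y j..y (Suc j)}"
  then show "Y.Q (C (mid n k a + 2)) Y = 0"
    using V k j row_subset[of k j "anc n k j"] unfolding VC_def by fastforce
qed

text \<open>Crossing a line inside the leaf changes \<open>Hc\<close> by the second derivative of
  the cofactor on that line, which vanishes there.\<close>

lemma Hc_leaf:
  assumes V: "VC C" and l: "(k, a, b) \<in> leaves" and j: "anc n k j = b" "j < M * 2 ^ n"
  shows "a * 2 ^ (n - k) \<le> i \<Longrightarrow> i < (a + 1) * 2 ^ (n - k) \<Longrightarrow> Hc C i j = Hc C (a * 2 ^ (n - k)) j"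
proof (induction i rule: dec_induct)
  case (step i)
  then have p: "a * 2 ^ (n - k) < Suc i" "Suc i < (a + 1) * 2 ^ (n - k)" by auto
  obtain k' a' where k': "k' < n" "Suc i = mid n k' a'" "(a', anc n k' j) \<notin> D k'" "a' < N * 2 ^ k'"
    using mid_in_leaf[OF l p j(1)] by blast
  have "Y.second (C (mid n k' a' + 2)) j = 0" using VC_second[OF V k'(1,4) j(2) k'(3)] .
  then have "hdiff (Hc C) (Suc i) j = 0" using k'(2) hdiff_Hc by metis
  then show ?case using step by (simp add: hdiff_def)
qed simp

definition sC :: "(nat \<Rightarrow> nat \<Rightarrow> real) \<Rightarrow> nat \<Rightarrow> nat \<Rightarrow> nat \<Rightarrow> bool \<Rightarrow> real" where
  "sC C k a b r = (if k < n \<and> (a, b) \<in> act M D k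
    then if r then Y.Q' (C (mid n k a + 2)) (y (b * 2 ^ (n - k))) else Y.Q (C (mid n k a + 2)) (y (b * 2 ^ (n - k))) else 0)"

lemma inact_sC: "inact (sC C)"
  by (auto simp: inact_def sC_def)

text \<open>Next to an inactive point lies an undivided cell, on which the cofactor vanishes; so its
  value and slope at the point are 0, and the cut-off in \<open>sC\<close> changes nothing.\<close>

lemma sC_eq:
  assumes V: "VC C" and k: "k < n" "a < N * 2 ^ k" and b: "b \<le> M * 2 ^ k"
  shows "sC C k a b r = (if r then Y.Q' (C (mid n k a + 2)) (y (b * 2 ^ (n - k))) else Y.Q (C (mid n k a + 2)) (y (b * 2 ^ (n - k))))"
proof (cases "(a, b) \<in> act M D k")
  case True
  then show ?thesis using k by (simp add: sC_def)
next
  case False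
  define c where "c = C (mid n k a + 2)"
  from False b consider "b < M * 2 ^ k" "(a, b) \<notin> D k" | "0 < b" "(a, b - 1) \<notin> D k"
    by (auto simp: act_def)
  then have "Y.Q c (y (b * 2 ^ (n - k))) = 0 \<and> Y.Q' c (y (b * 2 ^ (n - k))) = 0"
  proof cases
    case 1
    define j where "j = b * 2 ^ (n - k)"
    have "b * 2 ^ (n - k) < (b + 1) * 2 ^ (n - k)" by simp
    then have "j < M * 2 ^ n" using row_range[of k b] 1 k unfolding j_def by linarith
    then have j: "j < M * 2 ^ n" "anc n k j = b" by (auto simp: j_def anc_eq_iff)
    have z: "Y.Q c Y = 0" if "Y \<in> {y j..y (Suc j)}" for Y
      using V k 1 row_subset(1)[OF _ j(2,1)] that unfolding VC_def c_def by fastforce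
    have "y j \<le> y (Suc j)" using Y.t_mono[of j "Suc j"] j by simp
    then show ?thesis using z[of "y j"] Y.Q_zero_interval(1)[OF j(1), of c] z by (auto simp: j_def)
  next
    case 2
    define j where "j = b * 2 ^ (n - k) - 1"
    have pw: "0 < b * 2 ^ (n - k)" using 2 by simp
    have sj: "Suc j = b * 2 ^ (n - k)" using pw by (simp add: j_def)
    have bb: "b - 1 < M * 2 ^ k" using 2 b by simp
    have "(b - 1 + 1) * 2 ^ (n - k) \<le> M * 2 ^ n" using row_range[of k "b - 1"] bb k by simp
    then have j: "j < M * 2 ^ n" using sj 2 by simp
    have an: "anc n k j = b - 1"
      unfolding j_def anc_def using pw by (subst div_pred) auto
    have z: "Y.Q c Y = 0" if "Y \<in> {y j..y (Suc j)}" for Y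
      using V k 2 bb row_subset(1)[OF _ an j] that unfolding VC_def c_def by fastforce
    have "y j \<le> y (Suc j)" using Y.t_mono[of j "Suc j"] j by simp
    then show ?thesis using z[of "y (Suc j)"] Y.Q_zero_interval(3)[OF j, of c] z by (auto simp: sj)
  qed
  then show ?thesis using False by (simp add: sC_def c_def)
qed

lemma lam_sC:
  assumes V: "VC C" and ab: "(a, b) \<in> D k"
  shows "lam y n (Hc C) (sC C) k a b w0 w1 = 0"
proof -
  have k: "k < n" "a < N * 2 ^ k" "b < M * 2 ^ k" using ab D_less_n D_range by blast+
  have sec: "Y.second (C (mid n k a + 2)) j = Hc C (mid n k a) j - Hc C (mid n k a - 1) j" for j
    using hdiff_Hc[of C "mid n k a" j] mid_pos[of n k a] by (simp add: hdiff_def)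
  have "lam y n (Hc C) (sC C) k a b w0 w1 = lam y n (Hc C) (\<lambda>k' a' b r. if r then Y.Q' (C (mid n k a + 2)) (y (b * 2 ^ (n - k')))
      else Y.Q (C (mid n k a + 2)) (y (b * 2 ^ (n - k')))) k a b w0 w1"
    by (rule lam_cong) (use sC_eq[OF V k(1,2)] k(3) in auto)
  then show ?thesis using lam_of_cofactor[OF k(1,3) sec] by simp
qed

section \<open>The parameter vector, the constraint functionals and their independence\<close>

definition Hz :: "(idx \<Rightarrow> real) \<Rightarrow> nat \<Rightarrow> nat \<Rightarrow> real" where
  "Hz z i j = (case lf i j of (k, a, b) \<Rightarrow> z (Cl k a b))"

definition sV :: "(idx \<Rightarrow> real) \<Rightarrow> nat \<Rightarrow> nat \<Rightarrow> nat \<Rightarrow> bool \<Rightarrow> real" where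
  "sV z k a b r = z (VS k a b r)"

definition sH :: "(idx \<Rightarrow> real) \<Rightarrow> nat \<Rightarrow> nat \<Rightarrow> nat \<Rightarrow> bool \<Rightarrow> real" where
  "sH z k b a r = z (HS k b a r)"

definition Idx :: "idx set" where
  "Idx = {Cl k a b | k a b. (k, a, b) \<in> leaves} \<union> {VS k a b r | k a b r. k < n \<and> (a, b) \<in> act M D k}
    \<union> {HS k b a r | k b a r. k < n \<and> (b, a) \<in> act N (swp D) k}
    \<union> {VB i r | i r. i < N} \<union> {HB i r | i r. i < M} \<union> {KB r s | r s. True}"

lemma Idx_iff [simp]:
  "Cl k a b \<in> Idx \<longleftrightarrow> (k, a, b) \<in> leaves" "VS k a b r \<in> Idx \<longleftrightarrow> k < n \<and> (a, b) \<in> act M D k"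
  "HS k b a r \<in> Idx \<longleftrightarrow> k < n \<and> (b, a) \<in> act N (swp D) k" "VB i r \<in> Idx \<longleftrightarrow> i < N" "HB j r \<in> Idx \<longleftrightarrow> j < M"
  "KB r s \<in> Idx"
  by (auto simp: Idx_def)

text \<open>The first Boolean is the direction (\<open>True\<close> for vertical), the second the
  weight (\<open>False\<close> for \<open>1\<close>, \<open>True\<close> for the one vanishing at
  the centre). For an isolated cell one vertical constraint is left out, the one that
  \<open>omitted_constraint\<close> recovers.\<close>

definition J :: "((nat \<times> nat \<times> nat) \<times> bool \<times> bool) set" where
  "J = K \<times> UNIV - {((k, a, b), True, True) | k a b. (a, b) \<in> iso k}"

definition phi :: "(nat \<times> nat \<times> nat) \<times> bool \<times> bool \<Rightarrow> (idx \<Rightarrow> real) \<Rightarrow> real" where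
  "phi = (\<lambda>((k, a, b), d, r) z. if d
    then lam y n (Hz z) (sV z) k a b (if r then - y (mid n k b) else 1) (if r then 1 else 0)
    else lam x n (\<lambda>i j. Hz z j i) (sH z) k b a (if r then - x (mid n k a) else 1) (if r then 1 else 0))"

lemma phi_add: "phi j (z + z') = phi j z + phi j z'"
proof -
  have 1: "Hz (z + z') = (\<lambda>i j. Hz z i j + Hz z' i j)"
    by (auto simp: Hz_def fun_eq_iff split: prod.splits)
  have 2: "sV (z + z') = (\<lambda>k a b r. sV z k a b r + sV z' k a b r)" "sH (z + z') = (\<lambda>k a b r. sH z k a b r + sH z' k a b r)"
    by (auto simp: sV_def sH_def fun_eq_iff)
  obtain k a b d r where "j = ((k, a, b), d, r)" by (metis prod_cases3 surj_pair)
  then show ?thesis by (simp add: phi_def 1 2 lam_add)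
qed

lemma phi_scale: "phi j (rscale c z) = c * phi j z"
proof -
  have 1: "Hz (rscale c z) = (\<lambda>i j. c * Hz z i j)"
    by (auto simp: Hz_def fun_eq_iff rscale_def split: prod.splits)
  have 2: "sV (rscale c z) = (\<lambda>k a b r. c * sV z k a b r)" "sH (rscale c z) = (\<lambda>k a b r. c * sH z k a b r)"
    by (auto simp: sV_def sH_def fun_eq_iff rscale_def)
  obtain k a b d r where "j = ((k, a, b), d, r)" by (metis prod_cases3 surj_pair)
  then show ?thesis by (simp add: phi_def 1 2 lam_scale)
qed

text \<open>The value on a leaf is read off at its lower left fine cell.\<close>

definition zof :: "(nat \<Rightarrow> nat \<Rightarrow> real) \<Rightarrow> (nat \<Rightarrow> nat \<Rightarrow> nat \<Rightarrow> bool \<Rightarrow> real) \<Rightarrow> (nat \<Rightarrow> nat \<Rightarrow> nat \<Rightarrow> bool \<Rightarrow> real) \<Rightarrow>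
    (nat \<Rightarrow> bool \<Rightarrow> real) \<Rightarrow> (nat \<Rightarrow> bool \<Rightarrow> real) \<Rightarrow> (bool \<Rightarrow> bool \<Rightarrow> real) \<Rightarrow> idx \<Rightarrow> real" where
  "zof h s s' vb hb kb i = (if i \<in> Idx then (case i of Cl k a b \<Rightarrow> h (a * 2 ^ (n - k)) (b * 2 ^ (n - k))
    | VS k a b r \<Rightarrow> s k a b r | HS k b a r \<Rightarrow> s' k b a r | VB i r \<Rightarrow> vb i r | HB j r \<Rightarrow> hb j r | KB r s \<Rightarrow> kb r s) else 0)"

lemma zof_supported: "zof h s s' vb hb kb \<in> supported Idx"
  by (simp add: supported_def zof_def)

lemma leaf_corner:
  assumes "(k, a, b) \<in> leaves"
  shows "lf (a * 2 ^ (n - k)) (b * 2 ^ (n - k)) = (k, a, b)" "a * 2 ^ (n - k) < N * 2 ^ n" "b * 2 ^ (n - k) < M * 2 ^ n"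
proof -
  interpret S: dmesh M N n "swp D" y x by (rule dmesh_swp)
  show "lf (a * 2 ^ (n - k)) (b * 2 ^ (n - k)) = (k, a, b)"
    by (rule lf_unique[OF assms]) (simp_all add: anc_eq_iff)
  have "k \<le> n" "a < N * 2 ^ k" "b < M * 2 ^ k" using assms L_range by (auto simp: leaves_def)
  moreover have "a * 2 ^ (n - k) < (a + 1) * 2 ^ (n - k)" "b * 2 ^ (n - k) < (b + 1) * 2 ^ (n - k)" by simp_all
  ultimately show "a * 2 ^ (n - k) < N * 2 ^ n" "b * 2 ^ (n - k) < M * 2 ^ n"
    using S.row_range[of k a] row_range[of k b] by linarith+
qed

lemma Hz_zof:
  assumes "good h" "i < N * 2 ^ n" "j < M * 2 ^ n"
  shows "Hz (zof h s s' vb hb kb) i j = h i j"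
proof -
  obtain k a b where l: "lf i j = (k, a, b)" by (metis prod_cases3)
  then have L: "(k, a, b) \<in> leaves" using lf_leaves assms by metis
  note c = leaf_corner[OF L]
  have "h (a * 2 ^ (n - k)) (b * 2 ^ (n - k)) = h i j"
    using assms c l unfolding good_def by metis
  then show ?thesis using L by (simp add: Hz_def l zof_def)
qed

lemma good_Hz: "good (Hz z)"
  by (simp add: good_def Hz_def)

lemma inact_sV: "z \<in> supported Idx \<Longrightarrow> inact (sV z)"
  by (auto simp: supported_def inact_def sV_def)

lemma inact_sH: "z \<in> supported Idx \<Longrightarrow> dmesh.inact N n (swp D) (sH z)"
proof -
  interpret S: dmesh M N n "swp D" y x by (rule dmesh_swp)
  show "z \<in> supported Idx \<Longrightarrow> S.inact (sH z)" by (auto simp: supported_def S.inact_def sH_def)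
qed

lemma sV_zof: "inact s \<Longrightarrow> sV (zof h s s' vb hb kb) = s"
  by (auto simp: sV_def zof_def inact_def fun_eq_iff)

lemma sH_zof: "dmesh.inact N n (swp D) s' \<Longrightarrow> sH (zof h s s' vb hb kb) = s'"
proof -
  interpret S: dmesh M N n "swp D" y x by (rule dmesh_swp)
  show "S.inact s' \<Longrightarrow> sH (zof h s s' vb hb kb) = s'" by (auto simp: sH_def zof_def S.inact_def fun_eq_iff)
qed

lemma lam_Hz_zof:
  assumes "good h" "inact s" "(a, b) \<in> D k"
  shows "lam y n (Hz (zof h s s' vb hb kb)) (sV (zof h s s' vb hb kb)) k a b w0 w1 = lam y n h s k a b w0 w1"
proof (rule lam_cong)
  have k: "k < n" "a < N * 2 ^ k" "b < M * 2 ^ k" using assms D_less_n D_range by blast+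
  fix j
  assume "j \<in> {b * 2 ^ (n - k)..<(b + 1) * 2 ^ (n - k)}"
  then have j: "j < M * 2 ^ n" using row_range[of k b] k by simp
  show "Hz (zof h s s' vb hb kb) (mid n k a) j - Hz (zof h s s' vb hb kb) (mid n k a - 1) j = h (mid n k a) j - h (mid n k a - 1) j"
    using Hz_zof[OF assms(1) _ j] mid_less[OF k(1,2)] by simp
qed (simp_all add: sV_zof assms)

lemma lam_Hz_zof':
  assumes "good h" "dmesh.inact N n (swp D) s'" "(a, b) \<in> D k"
  shows "lam x n (\<lambda>i j. Hz (zof h s s' vb hb kb) j i) (sH (zof h s s' vb hb kb)) k b a w0 w1 = lam x n (\<lambda>i j. h j i) s' k b a w0 w1"
proof (rule lam_cong)
  interpret S: dmesh M N n "swp D" y x by (rule dmesh_swp)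
  have k: "k < n" "a < N * 2 ^ k" "b < M * 2 ^ k" using assms D_less_n D_range by blast+
  fix j
  assume "j \<in> {a * 2 ^ (n - k)..<(a + 1) * 2 ^ (n - k)}"
  then have j: "j < N * 2 ^ n" using S.row_range[of k a] k by simp
  show "Hz (zof h s s' vb hb kb) j (mid n k b) - Hz (zof h s s' vb hb kb) j (mid n k b - 1) = h j (mid n k b) - h j (mid n k b - 1)"
    using Hz_zof[OF assms(1) j] S.mid_less[OF k(1,3)] by simp
qed (simp_all add: sH_zof assms)

lemma finite_J: "finite J"
  unfolding J_def using finite_K by auto

text \<open>Extended by 0 to the omitted functionals, a relation among the \<open>phi j\<close>
  becomes a \<open>rel\<close> with \<open>B = 0\<close> on the isolated cells, which
  \<open>rel_trivial\<close> excludes.\<close>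

lemma phi_independent:
  assumes w: "\<And>z. z \<in> supported Idx \<Longrightarrow> (\<Sum>j\<in>J. w j * phi j z) = 0" and j: "j \<in> J"
  shows "w j = 0"
proof -
  define v where "v j = (if j \<in> J then w j else 0)" for j
  define A B where "A k a b = v ((k, a, b), True, False)" and "B k a b = v ((k, a, b), True, True)" for k a b
  define A' B' where "A' k a b = v ((k, a, b), False, False)" and "B' k a b = v ((k, a, b), False, True)" for k a b
  have "rel A B A' B'"
    unfolding rel_def
  proof (intro allI impI)
    fix h s s'
    assume h: "good h" and s: "inact s" and s': "dmesh.inact N n (swp D) s'"
    define z where "z = zof h s s' (\<lambda>_ _. 0) (\<lambda>_ _. 0) (\<lambda>_ _. 0)"
    have "(\<Sum>j\<in>J. w j * phi j z) = 0" by (rule w) (simp add: z_def zof_supported)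
    moreover have "(\<Sum>j\<in>J. w j * phi j z) = (\<Sum>j\<in>K \<times> UNIV. v j * phi j z)"
      by (rule sum.mono_neutral_cong_left) (auto simp: finite_K v_def J_def)
    ultimately have "(\<Sum>q\<in>K. \<Sum>dr\<in>UNIV. v (q, dr) * phi (q, dr) z) = 0"
      by (simp add: sum.cartesian_product)
    moreover have "(\<Sum>dr\<in>UNIV. v (q, dr) * phi (q, dr) z) = (case q of (k, a, b) \<Rightarrow>
        lam y n h s k a b (A k a b - B k a b * y (mid n k b)) (B k a b)
      + lam x n (\<lambda>i j. h j i) s' k b a (A' k a b - B' k a b * x (mid n k a)) (B' k a b))" if "q \<in> K" for q
    proof -
      obtain k a b where q: "q = (k, a, b)" by (cases q)
      have ab: "(a, b) \<in> D k" using that by (simp add: q K_def)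
      have U: "(\<Sum>dr\<in>UNIV. g dr) = g (True, True) + g (True, False) + g (False, True) + g (False, False)"
        for g :: "bool \<times> bool \<Rightarrow> real"
        by (simp add: UNIV_Times_UNIV[symmetric] sum.cartesian_product[symmetric] UNIV_bool del: UNIV_Times_UNIV)
      show ?thesis
        unfolding q U phi_def z_def
        using lam_weights[of y n h s k a b "A k a b - B k a b * y (mid n k b)" "B k a b" "y (mid n k b)"]
          lam_weights[of x n "\<lambda>i j. h j i" s' k b a "A' k a b - B' k a b * x (mid n k a)" "B' k a b" "x (mid n k a)"]
        by (simp add: lam_Hz_zof[OF h s ab] lam_Hz_zof'[OF h s' ab] A_def B_def A'_def B'_def)
    qed
    ultimately show "(\<Sum>(k, a, b)\<in>K. lam y n h s k a b (A k a b - B k a b * y (mid n k b)) (B k a b)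
      + lam x n (\<lambda>i j. h j i) s' k b a (A' k a b - B' k a b * x (mid n k a)) (B' k a b)) = 0" by simp
  qed
  moreover have "B k a b = 0" if "(a, b) \<in> iso k" for k a b
    using that by (simp add: B_def v_def J_def)
  ultimately have z: "(a, b) \<in> D k \<Longrightarrow> A k a b = 0 \<and> B k a b = 0 \<and> A' k a b = 0 \<and> B' k a b = 0" for k a b
    using rel_trivial by blast
  obtain k a b d r where je: "j = ((k, a, b), d, r)" by (metis prod_cases3 surj_pair)
  have "v j = 0" using z[of a b k] j
    by (cases d; cases r) (auto simp: je J_def K_def A_def B_def A'_def B'_def)
  then show ?thesis using j by (simp add: v_def)
qed

definition Ker :: "(idx \<Rightarrow> real) set" where
  "Ker = {z \<in> supported Idx. \<forall>j\<in>J. phi j z = 0}"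

lemma Ker_lam:
  assumes z: "z \<in> Ker" and ab: "(a, b) \<in> D k"
  shows "lam y n (Hz z) (sV z) k a b w0 w1 = 0" "lam x n (\<lambda>i j. Hz z j i) (sH z) k b a w0 w1 = 0"
proof -
  have supp: "z \<in> supported Idx" and phi: "\<And>j. j \<in> J \<Longrightarrow> phi j z = 0" using z by (auto simp: Ker_def)
  have H: "lam x n (\<lambda>i j. Hz z j i) (sH z) k b a w0 w1 = 0" if "(a, b) \<in> D k" for k a b w0 w1
  proof -
    have "((k, a, b), False, r) \<in> J" for r using that by (auto simp: J_def K_def)
    from phi[OF this[of True]] phi[OF this[of False]] show ?thesis
      using lam_weights[of x n "\<lambda>i j. Hz z j i" "sH z" k b a w0 w1 "x (mid n k a)"] by (simp add: phi_def)
  qed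
  then show "lam x n (\<lambda>i j. Hz z j i) (sH z) k b a w0 w1 = 0" using ab by blast
  show "lam y n (Hz z) (sV z) k a b w0 w1 = 0"
  proof (rule omitted_constraint[OF good_Hz inact_sV[OF supp] inact_sH[OF supp] H _ _ ab])
    fix k a b
    assume ab: "(a, b) \<in> D k"
    have "((k, a, b), True, False) \<in> J" using ab by (auto simp: J_def K_def)
    from phi[OF this] show "lam y n (Hz z) (sV z) k a b 1 0 = 0" by (simp add: phi_def)
    assume "(a, b) \<notin> iso k"
    then have "((k, a, b), True, True) \<in> J" using ab by (auto simp: J_def K_def)
    from phi[OF this] show "lam y n (Hz z) (sV z) k a b (- y (mid n k b)) 1 = 0" by (simp add: phi_def)
  qed
qed

text \<open>Inverse to reading off the parameters. Indices below 2 hold the initial data along the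
  lower and left boundary; all other coefficients are mixed differences of the piecewise constant
  function \<open>Hz z\<close>.\<close>

definition Cz :: "(idx \<Rightarrow> real) \<Rightarrow> nat \<Rightarrow> nat \<Rightarrow> real" where
  "Cz z a b = (if a < 2 \<and> b < 2 then z (KB (a = 1) (b = 1))
    else if a < 2 then jmp n (\<lambda>j r. z (HB j r)) (sH z) (b - 2) (a = 1)
    else if b < 2 then jmp n (\<lambda>i r. z (VB i r)) (sV z) (a - 2) (b = 1)
    else mdiff (Hz z) (a - 2) (b - 2))"

lemma second_Cz: "Y.second (Cz z (p + 2)) j = hdiff (Hz z) p j"
  by (induction j) (simp_all add: Y.second_0 Y.second_Suc Cz_def mdiff_def)

lemma second_Cz': "X.second (\<lambda>a. Cz z a (s + 2)) i = hdiff (\<lambda>i j. Hz z j i) s i"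
  by (induction i) (simp_all add: X.second_0 X.second_Suc Cz_def mdiff_swap[of "Hz z", symmetric], simp_all add: mdiff_def)

lemma Ker_VC:
  assumes z: "z \<in> Ker"
  shows "VC (Cz z)" and "dmesh.VC M N n (swp D) x (\<lambda>a b. Cz z b a)"
    and "k < n \<Longrightarrow> a < N * 2 ^ k \<Longrightarrow> b \<le> M * 2 ^ k \<Longrightarrow> sV z k a b False = Y.Q (Cz z (mid n k a + 2)) (y (b * 2 ^ (n - k)))
      \<and> sV z k a b True = Y.Q' (Cz z (mid n k a + 2)) (y (b * 2 ^ (n - k)))"
    and "k < n \<Longrightarrow> b < M * 2 ^ k \<Longrightarrow> a \<le> N * 2 ^ k \<Longrightarrow> sH z k b a False = X.Q (\<lambda>a. Cz z a (mid n k b + 2)) (x (a * 2 ^ (n - k)))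
      \<and> sH z k b a True = X.Q' (\<lambda>a. Cz z a (mid n k b + 2)) (x (a * 2 ^ (n - k)))"
proof -
  interpret S: dmesh M N n "swp D" y x by (rule dmesh_swp)
  have supp: "z \<in> supported Idx" using z by (simp add: Ker_def)
  have 1: "Y.second (Cz z (mid n k a + 2)) j = Hz z (mid n k a) j - Hz z (mid n k a - 1) j" for k a j
    using second_Cz[of z "mid n k a" j] mid_pos[of n k a] by (simp add: hdiff_def)
  have 2: "X.second (\<lambda>a. Cz z a (mid n k b + 2)) i = Hz z i (mid n k b) - Hz z i (mid n k b - 1)" for k b i
    using second_Cz'[of z "mid n k b" i] mid_pos[of n k b] by (simp add: hdiff_def)
  have 3: "sV z k a 0 False = Cz z (mid n k a + 2) 0 \<and> sV z k a 0 True = Cz z (mid n k a + 2) 1"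
    "sH z k a 0 False = Cz z 0 (mid n k a + 2) \<and> sH z k a 0 True = Cz z 1 (mid n k a + 2)" if "k < n" for k a
    by (simp_all add: Cz_def jmp_mid[OF that])
  note V = VC_of[OF good_Hz[of z] inact_sV[OF supp], of "Cz z"]
  show "VC (Cz z)" by (rule V(1)) (use Ker_lam[OF z] 1 3 in auto)
  show "k < n \<Longrightarrow> a < N * 2 ^ k \<Longrightarrow> b \<le> M * 2 ^ k \<Longrightarrow> sV z k a b False = Y.Q (Cz z (mid n k a + 2)) (y (b * 2 ^ (n - k)))
      \<and> sV z k a b True = Y.Q' (Cz z (mid n k a + 2)) (y (b * 2 ^ (n - k)))"
    by (rule V(2)) (use Ker_lam[OF z] 1 3 in auto)
  have g: "S.good (\<lambda>i j. Hz z j i)" using good_Hz good_swp by blast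
  note H = S.VC_of[OF g inact_sH[OF supp], of "\<lambda>a b. Cz z b a"]
  show "S.VC (\<lambda>a b. Cz z b a)" by (rule H(1)) (use Ker_lam[OF z] 2 3 in auto)
  show "k < n \<Longrightarrow> b < M * 2 ^ k \<Longrightarrow> a \<le> N * 2 ^ k \<Longrightarrow> sH z k b a False = X.Q (\<lambda>a. Cz z a (mid n k b + 2)) (x (a * 2 ^ (n - k)))
      \<and> sH z k b a True = X.Q' (\<lambda>a. Cz z a (mid n k b + 2)) (x (a * 2 ^ (n - k)))"
    by (rule H(2)) (use Ker_lam[OF z] 2 3 in auto)
qed

section \<open>The isomorphism between the kernel and the spline space\<close>

definition Psi :: "(idx \<Rightarrow> real) \<Rightarrow> point \<Rightarrow> real" where
  "Psi z = B.F (Cz z)"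

lemma mdiff_add: "mdiff (\<lambda>i j. h i j + h' i j) p s = mdiff h p s + mdiff h' p s"
  and mdiff_scale: "mdiff (\<lambda>i j. c * h i j) p s = c * mdiff h p s"
  by (simp_all add: mdiff_def hdiff_def algebra_simps)

lemma Psi_linear: "Vector_Spaces.linear rscale fscale Psi"
proof -
  have 1: "Hz (z + z') = (\<lambda>i j. Hz z i j + Hz z' i j)" "Hz (rscale c z) = (\<lambda>i j. c * Hz z i j)" for z z' c
    by (auto simp: Hz_def fun_eq_iff rscale_def split: prod.splits)
  have 2: "Cz (z + z') a b = Cz z a b + Cz z' a b" "Cz (rscale c z) a b = c * Cz z a b" for z z' c a b
    unfolding Cz_def 1 mdiff_add mdiff_scale by (auto simp: jmp_def sV_def sH_def rscale_def)
  have "Psi (z + z') = Psi z + Psi z'" for z z'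
    by (auto simp: Psi_def B.F_def fun_eq_iff 2 algebra_simps sum.distrib simp del: sum.lessThan_Suc)
  moreover have "Psi (rscale c z) = fscale c (Psi z)" for c z
    by (auto simp: Psi_def B.F_def fun_eq_iff 2 fscale_def sum_distrib_left mult.assoc simp del: sum.lessThan_Suc)
  ultimately show ?thesis
    unfolding Vector_Spaces.linear_iff using rfun.vector_space_axioms fun_space.vector_space_axioms by blast
qed

text \<open>A zero spline has zero coefficients. Summing the differences back gives
  \<open>Hz z = 0\<close> on the grid, the states are values and slopes of zero cofactors, and the
  remaining entries of \<open>z\<close> are coefficients themselves.\<close>

lemma Psi_kernel:
  assumes z: "z \<in> Ker" and P: "Psi z = 0"
  shows "z = 0"
proof
  interpret S: dmesh M N n "swp D" y x by (rule dmesh_swp)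
  have supp: "z i = 0" if "i \<notin> Idx" for i using z that by (auto simp: Ker_def supported_def)
  have C0: "Cz z a b = 0" if "a < N * 2 ^ n + 2" "b < M * 2 ^ n + 2" for a b
  proof (rule B.F_unique[OF _ that])
    show "B.F (Cz z) p = 0" for p using fun_cong[OF P, of p] by (simp add: Psi_def)
  qed
  have hd0: "hdiff (Hz z) p j = 0" if "p < N * 2 ^ n" "j < M * 2 ^ n" for p j
    unfolding second_Cz[symmetric] Y.second_def using that by (intro sum.neutral) (auto intro!: C0)
  have H0: "Hz z p j = 0" if "p < N * 2 ^ n" "j < M * 2 ^ n" for p j
    using that
  proof (induction p)
    case (Suc p)
    then show ?case using hd0[of "Suc p" j] by (simp add: hdiff_def)
  qed (use hd0[of 0 j] in \<open>simp add: hdiff_def\<close>)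
  have QV: "Y.Q (Cz z (mid n k a + 2)) Y = 0" "Y.Q' (Cz z (mid n k a + 2)) Y = 0" if "k < n" "a < N * 2 ^ k" for k a Y
    unfolding Y.Q_def Y.Q'_def using mid_less[OF that] by (auto intro!: sum.neutral C0 simp del: sum.lessThan_Suc)
  have QH: "X.Q (\<lambda>a. Cz z a (mid n k b + 2)) X = 0" "X.Q' (\<lambda>a. Cz z a (mid n k b + 2)) X = 0" if "k < n" "b < M * 2 ^ k" for k b X
    unfolding X.Q_def X.Q'_def using S.mid_less[OF that] by (auto intro!: sum.neutral C0 simp del: sum.lessThan_Suc)
  have act_rng: "a < N * 2 ^ k \<and> b \<le> M * 2 ^ k" if "(a, b) \<in> act M D k" for a b k
  proof -
    have "(a, b - 1) \<in> D k \<or> (a, b) \<in> D k" using that M by (cases "0 < b") (auto simp: act_def)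
    then show ?thesis using that D_range by (auto simp: act_def)
  qed
  have act_rng': "b < M * 2 ^ k \<and> a \<le> N * 2 ^ k" if "(b, a) \<in> act N (swp D) k" for a b k
  proof -
    have "(b, a - 1) \<in> swp D k \<or> (b, a) \<in> swp D k" using that N by (cases "0 < a") (auto simp: act_def)
    then show ?thesis using that S.D_range by (auto simp: act_def)
  qed
  have small: "i * 2 ^ n + 2 < N * 2 ^ n + 2" "j * 2 ^ n + 2 < M * 2 ^ n + 2" if "i < N" "j < M" for i j
    using that by simp_all
  fix i
  show "z i = 0 i"
  proof (cases "i \<in> Idx")
    case True
    show ?thesis
    proof (cases i)
      case (Cl k a b)
      then have "(k, a, b) \<in> leaves" using True by simp
      note c = leaf_corner[OF this]
      show ?thesis using H0[OF c(2,3)] by (simp add: Hz_def c Cl)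
    next
      case (VS k a b r)
      then have "k < n" "a < N * 2 ^ k" "b \<le> M * 2 ^ k" using True act_rng by auto
      then show ?thesis using Ker_VC(3)[OF z, of k a b] QV[of k a] by (cases r) (auto simp: VS sV_def)
    next
      case (HS k b a r)
      then have "k < n" "b < M * 2 ^ k" "a \<le> N * 2 ^ k" using True act_rng' by auto
      then show ?thesis using Ker_VC(4)[OF z, of k b a] QH[of k b] by (cases r) (auto simp: HS sH_def)
    next
      case (VB i' r)
      have "Cz z (i' * 2 ^ n + 2) (if r then 1 else 0) = z (VB i' r)" by (cases r) (simp_all add: Cz_def jmp_def)
      then show ?thesis using C0[OF small(1)[of i' 0], of "if r then 1 else 0"] True M by (simp add: VB split: if_splits)
    next
      case (HB j' r)
      have "Cz z (if r then 1 else 0) (j' * 2 ^ n + 2) = z (HB j' r)" by (cases r) (simp_all add: Cz_def jmp_def)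
      then show ?thesis using C0[OF _ small(2)[of 0 j'], of "if r then 1 else 0"] True N by (simp add: HB split: if_splits)
    next
      case (KB r s)
      have "Cz z (if r then 1 else 0) (if s then 1 else 0) = z (KB r s)" by (cases r; cases s) (simp_all add: Cz_def)
      then show ?thesis using C0[of "if r then 1 else 0" "if s then 1 else 0"] by (simp add: KB split: if_splits)
    qed
  qed (use supp in auto)
qed

lemma mid_less_imp: "k < n \<Longrightarrow> mid n k a < N * 2 ^ n \<Longrightarrow> a < N * 2 ^ k"
proof -
  assume k: "k < n" and m: "mid n k a < N * 2 ^ n"
  have "(2::nat) ^ n = 2 ^ k * 2 ^ (n - k)" using k by (simp add: power_add[symmetric])
  then have e: "N * 2 ^ n = (N * 2 ^ k) * 2 ^ (n - k)" by (simp only: mult.assoc)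
  have "anc n k (mid n k a) < N * 2 ^ k" using m unfolding anc_def e by (rule less_mult_imp_div_less)
  then show ?thesis using anc_mid[OF k] by simp
qed

lemma jmp_sC:
  assumes V: "VC C" and p: "p < N * 2 ^ n"
  shows "jmp n (\<lambda>i r. if i < N then C (i * 2 ^ n + 2) (if r then 1 else 0) else 0) (sC C) p r = C (p + 2) (if r then 1 else 0)"
proof (cases "2 ^ n dvd p")
  case True
  then obtain i where i: "p = i * 2 ^ n" by (metis dvd_def mult.commute)
  then have "i < N" using p by simp
  then show ?thesis using True i by (simp add: jmp_def)
next
  case False
  then have "0 < p" by (cases p) auto
  then obtain k a where k: "k < n" "p = mid n k a" using mid_exists False by blast
  then have "a < N * 2 ^ k" using mid_less_imp p by blast
  then show ?thesis using sC_eq[OF V k(1), of a 0 r] k by (simp add: jmp_mid Y.Q_0 Y.Q'_0)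
qed

text \<open>The parameters read off from a spline satisfy the constraints because they come from
  true cofactors, and they reproduce the coefficients of the spline.\<close>

lemma Psi_surj:
  assumes V: "VC C" and H: "dmesh.VC M N n (swp D) x (\<lambda>a b. C b a)"
  shows "\<exists>z\<in>Ker. Psi z = B.F C"
proof -
  interpret S: dmesh M N n "swp D" y x by (rule dmesh_swp)
  have HcS: "S.Hc (\<lambda>a b. C b a) j i = Hc C i j" for i j
    unfolding Hc_def S.Hc_def by (rule sum.swap)
  \<comment> \<open>\<open>Hc_leaf\<close> moves horizontally inside the leaf, its mirror image
    moves vertically.\<close>
  have const: "Hc C i j = Hc C (a * 2 ^ (n - k)) (b * 2 ^ (n - k))"
    if l: "lf i j = (k, a, b)" and ij: "i < N * 2 ^ n" "j < M * 2 ^ n" for i j k a b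
  proof -
    have L: "(k, a, b) \<in> leaves" using lf_leaves[OF ij] l by simp
    have L': "(k, b, a) \<in> S.leaves" using L swp_leaf(3) by simp
    have an: "anc n k i = a" "anc n k j = b" using l by (auto simp: lf_def)
    note c = leaf_corner[OF L]
    have "Hc C i j = Hc C (a * 2 ^ (n - k)) j"
      using Hc_leaf[OF V L an(2) ij(2), of i] an(1) by (simp add: anc_eq_iff)
    also have "\<dots> = Hc C (a * 2 ^ (n - k)) (b * 2 ^ (n - k))"
      using S.Hc_leaf[OF H L', of "a * 2 ^ (n - k)" j] an(2) c(2) by (simp add: anc_eq_iff HcS)
    finally show ?thesis .
  qed
  have g: "good (Hc C)"
    unfolding good_def by (metis const prod_cases3)
  define s' where "s' = S.sC (\<lambda>a b. C b a)"
  define z where "z = zof (Hc C) (sC C) s' (\<lambda>i r. C (i * 2 ^ n + 2) (if r then 1 else 0))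
    (\<lambda>j r. C (if r then 1 else 0) (j * 2 ^ n + 2)) (\<lambda>r s. C (if r then 1 else 0) (if s then 1 else 0))"
  have s': "S.inact s'" unfolding s'_def by (rule S.inact_sC)
  have lamH: "lam x n (\<lambda>i j. Hc C j i) s' k b a w0 w1 = 0" if "(a, b) \<in> D k" for a b k w0 w1
    using S.lam_sC[OF H, of b a k w0 w1] that by (simp add: s'_def HcS[symmetric] eta_contract_eq)
  have "z \<in> Ker"
    unfolding Ker_def
  proof (intro CollectI conjI ballI)
    show "z \<in> supported Idx" by (simp add: z_def zof_supported)
    fix j
    assume j: "j \<in> J"
    obtain k a b d r where je: "j = ((k, a, b), d, r)" by (metis prod_cases3 surj_pair)
    have ab: "(a, b) \<in> D k" using j by (simp add: je J_def K_def)
    show "phi j z = 0"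
      unfolding je phi_def z_def using lam_Hz_zof[OF g inact_sC ab] lam_Hz_zof'[OF g s' ab] lam_sC[OF V ab] lamH[OF ab] by simp
  qed
  moreover have "Cz z a b = C a b" if ab: "a < N * 2 ^ n + 2" "b < M * 2 ^ n + 2" for a b
  proof -
    have sV: "sV z = sC C" "sH z = s'" unfolding z_def by (simp_all add: sV_zof inact_sC sH_zof s')
    have vb: "(\<lambda>i r. z (VB i r)) = (\<lambda>i r. if i < N then C (i * 2 ^ n + 2) (if r then 1 else 0) else 0)"
      "(\<lambda>j r. z (HB j r)) = (\<lambda>j r. if j < M then C (if r then 1 else 0) (j * 2 ^ n + 2) else 0)"
      by (auto simp: z_def zof_def fun_eq_iff)
    consider "a < 2" "b < 2" | p where "a = p + 2" "b < 2" | s where "a < 2" "b = s + 2" | p s where "a = p + 2" "b = s + 2"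
      by (metis add.commute le_Suc_ex not_less)
    then show ?thesis
    proof cases
      case 1
      then show ?thesis by (auto simp: Cz_def z_def zof_def less_Suc_eq numeral_2_eq_2)
    next
      case (2 p)
      then have "Cz z a b = jmp n (\<lambda>i r. z (VB i r)) (sV z) p (b = 1)" by (simp add: Cz_def)
      also have "\<dots> = C (p + 2) (if b = 1 then 1 else 0)"
        unfolding vb sV using jmp_sC[OF V, of p] ab 2 by simp
      also have "(if b = 1 then 1 else 0) = b" using 2 by auto
      finally show ?thesis using 2 by simp
    next
      case (3 s)
      then have "Cz z a b = jmp n (\<lambda>i r. z (HB i r)) (sH z) s (a = 1)" by (simp add: Cz_def)
      also have "\<dots> = C (if a = 1 then 1 else 0) (s + 2)"
        unfolding vb sV s'_def using S.jmp_sC[OF H, of s] ab 3 by simp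
      also have "(if a = 1 then 1 else 0) = a" using 3 by auto
      finally show ?thesis using 3 by simp
    next
      case (4 p s)
      have "Cz z a b = mdiff (Hz z) p s" using 4 by (simp add: Cz_def)
      also have "\<dots> = mdiff (Hc C) p s"
        using ab 4 M unfolding mdiff_def hdiff_def z_def by (simp add: Hz_zof[OF g])
      finally show ?thesis using 4 by (simp add: mdiff_Hc)
    qed
  qed
  then have "Psi z = B.F C"
    unfolding Psi_def B.F_def fun_eq_iff by (auto intro!: sum.cong simp del: sum.lessThan_Suc)
  ultimately show ?thesis by blast
qed

section \<open>Counting parameters and constraints\<close>

lemma finite_leaves: "finite leaves"
proof (rule finite_subset)
  show "leaves \<subseteq> (SIGMA k:{..n}. L k)" by (auto simp: leaves_def)
  show "finite (SIGMA k:{..n}. L k)" using finite_L by auto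
qed

lemma Idx_Un:
  "Idx = (\<lambda>(k, a, b). Cl k a b) ` leaves
    \<union> (\<lambda>(q, r). VS (fst q) (fst (snd q)) (snd (snd q)) r) ` ((SIGMA k:{..<n}. act M D k) \<times> UNIV)
    \<union> (\<lambda>(q, r). HS (fst q) (fst (snd q)) (snd (snd q)) r) ` ((SIGMA k:{..<n}. act N (swp D) k) \<times> UNIV)
    \<union> (\<lambda>(i, r). VB i r) ` ({..<N} \<times> UNIV) \<union> (\<lambda>(i, r). HB i r) ` ({..<M} \<times> UNIV)
    \<union> (\<lambda>(r, s). KB r s) ` UNIV" (is "_ = ?A1 \<union> ?A2 \<union> ?A3 \<union> ?A4 \<union> ?A5 \<union> ?A6")
proof -
  have "{Cl k a b | k a b. (k, a, b) \<in> leaves} = ?A1" by force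
  moreover have "{VS k a b r | k a b r. k < n \<and> (a, b) \<in> act M D k} = ?A2"
  proof (intro subset_antisym subsetI)
    fix i
    assume "i \<in> {VS k a b r | k a b r. k < n \<and> (a, b) \<in> act M D k}"
    then obtain k a b r where "i = VS k a b r" "k < n" "(a, b) \<in> act M D k" by blast
    then show "i \<in> ?A2" by (intro image_eqI[where x = "((k, a, b), r)"]) auto
  qed auto
  moreover have "{HS k b a r | k b a r. k < n \<and> (b, a) \<in> act N (swp D) k} = ?A3"
  proof (intro subset_antisym subsetI)
    fix i
    assume "i \<in> {HS k b a r | k b a r. k < n \<and> (b, a) \<in> act N (swp D) k}"
    then obtain k b a r where "i = HS k b a r" "k < n" "(b, a) \<in> act N (swp D) k" by blast
    then show "i \<in> ?A3" by (intro image_eqI[where x = "((k, b, a), r)"]) auto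
  qed auto
  moreover have "{VB i r | i r. i < N} = ?A4" "{HB i r | i r. i < M} = ?A5" "{KB r s | r s. True} = ?A6"
    by force+
  ultimately show ?thesis unfolding Idx_def by (simp only:)
qed

lemma finite_Idx: "finite Idx"
  and card_Idx: "card Idx = card leaves + 2 * (\<Sum>k<n. card (act M D k)) + 2 * (\<Sum>k<n. card (act N (swp D) k))
    + 2 * N + 2 * M + 4"
proof -
  interpret S: dmesh M N n "swp D" y x by (rule dmesh_swp)
  let ?A1 = "(\<lambda>(k, a, b). Cl k a b) ` leaves"
  let ?A2 = "(\<lambda>(q, r). VS (fst q) (fst (snd q)) (snd (snd q)) r) ` ((SIGMA k:{..<n}. act M D k) \<times> UNIV)"
  let ?A3 = "(\<lambda>(q, r). HS (fst q) (fst (snd q)) (snd (snd q)) r) ` ((SIGMA k:{..<n}. act N (swp D) k) \<times> UNIV)"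
  let ?A4 = "(\<lambda>(i, r). VB i r) ` ({..<N} \<times> UNIV)"
  let ?A5 = "(\<lambda>(i, r). HB i r) ` ({..<M} \<times> UNIV)"
  let ?A6 = "(\<lambda>(r, s). KB r s) ` UNIV"
  have fin: "finite ?A1" "finite ?A2" "finite ?A3" "finite ?A4" "finite ?A5" "finite ?A6"
    using finite_leaves finite_act S.finite_act by (auto intro!: finite_imageI finite_SigmaI)
  then show "finite Idx" unfolding Idx_Un by (intro finite_UnI)
  have c1: "card ?A1 = card leaves" by (rule card_image) (auto simp: inj_on_def)
  have "card ?A2 = card ((SIGMA k:{..<n}. act M D k) \<times> (UNIV :: bool set))"
    by (rule card_image) (auto simp: inj_on_def)
  then have c2: "card ?A2 = 2 * (\<Sum>k<n. card (act M D k))"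
    using finite_act by (simp add: card_cartesian_product card_SigmaI)
  have "card ?A3 = card ((SIGMA k:{..<n}. act N (swp D) k) \<times> (UNIV :: bool set))"
    by (rule card_image) (auto simp: inj_on_def)
  then have c3: "card ?A3 = 2 * (\<Sum>k<n. card (act N (swp D) k))"
    using S.finite_act by (simp add: card_cartesian_product card_SigmaI)
  have "card ?A4 = card ({..<N} \<times> (UNIV :: bool set))" by (rule card_image) (auto simp: inj_on_def)
  then have c4: "card ?A4 = 2 * N" by (simp add: card_cartesian_product)
  have "card ?A5 = card ({..<M} \<times> (UNIV :: bool set))" by (rule card_image) (auto simp: inj_on_def)
  then have c5: "card ?A5 = 2 * M" by (simp add: card_cartesian_product)
  have "card ?A6 = card (UNIV :: (bool \<times> bool) set)" by (rule card_image) (auto simp: inj_on_def)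
  then have c6: "card ?A6 = 4" by (simp add: card_UNIV_bool)
  have "card Idx = card ?A1 + card ?A2 + card ?A3 + card ?A4 + card ?A5 + card ?A6"
  proof -
    have "?A1 \<inter> ?A2 = {}" "(?A1 \<union> ?A2) \<inter> ?A3 = {}" "(?A1 \<union> ?A2 \<union> ?A3) \<inter> ?A4 = {}"
      "(?A1 \<union> ?A2 \<union> ?A3 \<union> ?A4) \<inter> ?A5 = {}" "(?A1 \<union> ?A2 \<union> ?A3 \<union> ?A4 \<union> ?A5) \<inter> ?A6 = {}"
      by auto
    then show ?thesis
      unfolding Idx_Un using fin by (simp only: card_Un_disjoint finite_UnI)
  qed
  then show "card Idx = card leaves + 2 * (\<Sum>k<n. card (act M D k)) + 2 * (\<Sum>k<n. card (act N (swp D) k))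
    + 2 * N + 2 * M + 4"
    unfolding c1 c2 c3 c4 c5 c6 by simp
qed

lemma finite_iso: "finite (iso k)" and iso_D: "iso k \<subseteq> D k"
  using finite_subset[OF _ finite_D, of "iso k" k] by (auto simp: iso_def)

lemma card_J: "card J + (\<Sum>k<n. card (iso k)) = 4 * (\<Sum>k<n. card (D k))"
proof -
  define I where "I = (\<lambda>q. (q, True, True)) ` (SIGMA k:{..<n}. iso k)"
  have sub: "(SIGMA k:{..<n}. iso k) \<subseteq> K" unfolding K_Sigma using iso_D by auto
  have "{((k, a, b), True, True) | k a b. (a, b) \<in> iso k} = I"
  proof -
    have "k < n" if "(a, b) \<in> iso k" for k a b using that iso_D D_less_n by blast
    then show ?thesis unfolding I_def by force
  qed
  then have J: "J = K \<times> UNIV - I" by (simp add: J_def)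
  have IK: "I \<subseteq> K \<times> UNIV" using sub by (auto simp: I_def)
  have fin: "finite (K \<times> (UNIV :: (bool \<times> bool) set))" using finite_K by simp
  have "card J + card I = card (K \<times> (UNIV :: (bool \<times> bool) set))"
    unfolding J card_Diff_subset[OF finite_subset[OF IK fin] IK] using card_mono[OF fin IK] by simp
  moreover have "card I = (\<Sum>k<n. card (iso k))"
    unfolding I_def using finite_iso by (subst card_image) (auto simp: inj_on_def card_SigmaI)
  moreover have "card K = (\<Sum>k<n. card (D k))" unfolding K_Sigma using finite_D by (simp add: card_SigmaI)
  ultimately show ?thesis by (simp add: card_cartesian_product card_UNIV_bool)
qed

lemma card_L_Suc: "card (L (Suc k)) = 4 * card (D k)"
proof -
  define f where "f = (\<lambda>((a, b), e, f). (2 * a + of_bool e, 2 * b + of_bool f) :: nat \<times> nat)"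
  have "bij_betw f (D k \<times> UNIV) (L (Suc k))"
  proof (rule bij_betw_byWitness[of _ "\<lambda>(a, b). ((a div 2, b div 2), odd a, odd b)"])
    show "\<forall>q\<in>D k \<times> UNIV. (\<lambda>(a, b). ((a div 2, b div 2), odd a, odd b)) (f q) = q"
      by (auto simp: f_def of_bool_def split: if_splits)
    show "\<forall>q\<in>L (Suc k). f ((\<lambda>(a, b). ((a div 2, b div 2), odd a, odd b)) q) = q"
      by (auto simp: f_def of_bool_def split: if_splits)
    show "f ` (D k \<times> UNIV) \<subseteq> L (Suc k)" by (auto simp: f_def of_bool_def)
    show "(\<lambda>(a, b). ((a div 2, b div 2), odd a, odd b)) ` L (Suc k) \<subseteq> D k \<times> UNIV" by auto
  qed
  then have "card (L (Suc k)) = card (D k \<times> (UNIV :: (bool \<times> bool) set))" using bij_betw_same_card by metis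
  then show ?thesis by (simp add: card_cartesian_product card_UNIV_bool)
qed

text \<open>Each division replaces one cell by four.\<close>

lemma card_leaves: "card leaves = N * M + 3 * (\<Sum>k<n. card (D k))"
proof -
  have "leaves = (SIGMA k:{..n}. L k - D k)" by (auto simp: leaves_def)
  then have "card leaves = (\<Sum>k\<le>n. card (L k - D k))" using finite_L by (simp add: card_SigmaI)
  \<comment> \<open>For the induction the divided cells of the last level are counted as well; at
    \<open>m = n\<close> there are none.\<close>
  moreover have "(\<Sum>k\<le>m. card (L k - D k)) + card (D m) = N * M + 3 * (\<Sum>k<m. card (D k))" for m
  proof (induction m)
    case 0
    have "card (L 0 - D 0) + card (D 0) = card (L 0)"
      using D_L[of 0] finite_L[of 0] by (metis card_Diff_subset card_mono finite_subset le_add_diff_inverse2)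
    then show ?case by (simp add: card_cartesian_product)
  next
    case (Suc m)
    have "card (L (Suc m) - D (Suc m)) + card (D (Suc m)) = card (L (Suc m))"
      using D_L[of "Suc m"] finite_L[of "Suc m"] by (metis card_Diff_subset card_mono finite_subset le_add_diff_inverse2)
    then show ?case using Suc card_L_Suc[of m] by (simp del: lcells.simps)
  qed
  from this[of n] have "(\<Sum>k\<le>n. card (L k - D k)) = N * M + 3 * (\<Sum>k<n. card (D k))" by (simp add: D_n)
  ultimately show ?thesis by simp
qed

theorem dim_splines:
  "fun_space.dim {B.F C | C. VC C \<and> dmesh.VC M N n (swp D) x (\<lambda>a b. C b a)} + card J = card Idx"
proof -
  interpret S: dmesh M N n "swp D" y x by (rule dmesh_swp)
  have sub: "rfun.subspace Ker"
  proof -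
    have z: "phi j 0 = 0" for j using phi_add[of j 0 0] by simp
    show ?thesis
      using subspace_supported[of Idx] phi_add phi_scale z
      unfolding rfun.subspace_def Ker_def by auto
  qed
  have dK: "rfun.dim Ker + card J = rfun.dim (supported Idx)"
    unfolding Ker_def
    by (rule rfun.dim_common_kernel[OF subspace_supported finite_J _ supported_span[OF finite_Idx]])
      (use finite_Idx phi_add phi_scale phi_independent in auto)
  interpret VP: vector_space_pair rscale fscale ..
  have img: "Psi ` Ker = {B.F C | C. VC C \<and> S.VC (\<lambda>a b. C b a)}"
  proof
    show "Psi ` Ker \<subseteq> {B.F C | C. VC C \<and> S.VC (\<lambda>a b. C b a)}"
      using Ker_VC(1,2) unfolding Psi_def by blast
    show "{B.F C | C. VC C \<and> S.VC (\<lambda>a b. C b a)} \<subseteq> Psi ` Ker" using Psi_surj by force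
  qed
  have inj: "inj_on Psi Ker"
  proof (rule inj_onI)
    fix u v
    assume uv: "u \<in> Ker" "v \<in> Ker" "Psi u = Psi v"
    have "u - v \<in> Ker" using rfun.subspace_diff[OF sub uv(1,2)] .
    moreover have "Psi (u - v) = 0" using VP.linear_diff[OF Psi_linear] uv(3) by simp
    ultimately have "u - v = 0" by (rule Psi_kernel)
    then show "u = v" by simp
  qed
  have "fun_space.dim (Psi ` Ker) = rfun.dim Ker" by (rule VP.dim_image_inj[OF Psi_linear sub inj])
  then show ?thesis using dK img dim_supported[OF finite_Idx] by simp
qed

text \<open>The coefficient of \<open>card (D k)\<close> is \<open>3 - 4\<close>: a division adds
  three leaves and four constraints. An isolated cell gives one constraint back.\<close>

corollary dim_splines_count:
  "int (fun_space.dim {B.F C | C. VC C \<and> dmesh.VC M N n (swp D) x (\<lambda>a b. C b a)}) =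
    int N * int M + 2 * int N + 2 * int M + 4
    + (\<Sum>k<n. 2 * int (card (act M D k)) + 2 * int (card (act N (swp D) k)) - int (card (D k)) + int (card (iso k)))"
proof -
  have "int (fun_space.dim {B.F C | C. VC C \<and> dmesh.VC M N n (swp D) x (\<lambda>a b. C b a)}) = int (card Idx) - int (card J)"
    using dim_splines by linarith
  moreover have "int (card J) = 4 * (\<Sum>k<n. int (card (D k))) - (\<Sum>k<n. int (card (iso k)))"
    using arg_cong[OF card_J, of int] by simp
  moreover have "int (card Idx) = int N * int M + 3 * (\<Sum>k<n. int (card (D k))) + 2 * (\<Sum>k<n. int (card (act M D k)))
      + 2 * (\<Sum>k<n. int (card (act N (swp D) k))) + 2 * int N + 2 * int M + 4"
    unfolding card_Idx card_leaves by simp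
  ultimately show ?thesis by (simp add: sum.distrib sum_subtractf flip: sum_distrib_left)
qed

end

section \<open>Edges and l-edges in an index grid\<close>

abbreviation swap_image :: "point set \<Rightarrow> point set" where
  "swap_image S \<equiv> prod.swap ` S"

text \<open>The notions of edge, interior line and l-edge, with the mesh reduced to its skeleton,
  its vertices and the boundary; in this form they can be transported along the exchange of the
  axes.\<close>

definition Edg :: "point set \<Rightarrow> point set \<Rightarrow> point set set" where
  "Edg S V = {closed_segment v w | v w. v \<in> V \<and> w \<in> V \<and> v \<noteq> w \<and> (fst v = fst w \<or> snd v = snd w) \<and>
     closed_segment v w \<subseteq> S \<and> open_segment v w \<inter> V = {}}"

definition IL :: "point set set \<Rightarrow> point set \<Rightarrow> point set \<Rightarrow> bool" where
  "IL E B l \<longleftrightarrow> (\<exists>a b F. F \<noteq> {} \<and> F \<subseteq> {e \<in> E. \<not> e \<subseteq> B} \<and> l = closed_segment a b \<and> l = \<Union>F)"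

definition LE :: "point set set \<Rightarrow> point set \<Rightarrow> point set set" where
  "LE E B = {l. IL E B l \<and> (\<forall>l'. IL E B l' \<and> l \<subseteq> l' \<longrightarrow> l' = l)}"

text \<open>For a segment: vertical and not a single point. Phrased for arbitrary sets, it passes to
  supersets.\<close>

definition vert :: "point set \<Rightarrow> bool" where
  "vert e \<longleftrightarrow> (\<exists>v\<in>e. \<exists>w\<in>e. v \<noteq> w \<and> fst v = fst w)"

lemma mesh_edges_Edg: "mesh_edges M = Edg (skeleton M) (mesh_vertices M)"
  by (simp add: mesh_edges_def Edg_def)

lemma interior_ledges_LE: "interior_ledges M = LE (mesh_edges M) (frontier (mesh_domain M))"
proof -
  have "interior_edges M = {e \<in> mesh_edges M. \<not> e \<subseteq> frontier (mesh_domain M)}"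
    by (auto simp: interior_edges_def boundary_edges_def)
  then show ?thesis by (simp add: interior_ledges_def LE_def IL_def interior_line_def)
qed

lemma swap_swap_image [simp]: "swap_image (swap_image S) = S"
  by (simp add: image_image)

lemma inj_swap_image: "inj swap_image"
  by (rule inj_on_inverseI[where g = swap_image]) simp

lemma card_swap_image [simp]: "card (swap_image ` A) = card A"
  and finite_swap_image [simp]: "finite (swap_image ` A) \<longleftrightarrow> finite A"
proof -
  have "inj_on swap_image A" by (rule inj_on_subset[OF inj_swap_image subset_UNIV])
  then show "card (swap_image ` A) = card A" "finite (swap_image ` A) \<longleftrightarrow> finite A"
    by (rule card_image, rule finite_image_iff)
qed

lemma swap_image_subset_iff: "swap_image A \<subseteq> swap_image B \<longleftrightarrow> A \<subseteq> B"
  by (metis image_mono swap_swap_image)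

lemma closed_segment_swap: "closed_segment (prod.swap v) (prod.swap w) = swap_image (closed_segment v w)"
proof -
  have "linear (prod.swap :: point \<Rightarrow> point)" by (intro linearI) (auto simp: prod_eq_iff)
  then show ?thesis by (simp add: closed_segment_linear_image)
qed

lemma open_segment_swap: "open_segment (prod.swap v) (prod.swap w) = swap_image (open_segment v w)"
proof -
  have "inj (prod.swap :: point \<Rightarrow> point)" by (rule injI) (auto simp: prod_eq_iff)
  then show ?thesis unfolding open_segment_def closed_segment_swap by (simp add: image_set_diff)
qed

lemma Edg_swap_sub: "e \<in> Edg S V \<Longrightarrow> swap_image e \<in> Edg (swap_image S) (swap_image V)"
proof -
  assume "e \<in> Edg S V"
  then obtain v w where "e = closed_segment v w" and vw: "v \<in> V" "w \<in> V" "v \<noteq> w" "fst v = fst w \<or> snd v = snd w"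
    "closed_segment v w \<subseteq> S" "open_segment v w \<inter> V = {}" by (auto simp: Edg_def)
  then have e: "swap_image e = closed_segment (prod.swap v) (prod.swap w)" by (simp add: closed_segment_swap)
  have "prod.swap v \<in> swap_image V" "prod.swap w \<in> swap_image V" "prod.swap v \<noteq> prod.swap w"
    using vw by (auto simp: prod_eq_iff)
  moreover have "fst (prod.swap v) = fst (prod.swap w) \<or> snd (prod.swap v) = snd (prod.swap w)" using vw by auto
  moreover have "closed_segment (prod.swap v) (prod.swap w) \<subseteq> swap_image S"
    unfolding closed_segment_swap using vw by (intro image_mono)
  moreover have "open_segment (prod.swap v) (prod.swap w) \<inter> swap_image V = {}"
    unfolding open_segment_swap using vw by (simp flip: image_Int)
  ultimately show ?thesis unfolding Edg_def e by blast
qed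

lemma Edg_swap: "Edg (swap_image S) (swap_image V) = swap_image ` Edg S V"
proof
  show "swap_image ` Edg S V \<subseteq> Edg (swap_image S) (swap_image V)" using Edg_swap_sub by blast
  show "Edg (swap_image S) (swap_image V) \<subseteq> swap_image ` Edg S V"
  proof
    fix e
    assume "e \<in> Edg (swap_image S) (swap_image V)"
    from Edg_swap_sub[OF this] have "swap_image e \<in> Edg S V" by simp
    then show "e \<in> swap_image ` Edg S V" by (metis image_eqI swap_swap_image)
  qed
qed

lemma IL_swap: "IL E B l \<Longrightarrow> IL (swap_image ` E) (swap_image B) (swap_image l)"
proof -
  assume "IL E B l"
  then obtain a b F where F: "F \<noteq> {}" "F \<subseteq> {e \<in> E. \<not> e \<subseteq> B}" "l = closed_segment a b" "l = \<Union>F"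
    unfolding IL_def by blast
  have "swap_image ` F \<subseteq> {e \<in> swap_image ` E. \<not> e \<subseteq> swap_image B}"
    using F(2) swap_image_subset_iff by blast
  moreover have "swap_image l = \<Union>(swap_image ` F)" using F(4) by blast
  moreover have "swap_image l = closed_segment (prod.swap a) (prod.swap b)" using F(3) closed_segment_swap by simp
  ultimately show ?thesis unfolding IL_def
    using F(1) by (intro exI[of _ "prod.swap a"] exI[of _ "prod.swap b"] exI[of _ "swap_image ` F"] conjI) simp_all
qed

lemma LE_swap: "LE (swap_image ` E) (swap_image B) = swap_image ` LE E B"
proof -
  have E2: "swap_image ` swap_image ` E = E" for E by (auto simp: image_image)
  have sub: "swap_image l \<in> LE (swap_image ` E) (swap_image B)" if l: "l \<in> LE E B" for E B l
  proof -
    have "l' = swap_image l" if l': "IL (swap_image ` E) (swap_image B) l'" "swap_image l \<subseteq> l'" for l'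
    proof -
      have "IL E B (swap_image l')" using IL_swap[OF l'(1)] by (simp add: E2)
      moreover have "l \<subseteq> swap_image l'" using l'(2) swap_image_subset_iff by (metis swap_swap_image)
      ultimately have "swap_image l' = l" using l unfolding LE_def by blast
      then show ?thesis by (metis swap_swap_image)
    qed
    moreover have "IL (swap_image ` E) (swap_image B) (swap_image l)" using IL_swap l by (simp add: LE_def)
    ultimately show ?thesis by (simp add: LE_def)
  qed
  show ?thesis
  proof
    show "swap_image ` LE E B \<subseteq> LE (swap_image ` E) (swap_image B)" using sub by blast
    show "LE (swap_image ` E) (swap_image B) \<subseteq> swap_image ` LE E B"
    proof
      fix l
      assume "l \<in> LE (swap_image ` E) (swap_image B)"
      from sub[OF this] have "swap_image l \<in> LE E B" by (simp add: E2)
      then show "l \<in> swap_image ` LE E B" by (metis image_eqI swap_swap_image)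
    qed
  qed
qed

lemma vertical_segment: "closed_segment (c, a) (c, b) = {c} \<times> closed_segment a b" for a b c :: real
proof -
  have "(1 - u) * c + u * c = c" for u by (simp add: algebra_simps)
  then show ?thesis by (auto simp: closed_segment_def)
qed

lemma segment_same_fst:
  fixes a b p q :: point
  assumes "p \<in> closed_segment a b" "q \<in> closed_segment a b" "p \<noteq> q" "fst p = fst q"
  shows "fst a = fst b"
proof -
  obtain u v where u: "p = (1 - u) *\<^sub>R a + u *\<^sub>R b" and v: "q = (1 - v) *\<^sub>R a + v *\<^sub>R b"
    using assms by (auto simp: closed_segment_def)
  have "(1 - u) * fst a + u * fst b = (1 - v) * fst a + v * fst b" using assms(4) by (simp add: u v)
  then have "(u - v) * (fst b - fst a) = 0" by (simp add: algebra_simps)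
  moreover have "u \<noteq> v" using assms(3) u v by auto
  ultimately show ?thesis by simp
qed

lemma vert_segment: "vert (closed_segment a b) \<Longrightarrow> fst a = fst b"
  unfolding vert_def using segment_same_fst by blast

lemma vert_mono: "vert e \<Longrightarrow> e \<subseteq> l \<Longrightarrow> vert l"
  unfolding vert_def by blast

lemma vert_swap_segment: "vert (swap_image (closed_segment a b)) \<Longrightarrow> snd a = snd b"
  using vert_segment[of "prod.swap a" "prod.swap b"] by (simp add: closed_segment_swap)

lemma frontier_rect:
  fixes a b c d :: real
  assumes "a < b" "c < d"
  shows "frontier ({a..b} \<times> {c..d}) = {(u, v). (u = a \<or> u = b) \<and> v \<in> {c..d} \<or> (v = c \<or> v = d) \<and> u \<in> {a..b}}"
  using assms by (auto simp: frontier_def interior_Times closure_Times)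

section \<open>Edges, l-edges and valences in terms of unit segments\<close>

lemma (in knots) t_between:
  assumes "c < q" "v \<in> {t c..t q}"
  shows "\<exists>j\<in>{c..<q}. v \<in> {t j..t (Suc j)}"
  using assms
proof (induction q)
  case (Suc q)
  show ?case
  proof (cases "c < q \<and> v \<le> t q")
    case True
    then obtain j where "j \<in> {c..<q}" "v \<in> {t j..t (Suc j)}" using Suc by auto
    then show ?thesis by (intro bexI[of _ j]) auto
  next
    case False
    then have "t q \<le> v" using Suc.prems by (cases "c = q") auto
    then show ?thesis using Suc.prems by (intro bexI[of _ q]) auto
  qed
qed simp

text \<open>\<open>vs i j\<close> and \<open>hs i j\<close> say that the unit segment from
  \<open>(i, j)\<close> upwards or to the right belongs to the mesh. By \<open>v_end\<close> and
  \<open>h_end\<close> a line begins or stops only on a line of the other direction, so that its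
  ends are vertices.\<close>

locale grid = X: knots x P + Y: knots y Q for x y :: "nat \<Rightarrow> real" and P Q :: nat +
  fixes vs hs :: "nat \<Rightarrow> nat \<Rightarrow> bool"
  assumes vs_range: "vs i j \<Longrightarrow> i \<le> P \<and> j < Q" and hs_range: "hs i j \<Longrightarrow> i < P \<and> j \<le> Q"
    and v_end: "vs i j \<noteq> (0 < j \<and> vs i (j - 1)) \<Longrightarrow> hs i j \<or> (0 < i \<and> hs (i - 1) j)"
    and h_end: "hs i j \<noteq> (0 < i \<and> hs (i - 1) j) \<Longrightarrow> vs i j \<or> (0 < j \<and> vs i (j - 1))"
begin

definition vertex :: "nat \<Rightarrow> nat \<Rightarrow> bool" where
  "vertex i j \<longleftrightarrow> (vs i j \<or> (0 < j \<and> vs i (j - 1))) \<and> (hs i j \<or> (0 < i \<and> hs (i - 1) j))"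

definition Sk :: "point set" where
  "Sk = {(u, v). (\<exists>i j. vs i j \<and> u = x i \<and> v \<in> {y j..y (Suc j)}) \<or> (\<exists>i j. hs i j \<and> v = y j \<and> u \<in> {x i..x (Suc i)})}"

definition Vx :: "point set" where
  "Vx = {(x i, y j) | i j. vertex i j}"

definition bx :: "point set" where
  "bx = {x 0..x P} \<times> {y 0..y Q}"

lemma grid_swp: "grid y x Q P (\<lambda>j i. hs i j) (\<lambda>j i. vs i j)"
  using vs_range hs_range v_end h_end by unfold_locales auto

lemma swp_sets:
  "grid.vertex (\<lambda>j i. hs i j) (\<lambda>j i. vs i j) j i \<longleftrightarrow> vertex i j"
  "grid.Sk y x (\<lambda>j i. hs i j) (\<lambda>j i. vs i j) = swap_image Sk"
  "grid.Vx y x (\<lambda>j i. hs i j) (\<lambda>j i. vs i j) = swap_image Vx"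
  "grid.bx y x Q P = swap_image bx"
proof -
  interpret S: grid y x Q P "\<lambda>j i. hs i j" "\<lambda>j i. vs i j" by (rule grid_swp)
  show v: "S.vertex j i \<longleftrightarrow> vertex i j" for i j by (auto simp: vertex_def S.vertex_def)
  show "S.Sk = swap_image Sk" by (force simp: Sk_def S.Sk_def)
  show "S.Vx = swap_image Vx" by (force simp: Vx_def S.Vx_def v)
  show "S.bx = swap_image bx" by (force simp: bx_def S.bx_def)
qed

lemma vertex_range: "vertex i j \<Longrightarrow> i \<le> P \<and> j \<le> Q"
  using vs_range[of i j] vs_range[of i "j - 1"] by (auto simp: vertex_def)

text \<open>No horizontal grid line has its ordinate strictly inside a unit interval, so only a
  vertical unit segment can contain the point.\<close>

lemma Sk_vs:
  assumes "(x i, v) \<in> Sk" "i \<le> P" "t < Q" "y t < v" "v < y (Suc t)"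
  shows "vs i t"
proof -
  consider i' j where "vs i' j" "x i = x i'" "v \<in> {y j..y (Suc j)}" | i' j where "hs i' j" "v = y j"
    using assms(1) by (auto simp: Sk_def)
  then show ?thesis
  proof cases
    case (1 i' j)
    then have r: "i' \<le> P" "j < Q" using vs_range by auto
    then have "i' = i" using 1 assms X.t_eq_iff by simp
    have "y j < y (Suc t)" "y t < y (Suc j)" using 1 assms by auto
    then have "j < Suc t" "t < Suc j" using r assms(3) Y.t_less_iff by auto
    then have "j = t" by simp
    then show ?thesis using 1 \<open>i' = i\<close> by simp
  next
    case (2 i' j)
    then have "j \<le> Q" using hs_range by blast
    then have "t < j" "j < Suc t" using 2 assms Y.t_less_iff[of t j] Y.t_less_iff[of j "Suc t"] by auto
    then show ?thesis by simp
  qed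
qed

definition vE :: "nat \<Rightarrow> nat \<Rightarrow> nat \<Rightarrow> point set" where
  "vE i c d = {x i} \<times> {y c..y d}"

definition vedge :: "nat \<Rightarrow> nat \<Rightarrow> nat \<Rightarrow> bool" where
  "vedge i c d \<longleftrightarrow> c < d \<and> vertex i c \<and> vertex i d \<and> (\<forall>j\<in>{c..<d}. vs i j) \<and> (\<forall>j. c < j \<and> j < d \<longrightarrow> \<not> vertex i j)"

lemma mid_between: "t < Q \<Longrightarrow> y t < (y t + y (Suc t)) / 2 \<and> (y t + y (Suc t)) / 2 < y (Suc t)"
  using Y.t_Suc[of t] by simp

lemma vE_nonempty: "c \<le> d \<Longrightarrow> d \<le> Q \<Longrightarrow> (x i, y c) \<in> vE i c d \<and> (x i, y d) \<in> vE i c d"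
  using Y.t_mono[of c d] by (simp add: vE_def)

lemma vE_vert: "c < d \<Longrightarrow> d \<le> Q \<Longrightarrow> vert (vE i c d)"
  unfolding vert_def using vE_nonempty[of c d i] Y.t_less[of c d]
  by (intro bexI[of _ "(x i, y c)"] bexI[of _ "(x i, y d)"]) auto

lemma vE_segment: "c \<le> d \<Longrightarrow> d \<le> Q \<Longrightarrow> vE i c d = closed_segment (x i, y c) (x i, y d)"
  using Y.t_mono[of c d] by (simp add: vE_def vertical_segment closed_segment_eq_real_ivl)

lemma vE_subset_iff:
  assumes "c < d" "d \<le> Q" "c' < d'" "d' \<le> Q" "i \<le> P" "i' \<le> P"
  shows "vE i c d \<subseteq> vE i' c' d' \<longleftrightarrow> i = i' \<and> c' \<le> c \<and> d \<le> d'"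
proof
  assume "vE i c d \<subseteq> vE i' c' d'"
  then have "(x i, y c) \<in> vE i' c' d'" "(x i, y d) \<in> vE i' c' d'" using vE_nonempty[of c d i] assms by auto
  then show "i = i' \<and> c' \<le> c \<and> d \<le> d'"
    using assms by (auto simp: vE_def X.t_eq_iff Y.t_le_iff)
next
  assume "i = i' \<and> c' \<le> c \<and> d \<le> d'"
  then show "vE i c d \<subseteq> vE i' c' d'"
    using assms Y.t_mono[of c' c] Y.t_mono[of d d'] by (auto simp: vE_def)
qed

lemma vE_in_Sk:
  assumes "\<forall>j\<in>{c..<d}. vs i j" "c < d" "d \<le> Q"
  shows "vE i c d \<subseteq> Sk"
proof
  fix p
  assume "p \<in> vE i c d"
  then obtain v where p: "p = (x i, v)" "v \<in> {y c..y d}" by (auto simp: vE_def)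
  then obtain j where "j \<in> {c..<d}" "v \<in> {y j..y (Suc j)}" using Y.t_between[OF assms(2)] by blast
  then show "p \<in> Sk" using p assms(1) unfolding Sk_def by blast
qed

text \<open>\<open>Sk_vs\<close> at the midpoint of each unit interval turns containment in the
  skeleton into the presence of unit segments, and the order of the knots turns the absence of
  vertices inside the edge into a condition on indices.\<close>

lemma Edg_vert: "e \<in> Edg Sk Vx \<and> vert e \<longleftrightarrow> (\<exists>i c d. vedge i c d \<and> e = vE i c d)"
proof
  assume A: "e \<in> Edg Sk Vx \<and> vert e"
  then obtain v w where e: "e = closed_segment v w" and vw: "v \<in> Vx" "w \<in> Vx" "v \<noteq> w"
    and sub: "closed_segment v w \<subseteq> Sk" "open_segment v w \<inter> Vx = {}"
    unfolding Edg_def by blast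
  have fst: "fst v = fst w" using A e vert_segment by simp
  obtain i j where v: "v = (x i, y j)" "vertex i j" using vw by (auto simp: Vx_def)
  obtain i' j' where w: "w = (x i', y j')" "vertex i' j'" using vw by (auto simp: Vx_def)
  have "i' = i" using fst v w vertex_range[of i j] vertex_range[of i' j'] X.t_eq_iff by simp
  then have "j \<noteq> j'" using vw v w by auto
  define c d where "c = min j j'" and "d = max j j'"
  have cd: "c < d" "vertex i c" "vertex i d" "d \<le> Q"
    using \<open>j \<noteq> j'\<close> v w \<open>i' = i\<close> vertex_range[of i j] vertex_range[of i j'] by (auto simp: c_def d_def min_def max_def)
  have e': "e = vE i c d"
    unfolding e v w \<open>i' = i\<close> using cd vE_segment[of c d i] closed_segment_commute[of "(x i, y j)"]
    by (auto simp: c_def d_def min_def max_def)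
  have "vs i t" if t: "t \<in> {c..<d}" for t
  proof (rule Sk_vs)
    have tQ: "t < Q" using t cd by simp
    show "i \<le> P" using vertex_range cd by blast
    show "y t < (y t + y (Suc t)) / 2" "(y t + y (Suc t)) / 2 < y (Suc t)" "t < Q" using mid_between[OF tQ] tQ by auto
    have "y c \<le> y t" "y (Suc t) \<le> y d" using t cd Y.t_mono[of c t] Y.t_mono[of "Suc t" d] by auto
    then have "(x i, (y t + y (Suc t)) / 2) \<in> e" using mid_between[OF tQ] unfolding e' vE_def by auto
    then show "(x i, (y t + y (Suc t)) / 2) \<in> Sk" using sub(1) e by blast
  qed
  moreover have "\<not> vertex i t" if t: "c < t" "t < d" for t
  proof
    assume vt: "vertex i t"
    have l: "y c < y t" "y t < y d" using t cd Y.t_less[of c t] Y.t_less[of t d] by auto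
    then have "(x i, y t) \<in> vE i c d" by (simp add: vE_def)
    then have "(x i, y t) \<in> closed_segment v w" by (metis e e')
    moreover have "(x i, y t) \<noteq> v" "(x i, y t) \<noteq> w" using l v w by (auto simp: c_def d_def min_def max_def split: if_splits)
    ultimately have "(x i, y t) \<in> open_segment v w" by (simp add: open_segment_def)
    then show False using sub(2) vt unfolding Vx_def by blast
  qed
  ultimately show "\<exists>i c d. vedge i c d \<and> e = vE i c d" using cd e' unfolding vedge_def by blast
next
  assume "\<exists>i c d. vedge i c d \<and> e = vE i c d"
  then obtain i c d where ed: "vedge i c d" and e: "e = vE i c d" by blast
  then have cd: "c < d" "vertex i c" "vertex i d" "\<forall>j\<in>{c..<d}. vs i j" "\<And>j. c < j \<Longrightarrow> j < d \<Longrightarrow> \<not> vertex i j"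
    by (auto simp: vedge_def)
  then have r: "i \<le> P" "d \<le> Q" using vertex_range by blast+
  have seg: "e = closed_segment (x i, y c) (x i, y d)" using e vE_segment cd r by simp
  have "open_segment (x i, y c) (x i, y d) \<inter> Vx = {}"
  proof -
    have False if pp: "p \<in> open_segment (x i, y c) (x i, y d)" "p \<in> Vx" for p
    proof -
      obtain i' j where p: "p = (x i', y j)" "vertex i' j" using pp(2) by (auto simp: Vx_def)
      have m: "p \<in> vE i c d" "p \<noteq> (x i, y c)" "p \<noteq> (x i, y d)" using pp(1) seg e by (auto simp: open_segment_def)
      have r': "i' \<le> P" "j \<le> Q" using vertex_range p by blast+
      have "i' = i" "c \<le> j" "j \<le> d" using m(1) p r r' cd(1) by (auto simp: vE_def X.t_eq_iff Y.t_le_iff)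
      moreover have "j \<noteq> c" "j \<noteq> d" using m p \<open>i' = i\<close> by auto
      ultimately show False using cd(5)[of j] p by simp
    qed
    then show ?thesis by blast
  qed
  moreover have "(x i, y c) \<in> Vx" "(x i, y d) \<in> Vx" using cd unfolding Vx_def by blast+
  moreover have "(x i, y c) \<noteq> (x i, y d)" using Y.t_less[of c d] cd r by simp
  moreover have "closed_segment (x i, y c) (x i, y d) \<subseteq> Sk" using vE_in_Sk[OF cd(4,1) r(2)] e seg by simp
  ultimately have "e \<in> Edg Sk Vx" unfolding Edg_def seg by auto
  then show "e \<in> Edg Sk Vx \<and> vert e" using vE_vert cd r e by simp
qed

lemma Edg_vert_or: "e \<in> Edg S V \<Longrightarrow> vert e \<or> vert (swap_image e)"
proof -
  assume "e \<in> Edg S V"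
  then obtain v w where e: "e = closed_segment v w" "v \<noteq> w" "fst v = fst w \<or> snd v = snd w" by (auto simp: Edg_def)
  then have vw: "v \<in> e" "w \<in> e" by simp_all
  from e(3) show ?thesis
  proof
    assume "fst v = fst w"
    then show ?thesis using vw e(2) unfolding vert_def by blast
  next
    assume "snd v = snd w"
    then have "fst (prod.swap v) = fst (prod.swap w)" "prod.swap v \<noteq> prod.swap w" using e(2) by (auto simp: prod_eq_iff)
    moreover have "prod.swap v \<in> swap_image e" "prod.swap w \<in> swap_image e" using vw by auto
    ultimately show ?thesis unfolding vert_def by blast
  qed
qed

lemma Edg_not_both: "e \<in> Edg S V \<Longrightarrow> \<not> (vert e \<and> vert (swap_image e))"
proof
  assume "e \<in> Edg S V" and b: "vert e \<and> vert (swap_image e)"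
  then obtain v w where e: "e = closed_segment v w" "v \<noteq> w" by (auto simp: Edg_def)
  have "fst v = fst w" using b vert_segment e(1) by simp
  moreover have "snd v = snd w" using b vert_swap_segment e(1) by simp
  ultimately show False using e(2) by (auto simp: prod_eq_iff)
qed

lemma frontier_bx: "frontier bx = {(u, v). (u = x 0 \<or> u = x P) \<and> v \<in> {y 0..y Q} \<or> (v = y 0 \<or> v = y Q) \<and> u \<in> {x 0..x P}}"
  unfolding bx_def using X.t_less[of 0 P] Y.t_less[of 0 Q] X.P Y.P by (intro frontier_rect) auto

lemma vE_frontier:
  assumes "c < d" "d \<le> Q" "i \<le> P"
  shows "vE i c d \<subseteq> frontier bx \<longleftrightarrow> i = 0 \<or> i = P"
proof
  assume sub: "vE i c d \<subseteq> frontier bx"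
  define v where "v = (y c + y d) / 2"
  have "y c < y d" "y 0 \<le> y c" "y d \<le> y Q" using assms Y.t_less[of c d] Y.t_mono[of 0 c] Y.t_mono[of d Q] by auto
  then have v: "v \<in> {y c..y d}" "v \<noteq> y 0" "v \<noteq> y Q" by (auto simp: v_def)
  then have "(x i, v) \<in> frontier bx" using sub by (auto simp: vE_def)
  then have "x i = x 0 \<or> x i = x P" using v unfolding frontier_bx by auto
  then show "i = 0 \<or> i = P" using assms X.t_eq_iff[of i 0] X.t_eq_iff[of i P] by auto
next
  assume "i = 0 \<or> i = P"
  then show "vE i c d \<subseteq> frontier bx"
    using assms Y.t_mono[of 0 c] Y.t_mono[of d Q] unfolding frontier_bx vE_def by auto
qed

text \<open>\<open>vrun\<close> describes the vertical interior lines, \<open>vline\<close> the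
  maximal ones. The latter mentions no vertices, since \<open>v_end\<close> supplies them at both
  ends.\<close>

definition vrun :: "nat \<Rightarrow> nat \<Rightarrow> nat \<Rightarrow> bool" where
  "vrun i c d \<longleftrightarrow> 0 < i \<and> i < P \<and> c < d \<and> vertex i c \<and> vertex i d \<and> (\<forall>j\<in>{c..<d}. vs i j)"

definition vline :: "nat \<Rightarrow> nat \<Rightarrow> nat \<Rightarrow> bool" where
  "vline i c d \<longleftrightarrow> 0 < i \<and> i < P \<and> c < d \<and> (\<forall>j\<in>{c..<d}. vs i j) \<and> \<not> (0 < c \<and> vs i (c - 1)) \<and> \<not> vs i d"

lemma vline_vrun: "vline i c d \<Longrightarrow> vrun i c d"
proof -
  assume v: "vline i c d"
  then have "vs i c" "\<not> (0 < c \<and> vs i (c - 1))" by (auto simp: vline_def)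
  then have "vertex i c" using v_end[of i c] by (auto simp: vertex_def)
  moreover have "vs i (d - 1)" "0 < d" "\<not> vs i d" using v by (auto simp: vline_def)
  then have "vertex i d" using v_end[of i d] by (auto simp: vertex_def)
  ultimately show ?thesis using v by (auto simp: vline_def vrun_def)
qed

lemma vrun_range: "vrun i c d \<Longrightarrow> i \<le> P \<and> d \<le> Q"
  using vertex_range by (auto simp: vrun_def)

lemma vedge_at:
  assumes "vrun i c d" "c \<le> j" "j < d"
  shows "\<exists>c' d'. vedge i c' d' \<and> c \<le> c' \<and> c' \<le> j \<and> j < d' \<and> d' \<le> d"
proof -
  have ab: "vertex i c" "vertex i d" "\<forall>t\<in>{c..<d}. vs i t" using assms by (auto simp: vrun_def)
  define c' where "c' = Max {t. vertex i t \<and> c \<le> t \<and> t \<le> j}"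
  define d' where "d' = Min {t. vertex i t \<and> j < t \<and> t \<le> d}"
  have c'1: "c' \<in> {t. vertex i t \<and> c \<le> t \<and> t \<le> j}" unfolding c'_def by (rule Max_in) (use ab assms in auto)
  have d'1: "d' \<in> {t. vertex i t \<and> j < t \<and> t \<le> d}" unfolding d'_def by (rule Min_in) (use ab assms in auto)
  have c'2: "t \<le> c'" if "vertex i t" "c \<le> t" "t \<le> j" for t unfolding c'_def using that by (intro Max_ge) auto
  have d'2: "d' \<le> t" if "vertex i t" "j < t" "t \<le> d" for t unfolding d'_def using that by (intro Min_le) auto
  have "\<not> vertex i t" if "c' < t" "t < d'" for t
    using c'2[of t] d'2[of t] that c'1 d'1 by (cases "t \<le> j") auto
  then have "vedge i c' d'" using c'1 d'1 ab(3) by (auto simp: vedge_def)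
  then show ?thesis using c'1 d'1 by auto
qed

text \<open>All edges in a vertical segment are vertical and on the same grid line. The two extreme
  points of the segment lie on such edges and are therefore ends of them, and the midpoint of each
  unit interval shows that the unit segment there is present.\<close>

lemma IL_vert: "IL (Edg Sk Vx) (frontier bx) l \<and> vert l \<longleftrightarrow> (\<exists>i c d. vrun i c d \<and> l = vE i c d)"
proof
  assume A: "IL (Edg Sk Vx) (frontier bx) l \<and> vert l"
  then obtain a b F where F: "F \<noteq> {}" "F \<subseteq> {e \<in> Edg Sk Vx. \<not> e \<subseteq> frontier bx}" and l: "l = closed_segment a b" "l = \<Union>F"
    unfolding IL_def by blast
  have fst: "fst a = fst b" using A l(1) vert_segment by simp
  define m m' where "m = min (snd a) (snd b)" and "m' = max (snd a) (snd b)"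
  have l': "l = {fst a} \<times> {m..m'}"
    using l(1) fst vertical_segment[of "fst a" "snd a" "snd b"] prod.collapse[of a] prod.collapse[of b]
    by (auto simp: closed_segment_eq_real_ivl m_def m'_def)
  have FE: "\<exists>i c d. vedge i c d \<and> e = vE i c d \<and> x i = fst a \<and> 0 < i \<and> i < P \<and> d \<le> Q" if "e \<in> F" for e
  proof -
    have e: "e \<in> Edg Sk Vx" "\<not> e \<subseteq> frontier bx" using that F by auto
    have "e \<subseteq> l" using that l by blast
    have "vert e"
    proof (rule ccontr)
      assume "\<not> vert e"
      then obtain v w where "v \<in> e" "w \<in> e" "v \<noteq> w" "snd v = snd w"
        using Edg_vert_or[OF e(1)] unfolding vert_def by (auto simp: prod_eq_iff)
      moreover have "fst v = fst a" "fst w = fst a" using calculation(1,2) \<open>e \<subseteq> l\<close> unfolding l' by (auto simp: mem_Times_iff)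
      ultimately show False by (simp add: prod_eq_iff)
    qed
    then obtain i c d where vd: "vedge i c d" "e = vE i c d" using Edg_vert e by blast
    have r: "c < d" "d \<le> Q" "i \<le> P" using vd vertex_range by (auto simp: vedge_def)
    have "(x i, y c) \<in> l" using vE_nonempty[of c d i] r vd \<open>e \<subseteq> l\<close> by auto
    then have "x i = fst a" unfolding l' by auto
    moreover have "0 < i" "i < P" using e(2) vE_frontier[OF r] vd r by auto
    ultimately show ?thesis using vd r by blast
  qed
  have iu: "i = i'" if "x i = fst a" "x i' = fst a" "i < P" "i' < P" for i i'
    using that X.t_eq_iff[of i i'] by simp
  obtain e0 where "e0 \<in> F" using F by blast
  from FE[OF this] obtain i where i: "x i = fst a" "0 < i" "i < P" by blast
  have mm: "m \<le> m'" by (simp add: m_def m'_def)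
  then have "(fst a, m) \<in> \<Union>F" "(fst a, m') \<in> \<Union>F" using l(2) l' by auto
  then obtain e1 e2 where e1: "e1 \<in> F" "(fst a, m) \<in> e1" and e2: "e2 \<in> F" "(fst a, m') \<in> e2" by blast
  obtain c d1 where 1: "vedge i c d1" "e1 = vE i c d1" "d1 \<le> Q" using FE[OF e1(1)] iu i by blast
  obtain c2 d where 2: "vedge i c2 d" "e2 = vE i c2 d" "d \<le> Q" using FE[OF e2(1)] iu i by blast
  have cd: "c < d1" "c2 < d" using 1 2 by (auto simp: vedge_def)
  have "e1 \<subseteq> l" "e2 \<subseteq> l" using e1 e2 l by blast+
  then have "(x i, y c) \<in> l" "(x i, y d) \<in> l" "(x i, y d1) \<in> l" using vE_nonempty[of c d1 i] vE_nonempty[of c2 d i] 1 2 cd by auto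
  then have m: "y c = m" "y d = m'" "y d1 \<le> m'" using e1(2) e2(2) unfolding 1(2) 2(2) l' by (auto simp: vE_def)
  have lE: "l = vE i c d" using l' m i by (simp add: vE_def)
  have "c < d" using m Y.t_less[of c d1] cd 1(3) Y.t_less_iff[of c d] 2(3) by auto
  moreover have "vs i t" if t: "t \<in> {c..<d}" for t
  proof -
    have tQ: "t < Q" using t 2 by simp
    have "y c \<le> y t" "y (Suc t) \<le> y d" using t 2 Y.t_mono[of c t] Y.t_mono[of "Suc t" d] by auto
    then have "(x i, (y t + y (Suc t)) / 2) \<in> l" unfolding lE vE_def using mid_between[OF tQ] by auto
    then obtain e where e: "e \<in> F" "(x i, (y t + y (Suc t)) / 2) \<in> e" using l(2) by blast
    obtain c' d' where 3: "vedge i c' d'" "e = vE i c' d'" "d' \<le> Q" using FE[OF e(1)] iu i by blast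
    have "c' < d'" using 3 by (simp add: vedge_def)
    have "y c' < y (Suc t)" "y t < y d'" using e(2) mid_between[OF tQ] unfolding 3(2) vE_def by auto
    then have "c' \<le> t" "t < d'" using 3(3) tQ \<open>c' < d'\<close> Y.t_less_iff[of c' "Suc t"] Y.t_less_iff[of t d'] by auto
    then show ?thesis using 3(1) by (auto simp: vedge_def)
  qed
  ultimately have "vrun i c d" using 1(1) 2(1) i by (auto simp: vrun_def vedge_def)
  then show "\<exists>i c d. vrun i c d \<and> l = vE i c d" using lE by blast
next
  assume "\<exists>i c d. vrun i c d \<and> l = vE i c d"
  then obtain i c d where r: "vrun i c d" and l: "l = vE i c d" by blast
  have cd: "c < d" "0 < i" "i < P" "d \<le> Q" using r vrun_range by (auto simp: vrun_def)
  define F where "F = {vE i c' d' | c' d'. vedge i c' d' \<and> c \<le> c' \<and> d' \<le> d}"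
  have "F \<noteq> {}" using vedge_at[OF r order.refl cd(1)] unfolding F_def by blast
  moreover have "F \<subseteq> {e \<in> Edg Sk Vx. \<not> e \<subseteq> frontier bx}"
  proof
    fix e
    assume "e \<in> F"
    then obtain c' d' where e: "vedge i c' d'" "e = vE i c' d'" "d' \<le> d" unfolding F_def by blast
    then have "c' < d'" by (simp add: vedge_def)
    then show "e \<in> {e \<in> Edg Sk Vx. \<not> e \<subseteq> frontier bx}" using Edg_vert e vE_frontier[of c' d' i] cd by auto
  qed
  moreover have "vE i c d = \<Union>F"
  proof
    show "\<Union>F \<subseteq> vE i c d"
    proof
      fix p
      assume "p \<in> \<Union>F"
      then obtain c' d' where e: "vedge i c' d'" "p \<in> vE i c' d'" "c \<le> c'" "d' \<le> d" unfolding F_def by blast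
      then have "c' < d'" by (simp add: vedge_def)
      then show "p \<in> vE i c d" using vE_subset_iff[of c' d' c d i i] e cd by auto
    qed
    show "vE i c d \<subseteq> \<Union>F"
    proof
      fix p
      assume "p \<in> vE i c d"
      then obtain v where p: "p = (x i, v)" "v \<in> {y c..y d}" by (auto simp: vE_def)
      then obtain j where j: "j \<in> {c..<d}" "v \<in> {y j..y (Suc j)}" using Y.t_between[OF cd(1)] by blast
      have "c \<le> j" "j < d" using j by auto
      from vedge_at[OF r this] obtain c' d' where e: "vedge i c' d'" "c \<le> c'" "c' \<le> j" "j < d'" "d' \<le> d" by blast
      have "y c' \<le> y j" "y (Suc j) \<le> y d'" using e cd Y.t_mono[of c' j] Y.t_mono[of "Suc j" d'] by auto
      then have "p \<in> vE i c' d'" using j p by (auto simp: vE_def)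
      then show "p \<in> \<Union>F" using e unfolding F_def by blast
    qed
  qed
  ultimately have "IL (Edg Sk Vx) (frontier bx) l"
    unfolding IL_def l using vE_segment[of c d i] cd
    by (intro exI[of _ "(x i, y c)"] exI[of _ "(x i, y d)"] exI[of _ F]) auto
  then show "IL (Edg Sk Vx) (frontier bx) l \<and> vert l" using vE_vert cd l by simp
qed

lemma vline_extends:
  assumes "0 < i" "i < P" "c < d" "\<forall>j\<in>{c..<d}. vs i j"
  shows "\<exists>c' d'. vline i c' d' \<and> c' \<le> c \<and> d \<le> d'"
proof -
  define c' where "c' = (LEAST t. \<forall>j\<in>{t..<d}. vs i j)"
  define d' where "d' = (LEAST t. d \<le> t \<and> \<not> vs i t)"
  have c1: "\<forall>j\<in>{c'..<d}. vs i j" unfolding c'_def by (rule LeastI[of _ c]) (use assms in auto)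
  have c2: "c' \<le> c" unfolding c'_def by (rule Least_le) (use assms in auto)
  have c3: "\<not> (0 < c' \<and> vs i (c' - 1))"
  proof
    assume A: "0 < c' \<and> vs i (c' - 1)"
    have "\<forall>j\<in>{c' - 1..<d}. vs i j"
    proof
      fix j
      assume "j \<in> {c' - 1..<d}"
      then show "vs i j" using A c1 by (cases "j = c' - 1") auto
    qed
    then have "c' \<le> c' - 1" unfolding c'_def by (rule Least_le)
    then show False using conjunct1[OF A] by linarith
  qed
  have "\<not> vs i (max d Q)" using vs_range[of i "max d Q"] by auto
  then have ex: "d \<le> max d Q \<and> \<not> vs i (max d Q)" by simp
  have d1: "d \<le> d' \<and> \<not> vs i d'" unfolding d'_def by (rule LeastI[of _ "max d Q"]) (use ex in simp)
  have d2: "vs i t" if "d \<le> t" "t < d'" for t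
    using not_less_Least[of t "\<lambda>t. d \<le> t \<and> \<not> vs i t"] that unfolding d'_def by auto
  have "vline i c' d'"
    unfolding vline_def using assms c1 c2 c3 d1 d2 by (auto simp: not_less)
  then show ?thesis using c2 d1 by blast
qed

lemma LE_vert: "l \<in> LE (Edg Sk Vx) (frontier bx) \<and> vert l \<longleftrightarrow> (\<exists>i c d. vline i c d \<and> l = vE i c d)"
proof
  assume A: "l \<in> LE (Edg Sk Vx) (frontier bx) \<and> vert l"
  then have "IL (Edg Sk Vx) (frontier bx) l \<and> vert l" by (simp add: LE_def)
  then obtain i c d where r: "vrun i c d" "l = vE i c d" unfolding IL_vert by blast
  then obtain c' d' where v: "vline i c' d'" "c' \<le> c" "d \<le> d'" using vline_extends[of i c d] by (auto simp: vrun_def)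
  note r' = vline_vrun[OF v(1)]
  have "vE i c d \<subseteq> vE i c' d'"
    using vE_subset_iff[of c d c' d' i i] r v vrun_range[OF r'] vrun_range[OF r(1)] r' by (auto simp: vrun_def)
  moreover have "IL (Edg Sk Vx) (frontier bx) (vE i c' d')" using IL_vert[of "vE i c' d'"] r' by blast
  ultimately have "vE i c' d' = l" using A r by (simp add: LE_def)
  then show "\<exists>i c d. vline i c d \<and> l = vE i c d" using v by blast
next
  assume "\<exists>i c d. vline i c d \<and> l = vE i c d"
  then obtain i c d where v: "vline i c d" "l = vE i c d" by blast
  note r = vline_vrun[OF v(1)]
  have cd: "c < d" "d \<le> Q" "i \<le> P" using r vrun_range by (auto simp: vrun_def)
  have "l' = l" if l': "IL (Edg Sk Vx) (frontier bx) l'" "l \<subseteq> l'" for l'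
  proof -
    have "vert l" using vE_vert cd v by simp
    then have "vert l'" using l'(2) by (rule vert_mono)
    then have "IL (Edg Sk Vx) (frontier bx) l' \<and> vert l'" using l' by blast
    then obtain i' c' d' where r': "vrun i' c' d'" "l' = vE i' c' d'" unfolding IL_vert by blast
    have cd': "c' < d'" "d' \<le> Q" "i' \<le> P" using r' vrun_range by (auto simp: vrun_def)
    have s: "i = i'" "c' \<le> c" "d \<le> d'" using vE_subset_iff[OF cd(1,2) cd'(1,2) cd(3) cd'(3)] l'(2) v(2) r'(2) by auto
    have "c' = c"
    proof (rule ccontr)
      assume "c' \<noteq> c"
      then have "c' \<le> c - 1" "0 < c" "c - 1 < d'" using s cd by auto
      then show False using r'(1) v(1) s by (auto simp: vrun_def vline_def)
    qed
    moreover have "d' = d"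
    proof (rule ccontr)
      assume "d' \<noteq> d"
      then have "c' \<le> d" "d < d'" using s cd by auto
      then show False using r'(1) v(1) s by (auto simp: vrun_def vline_def)
    qed
    ultimately show ?thesis using s v r' by simp
  qed
  moreover have "IL (Edg Sk Vx) (frontier bx) l \<and> vert l" unfolding IL_vert using r v by blast
  ultimately show "l \<in> LE (Edg Sk Vx) (frontier bx) \<and> vert l" by (simp add: LE_def)
qed

text \<open>The lower end points identify the vertical l-edges, so that these can be counted as
  index pairs.\<close>

definition vstarts :: "(nat \<times> nat) set" where
  "vstarts = {(i, j). 0 < i \<and> i < P \<and> vs i j \<and> \<not> (0 < j \<and> vs i (j - 1))}"

lemma card_LE_vert: "card {l \<in> LE (Edg Sk Vx) (frontier bx). vert l} = card vstarts"
  and finite_LE_vert: "finite {l \<in> LE (Edg Sk Vx) (frontier bx). vert l}"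
proof -
  define f where "f = (\<lambda>(i, j). vE i j (LEAST d. j \<le> d \<and> \<not> vs i d))"
  have vl: "vline i c (LEAST d. c \<le> d \<and> \<not> vs i d)" if "(i, c) \<in> vstarts" for i c
  proof -
    have s: "0 < i" "i < P" "vs i c" "\<not> (0 < c \<and> vs i (c - 1))" using that by (auto simp: vstarts_def)
    have "\<forall>j\<in>{c..<Suc c}. vs i j" using s by simp
    then obtain c' d' where v: "vline i c' d'" "c' \<le> c" "Suc c \<le> d'" using vline_extends[OF s(1,2), of c "Suc c"] by auto
    have "c' = c"
    proof (rule ccontr)
      assume "c' \<noteq> c"
      then have "c - 1 \<in> {c'..<d'}" "0 < c" using v by auto
      then show False using v(1) s(4) unfolding vline_def by blast
    qed
    moreover have "(LEAST d. c \<le> d \<and> \<not> vs i d) = d'"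
      by (rule Least_equality) (use v \<open>c' = c\<close> in \<open>auto simp: vline_def not_less[symmetric]\<close>)
    ultimately show ?thesis using v by simp
  qed
  have "bij_betw f vstarts {l \<in> LE (Edg Sk Vx) (frontier bx). vert l}"
    unfolding bij_betw_def
  proof
    show "inj_on f vstarts"
    proof (rule inj_onI, clarify)
      fix i c i' c'
      assume a: "(i, c) \<in> vstarts" "(i', c') \<in> vstarts" and e: "f (i, c) = f (i', c')"
      note v = vline_vrun[OF vl[OF a(1)]] and v' = vline_vrun[OF vl[OF a(2)]]
      define d d' where "d = (LEAST d. c \<le> d \<and> \<not> vs i d)" and "d' = (LEAST d. c' \<le> d \<and> \<not> vs i' d)"
      have r: "c < d" "d \<le> Q" "c' < d'" "d' \<le> Q" "i \<le> P" "i' \<le> P"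
        using vrun_range[OF v[folded d_def]] vrun_range[OF v'[folded d'_def]] v[folded d_def] v'[folded d'_def]
        by (simp_all add: vrun_def)
      have "vE i c d = vE i' c' d'" using e by (simp add: f_def d_def d'_def)
      then have "vE i c d \<subseteq> vE i' c' d'" "vE i' c' d' \<subseteq> vE i c d" by auto
      then show "i = i' \<and> c = c'"
        using vE_subset_iff[OF r] vE_subset_iff[OF r(3,4,1,2,6,5)] by auto
    qed
    show "f ` vstarts = {l \<in> LE (Edg Sk Vx) (frontier bx). vert l}"
    proof
      show "f ` vstarts \<subseteq> {l \<in> LE (Edg Sk Vx) (frontier bx). vert l}"
      proof
        fix l
        assume "l \<in> f ` vstarts"
        then obtain i c where "(i, c) \<in> vstarts" "l = f (i, c)" by auto
        then have "vline i c (LEAST d. c \<le> d \<and> \<not> vs i d)" "l = vE i c (LEAST d. c \<le> d \<and> \<not> vs i d)"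
          using vl by (simp_all add: f_def)
        then have "\<exists>i c d. vline i c d \<and> l = vE i c d" by blast
        then show "l \<in> {l \<in> LE (Edg Sk Vx) (frontier bx). vert l}" unfolding LE_vert[symmetric] by simp
      qed
      show "{l \<in> LE (Edg Sk Vx) (frontier bx). vert l} \<subseteq> f ` vstarts"
      proof
        fix l
        assume "l \<in> {l \<in> LE (Edg Sk Vx) (frontier bx). vert l}"
        then have "l \<in> LE (Edg Sk Vx) (frontier bx) \<and> vert l" by simp
        then obtain i c d where v: "vline i c d" "l = vE i c d" unfolding LE_vert by blast
        have "(LEAST d. c \<le> d \<and> \<not> vs i d) = d"
          by (rule Least_equality) (use v in \<open>auto simp: vline_def not_less[symmetric]\<close>)
        then have "l = f (i, c)" using v by (simp add: f_def)
        moreover have "(i, c) \<in> vstarts" using v by (auto simp: vline_def vstarts_def)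
        ultimately show "l \<in> f ` vstarts" by blast
      qed
    qed
  qed
  moreover have "finite vstarts"
    by (rule finite_subset[of _ "{..P} \<times> {..<Q}"]) (use vs_range in \<open>auto simp: vstarts_def\<close>)
  ultimately show "card {l \<in> LE (Edg Sk Vx) (frontier bx). vert l} = card vstarts"
    "finite {l \<in> LE (Edg Sk Vx) (frontier bx). vert l}"
    by (simp_all add: bij_betw_same_card bij_betw_finite)
qed

lemma LE_vert_or: "l \<in> LE (Edg S V) B \<Longrightarrow> vert l \<noteq> vert (swap_image l)"
proof -
  assume "l \<in> LE (Edg S V) B"
  then obtain a b F where F: "F \<noteq> {}" "F \<subseteq> {e \<in> Edg S V. \<not> e \<subseteq> B}" "l = closed_segment a b" "l = \<Union>F"
    unfolding LE_def IL_def by blast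
  then obtain e where "e \<in> Edg S V" "e \<subseteq> l" by blast
  then have or: "vert l \<or> vert (swap_image l)"
    using Edg_vert_or[of e] vert_mono[of e l] vert_mono[of "swap_image e" "swap_image l"] swap_image_subset_iff by blast
  have "\<not> (vert l \<and> vert (swap_image l))"
  proof
    assume b: "vert l \<and> vert (swap_image l)"
    have "fst a = fst b" using b vert_segment unfolding F(3) by blast
    moreover have "snd a = snd b" using b vert_swap_segment unfolding F(3) by blast
    ultimately have "a = b" by (auto simp: prod_eq_iff)
    then show False using b F(3) by (auto simp: vert_def)
  qed
  then show ?thesis using or by blast
qed

lemma frontier_swap: "frontier (swap_image bx) = swap_image (frontier bx)"
proof -
  interpret S: grid y x Q P "\<lambda>j i. hs i j" "\<lambda>j i. vs i j" by (rule grid_swp)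
  show ?thesis unfolding swp_sets(4)[symmetric] S.frontier_bx frontier_bx by force
qed

lemma card_LE: "card (LE (Edg Sk Vx) (frontier bx)) = card vstarts + card (grid.vstarts Q (\<lambda>j i. hs i j))"
proof -
  interpret S: grid y x Q P "\<lambda>j i. hs i j" "\<lambda>j i. vs i j" by (rule grid_swp)
  let ?LE = "LE (Edg Sk Vx) (frontier bx)"
  have SLE: "LE (Edg S.Sk S.Vx) (frontier S.bx) = swap_image ` ?LE"
    unfolding swp_sets Edg_swap frontier_swap by (rule LE_swap)
  have "{l \<in> swap_image ` ?LE. vert l} = swap_image ` {l \<in> ?LE. \<not> vert l}"
    using LE_vert_or by auto
  then have c: "card {l \<in> ?LE. \<not> vert l} = card S.vstarts" and f': "finite {l \<in> ?LE. \<not> vert l}"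
    using S.card_LE_vert S.finite_LE_vert unfolding SLE by simp_all
  have U: "?LE = {l \<in> ?LE. vert l} \<union> {l \<in> ?LE. \<not> vert l}" by blast
  have "card ?LE = card {l \<in> ?LE. vert l} + card {l \<in> ?LE. \<not> vert l}"
    by (subst U, rule card_Un_disjoint[OF finite_LE_vert f']) blast
  then show ?thesis using card_LE_vert c by simp
qed

text \<open>An edge has no vertex inside, so at most one edge leaves a vertex upwards and one
  downwards. If the adjacent unit segment is present, such an edge exists, because by
  \<open>v_end\<close> a line cannot stop before it reaches another vertex.\<close>

lemma card_vert_edges_at:
  assumes v: "vertex i j"
  shows "card {e \<in> Edg Sk Vx. vert e \<and> (x i, y j) \<in> e} = of_bool (vs i j) + of_bool (0 < j \<and> vs i (j - 1))"
    and "finite {e \<in> Edg Sk Vx. vert e \<and> (x i, y j) \<in> e}"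
proof -
  have ij: "i \<le> P" "j \<le> Q" using vertex_range[OF v] by auto
  have eq: "{e \<in> Edg Sk Vx. vert e \<and> (x i, y j) \<in> e} = {vE i j d | d. vedge i j d} \<union> {vE i c j | c. vedge i c j}"
  proof (intro equalityI subsetI)
    fix e
    assume "e \<in> {e \<in> Edg Sk Vx. vert e \<and> (x i, y j) \<in> e}"
    then obtain i' c d where e: "vedge i' c d" "e = vE i' c d" "(x i, y j) \<in> vE i' c d" using Edg_vert by blast
    then have r: "i' \<le> P" "c \<le> Q" "d \<le> Q" using vertex_range by (auto simp: vedge_def)
    have "i' = i" "c \<le> j" "j \<le> d" using e(3) r ij by (auto simp: vE_def X.t_eq_iff Y.t_le_iff)
    moreover have "j = c \<or> j = d" using e(1) v calculation by (auto simp: vedge_def le_less)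
    ultimately show "e \<in> {vE i j d | d. vedge i j d} \<union> {vE i c j | c. vedge i c j}" using e by blast
  next
    fix e
    assume "e \<in> {vE i j d | d. vedge i j d} \<union> {vE i c j | c. vedge i c j}"
    then show "e \<in> {e \<in> Edg Sk Vx. vert e \<and> (x i, y j) \<in> e}"
    proof
      assume "e \<in> {vE i j d | d. vedge i j d}"
      then obtain d where d: "vedge i j d" "e = vE i j d" by blast
      then have "j < d" "d \<le> Q" using vertex_range by (auto simp: vedge_def)
      then show ?thesis using Edg_vert d vE_nonempty[of j d i] by auto
    next
      assume "e \<in> {vE i c j | c. vedge i c j}"
      then obtain c where d: "vedge i c j" "e = vE i c j" by blast
      then have "c < j" by (auto simp: vedge_def)
      then show ?thesis using Edg_vert d vE_nonempty[of c j i] ij by auto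
    qed
  qed
  have nxt: "\<exists>d. vedge i t d" if t: "vertex i t" "vs i t" for t
  proof -
    obtain d where d: "t < d" "vertex i d" "\<forall>s. t < s \<and> s < d \<longrightarrow> \<not> vertex i s"
    proof -
      have "\<exists>d>t. vertex i d"
      proof (rule ccontr)
        assume no: "\<not> (\<exists>d>t. vertex i d)"
        have "vs i (t + q)" for q
        proof (induction q)
          case (Suc q)
          have "\<not> vertex i (t + Suc q)" using no by auto
          then show ?case using Suc v_end[of i "t + Suc q"] by (auto simp: vertex_def)
        qed (use t in simp)
        from this[of Q] show False using vs_range by fastforce
      qed
      define d where "d = (LEAST d. t < d \<and> vertex i d)"
      have "t < d \<and> vertex i d" unfolding d_def by (rule LeastI_ex) (use \<open>\<exists>d>t. vertex i d\<close> in blast)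
      moreover have "\<not> vertex i s" if "t < s" "s < d" for s
        using not_less_Least[of s "\<lambda>d. t < d \<and> vertex i d"] that unfolding d_def by blast
      ultimately show ?thesis using that by blast
    qed
    have "vs i (t + q)" if "t + q < d" for q
      using that
    proof (induction q)
      case (Suc q)
      have "\<not> vertex i (t + Suc q)" using d(3) Suc.prems by auto
      then show ?case using Suc v_end[of i "t + Suc q"] by (auto simp: vertex_def)
    qed (use t in simp)
    then have "vs i s" if "s \<in> {t..<d}" for s using that le_Suc_ex[of t s] by auto
    then show ?thesis using d t unfolding vedge_def by blast
  qed
  have prv: "\<exists>c. vedge i c t" if t: "vertex i t" "0 < t" "vs i (t - 1)" for t
  proof -
    have ex: "\<exists>c<t. vertex i c"
    proof (rule ccontr)
      assume no: "\<not> (\<exists>c<t. vertex i c)"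
      have "vs i (t - Suc q)" if "q < t" for q
        using that
      proof (induction q)
        case (Suc q)
        have "\<not> vertex i (t - Suc q)" using no Suc by auto
        then have "vs i (t - Suc q - 1)" "0 < t - Suc q" using Suc v_end[of i "t - Suc q"] by (auto simp: vertex_def)
        then show ?case by simp
      qed (use t in simp)
      from this[of "t - 1"] have "vs i 0" using t by simp
      then have "vertex i 0" using v_end[of i 0] by (auto simp: vertex_def)
      then show False using no t by blast
    qed
    define c where "c = Max {c. c < t \<and> vertex i c}"
    have fin: "finite {c. c < t \<and> vertex i c}" by (rule finite_subset[of _ "{..<t}"]) auto
    have c: "c < t" "vertex i c" using Max_in[OF fin] ex unfolding c_def by auto
    have c': "\<not> vertex i s" if "c < s" "s < t" for s
    proof
      assume "vertex i s"
      then have "s \<le> c" unfolding c_def using that by (intro Max_ge fin) auto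
      then show False using that by simp
    qed
    have run: "vs i (t - Suc q)" if "q < t - c" for q
      using that
    proof (induction q)
      case (Suc q)
      then have "\<not> vertex i (t - Suc q)" using c' by auto
      then have "vs i (t - Suc q - 1)" using Suc v_end[of i "t - Suc q"] by (auto simp: vertex_def)
      then show ?case by simp
    qed (use t in simp)
    have "vs i s" if "s \<in> {c..<t}" for s
    proof -
      have "s = t - Suc (t - Suc s)" "t - Suc s < t - c" using that by auto
      then show ?thesis using run[of "t - Suc s"] by simp
    qed
    then show ?thesis using c c' t unfolding vedge_def by blast
  qed
  have one: "finite {g d | d. R d} \<and> card {g d | d. R d} = of_bool A"
    if ex: "A \<Longrightarrow> \<exists>d. R d" and im: "\<And>d. R d \<Longrightarrow> A" and un: "\<And>d d'. R d \<Longrightarrow> R d' \<Longrightarrow> d = d'"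
    for g :: "nat \<Rightarrow> point set" and R A
  proof (cases A)
    case True
    then obtain d where d: "R d" using ex by blast
    then have "{g d | d. R d} = {g d}" using un by blast
    then show ?thesis using True by simp
  next
    case False
    then have "{g d | d. R d} = {}" using im by blast
    then show ?thesis using False by simp
  qed
  have U: "finite {vE i j d | d. vedge i j d} \<and> card {vE i j d | d. vedge i j d} = of_bool (vs i j)"
  proof (rule one)
    show "vs i j \<Longrightarrow> \<exists>d. vedge i j d" using nxt[OF v] .
    show "d = d'" if "vedge i j d" "vedge i j d'" for d d'
      using that unfolding vedge_def by (cases d d' rule: linorder_cases) auto
  qed (auto simp: vedge_def)
  have W: "finite {vE i c j | c. vedge i c j} \<and> card {vE i c j | c. vedge i c j} = of_bool (0 < j \<and> vs i (j - 1))"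
  proof (rule one)
    show "0 < j \<and> vs i (j - 1) \<Longrightarrow> \<exists>c. vedge i c j" using prv[OF v] by blast
    show "d = d'" if "vedge i d j" "vedge i d' j" for d d'
      using that unfolding vedge_def by (cases d d' rule: linorder_cases) auto
  qed (auto simp: vedge_def)
  have disj: "{vE i j d | d. vedge i j d} \<inter> {vE i c j | c. vedge i c j} = {}"
  proof -
    have "vE i j d \<noteq> vE i c j" if "vedge i j d" "vedge i c j" for c d
    proof
      assume "vE i j d = vE i c j"
      then have "vE i j d \<subseteq> vE i c j" by simp
      moreover have "j < d" "c < j" "d \<le> Q" using that vertex_range by (auto simp: vedge_def)
      ultimately show False using vE_subset_iff[of j d c j i i] ij by simp
    qed
    then show ?thesis by blast
  qed
  have fin: "finite {vE i j d | d. vedge i j d}" "finite {vE i c j | c. vedge i c j}" using U W by auto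
  show "finite {e \<in> Edg Sk Vx. vert e \<and> (x i, y j) \<in> e}" unfolding eq using fin by simp
  have "card {e \<in> Edg Sk Vx. vert e \<and> (x i, y j) \<in> e} = card {vE i j d | d. vedge i j d} + card {vE i c j | c. vedge i c j}"
    unfolding eq by (rule card_Un_disjoint[OF fin disj])
  then show "card {e \<in> Edg Sk Vx. vert e \<and> (x i, y j) \<in> e} = of_bool (vs i j) + of_bool (0 < j \<and> vs i (j - 1))"
    using U W by simp
qed

lemma card_edges_at:
  assumes v: "vertex i j"
  shows "card {e \<in> Edg Sk Vx. (x i, y j) \<in> e} = of_bool (vs i j) + of_bool (0 < j \<and> vs i (j - 1))
    + of_bool (hs i j) + of_bool (0 < i \<and> hs (i - 1) j)"
proof -
  interpret S: grid y x Q P "\<lambda>j i. hs i j" "\<lambda>j i. vs i j" by (rule grid_swp)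
  have v': "S.vertex j i" using v swp_sets(1) by simp
  have "{e \<in> Edg S.Sk S.Vx. vert e \<and> (y j, x i) \<in> e} = swap_image ` {e \<in> Edg Sk Vx. \<not> vert e \<and> (x i, y j) \<in> e}"
    unfolding swp_sets Edg_swap using Edg_vert_or Edg_not_both by force
  then have c: "card {e \<in> Edg Sk Vx. \<not> vert e \<and> (x i, y j) \<in> e} = of_bool (hs i j) + of_bool (0 < i \<and> hs (i - 1) j)"
    and f': "finite {e \<in> Edg Sk Vx. \<not> vert e \<and> (x i, y j) \<in> e}"
    using S.card_vert_edges_at[OF v'] by simp_all
  have U: "{e \<in> Edg Sk Vx. (x i, y j) \<in> e} = {e \<in> Edg Sk Vx. vert e \<and> (x i, y j) \<in> e} \<union> {e \<in> Edg Sk Vx. \<not> vert e \<and> (x i, y j) \<in> e}" by blast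
  have "card {e \<in> Edg Sk Vx. (x i, y j) \<in> e} = card {e \<in> Edg Sk Vx. vert e \<and> (x i, y j) \<in> e}
      + card {e \<in> Edg Sk Vx. \<not> vert e \<and> (x i, y j) \<in> e}"
    by (subst U, rule card_Un_disjoint[OF card_vert_edges_at(2)[OF v] f']) blast
  then show ?thesis using card_vert_edges_at(1)[OF v] c by simp
qed

end

section \<open>Hierarchical meshes in index coordinates\<close>

text \<open>Repeated bisection of the knots in a single formula: \<open>a div 2\<close> and
  \<open>(a + 1) div 2\<close> coincide for even \<open>a\<close>, an old knot, and are neighbours
  for odd \<open>a\<close>, a new midpoint.\<close>

fun dy :: "(nat \<Rightarrow> real) \<Rightarrow> nat \<Rightarrow> nat \<Rightarrow> real" where
  "dy x 0 a = x a"
| "dy x (Suc k) a = (dy x k (a div 2) + dy x k ((a + 1) div 2)) / 2"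

lemma dy_even: "dy x (Suc k) (2 * a) = dy x k a"
  by simp

lemma dy_odd: "dy x (Suc k) (2 * a + 1) = (dy x k a + dy x k (a + 1)) / 2"
proof -
  have "(2 * a + 1 + 1) div 2 = a + 1" by simp
  then show ?thesis by simp
qed

declare dy.simps(2) [simp del]

lemma dy_pow: "dy x (k + m) (a * 2 ^ m) = dy x k a"
proof (induction m)
  case (Suc m)
  have e: "a * 2 ^ Suc m = 2 * (a * 2 ^ m)" by simp
  have "dy x (k + Suc m) (a * 2 ^ Suc m) = dy x (Suc (k + m)) (2 * (a * 2 ^ m))" by (simp only: add_Suc_right e)
  also have "\<dots> = dy x k a" using Suc by (simp only: dy_even)
  finally show ?case .
qed simp

lemma dy_fine: "k \<le> n \<Longrightarrow> dy x n (a * 2 ^ (n - k)) = dy x k a"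
  using dy_pow[of x k "n - k" a] by simp

lemma dy_mid: "k < n \<Longrightarrow> dy x n (mid n k a) = (dy x k a + dy x k (a + 1)) / 2"
  using dy_fine[of "Suc k" n x "2 * a + 1"] dy_odd[of x k a] by (simp add: mid_def)

lemma dy_knots: "knots x N \<Longrightarrow> knots (dy x k) (N * 2 ^ k)"
proof (induction k)
  case 0
  then have "dy x 0 = x" by (auto simp: fun_eq_iff)
  then show ?case using 0 by simp
next
  case (Suc k)
  interpret knots "dy x k" "N * 2 ^ k" by (rule Suc.IH[OF Suc.prems])
  show ?case
  proof
    show "0 < N * 2 ^ Suc k" using P by simp
    fix p
    assume p: "p < N * 2 ^ Suc k"
    show "dy x (Suc k) p < dy x (Suc k) (Suc p)"
    proof (cases "even p")
      case True
      then obtain q where q: "p = 2 * q" by blast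
      then have "dy x k q < dy x k (Suc q)" using t_Suc[of q] p by simp
      then show ?thesis using dy_odd[of x k q] dy_even[of x k q] by (simp add: q)
    next
      case False
      then obtain q where q: "p = 2 * q + 1" by (elim oddE)
      then have "dy x k q < dy x k (Suc q)" using t_Suc[of q] p by simp
      moreover have "Suc p = 2 * (q + 1)" using q by simp
      ultimately show ?thesis using dy_odd[of x k q] dy_even[of x k "q + 1"] by (simp only: q) simp
    qed
  qed
qed

definition cellof :: "(nat \<Rightarrow> real) \<Rightarrow> (nat \<Rightarrow> real) \<Rightarrow> nat \<Rightarrow> nat \<Rightarrow> nat \<Rightarrow> cell" where
  "cellof xs ys k a b = ((dy xs k a, dy ys k b), (dy xs k (a + 1), dy ys k (b + 1)))"

definition meshof :: "nat \<Rightarrow> nat \<Rightarrow> (nat \<Rightarrow> (nat \<times> nat) set) \<Rightarrow> (nat \<Rightarrow> real) \<Rightarrow> (nat \<Rightarrow> real) \<Rightarrow> nat \<Rightarrow> cell set" where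
  "meshof N M D xs ys k = {cellof xs ys j a b | j a b. j \<le> k \<and> (a, b) \<in> lcells N M D j \<and> (j < k \<longrightarrow> (a, b) \<notin> D j)}"

text \<open>\<open>vseg N M D k i j\<close>: the vertical segment from \<open>(i, j)\<close> to \<open>(i, j + 1)\<close> in the grid of level \<open>k\<close>
  lies on the skeleton of the mesh of level \<open>k\<close>.\<close>

fun vseg :: "nat \<Rightarrow> nat \<Rightarrow> (nat \<Rightarrow> (nat \<times> nat) set) \<Rightarrow> nat \<Rightarrow> nat \<Rightarrow> nat \<Rightarrow> bool" where
  "vseg N M D 0 i j = (i \<le> N \<and> j < M)"
| "vseg N M D (Suc k) i j = (if even i then vseg N M D k (i div 2) (j div 2) else (i div 2, j div 2) \<in> D k)"

lemma vseg_even: "vseg N M D (Suc k) (2 * i) j = vseg N M D k i (j div 2)"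
  and vseg_odd: "vseg N M D (Suc k) (2 * i + 1) j \<longleftrightarrow> (i, j div 2) \<in> D k"
  by simp_all

declare vseg.simps(2) [simp del]

lemma parity_div: "(2 * j + 1) div 2 = (j::nat)" "(2 * j - 1) div 2 = j - (1::nat)" "(2 * j + 1 - 1) div 2 = (j::nat)"
  by (cases j; simp)+

context dyadic
begin

abbreviation "vs k \<equiv> vseg N M D k"
abbreviation "hs k \<equiv> (\<lambda>i j. vseg M N (swp D) k j i)"

lemma vs_range: "vs k i j \<Longrightarrow> i \<le> N * 2 ^ k \<and> j < M * 2 ^ k"
proof (induction k arbitrary: i j)
  case (Suc k)
  show ?case
  proof (cases "even i")
    case True
    then obtain i' where "i = 2 * i'" by blast
    then have "vs k i' (j div 2)" using Suc.prems by (simp add: vseg_even)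
    from Suc.IH[OF this] show ?thesis using \<open>i = 2 * i'\<close> by auto
  next
    case False
    then obtain i' where "i = 2 * i' + 1" by (elim oddE)
    then have "(i', j div 2) \<in> D k" using Suc.prems vseg_odd by blast
    from D_range[OF this] show ?thesis using \<open>i = 2 * i' + 1\<close> by auto
  qed
qed simp

lemma vs_sides: "(a, b) \<in> L k \<Longrightarrow> vs k a b \<and> vs k (a + 1) b"
proof (induction k arbitrary: a b)
  case (Suc k)
  then have D': "(a div 2, b div 2) \<in> D k" by simp
  then have IH: "vs k (a div 2) (b div 2)" "vs k (a div 2 + 1) (b div 2)" using Suc.IH D_L by blast+
  show ?case
  proof (cases "even a")
    case True
    then obtain a' where a: "a = 2 * a'" by blast
    then show ?thesis using IH(1) D' vseg_even vseg_odd by auto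
  next
    case False
    then obtain a' where a: "a = 2 * a' + 1" by (elim oddE)
    have "a + 1 = 2 * (a' + 1)" using a by simp
    then have "vs (Suc k) (a + 1) b" using IH(2) a vseg_even[of N M D k "a' + 1" b] by simp
    moreover have "vs (Suc k) a b" using D' a vseg_odd by simp
    ultimately show ?thesis by blast
  qed
qed simp

lemma swp_L: "(b, a) \<in> lcells M N (swp D) k \<longleftrightarrow> (a, b) \<in> L k"
  by (cases k) auto

lemma hs_sides: "(a, b) \<in> L k \<Longrightarrow> hs k a b \<and> hs k a (b + 1)"
proof -
  interpret S: dyadic M N n "swp D" by (rule dyadic_swp)
  show "(a, b) \<in> L k \<Longrightarrow> hs k a b \<and> hs k a (b + 1)" using S.vs_sides[of b a k] swp_L by simp
qed

text \<open>At an even abscissa the induction hypothesis applies. New vertical lines, at odd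
  abscissae, begin and stop on the lower and upper sides of divided cells, which are present as
  horizontal segments.\<close>

lemma vs_end: "vs k i j \<noteq> (0 < j \<and> vs k i (j - 1)) \<Longrightarrow> hs k i j \<or> (0 < i \<and> hs k (i - 1) j)"
proof (induction k arbitrary: i j)
  case 0
  then have "i \<le> N" "j \<le> M" by auto
  then show ?case using N by (cases "i = N") auto
next
  case (Suc k)
  \<comment> \<open>The two unit segments that meet at an odd ordinate come from the same unit of
    the coarser level, so both are present or neither is.\<close>
  have "even j"
  proof (rule ccontr)
    assume "odd j"
    then obtain j' where j: "j = 2 * j' + 1" by (elim oddE)
    have "vs (Suc k) i j = vs (Suc k) i (j - 1)" unfolding vseg.simps j parity_div by simp
    then show False using Suc.prems j by simp
  qed
  then obtain j' where j: "j = 2 * j'" by blast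
  have hj: "hs (Suc k) i j = hs k (i div 2) j'" for i using j by (simp add: vseg_even)
  show ?case
  proof (cases "even i")
    case True
    then obtain i' where i: "i = 2 * i'" by blast
    have "vs k i' j' \<noteq> (0 < j' \<and> vs k i' (j' - 1))"
      using Suc.prems by (simp add: i j vseg_even parity_div del: One_nat_def)
    from Suc.IH[OF this] show ?thesis by (simp add: hj i parity_div del: One_nat_def)
  next
    case False
    then obtain i' where i: "i = 2 * i' + 1" by (elim oddE)
    have "((i', j') \<in> D k) \<noteq> (0 < j' \<and> (i', j' - 1) \<in> D k)"
      using Suc.prems unfolding i j vseg_odd by (simp add: parity_div del: One_nat_def)
    then have "hs k i' j'" using hs_sides[of i' j' k] hs_sides[of i' "j' - 1" k] D_L[of k] by auto
    then show ?thesis by (simp add: hj i)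
  qed
qed

definition vtx :: "nat \<Rightarrow> nat \<Rightarrow> nat \<Rightarrow> bool" where
  "vtx k i j \<longleftrightarrow> (vs k i j \<or> (0 < j \<and> vs k i (j - 1))) \<and> (hs k i j \<or> (0 < i \<and> hs k (i - 1) j))"

text \<open>Vertices with two even indices are old. A divided cell adds its centre, with two odd
  indices, and the midpoints of its sides, which it may share with the neighbour across the
  side.\<close>

lemma vtx_rec:
  shows "vtx (Suc k) (2 * i) (2 * j) = vtx k i j"
    and "vtx (Suc k) (2 * i + 1) (2 * j + 1) \<longleftrightarrow> (i, j) \<in> D k"
    and "vtx (Suc k) (2 * i + 1) (2 * j) \<longleftrightarrow> (i, j) \<in> D k \<or> (0 < j \<and> (i, j - 1) \<in> D k)"
    and "vtx (Suc k) (2 * i) (2 * j + 1) \<longleftrightarrow> (i, j) \<in> D k \<or> (0 < i \<and> (i - 1, j) \<in> D k)"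
proof -
  note v = vtx_def
  show "vtx (Suc k) (2 * i) (2 * j) = vtx k i j"
    unfolding v by (simp add: vseg_even parity_div del: One_nat_def)
  show "vtx (Suc k) (2 * i + 1) (2 * j + 1) \<longleftrightarrow> (i, j) \<in> D k"
    unfolding v vseg_odd parity_div by simp
  show "vtx (Suc k) (2 * i + 1) (2 * j) \<longleftrightarrow> (i, j) \<in> D k \<or> (0 < j \<and> (i, j - 1) \<in> D k)"
    unfolding v vseg_odd vseg_even parity_div
    using hs_sides[of i j k] hs_sides[of i "j - 1" k] D_L[of k] by auto
  show "vtx (Suc k) (2 * i) (2 * j + 1) \<longleftrightarrow> (i, j) \<in> D k \<or> (0 < i \<and> (i - 1, j) \<in> D k)"
    unfolding v vseg_odd vseg_even parity_div
    using vs_sides[of i j k] vs_sides[of "i - 1" j k] D_L[of k] by auto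
qed

end

section \<open>From cells to unit segments at every level\<close>

lemma quarters_union:
  assumes "a < b" "c < d"
  shows "(\<Union>q\<in>quarters ((a, c), (b, d)). frontier (region q)) = frontier (region ((a, c), (b, d))) \<union>
      {(u, v). (u = (a + b) / 2 \<and> v \<in> {c..d}) \<or> (v = (c + d) / 2 \<and> u \<in> {a..b})}"
    and "(\<Union>q\<in>quarters ((a, c), (b, d)). corners q) = corners ((a, c), (b, d)) \<union>
      {((a + b) / 2, (c + d) / 2), ((a + b) / 2, c), ((a + b) / 2, d), (a, (c + d) / 2), (b, (c + d) / 2)}"
    and "(\<Union>q\<in>quarters ((a, c), (b, d)). region q) = region ((a, c), (b, d))"
proof -
  have r: "region ((p, r), (q, s)) = {p..q} \<times> {r..s}" for p q r s by (simp add: region_def cbox_Pair_eq)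
  define m k where "m = (a + b) / 2" and "k = (c + d) / 2"
  have mk: "a < m" "m < b" "c < k" "k < d" using assms by (auto simp: m_def k_def)
  have Q: "quarters ((a, c), (b, d)) = {((a, c), (m, k)), ((m, c), (b, k)), ((a, k), (m, d)), ((m, k), (b, d))}"
    by (simp add: m_def k_def Let_def)
  show "(\<Union>q\<in>quarters ((a, c), (b, d)). frontier (region q)) = frontier (region ((a, c), (b, d))) \<union>
      {(u, v). (u = (a + b) / 2 \<and> v \<in> {c..d}) \<or> (v = (c + d) / 2 \<and> u \<in> {a..b})}"
  proof (intro set_eqI)
    fix p :: point
    obtain u v where p: "p = (u, v)" by (rule prod.exhaust)
    have F: "(u, v) \<in> frontier (region ((p, r), (q, s))) \<longleftrightarrow> (u = p \<or> u = q) \<and> v \<in> {r..s} \<or> (v = r \<or> v = s) \<and> u \<in> {p..q}"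
      if "p < q" "r < s" for p q r s using frontier_rect[OF that] by (simp add: r)
    have I: "u \<in> {a..b} \<longleftrightarrow> u \<in> {a..m} \<or> u \<in> {m..b}" "v \<in> {c..d} \<longleftrightarrow> v \<in> {c..k} \<or> v \<in> {k..d}" using mk by auto
    have bool: "((A \<or> E) \<and> V \<or> (C \<or> K) \<and> U) \<or> ((E \<or> B) \<and> V \<or> (C \<or> K) \<and> U') \<or> ((A \<or> E) \<and> V' \<or> (K \<or> G) \<and> U) \<or>
        ((E \<or> B) \<and> V' \<or> (K \<or> G) \<and> U') \<longleftrightarrow>
        ((A \<or> B) \<and> (V \<or> V') \<or> (C \<or> G) \<and> (U \<or> U')) \<or> (E \<and> (V \<or> V') \<or> K \<and> (U \<or> U'))" for A B C E G K U U' V V' :: bool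
      by blast
    show "p \<in> (\<Union>q\<in>quarters ((a, c), (b, d)). frontier (region q)) \<longleftrightarrow> p \<in> frontier (region ((a, c), (b, d))) \<union>
      {(u, v). (u = (a + b) / 2 \<and> v \<in> {c..d}) \<or> (v = (c + d) / 2 \<and> u \<in> {a..b})}"
      unfolding Q m_def[symmetric] k_def[symmetric] p UN_insert UN_empty Un_empty_right Un_iff mem_Collect_eq prod.case
        F[OF mk(1,3)] F[OF mk(2,3)] F[OF mk(1,4)] F[OF mk(2,4)] F[OF assms] I by (rule bool)
  qed
  show "(\<Union>q\<in>quarters ((a, c), (b, d)). corners q) = corners ((a, c), (b, d)) \<union>
      {((a + b) / 2, (c + d) / 2), ((a + b) / 2, c), ((a + b) / 2, d), (a, (c + d) / 2), (b, (c + d) / 2)}"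
    unfolding Q m_def[symmetric] k_def[symmetric] by auto
  show "(\<Union>q\<in>quarters ((a, c), (b, d)). region q) = region ((a, c), (b, d))"
  proof (intro set_eqI)
    fix p :: point
    obtain u v where p: "p = (u, v)" by (rule prod.exhaust)
    show "p \<in> (\<Union>q\<in>quarters ((a, c), (b, d)). region q) \<longleftrightarrow> p \<in> region ((a, c), (b, d))"
    proof -
      have "u \<in> {a..b} \<longleftrightarrow> u \<in> {a..m} \<or> u \<in> {m..b}" "v \<in> {c..d} \<longleftrightarrow> v \<in> {c..k} \<or> v \<in> {k..d}" using mk by auto
      then show ?thesis unfolding Q p UN_insert UN_empty Un_empty_right Un_iff r mem_Times_iff fst_conv snd_conv by blast
    qed
  qed
qed

lemma region_cellof: "region (cellof xs ys k a b) = {dy xs k a..dy xs k (a + 1)} \<times> {dy ys k b..dy ys k (b + 1)}"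
  by (simp add: region_def cellof_def cbox_Pair_eq)

lemma quarters_cellof: "quarters (cellof xs ys k a b) = {cellof xs ys (Suc k) (2 * a) (2 * b), cellof xs ys (Suc k) (2 * a + 1) (2 * b),
    cellof xs ys (Suc k) (2 * a) (2 * b + 1), cellof xs ys (Suc k) (2 * a + 1) (2 * b + 1)}"
proof -
  have e: "dy x (Suc k) (2 * a + 1 + 1) = dy x k (a + 1)" for x a
    using dy_even[of x k "a + 1"] by simp
  show ?thesis unfolding cellof_def e dy_even dy_odd by (simp add: Let_def)
qed

locale hmesh = dyadic N M n D + GX: knots xs N + GY: knots ys M
  for N M n :: nat and D :: "nat \<Rightarrow> (nat \<times> nat) set" and xs ys :: "nat \<Rightarrow> real"
begin

lemma hmesh_swp: "hmesh M N n (swp D) ys xs"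
proof -
  interpret S: dyadic M N n "swp D" by (rule dyadic_swp)
  show ?thesis ..
qed

lemma knots_x: "knots (dy xs k) (N * 2 ^ k)" and knots_y: "knots (dy ys k) (M * 2 ^ k)"
  by (rule dy_knots[OF GX.knots_axioms], rule dy_knots[OF GY.knots_axioms])

sublocale dm: dmesh N M n D "dy xs n" "dy ys n"
proof -
  interpret X: knots "dy xs n" "N * 2 ^ n" by (rule knots_x)
  interpret Y: knots "dy ys n" "M * 2 ^ n" by (rule knots_y)
  show "dmesh N M n D (dy xs n) (dy ys n)"
    by unfold_locales (auto simp: dy_mid dy_fine[of _ n] simp del: mult_Suc add_mult_distrib dest!: less_imp_le)
qed

lemma grid_level: "grid (dy xs k) (dy ys k) (N * 2 ^ k) (M * 2 ^ k) (vs k) (hs k)"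
proof -
  interpret S: dyadic M N n "swp D" by (rule dyadic_swp)
  interpret X: knots "dy xs k" "N * 2 ^ k" by (rule knots_x)
  interpret Y: knots "dy ys k" "M * 2 ^ k" by (rule knots_y)
  show ?thesis
  proof
    fix i j
    show "vs k i j \<Longrightarrow> i \<le> N * 2 ^ k \<and> j < M * 2 ^ k" by (rule vs_range)
    show "hs k i j \<Longrightarrow> i < N * 2 ^ k \<and> j \<le> M * 2 ^ k" using S.vs_range by blast
    show "vs k i j \<noteq> (0 < j \<and> vs k i (j - 1)) \<Longrightarrow> hs k i j \<or> 0 < i \<and> hs k (i - 1) j" by (rule vs_end)
    show "hs k i j \<noteq> (0 < i \<and> hs k (i - 1) j) \<Longrightarrow> vs k i j \<or> 0 < j \<and> vs k i (j - 1)" using S.vs_end[of k j i] by simp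
  qed
qed

abbreviation "mesh \<equiv> meshof N M D xs ys"
abbreviation "cel \<equiv> cellof xs ys"

text \<open>Compared in the finest grid, the width of the cell gives its level, and the lower left
  corner then gives its indices.\<close>

lemma cel_inj:
  assumes "cel j a b = cel j' a' b'" "(a, b) \<in> L j" "(a', b') \<in> L j'" "j \<le> n" "j' \<le> n"
  shows "j = j' \<and> a = a' \<and> b = b'"
proof -
  interpret S: dmesh M N n "swp D" "dy ys n" "dy xs n" by (rule dm.dmesh_swp)
  have r: "a < N * 2 ^ j" "b < M * 2 ^ j" "a' < N * 2 ^ j'" "b' < M * 2 ^ j'" using L_range assms by blast+
  have e: "dy xs n (a * 2 ^ (n - j)) = dy xs n (a' * 2 ^ (n - j'))"
    "dy xs n ((a + 1) * 2 ^ (n - j)) = dy xs n ((a' + 1) * 2 ^ (n - j'))"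
    "dy ys n (b * 2 ^ (n - j)) = dy ys n (b' * 2 ^ (n - j'))"
    using assms(1) unfolding dy_fine[OF assms(4)] dy_fine[OF assms(5)] by (auto simp: cellof_def)
  have l: "a * 2 ^ (n - j) \<le> (a + 1) * 2 ^ (n - j)" "a' * 2 ^ (n - j') \<le> (a' + 1) * 2 ^ (n - j')"
    "b * 2 ^ (n - j) \<le> (b + 1) * 2 ^ (n - j)" "b' * 2 ^ (n - j') \<le> (b' + 1) * 2 ^ (n - j')" by simp_all
  note R = S.row_range[OF assms(4) r(1)] S.row_range[OF assms(5) r(3)] dm.row_range[OF assms(4) r(2)] dm.row_range[OF assms(5) r(4)]
  have "a * 2 ^ (n - j) = a' * 2 ^ (n - j')" "(a + 1) * 2 ^ (n - j) = (a' + 1) * 2 ^ (n - j')" "b * 2 ^ (n - j) = b' * 2 ^ (n - j')"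
    using e dm.X.t_eq_iff[of "a * 2 ^ (n - j)" "a' * 2 ^ (n - j')"] dm.X.t_eq_iff[of "(a + 1) * 2 ^ (n - j)" "(a' + 1) * 2 ^ (n - j')"]
      dm.Y.t_eq_iff[of "b * 2 ^ (n - j)" "b' * 2 ^ (n - j')"] l R by linarith+
  moreover from this have "(2::nat) ^ (n - j) = 2 ^ (n - j')" by simp
  moreover from this have "j = j'" using assms by (simp add: power_inject_exp)
  ultimately show ?thesis by simp
qed

lemma mesh_split: "Suc k \<le> n \<Longrightarrow> mesh (Suc k) = (mesh k - (\<lambda>(a, b). cel k a b) ` D k) \<union> (\<lambda>(a, b). cel (Suc k) a b) ` L (Suc k)"
  (is "_ \<Longrightarrow> ?l = ?r")
proof -
  assume k: "Suc k \<le> n"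
  show "?l = ?r"
  proof (intro equalityI subsetI)
    fix c
    assume "c \<in> ?l"
    then obtain j a b where c: "c = cel j a b" "j \<le> Suc k" "(a, b) \<in> L j" "j < Suc k \<longrightarrow> (a, b) \<notin> D j"
      unfolding meshof_def by blast
    show "c \<in> ?r"
    proof (cases "j = Suc k")
      case True
      then show ?thesis using c by (auto simp del: lcells.simps)
    next
      case False
      then have j: "j \<le> k" "(a, b) \<notin> D j" using c by auto
      then have "c \<in> mesh k" using c unfolding meshof_def by blast
      moreover have "c \<noteq> cel k a' b'" if "(a', b') \<in> D k" for a' b'
      proof
        assume "c = cel k a' b'"
        then have "j = k \<and> a = a' \<and> b = b'" using c that D_L k j by (intro cel_inj) auto
        then show False using that j by simp
      qed
      ultimately show ?thesis by auto
    qed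
  next
    fix c
    assume "c \<in> ?r"
    then show "c \<in> ?l"
    proof
      assume "c \<in> mesh k - (\<lambda>(a, b). cel k a b) ` D k"
      then obtain j a b where c: "c = cel j a b" "j \<le> k" "(a, b) \<in> L j" "j < k \<longrightarrow> (a, b) \<notin> D j"
        "c \<notin> (\<lambda>(a, b). cel k a b) ` D k" unfolding meshof_def by blast
      then have "(a, b) \<notin> D j" by (cases "j = k") force+
      then show ?thesis using c unfolding meshof_def by (intro CollectI exI[of _ j] exI[of _ a] exI[of _ b]) auto
    next
      assume "c \<in> (\<lambda>(a, b). cel (Suc k) a b) ` L (Suc k)"
      then obtain a b where "c = cel (Suc k) a b" "(a, b) \<in> L (Suc k)" by auto
      then show ?thesis unfolding meshof_def by (intro CollectI exI[of _ "Suc k"] exI[of _ a] exI[of _ b]) auto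
    qed
  qed
qed

lemma L_quarters: "(\<lambda>(a, b). cel (Suc k) a b) ` L (Suc k) = (\<Union>\<phi>\<in>(\<lambda>(a, b). cel k a b) ` D k. quarters \<phi>)"
proof (intro equalityI subsetI)
  fix c
  assume "c \<in> (\<lambda>(a, b). cel (Suc k) a b) ` L (Suc k)"
  then obtain a b where c: "c = cel (Suc k) a b" "(a div 2, b div 2) \<in> D k" by auto
  obtain e f where ef: "a = 2 * (a div 2) + e" "b = 2 * (b div 2) + f" "e \<in> {0, 1}" "f \<in> {0, 1}"
    by (metis insertCI mod2_eq_if mult_div_mod_eq)
  have "c \<in> quarters (cel k (a div 2) (b div 2))"
    using ef(3,4) unfolding quarters_cellof c(1) by (subst ef(1), subst ef(2)) (auto simp del: div_mult_self1)
  then show "c \<in> (\<Union>\<phi>\<in>(\<lambda>(a, b). cel k a b) ` D k. quarters \<phi>)" using c(2) by force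
next
  fix c
  assume "c \<in> (\<Union>\<phi>\<in>(\<lambda>(a, b). cel k a b) ` D k. quarters \<phi>)"
  then obtain a b where ab: "(a, b) \<in> D k" "c \<in> quarters (cel k a b)" by auto
  then obtain e f where "c = cel (Suc k) (2 * a + e) (2 * b + f)" "e \<le> 1" "f \<le> 1"
    unfolding quarters_cellof by (metis add_0_right empty_iff insert_iff le_refl zero_le_one)
  then show "c \<in> (\<lambda>(a, b). cel (Suc k) a b) ` L (Suc k)"
    using ab(1) by (intro image_eqI[of _ _ "(2 * a + e, 2 * b + f)"]) auto
qed

lemma mesh_level_diff: "Suc k \<le> n \<Longrightarrow> mesh (Suc k) - mesh k = (\<lambda>(a, b). cel (Suc k) a b) ` L (Suc k)"
proof -
  assume k: "Suc k \<le> n"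
  have "cel (Suc k) a b \<notin> mesh k" if "(a, b) \<in> L (Suc k)" for a b
  proof
    assume "cel (Suc k) a b \<in> mesh k"
    then obtain j a' b' where "cel (Suc k) a b = cel j a' b'" "j \<le> k" "(a', b') \<in> L j" unfolding meshof_def by blast
    then show False using cel_inj[of "Suc k" a b j a' b'] that k by simp
  qed
  then show ?thesis unfolding mesh_split[OF k] by (auto simp del: lcells.simps)
qed

lemma cel_strict:
  assumes "(a, b) \<in> L k"
  shows "dy xs k a < dy xs k (a + 1)" "dy ys k b < dy ys k (b + 1)"
proof -
  interpret X: knots "dy xs k" "N * 2 ^ k" by (rule knots_x)
  interpret Y: knots "dy ys k" "M * 2 ^ k" by (rule knots_y)
  show "dy xs k a < dy xs k (a + 1)" "dy ys k b < dy ys k (b + 1)"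
    using L_range[OF assms] X.t_Suc Y.t_Suc by auto
qed

lemma D_in_mesh: "(a, b) \<in> D k \<Longrightarrow> cel k a b \<in> mesh k"
  using D_L unfolding meshof_def by blast

text \<open>Applied with \<open>f\<close> the frontier, the corners and the region of a cell. By the
  assumption nothing is lost when a cell is replaced by its quarters, so each of these unions only
  grows.\<close>

lemma mesh_union_Suc:
  assumes "Suc k \<le> n" and f: "\<And>\<phi>. \<phi> \<in> (\<lambda>(a, b). cel k a b) ` D k \<Longrightarrow> f \<phi> \<subseteq> (\<Union>q\<in>quarters \<phi>. f q)"
  shows "(\<Union>\<phi>\<in>mesh (Suc k). f \<phi>) = (\<Union>\<phi>\<in>mesh k. f \<phi>) \<union> (\<Union>\<phi>\<in>(\<lambda>(a, b). cel k a b) ` D k. \<Union>q\<in>quarters \<phi>. f q)"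
proof -
  define A where "A = (\<lambda>(a, b). cel k a b) ` D k"
  have "A \<subseteq> mesh k" using D_in_mesh by (auto simp: A_def)
  then have 1: "(\<Union>\<phi>\<in>mesh k. f \<phi>) = (\<Union>\<phi>\<in>mesh k - A. f \<phi>) \<union> (\<Union>\<phi>\<in>A. f \<phi>)" by blast
  have 2: "(\<Union>\<phi>\<in>A. f \<phi>) \<subseteq> (\<Union>\<phi>\<in>A. \<Union>q\<in>quarters \<phi>. f q)" using f unfolding A_def by (intro UN_mono order.refl)
  have 3: "(\<Union>\<phi>\<in>mesh (Suc k). f \<phi>) = (\<Union>\<phi>\<in>mesh k - A. f \<phi>) \<union> (\<Union>\<phi>\<in>A. \<Union>q\<in>quarters \<phi>. f q)"
    unfolding mesh_split[OF assms(1)] L_quarters A_def[symmetric] by blast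
  show ?thesis unfolding A_def[symmetric] 1 3 Un_assoc Un_absorb1[OF 2] ..
qed

lemma dy_sub:
  assumes "j < M * 2 ^ Suc k"
  shows "{dy ys (Suc k) j..dy ys (Suc k) (Suc j)} \<subseteq> {dy ys k (j div 2)..dy ys k (Suc (j div 2))}"
proof -
  interpret Y: knots "dy ys k" "M * 2 ^ k" by (rule knots_y)
  have "dy ys k (j div 2) < dy ys k (Suc (j div 2))" using assms by (intro Y.t_Suc) auto
  then show ?thesis using dy_even[of ys k "j div 2"] dy_odd[of ys k "j div 2"] dy_even[of ys k "Suc (j div 2)"]
    by (cases "even j") (auto elim!: evenE oddE)
qed

lemma dy_cover: "{dy ys k j..dy ys k (Suc j)} \<subseteq> {dy ys (Suc k) (2 * j)..dy ys (Suc k) (Suc (2 * j))}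
    \<union> {dy ys (Suc k) (Suc (2 * j))..dy ys (Suc k) (Suc (Suc (2 * j)))}"
  using dy_even[of ys k j] dy_even[of ys k "Suc j"] by auto

lemma vpart_Suc: "(\<exists>i j. vs (Suc k) i j \<and> u = dy xs (Suc k) i \<and> v \<in> {dy ys (Suc k) j..dy ys (Suc k) (Suc j)}) \<longleftrightarrow>
    (\<exists>i j. vs k i j \<and> u = dy xs k i \<and> v \<in> {dy ys k j..dy ys k (Suc j)})
    \<or> (\<exists>a b. (a, b) \<in> D k \<and> u = dy xs (Suc k) (2 * a + 1) \<and> v \<in> {dy ys k b..dy ys k (b + 1)})" (is "?l \<longleftrightarrow> ?r1 \<or> ?r2")
proof
  assume ?l
  then obtain i j where h: "vs (Suc k) i j" "u = dy xs (Suc k) i" "v \<in> {dy ys (Suc k) j..dy ys (Suc k) (Suc j)}" by blast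
  then have v: "v \<in> {dy ys k (j div 2)..dy ys k (Suc (j div 2))}" using dy_sub vs_range by blast
  show "?r1 \<or> ?r2"
  proof (cases "even i")
    case True
    then obtain i' where i: "i = 2 * i'" by blast
    then have "vs k i' (j div 2)" "u = dy xs k i'" using h(1,2) dy_even by (auto simp: vseg_even)
    then show ?thesis using v by blast
  next
    case False
    then obtain i' where i: "i = 2 * i' + 1" by (elim oddE)
    then have "(i', j div 2) \<in> D k" using h(1) vseg_odd by blast
    then show ?thesis using v h(2) i by auto
  qed
next
  assume "?r1 \<or> ?r2"
  then show ?l
  proof
    assume ?r1
    then obtain i j where h: "vs k i j" "u = dy xs k i" "v \<in> {dy ys k j..dy ys k (Suc j)}" by blast
    have vv: "vs (Suc k) (2 * i) (2 * j)" "vs (Suc k) (2 * i) (Suc (2 * j))" "u = dy xs (Suc k) (2 * i)"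
      using h dy_even by (auto simp: vseg_even)
    then show ?l using dy_cover h(3) by blast
  next
    assume ?r2
    then obtain a b where h: "(a, b) \<in> D k" "u = dy xs (Suc k) (2 * a + 1)" "v \<in> {dy ys k b..dy ys k (Suc b)}" by auto
    have "vs (Suc k) (2 * a + 1) (2 * b)" "vs (Suc k) (2 * a + 1) (Suc (2 * b))"
      using h unfolding vseg_odd by auto
    then show ?l using dy_cover h(2,3) by blast
  qed
qed

definition cross :: "nat \<Rightarrow> nat \<Rightarrow> nat \<Rightarrow> point set" where
  "cross k a b = {(u, v). (u = dy xs (Suc k) (2 * a + 1) \<and> v \<in> {dy ys k b..dy ys k (b + 1)})
    \<or> (v = dy ys (Suc k) (2 * b + 1) \<and> u \<in> {dy xs k a..dy xs k (a + 1)})}"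

abbreviation "Skel k \<equiv> grid.Sk (dy xs k) (dy ys k) (vs k) (hs k)"
abbreviation "Vert k \<equiv> grid.Vx (dy xs k) (dy ys k) (vs k) (hs k)"

lemma Skel_Suc: "Skel (Suc k) = Skel k \<union> (\<Union>(a, b)\<in>D k. cross k a b)"
proof -
  interpret S: hmesh M N n "swp D" ys xs by (rule hmesh_swp)
  interpret G: grid "dy xs k" "dy ys k" "N * 2 ^ k" "M * 2 ^ k" "vs k" "hs k" by (rule grid_level)
  interpret G': grid "dy xs (Suc k)" "dy ys (Suc k)" "N * 2 ^ Suc k" "M * 2 ^ Suc k" "vs (Suc k)" "hs (Suc k)" by (rule grid_level)
  have "(u, v) \<in> Skel (Suc k) \<longleftrightarrow> (u, v) \<in> Skel k \<or> (\<exists>a b. (a, b) \<in> D k \<and> (u, v) \<in> cross k a b)" for u v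
  proof -
    have H: "(\<exists>i j. hs (Suc k) i j \<and> v = dy ys (Suc k) j \<and> u \<in> {dy xs (Suc k) i..dy xs (Suc k) (Suc i)}) \<longleftrightarrow>
      (\<exists>i j. hs k i j \<and> v = dy ys k j \<and> u \<in> {dy xs k i..dy xs k (Suc i)})
      \<or> (\<exists>a b. (a, b) \<in> D k \<and> v = dy ys (Suc k) (2 * b + 1) \<and> u \<in> {dy xs k a..dy xs k (a + 1)})"
      using S.vpart_Suc[of k v u] unfolding swp_swp swp_iff by blast
    show ?thesis unfolding G'.Sk_def G.Sk_def cross_def mem_Collect_eq case_prod_conv vpart_Suc[of k u v] H by blast
  qed
  then show ?thesis by auto
qed

lemma skeleton_mesh: "k \<le> n \<Longrightarrow> skeleton (mesh k) = Skel k"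
proof (induction k)
  case 0
  interpret G: grid "dy xs 0" "dy ys 0" "N * 2 ^ 0" "M * 2 ^ 0" "vs 0" "hs 0" by (rule grid_level)
  have fr: "frontier (region (cel 0 a b)) = {(u, v). (u = xs a \<or> u = xs (Suc a)) \<and> v \<in> {ys b..ys (Suc b)} \<or> (v = ys b \<or> v = ys (Suc b)) \<and> u \<in> {xs a..xs (Suc a)}}"
    if "a < N" "b < M" for a b
    using that GX.t_Suc GY.t_Suc by (simp add: region_cellof frontier_rect)
  have m0: "mesh 0 = {cel 0 a b | a b. a < N \<and> b < M}" by (auto simp: meshof_def)
  show ?case
  proof (intro equalityI subsetI)
    fix p
    assume "p \<in> skeleton (mesh 0)"
    then obtain a b where ab: "a < N" "b < M" "p \<in> frontier (region (cel 0 a b))" unfolding skeleton_def m0 by blast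
    obtain u v where p: "p = (u, v)" by (cases p)
    have "vs 0 a b" "vs 0 (Suc a) b" "hs 0 a b" "hs 0 a (Suc b)" using ab by auto
    then show "p \<in> Skel 0" using ab(3) unfolding fr[OF ab(1,2)] p G.Sk_def dy.simps by blast
  next
    fix p
    assume p0: "p \<in> Skel 0"
    obtain u v where p: "p = (u, v)" by (cases p)
    have "\<exists>a b. a < N \<and> b < M \<and> p \<in> frontier (region (cel 0 a b))"
    proof -
      consider i j where "i \<le> N" "j < M" "u = xs i" "v \<in> {ys j..ys (Suc j)}" | i j where "i < N" "j \<le> M" "v = ys j" "u \<in> {xs i..xs (Suc i)}"
        using p0 unfolding p G.Sk_def by auto
      then show ?thesis
      proof cases
        case (1 i j)
        define a where "a = (if i = N then N - 1 else i)"
        have "a < N" "i = a \<or> i = Suc a" using 1 N by (auto simp: a_def)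
        then show ?thesis using 1 fr[of a j] p by (intro exI[of _ a] exI[of _ j]) auto
      next
        case (2 i j)
        define b where "b = (if j = M then M - 1 else j)"
        have "b < M" "j = b \<or> j = Suc b" using 2 M by (auto simp: b_def)
        then show ?thesis using 2 fr[of i b] p by (intro exI[of _ i] exI[of _ b]) auto
      qed
    qed
    then show "p \<in> skeleton (mesh 0)" unfolding skeleton_def m0 by blast
  qed
next
  case (Suc k)
  have q: "(\<Union>q\<in>quarters (cel k a b). frontier (region q)) = frontier (region (cel k a b)) \<union> cross k a b" if "(a, b) \<in> D k" for a b
  proof -
    have "(a, b) \<in> L k" using that D_L by blast
    note c = cel_strict[OF this]
    show ?thesis using quarters_union(1)[OF c] unfolding cellof_def cross_def dy_odd by simp
  qed
  have "skeleton (mesh (Suc k)) = skeleton (mesh k) \<union> (\<Union>\<phi>\<in>(\<lambda>(a, b). cel k a b) ` D k. \<Union>q\<in>quarters \<phi>. frontier (region q))"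
    unfolding skeleton_def using Suc.prems q by (intro mesh_union_Suc) auto
  also have "\<dots> = skeleton (mesh k) \<union> (\<Union>(a, b)\<in>D k. frontier (region (cel k a b)) \<union> cross k a b)"
    using q by (auto simp: case_prod_beta)
  also have "\<dots> = skeleton (mesh k) \<union> (\<Union>(a, b)\<in>D k. cross k a b)"
    using D_in_mesh unfolding skeleton_def by blast
  finally show ?case using Suc Skel_Suc by simp
qed

lemma Vert_Suc: "Vert (Suc k) = Vert k \<union> (\<Union>(a, b)\<in>D k. {(dy xs (Suc k) (2 * a + 1), dy ys (Suc k) (2 * b + 1)),
    (dy xs (Suc k) (2 * a + 1), dy ys k b), (dy xs (Suc k) (2 * a + 1), dy ys k (b + 1)),
    (dy xs k a, dy ys (Suc k) (2 * b + 1)), (dy xs k (a + 1), dy ys (Suc k) (2 * b + 1))})" (is "_ = _ \<union> (\<Union>(a, b)\<in>D k. ?W a b)")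
proof -
  interpret G: grid "dy xs k" "dy ys k" "N * 2 ^ k" "M * 2 ^ k" "vs k" "hs k" by (rule grid_level)
  interpret G': grid "dy xs (Suc k)" "dy ys (Suc k)" "N * 2 ^ Suc k" "M * 2 ^ Suc k" "vs (Suc k)" "hs (Suc k)" by (rule grid_level)
  have e: "vtx k i j = G.vertex i j" "vtx (Suc k) i j = G'.vertex i j" for i j
    by (simp_all add: vtx_def G.vertex_def G'.vertex_def)
  note v = vtx_rec[of k, unfolded e]
  show ?thesis
  proof (intro equalityI subsetI)
    fix p
    assume "p \<in> Vert (Suc k)"
    then obtain i j where ij: "G'.vertex i j" "p = (dy xs (Suc k) i, dy ys (Suc k) j)" unfolding G'.Vx_def by blast
    obtain i' where "i = 2 * i' \<or> i = 2 * i' + 1" by (metis evenE oddE)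
    moreover obtain j' where "j = 2 * j' \<or> j = 2 * j' + 1" by (metis evenE oddE)
    ultimately consider "i = 2 * i'" "j = 2 * j'" | "i = 2 * i' + 1" "j = 2 * j' + 1" | "i = 2 * i' + 1" "j = 2 * j'" | "i = 2 * i'" "j = 2 * j' + 1" by blast
    then show "p \<in> Vert k \<union> (\<Union>(a, b)\<in>D k. ?W a b)"
    proof cases
      case 1
      then have "G.vertex i' j'" "p = (dy xs k i', dy ys k j')" using ij v(1) dy_even by simp_all
      then show ?thesis unfolding G.Vx_def by blast
    next
      case 2
      then have "(i', j') \<in> D k" using ij v(2) by simp
      then show ?thesis using ij 2 by (intro UnI2 UN_I[of "(i', j')"]) auto
    next
      case 3
      then have "(i', j') \<in> D k \<or> (0 < j' \<and> (i', j' - 1) \<in> D k)" "p = (dy xs (Suc k) (2 * i' + 1), dy ys k j')"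
        using ij v(3) dy_even by simp_all
      then show ?thesis
      proof (elim disjE conjE)
        assume "(i', j') \<in> D k" "p = (dy xs (Suc k) (2 * i' + 1), dy ys k j')"
        then show ?thesis by (intro UnI2 UN_I[of "(i', j')"]) auto
      next
        assume "0 < j'" "(i', j' - 1) \<in> D k" "p = (dy xs (Suc k) (2 * i' + 1), dy ys k j')"
        then show ?thesis by (intro UnI2 UN_I[of "(i', j' - 1)"]) auto
      qed
    next
      case 4
      then have "(i', j') \<in> D k \<or> (0 < i' \<and> (i' - 1, j') \<in> D k)" "p = (dy xs k i', dy ys (Suc k) (2 * j' + 1))"
        using ij v(4) dy_even by simp_all
      then show ?thesis
      proof (elim disjE conjE)
        assume "(i', j') \<in> D k" "p = (dy xs k i', dy ys (Suc k) (2 * j' + 1))"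
        then show ?thesis by (intro UnI2 UN_I[of "(i', j')"]) auto
      next
        assume "0 < i'" "(i' - 1, j') \<in> D k" "p = (dy xs k i', dy ys (Suc k) (2 * j' + 1))"
        then show ?thesis by (intro UnI2 UN_I[of "(i' - 1, j')"]) auto
      qed
    qed
  next
    have V': "(dy xs (Suc k) i, dy ys (Suc k) j) \<in> Vert (Suc k)" if "G'.vertex i j" for i j
      using that unfolding G'.Vx_def by blast
    have V: "(dy xs k i, dy ys k j) \<in> Vert (Suc k)" if "G.vertex i j" for i j
      using V'[of "2 * i" "2 * j"] that v(1) dy_even by simp
    fix p
    assume "p \<in> Vert k \<union> (\<Union>(a, b)\<in>D k. ?W a b)"
    then show "p \<in> Vert (Suc k)"
    proof
      assume "p \<in> Vert k"
      then show ?thesis using V unfolding G.Vx_def by blast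
    next
      assume "p \<in> (\<Union>(a, b)\<in>D k. ?W a b)"
      then obtain a b where ab: "(a, b) \<in> D k" "p \<in> ?W a b" by blast
      have "(dy xs (Suc k) (2 * a + 1), dy ys (Suc k) (2 * b + 1)) \<in> Vert (Suc k)"
        by (rule V') (use ab v(2) in simp)
      moreover have "(dy xs (Suc k) (2 * a + 1), dy ys k b) \<in> Vert (Suc k)"
        using V'[of "2 * a + 1" "2 * b"] v(3)[of a b] ab dy_even[of ys k b] by simp
      moreover have "(dy xs (Suc k) (2 * a + 1), dy ys k (b + 1)) \<in> Vert (Suc k)"
        using V'[of "2 * a + 1" "2 * (b + 1)"] v(3)[of a "b + 1"] ab dy_even[of ys k "b + 1"] by simp
      moreover have "(dy xs k a, dy ys (Suc k) (2 * b + 1)) \<in> Vert (Suc k)"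
        using V'[of "2 * a" "2 * b + 1"] v(4)[of a b] ab dy_even[of xs k a] by simp
      moreover have "(dy xs k (a + 1), dy ys (Suc k) (2 * b + 1)) \<in> Vert (Suc k)"
        using V'[of "2 * (a + 1)" "2 * b + 1"] v(4)[of "a + 1" b] ab dy_even[of xs k "a + 1"] by simp
      ultimately show ?thesis using ab(2) by blast
    qed
  qed
qed

lemma vertices_mesh: "k \<le> n \<Longrightarrow> mesh_vertices (mesh k) = Vert k"
proof (induction k)
  case 0
  interpret G: grid "dy xs 0" "dy ys 0" "N * 2 ^ 0" "M * 2 ^ 0" "vs 0" "hs 0" by (rule grid_level)
  have m0: "mesh 0 = {cel 0 a b | a b. a < N \<and> b < M}" by (auto simp: meshof_def)
  have v: "G.vertex i j \<longleftrightarrow> i \<le> N \<and> j \<le> M" for i j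
    using N M unfolding G.vertex_def by (auto simp: le_less)
  show ?case
  proof (intro equalityI subsetI)
    fix p
    assume "p \<in> mesh_vertices (mesh 0)"
    then obtain a b where "a < N" "b < M" "p \<in> corners (cel 0 a b)" unfolding mesh_vertices_def m0 by blast
    then have "p \<in> {(xs a, ys b), (xs a, ys (Suc b)), (xs (Suc a), ys b), (xs (Suc a), ys (Suc b))}"
      and le: "a \<le> N" "Suc a \<le> N" "b \<le> M" "Suc b \<le> M" by (auto simp: cellof_def)
    then have "\<exists>i j. i \<le> N \<and> j \<le> M \<and> p = (xs i, ys j)" by (elim insertE) blast+
    then show "p \<in> Vert 0" unfolding G.Vx_def v dy.simps by blast
  next
    fix p
    assume "p \<in> Vert 0"
    then obtain i j where ij: "i \<le> N" "j \<le> M" "p = (xs i, ys j)" unfolding G.Vx_def v by auto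
    define a b where "a = (if i = N then N - 1 else i)" and "b = (if j = M then M - 1 else j)"
    have "a < N" "i = a \<or> i = Suc a" "b < M" "j = b \<or> j = Suc b" using ij N M by (auto simp: a_def b_def)
    then show "p \<in> mesh_vertices (mesh 0)"
      unfolding mesh_vertices_def m0 using ij(3) by (intro UN_I[of "cel 0 a b"]) (auto simp: cellof_def)
  qed
next
  case (Suc k)
  let ?W = "\<lambda>a b. {(dy xs (Suc k) (2 * a + 1), dy ys (Suc k) (2 * b + 1)),
    (dy xs (Suc k) (2 * a + 1), dy ys k b), (dy xs (Suc k) (2 * a + 1), dy ys k (b + 1)),
    (dy xs k a, dy ys (Suc k) (2 * b + 1)), (dy xs k (a + 1), dy ys (Suc k) (2 * b + 1))}"
  have q: "(\<Union>q\<in>quarters (cel k a b). corners q) = corners (cel k a b) \<union> ?W a b" if "(a, b) \<in> D k" for a b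
  proof -
    have "(a, b) \<in> L k" using that D_L by blast
    note c = cel_strict[OF this]
    show ?thesis using quarters_union(2)[OF c] unfolding cellof_def dy_odd by simp
  qed
  have "mesh_vertices (mesh (Suc k)) = mesh_vertices (mesh k) \<union> (\<Union>\<phi>\<in>(\<lambda>(a, b). cel k a b) ` D k. \<Union>q\<in>quarters \<phi>. corners q)"
    unfolding mesh_vertices_def using Suc.prems q by (intro mesh_union_Suc) auto
  also have "\<dots> = mesh_vertices (mesh k) \<union> (\<Union>(a, b)\<in>D k. corners (cel k a b) \<union> ?W a b)"
  proof -
    have "(\<Union>\<phi>\<in>(\<lambda>(a, b). cel k a b) ` D k. \<Union>q\<in>quarters \<phi>. corners q) = (\<Union>(a, b)\<in>D k. corners (cel k a b) \<union> ?W a b)"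
    proof (intro equalityI subsetI)
      fix p
      assume "p \<in> (\<Union>\<phi>\<in>(\<lambda>(a, b). cel k a b) ` D k. \<Union>q\<in>quarters \<phi>. corners q)"
      then obtain \<phi> where "\<phi> \<in> (\<lambda>(a, b). cel k a b) ` D k" "p \<in> (\<Union>q\<in>quarters \<phi>. corners q)" by (rule UN_E)
      then obtain a b where ab: "(a, b) \<in> D k" "p \<in> (\<Union>q\<in>quarters (cel k a b). corners q)" by (elim imageE) auto
      then show "p \<in> (\<Union>(a, b)\<in>D k. corners (cel k a b) \<union> ?W a b)" unfolding q[OF ab(1)] by blast
    next
      fix p
      assume "p \<in> (\<Union>(a, b)\<in>D k. corners (cel k a b) \<union> ?W a b)"
      then obtain a b where ab: "(a, b) \<in> D k" "p \<in> corners (cel k a b) \<union> ?W a b" by blast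
      show "p \<in> (\<Union>\<phi>\<in>(\<lambda>(a, b). cel k a b) ` D k. \<Union>q\<in>quarters \<phi>. corners q)"
        by (rule UN_I[OF image_eqI[OF _ ab(1)]]) (use ab(2) q[OF ab(1)] in auto)
    qed
    then show ?thesis by simp
  qed
  also have "\<dots> = mesh_vertices (mesh k) \<union> (\<Union>(a, b)\<in>D k. ?W a b)"
    using D_in_mesh unfolding mesh_vertices_def by blast
  finally show ?case using Suc Vert_Suc by simp
qed

lemma domain_mesh: "k \<le> n \<Longrightarrow> mesh_domain (mesh k) = {xs 0..xs N} \<times> {ys 0..ys M}"
proof (induction k)
  case 0
  have m0: "mesh 0 = {cel 0 a b | a b. a < N \<and> b < M}" by (auto simp: meshof_def)
  show ?case
  proof (intro equalityI subsetI)
    fix p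
    assume "p \<in> mesh_domain (mesh 0)"
    then obtain a b where ab: "a < N" "b < M" "p \<in> {xs a..xs (Suc a)} \<times> {ys b..ys (Suc b)}"
      unfolding mesh_domain_def m0 by (auto simp: region_cellof)
    then show "p \<in> {xs 0..xs N} \<times> {ys 0..ys M}"
      using GX.t_mono[of 0 a] GX.t_mono[of "Suc a" N] GY.t_mono[of 0 b] GY.t_mono[of "Suc b" M] by auto
  next
    fix p
    assume "p \<in> {xs 0..xs N} \<times> {ys 0..ys M}"
    then obtain u v where p: "p = (u, v)" "u \<in> {xs 0..xs N}" "v \<in> {ys 0..ys M}" by blast
    obtain a where a: "a < N" "u \<in> {xs a..xs (Suc a)}" using GX.t_interval[OF p(2)] by blast
    obtain b where b: "b < M" "v \<in> {ys b..ys (Suc b)}" using GY.t_interval[OF p(3)] by blast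
    show "p \<in> mesh_domain (mesh 0)"
      unfolding mesh_domain_def m0 using a b p by (intro UN_I[of "cel 0 a b"]) (auto simp: region_cellof)
  qed
next
  case (Suc k)
  have q: "(\<Union>q\<in>quarters (cel k a b). region q) = region (cel k a b)" if "(a, b) \<in> D k" for a b
  proof -
    have "(a, b) \<in> L k" using that D_L by blast
    note c = cel_strict[OF this]
    show ?thesis using quarters_union(3)[OF c] unfolding cellof_def by simp
  qed
  have "mesh_domain (mesh (Suc k)) = mesh_domain (mesh k) \<union> (\<Union>\<phi>\<in>(\<lambda>(a, b). cel k a b) ` D k. \<Union>q\<in>quarters \<phi>. region q)"
    unfolding mesh_domain_def using Suc.prems q by (intro mesh_union_Suc) auto
  also have "(\<Union>\<phi>\<in>(\<lambda>(a, b). cel k a b) ` D k. \<Union>q\<in>quarters \<phi>. region q) \<subseteq> mesh_domain (mesh k)"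
  proof (rule UN_least)
    fix \<phi>
    assume "\<phi> \<in> (\<lambda>(a, b). cel k a b) ` D k"
    then obtain a b where ab: "(a, b) \<in> D k" "\<phi> = cel k a b" by auto
    show "(\<Union>q\<in>quarters \<phi>. region q) \<subseteq> mesh_domain (mesh k)"
      unfolding ab(2) q[OF ab(1)] mesh_domain_def using D_in_mesh[OF ab(1)] by blast
  qed
  then have "mesh_domain (mesh k) \<union> (\<Union>\<phi>\<in>(\<lambda>(a, b). cel k a b) ` D k. \<Union>q\<in>quarters \<phi>. region q) = mesh_domain (mesh k)"
    by (rule Un_absorb2)
  finally show ?case using Suc by simp
qed

lemma mesh_leaves: "mesh n = (\<lambda>(k, a, b). cel k a b) ` leaves"
proof -
  have "(j \<le> n \<and> (a, b) \<in> L j \<and> (j < n \<longrightarrow> (a, b) \<notin> D j)) \<longleftrightarrow> (j, a, b) \<in> leaves" for j a b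
    using D_n[of j] by (cases "j < n") (auto simp: leaves_def)
  then have "mesh n = {cel j a b | j a b. (j, a, b) \<in> leaves}" unfolding meshof_def by simp
  also have "\<dots> = (\<lambda>(k, a, b). cel k a b) ` leaves" by force
  finally show ?thesis .
qed

lemma spline_space_mesh:
  "spline_space 2 (mesh n) = {dm.B.F C | C. dm.VC C \<and> dmesh.VC M N n (swp D) (dy xs n) (\<lambda>a b. C b a)}"
proof -
  interpret S: dmesh M N n "swp D" "dy ys n" "dy xs n" by (rule dm.dmesh_swp)
  define Bx where "Bx = (\<lambda>(k, a, b). (a * 2 ^ (n - k), (a + 1) * 2 ^ (n - k), b * 2 ^ (n - k), (b + 1) * 2 ^ (n - k))) ` leaves"
  have dom: "mesh_domain (mesh n) = dm.B.box2"
    using domain_mesh[of n] dy_fine[of 0 n xs 0] dy_fine[of 0 n xs N] dy_fine[of 0 n ys 0] dy_fine[of 0 n ys M]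
    by (simp add: dm.B.box2_def)
  have reg: "region ` mesh n = (\<lambda>(i0, i1, j0, j1). {dy xs n i0..dy xs n i1} \<times> {dy ys n j0..dy ys n j1}) ` Bx"
    unfolding mesh_leaves Bx_def image_image
    by (rule image_cong[OF refl]) (auto simp: leaves_def region_cellof dy_fine simp del: add_mult_distrib mult_Suc)
  have BB: "i0 < i1 \<and> i1 \<le> N * 2 ^ n \<and> j0 < j1 \<and> j1 \<le> M * 2 ^ n" if hB: "(i0, i1, j0, j1) \<in> Bx" for i0 i1 j0 j1
  proof -
    obtain k a b where l: "(k, a, b) \<in> leaves" "i0 = a * 2 ^ (n - k)" "i1 = (a + 1) * 2 ^ (n - k)" "j0 = b * 2 ^ (n - k)" "j1 = (b + 1) * 2 ^ (n - k)"
      using hB unfolding Bx_def by auto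
    then have "k \<le> n" "a < N * 2 ^ k" "b < M * 2 ^ k" using L_range by (auto simp: leaves_def)
    then show ?thesis using S.row_range[of k a] dm.row_range[of k b] l(2-) by simp
  qed
  have cov: "\<exists>i0 i1 j0 j1. (i0, i1, j0, j1) \<in> Bx \<and> i0 \<le> i \<and> i < i1 \<and> j0 \<le> j \<and> j < j1"
    if ij: "i < N * 2 ^ n" "j < M * 2 ^ n" for i j
  proof -
    obtain k a b where l: "lf i j = (k, a, b)" by (metis prod_cases3)
    have L: "(k, a, b) \<in> leaves" using lf_leaves[OF ij] l by simp
    have "anc n k i = a" "anc n k j = b" using l by (auto simp: lf_def)
    then show ?thesis using L unfolding Bx_def anc_eq_iff by (intro exI conjI image_eqI[of _ _ "(k, a, b)"]) auto
  qed
  have cond: "(\<forall>(i0, i1, j0, j1)\<in>Bx. (\<forall>p Y. i0 < p \<longrightarrow> p < i1 \<longrightarrow> Y \<in> {dy ys n j0..dy ys n j1} \<longrightarrow> dm.Y.Q (C (p + 2)) Y = 0) \<and>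
      (\<forall>s X. j0 < s \<longrightarrow> s < j1 \<longrightarrow> X \<in> {dy xs n i0..dy xs n i1} \<longrightarrow> dm.X.Q (\<lambda>a. C a (s + 2)) X = 0))
    \<longleftrightarrow> dm.VC C \<and> S.VC (\<lambda>a b. C b a)" for C
  proof -
    have "S.VC (\<lambda>a b. C b a) \<longleftrightarrow> (\<forall>(k, a, b)\<in>leaves. \<forall>p Y. b * 2 ^ (n - k) < p \<longrightarrow> p < (b + 1) * 2 ^ (n - k) \<longrightarrow>
      Y \<in> {dy xs n (a * 2 ^ (n - k))..dy xs n ((a + 1) * 2 ^ (n - k))} \<longrightarrow> dm.X.Q (\<lambda>a. C a (p + 2)) Y = 0)"
    proof -
      have "(\<forall>(k, b, a)\<in>S.leaves. Pr k a b) \<longleftrightarrow> (\<forall>(k, a, b)\<in>leaves. Pr k a b)" for Pr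
        using swp_leaf(3) by fastforce
      then show ?thesis unfolding S.VC_leaves by simp
    qed
    then show ?thesis unfolding dm.VC_leaves Bx_def by fastforce
  qed
  show ?thesis
    using dm.B.spline_space_iff[OF dom reg BB cov] unfolding cond by blast
qed

end

text \<open>\<open>lcells\<close> is defined from \<open>D\<close>, while \<open>D k\<close> has to
  be chosen among the cells of level \<open>k\<close>. Building these cells from a division
  predicate \<open>R\<close> avoids the circularity.\<close>

fun lrec :: "(nat \<times> nat) set \<Rightarrow> (nat \<Rightarrow> nat \<times> nat \<Rightarrow> bool) \<Rightarrow> nat \<Rightarrow> (nat \<times> nat) set" where
  "lrec G R 0 = G"
| "lrec G R (Suc k) = {(a, b). (a div 2, b div 2) \<in> lrec G R k \<and> R k (a div 2, b div 2)}"

theorem hierarchical_mesh_index: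
  assumes "hierarchical_mesh T n"
  shows "\<exists>N M D xs ys. hmesh N M n D xs ys \<and> (\<forall>k\<le>n. T k = meshof N M D xs ys k)"
proof -
  have tp: "tensor_product_mesh (T 0)" and "\<forall>k<n. \<exists>E. E \<subseteq> level_cells T k \<and> T (Suc k) = (T k - E) \<union> (\<Union>\<phi>\<in>E. quarters \<phi>)"
    using assms unfolding hierarchical_mesh_def by blast+
  then obtain E where E: "\<And>k. k < n \<Longrightarrow> E k \<subseteq> level_cells T k \<and> T (Suc k) = (T k - E k) \<union> (\<Union>\<phi>\<in>E k. quarters \<phi>)"
    by metis
  obtain xl yl where sx: "sorted_wrt (<) xl" and sy: "sorted_wrt (<) yl" and len: "2 \<le> length xl" "2 \<le> length yl"
    and T0: "T 0 = {((xl ! i, yl ! j), (xl ! Suc i, yl ! Suc j)) | i j. Suc i < length xl \<and> Suc j < length yl}"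
    using tp unfolding tensor_product_mesh_def by blast
  define N M xs ys where "N = length xl - 1" and "M = length yl - 1" and "xs = (!) xl" and "ys = (!) yl"
  \<comment> \<open>The condition \<open>k < n\<close> makes \<open>D k\<close> empty from
    \<open>n\<close> on, where nothing is known about \<open>E k\<close>.\<close>
  define R where "R k q = (k < n \<and> cellof xs ys k (fst q) (snd q) \<in> E k)" for k q
  define D where "D k = {q \<in> lrec ({..<N} \<times> {..<M}) R k. R k q}" for k
  have L: "lcells N M D k = lrec ({..<N} \<times> {..<M}) R k" for k by (cases k) (auto simp: D_def)
  have "dyadic N M n D"
    using len by unfold_locales (auto simp: N_def M_def D_def R_def)
  moreover have "knots xs N" "knots ys M"
    using sx sy len by (unfold_locales; auto simp: N_def xs_def M_def ys_def sorted_wrt_iff_nth_less)+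
  ultimately have "hmesh N M n D xs ys" by (rule hmesh.intro)
  interpret hmesh N M n D xs ys by fact
  \<comment> \<open>The cells of level \<open>k\<close> are described along with the mesh, because
    the divided cells are chosen among them.\<close>
  have "k \<le> n \<longrightarrow> T k = meshof N M D xs ys k \<and> level_cells T k = (\<lambda>(a, b). cellof xs ys k a b) ` lcells N M D k" for k
  proof (induction k)
    case 0
    have "T 0 = (\<lambda>(a, b). cellof xs ys 0 a b) ` ({..<N} \<times> {..<M})"
      unfolding T0 by (force simp: cellof_def N_def M_def xs_def ys_def)
    moreover have "meshof N M D xs ys 0 = (\<lambda>(a, b). cellof xs ys 0 a b) ` ({..<N} \<times> {..<M})"
      by (force simp: meshof_def)
    ultimately show ?case by simp
  next
    case (Suc k)
    show ?case
    proof
      assume k: "Suc k \<le> n"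
      then have IH: "T k = mesh k" "level_cells T k = (\<lambda>(a, b). cel k a b) ` L k" using Suc by auto
      have "E k = (\<lambda>(a, b). cel k a b) ` D k"
      proof (intro equalityI subsetI)
        fix c
        assume c: "c \<in> E k"
        then obtain a b where ab: "(a, b) \<in> L k" "c = cel k a b" using E[of k] k IH by auto
        then have "(a, b) \<in> D k" using c k L by (simp add: D_def R_def)
        then show "c \<in> (\<lambda>(a, b). cel k a b) ` D k" using ab by force
      qed (auto simp: D_def R_def)
      then have "T (Suc k) = mesh (Suc k)" using E[of k] k IH mesh_split[OF k] L_quarters by simp
      then show "T (Suc k) = mesh (Suc k) \<and> level_cells T (Suc k) = (\<lambda>(a, b). cel (Suc k) a b) ` L (Suc k)"
        using mesh_level_diff[OF k] IH by (simp del: lcells.simps)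
    qed
  qed
  then show ?thesis using \<open>hmesh N M n D xs ys\<close> by blast
qed

section \<open>Level l-edges and the components they form\<close>

text \<open>Nonempty sets meet themselves, so the transitive closure of \<open>meet_rel\<close> is
  an equivalence relation on \<open>A\<close>. The third part is induction along a chain: a property
  passed on between meeting members spreads over the whole component.\<close>

lemma class_props:
  assumes ne: "{} \<notin> A"
  shows "l \<in> A \<Longrightarrow> \<exists>K\<in>A // (meet_rel A)\<^sup>+. l \<in> K"
    and "K \<in> A // (meet_rel A)\<^sup>+ \<Longrightarrow> l \<in> K \<Longrightarrow> l' \<in> A \<Longrightarrow> l \<inter> l' \<noteq> {} \<Longrightarrow> l' \<in> K"
    and "K \<in> A // (meet_rel A)\<^sup>+ \<Longrightarrow> l \<in> K \<Longrightarrow> Pr l \<Longrightarrow> (\<And>s t. Pr s \<Longrightarrow> s \<in> A \<Longrightarrow> t \<in> A \<Longrightarrow> s \<inter> t \<noteq> {} \<Longrightarrow> Pr t)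
      \<Longrightarrow> s \<in> K \<Longrightarrow> Pr s"
    and "K \<in> A // (meet_rel A)\<^sup>+ \<Longrightarrow> K' \<in> A // (meet_rel A)\<^sup>+ \<Longrightarrow> l \<in> K \<Longrightarrow> l \<in> K' \<Longrightarrow> K = K'"
    and "K \<in> A // (meet_rel A)\<^sup>+ \<Longrightarrow> K \<subseteq> A"
proof -
  let ?r = "meet_rel A"
  have r: "(s, t) \<in> ?r \<longleftrightarrow> s \<in> A \<and> t \<in> A \<and> s \<inter> t \<noteq> {}" for s t by (simp add: meet_rel_def)
  have sub: "?r \<subseteq> A \<times> A" using r by auto
  have refl: "(s, s) \<in> ?r" if "s \<in> A" for s using that ne r by auto
  have "sym ?r" by (rule symI) (auto simp: r)
  then have eq: "equiv A (?r\<^sup>+)"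
    using trancl_subset_Sigma[OF sub] refl
    by (intro equivI refl_onI sym_trancl trans_trancl) auto
  define R where "R = ?r\<^sup>+"
  note eq = eq[folded R_def]
  have rR: "(s, t) \<in> R" if "s \<in> A" "t \<in> A" "s \<inter> t \<noteq> {}" for s t unfolding R_def using that r by (intro r_into_trancl) simp
  show "l \<in> A \<Longrightarrow> \<exists>K\<in>A // ?r\<^sup>+. l \<in> K" unfolding R_def[symmetric]
    by (rule bexI[of _ "R `` {l}"]) (use equiv_class_self[OF eq] quotientI in auto)
  have cls: "K = R `` {l}" if K: "K \<in> A // R" "l \<in> K" for K l
  proof -
    obtain x where x: "x \<in> A" "K = R `` {x}" using K(1) by (rule quotientE)
    then have "(x, l) \<in> R" using K(2) by simp
    then show ?thesis using equiv_class_eq[OF eq] x(2) by simp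
  qed
  show sub: "K \<subseteq> A" if "K \<in> A // ?r\<^sup>+" for K using in_quotient_imp_subset[OF eq] that by (simp add: R_def)
  show "K \<in> A // ?r\<^sup>+ \<Longrightarrow> l \<in> K \<Longrightarrow> l' \<in> A \<Longrightarrow> l \<inter> l' \<noteq> {} \<Longrightarrow> l' \<in> K"
    using cls[of K l] sub[of K] rR[of l l'] by (auto simp: R_def)
  show "K \<in> A // ?r\<^sup>+ \<Longrightarrow> K' \<in> A // ?r\<^sup>+ \<Longrightarrow> l \<in> K \<Longrightarrow> l \<in> K' \<Longrightarrow> K = K'"
    using cls[of K l] cls[of K' l] by (simp add: R_def)
  assume K: "K \<in> A // ?r\<^sup>+" "l \<in> K" and P: "Pr l" and step: "\<And>s t. Pr s \<Longrightarrow> s \<in> A \<Longrightarrow> t \<in> A \<Longrightarrow> s \<inter> t \<noteq> {} \<Longrightarrow> Pr t"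
    and s: "s \<in> K"
  have "(l, s) \<in> ?r\<^sup>+" using cls[OF K[folded R_def]] s by (simp add: R_def)
  then show "Pr s"
  proof (induction rule: trancl_induct)
    case (base t)
    then show ?case using step[OF P] r by simp
  next
    case (step t u)
    then show ?case using \<open>\<And>s t. Pr s \<Longrightarrow> s \<in> A \<Longrightarrow> t \<in> A \<Longrightarrow> s \<inter> t \<noteq> {} \<Longrightarrow> Pr t\<close>[of t u] r by simp
  qed
qed

context dyadic
begin

lemma vs_pow: "vs (k + m) (i * 2 ^ m) j = vs k i (j div 2 ^ m)"
proof (induction m arbitrary: j)
  case (Suc m)
  have e: "i * 2 ^ Suc m = 2 * (i * 2 ^ m)" by simp
  have "vs (k + Suc m) (i * 2 ^ Suc m) j = vs (k + m) (i * 2 ^ m) (j div 2)"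
    unfolding add_Suc_right e vseg_even ..
  then show ?case using Suc by (simp add: div_mult2_eq)
qed simp

lemma vs_fine: "k \<le> n \<Longrightarrow> vs n (q * 2 ^ (n - k)) j = vs k q (anc n k j)"
  using vs_pow[of k "n - k" q j] by (simp add: anc_def)

lemma vs_mid: "k < n \<Longrightarrow> vs n (mid n k a) j \<longleftrightarrow> (a, anc n k j) \<in> D k"
proof -
  assume k: "k < n"
  have "vs n (mid n k a) j = vs (Suc k) (2 * a + 1) (anc n (Suc k) j)"
    using vs_fine[of "Suc k" "2 * a + 1" j] k by (simp only: mid_def Suc_le_eq)
  then show ?thesis using anc_Suc[OF k, of j] vseg_odd by metis
qed

end

context hmesh
begin

abbreviation "Bx \<equiv> grid.bx (dy xs n) (dy ys n) (N * 2 ^ n) (M * 2 ^ n)"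
abbreviation "Eg \<equiv> Edg (Skel n) (Vert n)"

lemma Bx: "Bx = {xs 0..xs N} \<times> {ys 0..ys M}"
proof -
  interpret G: grid "dy xs n" "dy ys n" "N * 2 ^ n" "M * 2 ^ n" "vs n" "hs n" by (rule grid_level)
  show ?thesis
    using dy_fine[of 0 n xs 0] dy_fine[of 0 n xs N] dy_fine[of 0 n ys 0] dy_fine[of 0 n ys M] by (simp add: G.bx_def)
qed

text \<open>These are the l-edges of level \<open>Suc k\<close>, which divide cells of level
  \<open>k\<close>. Since the skeletons grow with the level, comparing two consecutive ones replaces
  the least level in \<open>edge_level\<close>.\<close>

definition LL :: "nat \<Rightarrow> point set set" where
  "LL k = {l \<in> LE Eg (frontier Bx). \<forall>e\<in>Eg. e \<subseteq> l \<longrightarrow> e \<subseteq> Skel (Suc k) \<and> \<not> e \<subseteq> Skel k}"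

lemma Skel_mono: "j \<le> k \<Longrightarrow> Skel j \<subseteq> Skel k"
  by (induction rule: dec_induct) (use Skel_Suc in auto)

lemma LL_swp: "hmesh.LL M N n (swp D) ys xs k = swap_image ` LL k"
proof -
  interpret S: hmesh M N n "swp D" ys xs by (rule hmesh_swp)
  have Sk: "S.Skel k = swap_image (Skel k)" and Vx: "S.Vert k = swap_image (Vert k)" for k
  proof -
    interpret G: grid "dy xs k" "dy ys k" "N * 2 ^ k" "M * 2 ^ k" "vs k" "hs k" by (rule grid_level)
    show "S.Skel k = swap_image (Skel k)" "S.Vert k = swap_image (Vert k)" using G.swp_sets by simp_all
  qed
  interpret G: grid "dy xs n" "dy ys n" "N * 2 ^ n" "M * 2 ^ n" "vs n" "hs n" by (rule grid_level)
  have E: "S.Eg = swap_image ` Eg" unfolding Sk Vx Edg_swap ..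
  have F: "frontier S.Bx = swap_image (frontier Bx)" using G.swp_sets(4) G.frontier_swap by simp
  have L: "LE S.Eg (frontier S.Bx) = swap_image ` LE Eg (frontier Bx)" unfolding E F LE_swap ..
  have P: "(\<forall>e\<in>S.Eg. e \<subseteq> swap_image l \<longrightarrow> e \<subseteq> S.Skel (Suc k) \<and> \<not> e \<subseteq> S.Skel k)
    \<longleftrightarrow> (\<forall>e\<in>Eg. e \<subseteq> l \<longrightarrow> e \<subseteq> Skel (Suc k) \<and> \<not> e \<subseteq> Skel k)" for l
    unfolding E unfolding Sk ball_simps(9) swap_image_subset_iff ..
  show ?thesis
  proof (intro equalityI subsetI)
    fix l
    assume l: "l \<in> S.LL k"
    then obtain l0 where l0: "l0 \<in> LE Eg (frontier Bx)" "l = swap_image l0" unfolding S.LL_def L by blast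
    then have "l0 \<in> LL k" using l P[of l0] by (simp add: S.LL_def LL_def)
    then show "l \<in> swap_image ` LL k" using l0(2) by blast
  next
    fix l
    assume "l \<in> swap_image ` LL k"
    then obtain l0 where l0: "l0 \<in> LL k" "l = swap_image l0" by blast
    then have "l \<in> LE S.Eg (frontier S.Bx)" unfolding L LL_def by blast
    then show "l \<in> S.LL k" using l0 P[of l0] by (simp add: S.LL_def LL_def)
  qed
qed

lemma level_ledges_LL:
  assumes T: "\<And>j. j \<le> n \<Longrightarrow> T j = mesh j" and k: "k < n"
  shows "level_ledges T n (Suc k) = LL k"
proof -
  have E: "mesh_edges (T n) = Eg" using T skeleton_mesh vertices_mesh by (simp add: mesh_edges_Edg)
  have I: "interior_ledges (T n) = LE Eg (frontier Bx)"
    unfolding interior_ledges_LE E using T domain_mesh Bx by simp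
  have sk: "skeleton (T j) = Skel j" if "j \<le> n" for j using T skeleton_mesh that by simp
  have "edge_level T e = Suc k \<longleftrightarrow> e \<subseteq> Skel (Suc k) \<and> \<not> e \<subseteq> Skel k" if e: "e \<in> Eg" for e
  proof
    assume l: "edge_level T e = Suc k"
    have "e \<subseteq> skeleton (T n)" using e sk[of n] by (auto simp: Edg_def)
    then have "e \<subseteq> skeleton (T (edge_level T e))" unfolding edge_level_def by (rule LeastI)
    moreover have "\<not> e \<subseteq> skeleton (T k)" by (rule not_less_Least) (use l in \<open>simp add: edge_level_def\<close>)
    ultimately show "e \<subseteq> Skel (Suc k) \<and> \<not> e \<subseteq> Skel k" using l sk k by simp
  next
    assume e: "e \<subseteq> Skel (Suc k) \<and> \<not> e \<subseteq> Skel k"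
    show "edge_level T e = Suc k" unfolding edge_level_def
    proof (rule Least_equality)
      show "e \<subseteq> skeleton (T (Suc k))" using e sk k by simp
      fix j
      assume j: "e \<subseteq> skeleton (T j)"
      show "Suc k \<le> j"
      proof (rule ccontr)
        assume "\<not> Suc k \<le> j"
        then have "e \<subseteq> Skel j" "j \<le> k" using j sk k by auto
        then show False using e Skel_mono by blast
      qed
    qed
  qed
  then show ?thesis unfolding level_ledges_def E I LL_def by blast
qed

lemma fine_cell:
  assumes "k \<le> n" "j < M * 2 ^ n"
  shows "{dy ys n j..dy ys n (Suc j)} \<subseteq> {dy ys k (anc n k j)..dy ys k (anc n k j + 1)}"
proof -
  define b where "b = anc n k j"
  then have b: "b * 2 ^ (n - k) \<le> j" "Suc j \<le> (b + 1) * 2 ^ (n - k)" using anc_eq_iff[of n k j b] by auto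
  have "b * 2 ^ (n - k) < M * 2 ^ n" using b assms by simp
  also have "M * 2 ^ n = (M * 2 ^ k) * 2 ^ (n - k)" using assms(1) by (simp add: power_add[symmetric])
  finally have "b < M * 2 ^ k" by simp
  then have "(b + 1) * 2 ^ (n - k) \<le> M * 2 ^ n" using dm.row_range assms(1) by blast
  then have "dy ys n (b * 2 ^ (n - k)) \<le> dy ys n j" "dy ys n (Suc j) \<le> dy ys n ((b + 1) * 2 ^ (n - k))"
    using b assms(2) by (auto intro!: dm.Y.t_mono simp del: mult_Suc add_mult_distrib)
  then show ?thesis unfolding b_def[symmetric] dy_fine[OF assms(1)] by auto
qed

text \<open>The midpoint of a fine interval lies on no horizontal grid line, hence on a vertical
  line of the grid of level \<open>k\<close>, and these have indices divisible by
  \<open>2 ^ (n - k)\<close>.\<close>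

lemma midpoint_Skel:
  assumes "k \<le> n" "i \<le> N * 2 ^ n" "t < M * 2 ^ n" "(dy xs n i, (dy ys n t + dy ys n (Suc t)) / 2) \<in> Skel k"
  shows "2 ^ (n - k) dvd i"
proof -
  interpret G: grid "dy xs k" "dy ys k" "N * 2 ^ k" "M * 2 ^ k" "vs k" "hs k" by (rule grid_level)
  define v where "v = (dy ys n t + dy ys n (Suc t)) / 2"
  have v: "dy ys n t < v" "v < dy ys n (Suc t)" using dm.Y.t_Suc[OF assms(3)] by (auto simp: v_def)
  have fine: "q * 2 ^ (n - k) \<le> P * 2 ^ n" if "q \<le> P * 2 ^ k" for q P :: nat
  proof -
    have "q * 2 ^ (n - k) \<le> (P * 2 ^ k) * 2 ^ (n - k)" using that by (rule mult_right_mono) simp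
    also have "\<dots> = P * 2 ^ n" using assms(1) by (simp add: power_add[symmetric])
    finally show ?thesis .
  qed
  consider i' j where "vs k i' j" "dy xs n i = dy xs k i'" | i' j where "hs k i' j" "v = dy ys k j"
    using assms(4) unfolding G.Sk_def v_def by auto
  then show ?thesis
  proof cases
    case (1 i' j)
    then have "i' * 2 ^ (n - k) \<le> N * 2 ^ n" using fine G.vs_range by blast
    then have "i = i' * 2 ^ (n - k)"
      using 1(2) dm.X.t_eq_iff[OF assms(2), of "i' * 2 ^ (n - k)"] unfolding dy_fine[OF assms(1)] by blast
    then show ?thesis by simp
  next
    case (2 i' j)
    then have r: "j * 2 ^ (n - k) \<le> M * 2 ^ n" using fine G.hs_range by blast
    have "v = dy ys n (j * 2 ^ (n - k))" using 2(2) dy_fine[OF assms(1), of ys j] by simp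
    then have "t < j * 2 ^ (n - k)" "j * 2 ^ (n - k) < Suc t"
      using v dm.Y.t_less_iff[of t "j * 2 ^ (n - k)"] dm.Y.t_less_iff[of "j * 2 ^ (n - k)" "Suc t"] r assms(3) by auto
    then show ?thesis by simp
  qed
qed

lemma line_Skel:
  assumes k: "k \<le> n" and run: "\<forall>t\<in>{c..<d}. vs n (q * 2 ^ (n - k)) t" "c < d"
  shows "grid.vE (dy xs n) (dy ys n) (q * 2 ^ (n - k)) c d \<subseteq> Skel k"
proof
  interpret G: grid "dy xs n" "dy ys n" "N * 2 ^ n" "M * 2 ^ n" "vs n" "hs n" by (rule grid_level)
  interpret G': grid "dy xs k" "dy ys k" "N * 2 ^ k" "M * 2 ^ k" "vs k" "hs k" by (rule grid_level)
  fix p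
  assume "p \<in> G.vE (q * 2 ^ (n - k)) c d"
  then obtain v where p: "p = (dy xs k q, v)" "v \<in> {dy ys n c..dy ys n d}" using dy_fine[OF k] by (auto simp: G.vE_def)
  obtain t where t: "t \<in> {c..<d}" "v \<in> {dy ys n t..dy ys n (Suc t)}" using dm.Y.t_between[OF run(2) p(2)] by blast
  have "vs n (q * 2 ^ (n - k)) t" using run t by blast
  then have "vs k q (anc n k t)" "t < M * 2 ^ n" using vs_fine[OF k] G.vs_range by blast+
  moreover from this have "v \<in> {dy ys k (anc n k t)..dy ys k (Suc (anc n k t))}" using fine_cell[OF k, of t] t(2) by auto
  ultimately show "p \<in> Skel k" unfolding p G'.Sk_def by blast
qed

text \<open>An edge on the vertical line \<open>i\<close> lies in \<open>Skel j\<close> exactly when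
  \<open>2 ^ (n - j)\<close> divides \<open>i\<close>. So level \<open>Suc k\<close> means 2-adic
  valuation \<open>n - Suc k\<close>, which says that \<open>i\<close> is a midline of level
  \<open>k\<close>.\<close>

lemma LL_vert:
  assumes k: "k < n"
  shows "l \<in> LL k \<and> vert l \<longleftrightarrow> (\<exists>a c d. grid.vline (N * 2 ^ n) (vs n) (mid n k a) c d \<and>
    l = grid.vE (dy xs n) (dy ys n) (mid n k a) c d)"
proof -
  interpret G: grid "dy xs n" "dy ys n" "N * 2 ^ n" "M * 2 ^ n" "vs n" "hs n" by (rule grid_level)
  have on: "e \<subseteq> Skel j \<longleftrightarrow> 2 ^ (n - j) dvd i" if "j \<le> n" "G.vedge i c d" "e = G.vE i c d" for e j i c d
  proof
    assume s: "e \<subseteq> Skel j"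
    have cd: "c < d" "vs n i c" "i \<le> N * 2 ^ n" "d \<le> M * 2 ^ n" using that(2) G.vertex_range by (auto simp: G.vedge_def)
    then have c: "c < M * 2 ^ n" by simp
    have "dy ys n (Suc c) \<le> dy ys n d" using cd by (intro dm.Y.t_mono) auto
    then have "(dy xs n i, (dy ys n c + dy ys n (Suc c)) / 2) \<in> e" using G.mid_between[OF c] unfolding that(3) G.vE_def by auto
    then show "2 ^ (n - j) dvd i" using midpoint_Skel[OF that(1) cd(3) c] s by blast
  next
    assume "2 ^ (n - j) dvd i"
    then obtain q where "i = q * 2 ^ (n - j)" by (metis dvd_def mult.commute)
    then show "e \<subseteq> Skel j" using line_Skel[OF that(1), of c d q] that(2,3) by (simp add: G.vedge_def)
  qed
  show ?thesis
  proof
    assume A: "l \<in> LL k \<and> vert l"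
    then obtain i c d where l: "G.vline i c d" "l = G.vE i c d"
      using iffD1[OF G.LE_vert, of l] by (simp add: LL_def) blast
    have "c < d" using l(1) by (auto simp: G.vline_def)
    then obtain c' d' where e: "G.vedge i c' d'" "c \<le> c'" "d' \<le> d" using G.vedge_at[OF G.vline_vrun[OF l(1)], of c] by auto
    have r: "c < d" "d \<le> M * 2 ^ n" "i \<le> N * 2 ^ n" "c' < d'" using G.vrun_range[OF G.vline_vrun[OF l(1)]] e l(1)
      by (auto simp: G.vline_def G.vedge_def)
    have "d' \<le> M * 2 ^ n" using e r by simp
    then have "G.vE i c' d' \<subseteq> l" unfolding l(2) using G.vE_subset_iff[of c' d' c d i i] r e by blast
    moreover have "G.vE i c' d' \<in> Eg" using iffD2[OF G.Edg_vert] e(1) by blast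
    ultimately have "G.vE i c' d' \<subseteq> Skel (Suc k) \<and> \<not> G.vE i c' d' \<subseteq> Skel k" using A by (simp add: LL_def)
    then have lev: "2 ^ (n - Suc k) dvd i" "\<not> 2 ^ (n - k) dvd i"
      using on[OF _ e(1) refl, of "Suc k"] on[OF _ e(1) refl, of k] k by simp_all
    then obtain q where q: "i = q * 2 ^ (n - Suc k)" by (metis dvd_def mult.commute)
    have "odd q"
    proof
      assume "even q"
      then obtain a where "q = 2 * a" by blast
      then have "i = 2 ^ (n - k) * a" using q pow_split[OF k] by simp
      then show False using lev by simp
    qed
    then obtain a where "q = 2 * a + 1" by (elim oddE)
    then have "i = mid n k a" using q by (simp add: mid_def)
    then show "\<exists>a c d. G.vline (mid n k a) c d \<and> l = G.vE (mid n k a) c d" using l by blast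
  next
    assume "\<exists>a c d. G.vline (mid n k a) c d \<and> l = G.vE (mid n k a) c d"
    then obtain a c d where l: "G.vline (mid n k a) c d" "l = G.vE (mid n k a) c d" by blast
    then have LEl: "l \<in> LE Eg (frontier Bx)" "vert l" using iffD2[OF G.LE_vert, of l] by blast+
    have r: "c < d" "d \<le> M * 2 ^ n" "mid n k a \<le> N * 2 ^ n" using G.vrun_range[OF G.vline_vrun[OF l(1)]] l(1)
      by (auto simp: G.vline_def)
    have "e \<subseteq> Skel (Suc k) \<and> \<not> e \<subseteq> Skel k" if e: "e \<in> Eg" "e \<subseteq> l" for e
    proof -
      have "swap_image e \<subseteq> swap_image l" using e(2) by (rule image_mono)
      then have "\<not> vert (swap_image e)" using G.LE_vert_or[OF LEl(1)] LEl(2) vert_mono by meson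
      then have "vert e" using G.Edg_vert_or[OF e(1)] by blast
      then obtain i' c' d' where e': "G.vedge i' c' d'" "e = G.vE i' c' d'" using iffD1[OF G.Edg_vert, of e] e(1) by auto
      then have "c' < d'" "G.vertex i' d'" unfolding G.vedge_def by simp_all
      then have r': "c' < d'" "d' \<le> M * 2 ^ n" "i' \<le> N * 2 ^ n" using G.vertex_range[of i' d'] by simp_all
      have "G.vE i' c' d' \<subseteq> G.vE (mid n k a) c d" using e(2) e'(2) l(2) by simp
      then have "i' = mid n k a" using G.vE_subset_iff[OF r'(1,2) r(1,2) r'(3) r(3)] by simp
      moreover have "\<not> 2 ^ (n - k) dvd mid n k a"
      proof
        assume "2 ^ (n - k) dvd mid n k a"
        then have "2 * 2 ^ (n - Suc k) dvd (2 * a + 1) * (2::nat) ^ (n - Suc k)" unfolding mid_def pow_split[OF k] .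
        then have "2 dvd 2 * a + 1" using dvd_times_right_cancel_iff[of "2 ^ (n - Suc k)" 2 "2 * a + 1"] by simp
        then show False by simp
      qed
      moreover have "2 ^ (n - Suc k) dvd mid n k a" by (simp add: mid_def)
      ultimately show ?thesis using on[OF _ e', of "Suc k"] on[OF _ e', of k] k by simp
    qed
    then show "l \<in> LL k \<and> vert l" using LEl by (simp add: LL_def)
  qed
qed

lemma dy_mid_Suc: "k < n \<Longrightarrow> dy xs n (mid n k a) = dy xs (Suc k) (2 * a + 1)"
  using dy_fine[of "Suc k" n xs "2 * a + 1"] by (simp only: mid_def Suc_le_eq)

lemma level_index: "k \<le> n \<Longrightarrow> b \<le> P * 2 ^ k \<Longrightarrow> b * 2 ^ (n - k) \<le> P * 2 ^ n" for P :: nat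
proof -
  assume k: "k \<le> n" and "b \<le> P * 2 ^ k"
  then have "b * 2 ^ (n - k) \<le> (P * 2 ^ k) * 2 ^ (n - k)" by (intro mult_right_mono) auto
  also have "\<dots> = P * 2 ^ n" using k by (simp add: power_add[symmetric])
  finally show ?thesis .
qed

text \<open>On a midline of level \<open>k\<close> the presence of a unit segment depends only on
  the cell of level \<open>k\<close> around it, so a maximal line is made of whole cells.\<close>

lemma run_cover:
  assumes k: "k < n" and l: "grid.vline (N * 2 ^ n) (vs n) (mid n k a) c d" and t: "c \<le> t" "t < d" and b: "b = anc n k t"
  shows "(a, b) \<in> D k" "c \<le> b * 2 ^ (n - k)" "(b + 1) * 2 ^ (n - k) \<le> d"
proof -
  interpret G: grid "dy xs n" "dy ys n" "N * 2 ^ n" "M * 2 ^ n" "vs n" "hs n" by (rule grid_level)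
  have v: "\<forall>j\<in>{c..<d}. vs n (mid n k a) j" "\<not> (0 < c \<and> vs n (mid n k a) (c - 1))" "\<not> vs n (mid n k a) d"
    using l unfolding G.vline_def by blast+
  show D': "(a, b) \<in> D k" using v(1) t vs_mid[OF k] b by auto
  have tb: "b * 2 ^ (n - k) \<le> t" "t < (b + 1) * 2 ^ (n - k)" using anc_eq_iff[of n k t b] b by auto
  have in_run: "vs n (mid n k a) s" if "b * 2 ^ (n - k) \<le> s" "s < (b + 1) * 2 ^ (n - k)" for s
    using vs_mid[OF k, of a s] anc_eq_iff[of n k s b] that D' by auto
  show "c \<le> b * 2 ^ (n - k)"
  proof (rule ccontr)
    assume "\<not> c \<le> b * 2 ^ (n - k)"
    then have "0 < c" "b * 2 ^ (n - k) \<le> c - 1" by auto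
    then show False using in_run[of "c - 1"] v(2) t tb by linarith
  qed
  show "(b + 1) * 2 ^ (n - k) \<le> d"
  proof (rule ccontr)
    assume "\<not> (b + 1) * 2 ^ (n - k) \<le> d"
    then show False using in_run[of d] v(3) t tb by linarith
  qed
qed

lemma vert_line_exists:
  assumes D': "\<forall>b\<in>{b1..b2}. (a, b) \<in> D k" and b: "b1 \<le> b2"
  shows "\<exists>l\<in>LL k. {dy xs (Suc k) (2 * a + 1)} \<times> {dy ys k b1..dy ys k (b2 + 1)} \<subseteq> l"
proof -
  interpret G: grid "dy xs n" "dy ys n" "N * 2 ^ n" "M * 2 ^ n" "vs n" "hs n" by (rule grid_level)
  have D1: "(a, b1) \<in> D k" using D' b by simp
  then have k: "k < n" and a: "a < N * 2 ^ k" using D_less_n D_range by auto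
  define c d where "c = b1 * 2 ^ (n - k)" and "d = (b2 + 1) * 2 ^ (n - k)"
  have "vs n (mid n k a) t" if "t \<in> {c..<d}" for t
  proof -
    have "b1 \<le> anc n k t" "anc n k t < b2 + 1"
      using that unfolding c_def d_def anc_def by (auto simp: less_mult_imp_div_less less_eq_div_iff_mult_less_eq)
    then show ?thesis using D' vs_mid[OF k] by auto
  qed
  moreover have "c < d" unfolding c_def d_def by (rule mult_strict_right_mono) (use b in auto)
  ultimately obtain c' d' where l: "G.vline (mid n k a) c' d'" "c' \<le> c" "d \<le> d'"
    using G.vline_extends[of "mid n k a" c d] mid_less[OF k a] by auto
  have r: "d' \<le> M * 2 ^ n" using G.vrun_range[OF G.vline_vrun[OF l(1)]] by simp
  have "G.vE (mid n k a) c' d' \<in> LL k" using iffD2[OF LL_vert[OF k]] l(1) by blast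
  moreover have "{dy xs (Suc k) (2 * a + 1)} \<times> {dy ys k b1..dy ys k (b2 + 1)} \<subseteq> G.vE (mid n k a) c' d'"
    using dm.Y.t_mono[OF l(2)] dm.Y.t_mono[OF l(3) r] \<open>c < d\<close> l(3) r dy_mid_Suc[OF k, of a] dy_fine[of k n ys b1] dy_fine[of k n ys "b2 + 1"] k
    by (auto simp: G.vE_def c_def d_def)
  ultimately show ?thesis by blast
qed

lemma interior_cel: "interior (region (cel k a b)) = {dy xs k a<..<dy xs k (a + 1)} \<times> {dy ys k b<..<dy ys k (b + 1)}"
  by (simp add: region_cellof interior_Times)

text \<open>A cell of \<open>mesh k\<close> of a lower level is undivided, but if its interior meets
  the line it is an ancestor of a divided cell of level \<open>k\<close>, which is impossible. So
  the cell has level \<open>k\<close> and is itself one of those that the line crosses.\<close>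

lemma vert_line_divides:
  assumes l: "l \<in> LL k" "vert l" and k: "k < n" and \<psi>: "\<psi> \<in> mesh k" and m: "l \<inter> interior (region \<psi>) \<noteq> {}"
  shows "\<exists>a b. (a, b) \<in> D k \<and> \<psi> = cel k a b \<and> {dy xs (Suc k) (2 * a + 1)} \<times> {dy ys k b..dy ys k (b + 1)} \<subseteq> l"
proof -
  interpret G: grid "dy xs n" "dy ys n" "N * 2 ^ n" "M * 2 ^ n" "vs n" "hs n" by (rule grid_level)
  obtain a c d where v: "G.vline (mid n k a) c d" "l = G.vE (mid n k a) c d" using iffD1[OF LL_vert[OF k]] l by blast
  have r: "c < d" "d \<le> M * 2 ^ n" "mid n k a \<le> N * 2 ^ n" using G.vrun_range[OF G.vline_vrun[OF v(1)]] v(1)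
    by (auto simp: G.vline_def)
  obtain j a' b' where j: "\<psi> = cel j a' b'" "j \<le> k" "(a', b') \<in> L j" "j < k \<longrightarrow> (a', b') \<notin> D j"
    using \<psi> unfolding meshof_def by blast
  have jn: "j \<le> n" using j k by simp
  have rg: "a' < N * 2 ^ j" "b' < M * 2 ^ j" using L_range j(3) by auto
  have fx: "a' * 2 ^ (n - j) \<le> N * 2 ^ n" "(a' + 1) * 2 ^ (n - j) \<le> N * 2 ^ n"
    and fy: "b' * 2 ^ (n - j) \<le> M * 2 ^ n" "(b' + 1) * 2 ^ (n - j) \<le> M * 2 ^ n"
    using rg by (auto intro!: level_index[OF jn] simp del: mult_Suc add_mult_distrib)
  obtain p where p: "p \<in> l" "p \<in> interior (region \<psi>)" using m by blast
  define w where "w = snd p"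
  have w: "dy xs n (mid n k a) \<in> {dy xs j a'<..<dy xs j (a' + 1)}" "w \<in> {dy ys j b'<..<dy ys j (b' + 1)}" "w \<in> {dy ys n c..dy ys n d}"
    using p unfolding v(2) j(1) interior_cel G.vE_def w_def by auto
  obtain t where t: "t \<in> {c..<d}" "w \<in> {dy ys n t..dy ys n (Suc t)}" using dm.Y.t_between[OF r(1) w(3)] by blast
  have "a' * 2 ^ (n - j) < mid n k a" "mid n k a < (a' + 1) * 2 ^ (n - j)"
    using w(1) unfolding dy_fine[OF jn, symmetric]
    using dm.X.t_less_iff[OF fx(1) r(3)] dm.X.t_less_iff[OF r(3) fx(2)] by simp_all
  then have ax: "anc n j (mid n k a) = a'" unfolding anc_eq_iff by simp
  have "dy ys n (b' * 2 ^ (n - j)) < dy ys n (Suc t)" "dy ys n t < dy ys n ((b' + 1) * 2 ^ (n - j))"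
    using w(2) t(2) unfolding dy_fine[OF jn] by auto
  then have "b' * 2 ^ (n - j) < Suc t" "t < (b' + 1) * 2 ^ (n - j)"
    using dm.Y.t_less_iff[OF fy(1), of "Suc t"] dm.Y.t_less_iff[of t, OF _ fy(2)] t(1) r by auto
  then have by': "anc n j t = b'" unfolding anc_eq_iff by simp
  define b where "b = anc n k t"
  note cov = run_cover[OF k v(1) _ _ b_def]
  have D': "(a, b) \<in> D k" "c \<le> b * 2 ^ (n - k)" "(b + 1) * 2 ^ (n - k) \<le> d" using cov t(1) by auto
  have "j = k"
  proof (rule ccontr)
    assume "j \<noteq> k"
    then have jk: "j < k" using j by simp
    have "a div 2 ^ (k - j) = a'" "b div 2 ^ (k - j) = b'"
      using anc_anc[of j k n "mid n k a"] anc_anc[of j k n t] jk k ax by' anc_mid[OF k, of a] by (auto simp: b_def)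
    then show False using D_anc'[OF D'(1), of j] jk j(4) by simp
  qed
  then have "a' = a" "b' = b" using ax by' anc_mid[OF k, of a] by (auto simp: b_def)
  moreover have "{dy xs (Suc k) (2 * a + 1)} \<times> {dy ys k b..dy ys k (b + 1)} \<subseteq> l"
    using dm.Y.t_mono[OF D'(2)] dm.Y.t_mono[OF D'(3) r(2)] r(2) D'(3) dy_mid_Suc[OF k, of a] dy_fine[of k n ys b] dy_fine[of k n ys "b + 1"] k
    by (auto simp: G.vE_def v(2))
  ultimately show ?thesis using D'(1) j(1) \<open>j = k\<close> by blast
qed

text \<open>It suffices to touch the closed cell. Midlines of other columns stay away from it, so
  the line runs in column \<open>a\<close>, through the cell itself or the one above or below; as
  these two are undivided, it covers the height of the cell and nothing more.\<close>

lemma vert_line_iso: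
  assumes l: "l \<in> LL k" "vert l" and iso: "(a, b) \<in> iso k" and m: "l \<inter> region (cel k a b) \<noteq> {}"
  shows "l \<subseteq> region (cel k a b)"
proof -
  interpret G: grid "dy xs n" "dy ys n" "N * 2 ^ n" "M * 2 ^ n" "vs n" "hs n" by (rule grid_level)
  have ab: "(a, b) \<in> D k" and nb: "(a + 1, b) \<notin> D k" "(a, b - 1) \<notin> D k" "(a, b + 1) \<notin> D k" and b0: "0 < b"
    using iso by (auto simp: iso_def)
  have k: "k < n" and rg: "a < N * 2 ^ k" "b < M * 2 ^ k" using D_less_n D_range ab by auto
  then have kn: "k \<le> n" by simp
  obtain a' c d where v: "G.vline (mid n k a') c d" "l = G.vE (mid n k a') c d" using iffD1[OF LL_vert[OF k]] l by blast
  have r: "c < d" "d \<le> M * 2 ^ n" "mid n k a' \<le> N * 2 ^ n" using G.vrun_range[OF G.vline_vrun[OF v(1)]] v(1)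
    by (auto simp: G.vline_def)
  have fx: "a * 2 ^ (n - k) \<le> N * 2 ^ n" "(a + 1) * 2 ^ (n - k) \<le> N * 2 ^ n"
    and fy: "b * 2 ^ (n - k) \<le> M * 2 ^ n" "(b + 1) * 2 ^ (n - k) \<le> M * 2 ^ n"
    using rg by (auto intro!: level_index[OF kn] simp del: mult_Suc add_mult_distrib)
  obtain p where p: "p \<in> l" "p \<in> region (cel k a b)" using m by blast
  define w where "w = snd p"
  have w: "dy xs n (mid n k a') \<in> {dy xs k a..dy xs k (a + 1)}" "w \<in> {dy ys k b..dy ys k (b + 1)}" "w \<in> {dy ys n c..dy ys n d}"
    using p unfolding v(2) region_cellof G.vE_def w_def by auto
  obtain t where t: "t \<in> {c..<d}" "w \<in> {dy ys n t..dy ys n (Suc t)}" using dm.Y.t_between[OF r(1) w(3)] by blast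
  have m1: "a * 2 ^ (n - k) \<le> mid n k a'" "mid n k a' \<le> (a + 1) * 2 ^ (n - k)"
    using w(1) unfolding dy_fine[OF kn, symmetric]
    using dm.X.t_le_iff[OF fx(1) r(3)] dm.X.t_le_iff[OF r(3) fx(2)] by simp_all
  have m2: "a' * 2 ^ (n - k) \<le> mid n k a' - 1" "mid n k a' < (a' + 1) * 2 ^ (n - k)"
    using anc_mid_pred[OF k, of a'] anc_mid[OF k, of a'] unfolding anc_eq_iff by auto
  have "a * 2 ^ (n - k) < (a' + 1) * 2 ^ (n - k)" using m1 m2 by linarith
  moreover have "a' * 2 ^ (n - k) < (a + 1) * 2 ^ (n - k)" using m1 m2 mid_pos[of n k a'] by linarith
  ultimately have a': "a' = a" unfolding mult_less_cancel2 by simp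
  note cov = run_cover[OF k v(1)[unfolded a']]
  have "dy ys n (b * 2 ^ (n - k)) \<le> dy ys n (Suc t)" "dy ys n t \<le> dy ys n ((b + 1) * 2 ^ (n - k))"
    using w(2) t(2) unfolding dy_fine[OF kn] by auto
  then have tb: "b * 2 ^ (n - k) \<le> Suc t" "t \<le> (b + 1) * 2 ^ (n - k)"
    using dm.Y.t_le_iff[OF fy(1), of "Suc t"] dm.Y.t_le_iff[of t, OF _ fy(2)] t(1) r by auto
  define s where "s = anc n k t"
  have st: "s * 2 ^ (n - k) \<le> t" "t < (s + 1) * 2 ^ (n - k)" using anc_eq_iff[of n k t s] s_def by auto
  have "b * 2 ^ (n - k) \<le> (s + 1) * 2 ^ (n - k)" "s * 2 ^ (n - k) \<le> (b + 1) * 2 ^ (n - k)" using st tb by linarith+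
  then have sb: "b \<le> s + 1" "s \<le> b + 1" unfolding mult_le_cancel2 by simp_all
  have "(a, s) \<in> D k" using cov(1)[of t s] t(1) s_def by simp
  then have "s \<noteq> b + 1" "s \<noteq> b - 1" using nb by auto
  then have "s = b" using sb by linarith
  then have cd: "c \<le> b * 2 ^ (n - k)" "(b + 1) * 2 ^ (n - k) \<le> d" using cov(2,3)[of t b] t(1) s_def by auto
  have "c = b * 2 ^ (n - k)"
  proof (rule ccontr)
    define p where "p = b * 2 ^ (n - k)"
    assume "c \<noteq> b * 2 ^ (n - k)"
    then have c: "c \<le> p - 1" "p - 1 < d" using cd by (auto simp: p_def)
    have "p = (b - 1) * 2 ^ (n - k) + 2 ^ (n - k)" using b0 by (simp add: p_def mult_eq_if)
    moreover have "0 < (2::nat) ^ (n - k)" "b - 1 + 1 = b" using b0 by simp_all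
    ultimately have "anc n k (p - 1) = b - 1" unfolding anc_eq_iff p_def[symmetric] by (simp only: p_def[symmetric]) linarith
    then show False using cov(1)[OF c] nb by simp
  qed
  moreover have "d = (b + 1) * 2 ^ (n - k)"
  proof (rule ccontr)
    assume "d \<noteq> (b + 1) * 2 ^ (n - k)"
    then have c: "c \<le> (b + 1) * 2 ^ (n - k)" "(b + 1) * 2 ^ (n - k) < d" using cd by auto
    have "anc n k ((b + 1) * 2 ^ (n - k)) = b + 1" unfolding anc_def by (rule nonzero_mult_div_cancel_right) simp
    then show False using cov(1)[OF c] nb by simp
  qed
  ultimately have e: "{dy ys n c..dy ys n d} = {dy ys k b..dy ys k (b + 1)}" by (simp only: dy_fine[OF kn])
  show ?thesis unfolding v(2) region_cellof G.vE_def e using w(1) by (intro Sigma_mono) simp_all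
qed

text \<open>The new segments of a divided cell cross at its centre, which therefore serves as the
  witness for the cells that an l-edge divides.\<close>

definition ctr :: "nat \<Rightarrow> nat \<Rightarrow> nat \<Rightarrow> point" where
  "ctr k a b = (dy xs (Suc k) (2 * a + 1), dy ys (Suc k) (2 * b + 1))"

lemma ctr_swp: "hmesh.ctr ys xs k b a = prod.swap (ctr k a b)"
proof -
  interpret S: hmesh M N n "swp D" ys xs by (rule hmesh_swp)
  show ?thesis by (simp add: ctr_def S.ctr_def)
qed

lemma ctr_strict:
  assumes "(a, b) \<in> L k"
  shows "dy xs k a < dy xs (Suc k) (2 * a + 1)" "dy xs (Suc k) (2 * a + 1) < dy xs k (a + 1)"
    "dy ys k b < dy ys (Suc k) (2 * b + 1)" "dy ys (Suc k) (2 * b + 1) < dy ys k (b + 1)"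
  using cel_strict[OF assms] unfolding dy_odd by (simp_all add: field_simps)

lemma ctr_interior: "(a, b) \<in> L k \<Longrightarrow> ctr k a b \<in> interior (region (cel k a b))"
  using ctr_strict[of a b k] by (simp add: ctr_def interior_cel)

lemma ctr_region:
  assumes "ctr k a' b' \<in> region (cel k a b)" "(a, b) \<in> L k" "(a', b') \<in> L k"
  shows "a' = a \<and> b' = b"
proof -
  interpret X: knots "dy xs k" "N * 2 ^ k" by (rule knots_x)
  interpret Y: knots "dy ys k" "M * 2 ^ k" by (rule knots_y)
  have r: "a < N * 2 ^ k" "b < M * 2 ^ k" "a' < N * 2 ^ k" "b' < M * 2 ^ k" using L_range assms(2,3) by blast+
  note c = ctr_strict[OF assms(3)]
  have "dy xs k a' < dy xs k (a + 1)" "dy xs k a < dy xs k (a' + 1)" "dy ys k b' < dy ys k (b + 1)" "dy ys k b < dy ys k (b' + 1)"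
    using c assms(1) unfolding region_cellof ctr_def mem_Times_iff atLeastAtMost_iff fst_conv snd_conv by linarith+
  then have "a' < a + 1" "a < a' + 1" "b' < b + 1" "b < b' + 1"
    using X.t_less_iff[of a' "a + 1"] X.t_less_iff[of a "a' + 1"] Y.t_less_iff[of b' "b + 1"] Y.t_less_iff[of b "b' + 1"] r by auto
  then show ?thesis by simp
qed

lemma region_swp: "region (cellof ys xs k b a) = swap_image (region (cel k a b))"
  by (auto simp: region_cellof)

lemma interior_swp: "interior (region (cellof ys xs k b a)) = swap_image (interior (region (cel k a b)))"
proof -
  interpret S: hmesh M N n "swp D" ys xs by (rule hmesh_swp)
  show ?thesis unfolding interior_cel S.interior_cel by auto
qed

lemma swap_disjoint: "swap_image A \<inter> swap_image B \<noteq> {} \<longleftrightarrow> A \<inter> B \<noteq> {}"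
  by (auto simp: image_iff)

lemma swap_mem: "prod.swap p \<in> swap_image A \<longleftrightarrow> p \<in> A"
  by (metis image_eqI imageE swap_swap)

lemma LL_cases: "l \<in> LL k \<Longrightarrow> vert l \<or> (swap_image l \<in> hmesh.LL M N n (swp D) ys xs k \<and> vert (swap_image l))"
proof -
  interpret G: grid "dy xs n" "dy ys n" "N * 2 ^ n" "M * 2 ^ n" "vs n" "hs n" by (rule grid_level)
  assume "l \<in> LL k"
  then show ?thesis unfolding LL_swp using G.LE_vert_or[of l] by (auto simp: LL_def)
qed

lemma line_divides:
  assumes l: "l \<in> LL k" and k: "k < n" and \<psi>: "\<psi> \<in> mesh k" and m: "l \<inter> interior (region \<psi>) \<noteq> {}"
  shows "\<exists>a b. (a, b) \<in> D k \<and> \<psi> = cel k a b \<and> ctr k a b \<in> l"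
proof -
  show ?thesis
  proof (cases "vert l")
    case True
    obtain a b where ab: "(a, b) \<in> D k" "\<psi> = cel k a b" "{dy xs (Suc k) (2 * a + 1)} \<times> {dy ys k b..dy ys k (b + 1)} \<subseteq> l"
      using vert_line_divides[OF l True k \<psi> m] by blast
    have "ctr k a b \<in> {dy xs (Suc k) (2 * a + 1)} \<times> {dy ys k b..dy ys k (b + 1)}"
      using ctr_strict[OF subsetD[OF D_L ab(1)]] by (simp add: ctr_def)
    from subsetD[OF ab(3) this] show ?thesis using ab(1,2) by blast
  next
    case False
    interpret S: hmesh M N n "swp D" ys xs by (rule hmesh_swp)
    have l': "swap_image l \<in> S.LL k" "vert (swap_image l)" using LL_cases[OF l] False by auto
    obtain j a' b' where j: "\<psi> = cel j a' b'" "j \<le> k" "(a', b') \<in> L j" "j < k \<longrightarrow> (a', b') \<notin> D j"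
      using \<psi> unfolding meshof_def by blast
    have "S.cel j b' a' \<in> S.mesh k" unfolding meshof_def using j swp_L[of b' a' j] swp_iff[of b' a' D j] by blast
    moreover have "swap_image l \<inter> interior (region (S.cel j b' a')) \<noteq> {}"
      using m unfolding interior_swp j(1) swap_disjoint .
    ultimately obtain b a where ab: "(b, a) \<in> swp D k" "S.cel j b' a' = S.cel k b a"
      "{dy ys (Suc k) (2 * b + 1)} \<times> {dy xs k a..dy xs k (a + 1)} \<subseteq> swap_image l"
      using S.vert_line_divides[OF l' k] by blast
    have D': "(a, b) \<in> D k" using ab(1) by simp
    have "S.ctr k b a \<in> {dy ys (Suc k) (2 * b + 1)} \<times> {dy xs k a..dy xs k (a + 1)}"
      using ctr_strict[OF subsetD[OF D_L D']] by (simp add: S.ctr_def)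
    from subsetD[OF ab(3) this] have "S.ctr k b a \<in> swap_image l" .
    then have "ctr k a b \<in> l" unfolding ctr_swp swap_mem .
    moreover have "\<psi> = cel k a b" using ab(2) unfolding j(1) by (simp add: cellof_def)
    ultimately show ?thesis using D' by blast
  qed
qed

text \<open>The second part puts two divided cells, one above the other, into the same component. So
  a component that divides a single cell has no divided neighbour next to that cell.\<close>

lemma vert_line_ctr:
  assumes "(a, b) \<in> D k"
  shows "\<exists>l\<in>LL k. ctr k a b \<in> l" and "(a, b + 1) \<in> D k \<Longrightarrow> \<exists>l\<in>LL k. ctr k a b \<in> l \<and> ctr k a (b + 1) \<in> l"
proof -
  have c: "dy ys k b < dy ys (Suc k) (2 * b + 1) \<and> dy ys (Suc k) (2 * b + 1) < dy ys k (b + 1)" if "(a, b) \<in> D k" for b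
    using ctr_strict[of a b k] that D_L by blast
  have "\<forall>b'\<in>{b..b}. (a, b') \<in> D k" using assms by simp
  from vert_line_exists[OF this order.refl] obtain l where l: "l \<in> LL k" "{dy xs (Suc k) (2 * a + 1)} \<times> {dy ys k b..dy ys k (b + 1)} \<subseteq> l" by blast
  have "ctr k a b \<in> {dy xs (Suc k) (2 * a + 1)} \<times> {dy ys k b..dy ys k (b + 1)}" using c[OF assms] by (simp add: ctr_def)
  then have "ctr k a b \<in> l" by (rule subsetD[OF l(2)])
  then show "\<exists>l\<in>LL k. ctr k a b \<in> l" using l(1) by blast
  assume b': "(a, b + 1) \<in> D k"
  have "\<forall>b'\<in>{b..b + 1}. (a, b') \<in> D k" using assms b' by (metis atLeastAtMost_iff le_add1 le_antisym not_less_eq_eq Suc_eq_plus1)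
  from vert_line_exists[OF this] obtain l where l: "l \<in> LL k" "{dy xs (Suc k) (2 * a + 1)} \<times> {dy ys k b..dy ys k (b + 1 + 1)} \<subseteq> l" by auto
  have "{ctr k a b, ctr k a (b + 1)} \<subseteq> {dy xs (Suc k) (2 * a + 1)} \<times> {dy ys k b..dy ys k (b + 1 + 1)}"
    using c[OF assms] c[OF b'] by (simp add: ctr_def)
  from subset_trans[OF this l(2)] show "\<exists>l\<in>LL k. ctr k a b \<in> l \<and> ctr k a (b + 1) \<in> l" using l(1) by simp blast
qed

lemma horizontal_line_ctr:
  assumes "(a, b) \<in> D k" "(a + 1, b) \<in> D k"
  shows "\<exists>l\<in>LL k. ctr k a b \<in> l \<and> ctr k (a + 1) b \<in> l"
proof -
  interpret S: hmesh M N n "swp D" ys xs by (rule hmesh_swp)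
  obtain l where l: "l \<in> S.LL k" "S.ctr k b a \<in> l" "S.ctr k b (a + 1) \<in> l"
    using S.vert_line_ctr(2)[of b a k] assms by auto
  then obtain l0 where "l0 \<in> LL k" "l = swap_image l0" unfolding LL_swp by blast
  then show ?thesis using l(2,3) unfolding ctr_swp by (intro bexI[of _ l0]) (simp_all only: swap_mem simp_thms)
qed

lemma line_iso:
  assumes l: "l \<in> LL k" and iso: "(a, b) \<in> iso k" and m: "l \<inter> region (cel k a b) \<noteq> {}"
  shows "l \<subseteq> region (cel k a b)"
proof (cases "vert l")
  case True
  then show ?thesis using vert_line_iso[OF l _ iso m] by simp
next
  case False
  interpret S: hmesh M N n "swp D" ys xs by (rule hmesh_swp)
  have l': "swap_image l \<in> S.LL k" "vert (swap_image l)" using False LL_cases[OF l] by auto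
  have "(b, a) \<in> S.iso k" using swp_leaf(4) iso by blast
  moreover have "swap_image l \<inter> region (S.cel k b a) \<noteq> {}" using m unfolding region_swp swap_disjoint .
  ultimately have "swap_image l \<subseteq> region (S.cel k b a)" using S.vert_line_iso[OF l'] by blast
  then show ?thesis unfolding region_swp swap_image_subset_iff .
qed

lemma vert_side:
  assumes "(a, b) \<in> L k" "i = a \<or> i = a + 1"
  shows "\<exists>e\<in>Edg (Skel k) (Vert k). e \<subseteq> {dy xs k i} \<times> {dy ys k b..dy ys k (b + 1)}"
proof -
  interpret G: grid "dy xs k" "dy ys k" "N * 2 ^ k" "M * 2 ^ k" "vs k" "hs k" by (rule grid_level)
  have s: "vs k a b" "vs k (a + 1) b" "hs k a b" "hs k a (b + 1)" using vs_sides[OF assms(1)] hs_sides[OF assms(1)] by auto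
  then have "G.vertex i b" "G.vertex i (b + 1)" using assms(2) by (auto simp: G.vertex_def)
  then have "G.vedge i b (b + 1)" using s assms(2) by (auto simp: G.vedge_def)
  then have "G.vE i b (b + 1) \<in> Edg (Skel k) (Vert k)" using iffD2[OF G.Edg_vert] by blast
  then show ?thesis unfolding G.vE_def by blast
qed

lemma horizontal_side:
  assumes "(a, b) \<in> L k" "j = b \<or> j = b + 1"
  shows "\<exists>e\<in>Edg (Skel k) (Vert k). e \<subseteq> {dy xs k a..dy xs k (a + 1)} \<times> {dy ys k j}"
proof -
  interpret S: hmesh M N n "swp D" ys xs by (rule hmesh_swp)
  interpret G: grid "dy xs k" "dy ys k" "N * 2 ^ k" "M * 2 ^ k" "vs k" "hs k" by (rule grid_level)
  have "S.Skel k = swap_image (Skel k)" "S.Vert k = swap_image (Vert k)" using G.swp_sets by simp_all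
  then have E: "Edg (S.Skel k) (S.Vert k) = swap_image ` Edg (Skel k) (Vert k)" by (simp add: Edg_swap)
  have "(b, a) \<in> S.L k" using assms(1) swp_L by blast
  from S.vert_side[OF this assms(2)] obtain e where "e \<in> Edg (Skel k) (Vert k)" "swap_image e \<subseteq> {dy ys k j} \<times> {dy xs k a..dy xs k (a + 1)}"
    unfolding E by blast
  then show ?thesis by (intro bexI[of _ e]) force+
qed

lemma domain_level: "k \<le> n \<Longrightarrow> mesh_domain (mesh k) = {dy xs k 0..dy xs k (N * 2 ^ k)} \<times> {dy ys k 0..dy ys k (M * 2 ^ k)}"
  using domain_mesh dy_fine[of 0 k xs 0] dy_fine[of 0 k xs N] dy_fine[of 0 k ys 0] dy_fine[of 0 k ys M] by simp

text \<open>Each side of the cell contains an edge of the mesh, so an interior cell has no side on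
  the domain boundary. Conversely, if the indices are not extreme, the frontier of the cell and the
  frontier of the domain are disjoint.\<close>

lemma interior_cells_iff:
  assumes k: "k \<le> n" and ab: "(a, b) \<in> L k" "cel k a b \<in> mesh k"
  shows "cel k a b \<in> interior_cells (mesh k) \<longleftrightarrow> 0 < a \<and> a + 1 < N * 2 ^ k \<and> 0 < b \<and> b + 1 < M * 2 ^ k"
proof -
  interpret X: knots "dy xs k" "N * 2 ^ k" by (rule knots_x)
  interpret Y: knots "dy ys k" "M * 2 ^ k" by (rule knots_y)
  have E: "mesh_edges (mesh k) = Edg (Skel k) (Vert k)" using k skeleton_mesh vertices_mesh by (simp add: mesh_edges_Edg)
  have r: "a < N * 2 ^ k" "b < M * 2 ^ k" using L_range[OF ab(1)] by auto
  have o: "dy xs k 0 < dy xs k (N * 2 ^ k)" "dy ys k 0 < dy ys k (M * 2 ^ k)" using X.t_less X.P Y.t_less Y.P by auto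
  note cs = cel_strict[OF ab(1)]
  have fr: "frontier (region (cel k a b)) = {(u, v). (u = dy xs k a \<or> u = dy xs k (a + 1)) \<and> v \<in> {dy ys k b..dy ys k (b + 1)}
      \<or> (v = dy ys k b \<or> v = dy ys k (b + 1)) \<and> u \<in> {dy xs k a..dy xs k (a + 1)}}"
    unfolding region_cellof by (rule frontier_rect[OF cs])
  have fd: "frontier (mesh_domain (mesh k)) = {(u, v). (u = dy xs k 0 \<or> u = dy xs k (N * 2 ^ k)) \<and> v \<in> {dy ys k 0..dy ys k (M * 2 ^ k)}
      \<or> (v = dy ys k 0 \<or> v = dy ys k (M * 2 ^ k)) \<and> u \<in> {dy xs k 0..dy xs k (N * 2 ^ k)}}"
    unfolding domain_level[OF k] by (rule frontier_rect[OF o])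
  have sub: "{dy xs k a..dy xs k (a + 1)} \<subseteq> {dy xs k 0..dy xs k (N * 2 ^ k)}" "{dy ys k b..dy ys k (b + 1)} \<subseteq> {dy ys k 0..dy ys k (M * 2 ^ k)}"
    using X.t_mono[of 0 a] X.t_mono[of "a + 1" "N * 2 ^ k"] Y.t_mono[of 0 b] Y.t_mono[of "b + 1" "M * 2 ^ k"] r by auto
  have I: "cel k a b \<in> interior_cells (mesh k) \<longleftrightarrow>
      (\<forall>e\<in>Edg (Skel k) (Vert k). e \<subseteq> frontier (region (cel k a b)) \<longrightarrow> \<not> e \<subseteq> frontier (mesh_domain (mesh k)))"
    unfolding interior_cells_def interior_edges_def boundary_edges_def E using ab(2) by auto
  show ?thesis
  proof
    assume int: "cel k a b \<in> interior_cells (mesh k)"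
    have no: "\<not> e \<subseteq> frontier (mesh_domain (mesh k))" if "e \<in> Edg (Skel k) (Vert k)" "e \<subseteq> frontier (region (cel k a b))" for e
      using int that unfolding I by blast
    have V: "i \<noteq> 0 \<and> i \<noteq> N * 2 ^ k" if i: "i = a \<or> i = a + 1" for i
    proof -
      obtain e where e: "e \<in> Edg (Skel k) (Vert k)" "e \<subseteq> {dy xs k i} \<times> {dy ys k b..dy ys k (b + 1)}"
        using vert_side[OF ab(1) i] by blast
      have "e \<subseteq> frontier (region (cel k a b))" using e(2) i unfolding fr by auto
      from no[OF e(1) this] obtain p where p: "p \<in> e" "p \<notin> frontier (mesh_domain (mesh k))" by blast
      then obtain v where v: "p = (dy xs k i, v)" "v \<in> {dy ys k 0..dy ys k (M * 2 ^ k)}" using e(2) sub(2) by blast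
      have "i = 0 \<or> i = N * 2 ^ k \<longrightarrow> p \<in> frontier (mesh_domain (mesh k))" using v unfolding fd by blast
      then show ?thesis using p(2) by auto
    qed
    have H: "j \<noteq> 0 \<and> j \<noteq> M * 2 ^ k" if j: "j = b \<or> j = b + 1" for j
    proof -
      obtain e where e: "e \<in> Edg (Skel k) (Vert k)" "e \<subseteq> {dy xs k a..dy xs k (a + 1)} \<times> {dy ys k j}"
        using horizontal_side[OF ab(1) j] by blast
      have "e \<subseteq> frontier (region (cel k a b))" using e(2) j unfolding fr by auto
      from no[OF e(1) this] obtain p where p: "p \<in> e" "p \<notin> frontier (mesh_domain (mesh k))" by blast
      then obtain u where v: "p = (u, dy ys k j)" "u \<in> {dy xs k 0..dy xs k (N * 2 ^ k)}" using e(2) sub(1) by blast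
      have "j = 0 \<or> j = M * 2 ^ k \<longrightarrow> p \<in> frontier (mesh_domain (mesh k))" using v unfolding fd by blast
      then show ?thesis using p(2) by auto
    qed
    show "0 < a \<and> a + 1 < N * 2 ^ k \<and> 0 < b \<and> b + 1 < M * 2 ^ k" using V[of a] V[of "a + 1"] H[of b] H[of "b + 1"] r by linarith
  next
    assume bd: "0 < a \<and> a + 1 < N * 2 ^ k \<and> 0 < b \<and> b + 1 < M * 2 ^ k"
    have lt: "dy xs k 0 < dy xs k a" "dy xs k (a + 1) < dy xs k (N * 2 ^ k)" "dy ys k 0 < dy ys k b" "dy ys k (b + 1) < dy ys k (M * 2 ^ k)"
      using X.t_less[of 0 a] X.t_less[of "a + 1" "N * 2 ^ k"] Y.t_less[of 0 b] Y.t_less[of "b + 1" "M * 2 ^ k"] bd by auto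
    have dis: "p \<notin> frontier (mesh_domain (mesh k))" if p: "p \<in> frontier (region (cel k a b))" for p
      using p lt cs unfolding fr fd by force
    have "e \<noteq> {}" if "e \<in> Edg (Skel k) (Vert k)" for e using that by (auto simp: Edg_def)
    then show "cel k a b \<in> interior_cells (mesh k)" unfolding I using dis by blast
  qed
qed

text \<open>A counted component has an l-edge through the centre of its cell; a divided neighbour
  would be divided by the same component, so the cell is isolated. Conversely, the component at the
  centre of an isolated cell cannot reach the centre of another cell. Disjointness of components
  makes the correspondence bijective.\<close>

theorem delta1_level_iso:
  assumes T: "\<And>j. j \<le> n \<Longrightarrow> T j = mesh j" and k: "k < n"
  shows "delta1_level T n (Suc k) = card (iso k)"
proof -
  define A where "A = level_part T n (Suc k)"
  define W where "W = {{v} | v. v \<in> mesh_vertices (T n) \<and> vertex_level T v = Suc k}"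
  have LLk: "level_ledges T n (Suc k) = LL k" by (rule level_ledges_LL) (use T k in auto)
  have A: "A = LL k \<union> W" unfolding A_def W_def level_part_def LLk ..
  have ne: "s \<noteq> {}" if "s \<in> A" for s
  proof (cases "s \<in> LL k")
    case True
    then obtain F where "F \<noteq> {}" "F \<subseteq> Eg" "s = \<Union>F" unfolding LL_def LE_def IL_def by blast
    then obtain e where "e \<in> Eg" "e \<subseteq> s" by blast
    then show ?thesis by (auto simp: Edg_def)
  qed (use that in \<open>auto simp: A W_def\<close>)
  then have "{} \<notin> A" by blast
  note cl = class_props[OF this]
  define C where "C = A // (meet_rel A)\<^sup>+"
  have Tk: "T k = mesh k" using T k by simp
  have kn: "k \<le> n" using k by simp
  define dc where "dc K = divided_cells T n (Suc k) K" for K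
  have dc: "\<psi> \<in> dc K \<longleftrightarrow> \<psi> \<in> mesh k \<and> (\<exists>l\<in>K \<inter> LL k. l \<inter> interior (region \<psi>) \<noteq> {})" for \<psi> K
    by (simp add: dc_def divided_cells_def LLk Tk)
  define X where "X = {K \<in> C. \<exists>\<phi>\<in>interior_cells (mesh k). dc K = {\<phi>}}"
  have d: "delta1_level T n (Suc k) = card X"
    by (simp add: delta1_level_def level_components_def X_def C_def A_def dc_def Tk)
  have meets: "cel k a b \<in> dc K" if "(a, b) \<in> D k" "l \<in> K" "l \<in> LL k" "ctr k a b \<in> l" for a b l K
    using ctr_interior[of a b k] D_L D_in_mesh that unfolding dc by blast
  have eq: "a' = a \<and> b' = b" if "cel k a' b' = cel k a b" "(a, b) \<in> D k" "(a', b') \<in> D k" for a b a' b'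
    using cel_inj[OF that(1)] that(2,3) D_L kn by auto
  have part1: "\<exists>a b. (a, b) \<in> iso k \<and> dc K = {cel k a b} \<and> (\<exists>l\<in>K. ctr k a b \<in> l)" if K: "K \<in> X" for K
  proof -
    obtain \<phi> where KC: "K \<in> C" and \<phi>: "\<phi> \<in> interior_cells (mesh k)" "dc K = {\<phi>}" using K unfolding X_def by blast
    then have "\<phi> \<in> dc K" by simp
    then obtain l where l: "l \<in> K" "l \<in> LL k" "\<phi> \<in> mesh k" "l \<inter> interior (region \<phi>) \<noteq> {}" unfolding dc by blast
    obtain a b where ab: "(a, b) \<in> D k" "\<phi> = cel k a b" "ctr k a b \<in> l" using line_divides[OF l(2) k l(3,4)] by blast
    have abL: "(a, b) \<in> L k" using ab(1) D_L by blast
    have bd: "0 < a \<and> a + 1 < N * 2 ^ k \<and> 0 < b \<and> b + 1 < M * 2 ^ k"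
      using interior_cells_iff[OF kn abL] \<phi>(1) l(3) unfolding ab(2) by blast
    have nb: "a' = a \<and> b' = b" if m: "m \<in> LL k" "ctr k a b \<in> m" "ctr k a' b' \<in> m" "(a', b') \<in> D k" for m a' b'
    proof -
      have "m \<in> K" using cl(2)[of K l m] KC l m(1,2) ab(3) A unfolding C_def by blast
      then have "cel k a' b' \<in> dc K" using meets m by blast
      then show ?thesis using \<phi>(2) ab eq m(4) by blast
    qed
    have "(a, b + 1) \<notin> D k" using vert_line_ctr(2)[OF ab(1)] nb[of _ a "b + 1"] by auto
    moreover have "(a + 1, b) \<notin> D k" using horizontal_line_ctr[OF ab(1)] nb[of _ "a + 1" b] by auto
    moreover have "(a, b - 1) \<notin> D k"
    proof
      assume D': "(a, b - 1) \<in> D k"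
      have e: "b - 1 + 1 = b" using bd by simp
      from vert_line_ctr(2)[OF D'] obtain m where "m \<in> LL k" "ctr k a (b - 1) \<in> m" "ctr k a b \<in> m" using ab(1) unfolding e by blast
      then have "b - 1 = b" using nb[of m a "b - 1"] D' by blast
      then show False using bd by linarith
    qed
    moreover have "(a - 1, b) \<notin> D k"
    proof
      assume D': "(a - 1, b) \<in> D k"
      have e: "a - 1 + 1 = a" using bd by simp
      from horizontal_line_ctr[OF D'] obtain m where "m \<in> LL k" "ctr k (a - 1) b \<in> m" "ctr k a b \<in> m" using ab(1) unfolding e by blast
      then have "a - 1 = a" using nb[of m "a - 1" b] D' by blast
      then show False using bd by linarith
    qed
    ultimately have "(a, b) \<in> iso k" using ab(1) bd by (simp add: iso_def)
    then show ?thesis using \<phi>(2) ab l(1) by blast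
  qed
  have part2: "\<exists>K\<in>X. dc K = {cel k a b}" if iso: "(a, b) \<in> iso k" for a b
  proof -
    have D': "(a, b) \<in> D k" and bd: "0 < a \<and> a + 1 < N * 2 ^ k \<and> 0 < b \<and> b + 1 < M * 2 ^ k" using iso by (auto simp: iso_def)
    have abL: "(a, b) \<in> L k" using D' D_L by blast
    obtain l where l: "l \<in> LL k" "ctr k a b \<in> l" using vert_line_ctr(1)[OF D'] by blast
    obtain K where K: "K \<in> C" "l \<in> K" using cl(1)[of l] l(1) unfolding A C_def by blast
    \<comment> \<open>The invariant is to meet the closed cell. By \<open>line_iso\<close> an l-edge
      that meets it lies inside, a vertex trivially so, and hence everything that meets such a
      member meets the cell again.\<close>
    have all: "s \<inter> region (cel k a b) \<noteq> {}" if "s \<in> K" for s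
    proof (rule cl(3)[of K l "\<lambda>s. s \<inter> region (cel k a b) \<noteq> {}"])
      show "K \<in> A // (meet_rel A)\<^sup>+" "l \<in> K" "s \<in> K" using K that unfolding C_def by auto
      show "l \<inter> region (cel k a b) \<noteq> {}" using l(2) ctr_interior[OF abL] interior_subset by blast
      fix s t
      assume s: "s \<inter> region (cel k a b) \<noteq> {}" "s \<in> A" "s \<inter> t \<noteq> {}"
      have "s \<subseteq> region (cel k a b)" using s(1,2) line_iso[OF _ iso] unfolding A W_def by blast
      then show "t \<inter> region (cel k a b) \<noteq> {}" using s(3) by blast
    qed
    have "dc K = {cel k a b}"
    proof (intro equalityI subsetI)
      fix \<psi>
      assume "\<psi> \<in> dc K"
      then obtain m where m: "m \<in> K" "m \<in> LL k" "\<psi> \<in> mesh k" "m \<inter> interior (region \<psi>) \<noteq> {}" unfolding dc by blast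
      obtain a' b' where ab': "(a', b') \<in> D k" "\<psi> = cel k a' b'" "ctr k a' b' \<in> m" using line_divides[OF m(2) k m(3,4)] by blast
      have "m \<subseteq> region (cel k a b)" using line_iso[OF m(2) iso] all[OF m(1)] by blast
      then have "a' = a \<and> b' = b" using ctr_region[of k a' b' a b] ab' abL D_L by blast
      then show "\<psi> \<in> {cel k a b}" using ab'(2) by simp
    qed (use meets[OF D' K(2) l] in simp)
    moreover from this have "cel k a b \<in> interior_cells (mesh k)" using interior_cells_iff[OF kn abL D_in_mesh[OF D']] bd by blast
    ultimately show ?thesis using K(1) unfolding X_def by blast
  qed
  have "bij_betw dc X ((\<lambda>(a, b). {cel k a b}) ` iso k)"
  proof (rule bij_betw_imageI)
    show "inj_on dc X"
    proof (rule inj_onI)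
      fix K K'
      assume K: "K \<in> X" "K' \<in> X" "dc K = dc K'"
      obtain a b l where 1: "(a, b) \<in> iso k" "dc K = {cel k a b}" "l \<in> K" "ctr k a b \<in> l" using part1[OF K(1)] by blast
      obtain a' b' l' where 2: "(a', b') \<in> iso k" "dc K' = {cel k a' b'}" "l' \<in> K'" "ctr k a' b' \<in> l'" using part1[OF K(2)] by blast
      have "a' = a \<and> b' = b" using eq[of a' b' a b] K(3) 1(1,2) 2(1,2) by (auto simp: iso_def)
      then have "l \<inter> l' \<noteq> {}" using 1(4) 2(4) by blast
      moreover have C: "K \<in> A // (meet_rel A)\<^sup>+" "K' \<in> A // (meet_rel A)\<^sup>+" using K unfolding X_def C_def by blast+
      ultimately have "l' \<in> K" using cl(2)[OF C(1) 1(3)] subsetD[OF cl(5)[OF C(2)] 2(3)] by blast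
      from cl(4)[OF C this 2(3)] show "K = K'" .
    qed
    show "dc ` X = (\<lambda>(a, b). {cel k a b}) ` iso k"
    proof (intro equalityI subsetI)
      fix Y
      assume "Y \<in> dc ` X"
      then obtain K where "K \<in> X" "Y = dc K" by blast
      then obtain a b where "(a, b) \<in> iso k" "Y = {cel k a b}" using part1 by blast
      then show "Y \<in> (\<lambda>(a, b). {cel k a b}) ` iso k" by force
    next
      fix Y
      assume "Y \<in> (\<lambda>(a, b). {cel k a b}) ` iso k"
      then obtain a b where ab: "(a, b) \<in> iso k" "Y = {cel k a b}" by auto
      obtain K where "K \<in> X" "dc K = {cel k a b}" using part2[OF ab(1)] by blast
      then show "Y \<in> dc ` X" using ab(2) by blast
    qed
  qed
  then have "card X = card ((\<lambda>(a, b). {cel k a b}) ` iso k)" by (rule bij_betw_same_card)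
  also have "\<dots> = card (iso k)"
    using eq by (intro card_image inj_onI) (auto simp: iso_def)
  finally show ?thesis using d by simp
qed

end

section \<open>Counting vertices and l-edges level by level\<close>

text \<open>Used on vertex indices of level \<open>Suc k\<close>: two even indices mean an old
  point, one odd index the midpoint of a side, two odd indices the centre of a cell.\<close>

lemma card_parity:
  assumes "finite S"
  shows "card S = card {(i, j). (2 * i, 2 * j) \<in> S} + card {(i, j). (2 * i + 1, 2 * j) \<in> S}
    + card {(i, j). (2 * i, 2 * j + 1) \<in> S} + card {(i, j). (2 * i + 1, 2 * j + 1) \<in> (S :: (nat \<times> nat) set)}"
proof -
  define f where "f e d = (\<lambda>(i, j). (2 * i + e, 2 * j + d))" for e d :: nat
  define P where "P e d = {(i, j). (2 * i + e, 2 * j + d) \<in> S}" for e d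
  have img: "f e d ` P e d = {q \<in> S. fst q mod 2 = e \<and> snd q mod 2 = d}" if "e < 2" "d < 2" for e d
  proof (intro equalityI subsetI)
    fix q
    assume "q \<in> {q \<in> S. fst q mod 2 = e \<and> snd q mod 2 = d}"
    then have "q \<in> S" "fst q = 2 * (fst q div 2) + e" "snd q = 2 * (snd q div 2) + d" by auto
    then show "q \<in> f e d ` P e d"
      by (intro image_eqI[of _ _ "(fst q div 2, snd q div 2)"]) (auto simp: f_def P_def prod_eq_iff)
  qed (use that in \<open>auto simp: f_def P_def\<close>)
  have c: "card (P e d) = card {q \<in> S. fst q mod 2 = e \<and> snd q mod 2 = d}" if "e < 2" "d < 2" for e d
    unfolding img[OF that, symmetric] by (rule card_image[symmetric]) (auto simp: inj_on_def f_def)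
  have fin: "finite {q \<in> S. Pr q}" for Pr using assms by simp
  have "card S = card ({q \<in> S. fst q mod 2 = 0 \<and> snd q mod 2 = 0} \<union> {q \<in> S. fst q mod 2 = 1 \<and> snd q mod 2 = 0}
      \<union> {q \<in> S. fst q mod 2 = 0 \<and> snd q mod 2 = 1} \<union> {q \<in> S. fst q mod 2 = 1 \<and> snd q mod 2 = 1})"
    by (rule arg_cong[where f = card]) auto
  also have "\<dots> = card (P 0 0) + card (P 1 0) + card (P 0 1) + card (P 1 1)"
    using fin by (simp add: card_Un_disjoint disjoint_iff c)
  finally show ?thesis by (simp add: P_def)
qed

lemma swap_Collect: "prod.swap ` A = {(j, i). (i, j) \<in> A}"
  by force

lemma card_swap: "card (prod.swap ` A) = card A"
  by (rule card_image) (auto simp: inj_on_def)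

context dyadic
begin

text \<open>\<open>bnd\<close> and \<open>crs\<close> index the boundary vertices and
  crossing-vertices, \<open>sts\<close> the lower ends of vertical l-edges. \<open>adj\<close>
  collects the divided cells with a divided cell directly below, and \<open>bor\<close> counts those
  at the lower or upper side of the domain, a cell at both sides twice.\<close>

definition bnd :: "nat \<Rightarrow> (nat \<times> nat) set" where
  "bnd k = {(i, j). vtx k i j \<and> (i = 0 \<or> i = N * 2 ^ k \<or> j = 0 \<or> j = M * 2 ^ k)}"

definition crs :: "nat \<Rightarrow> (nat \<times> nat) set" where
  "crs k = {(i, j). 0 < i \<and> i < N * 2 ^ k \<and> 0 < j \<and> j < M * 2 ^ k \<and>
    vs k i j \<and> vs k i (j - 1) \<and> hs k i j \<and> hs k (i - 1) j}"

definition sts :: "nat \<Rightarrow> (nat \<times> nat) set" where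
  "sts k = {(i, j). 0 < i \<and> i < N * 2 ^ k \<and> vs k i j \<and> \<not> (0 < j \<and> vs k i (j - 1))}"

definition adj :: "nat \<Rightarrow> (nat \<times> nat) set" where
  "adj k = {(a, b) \<in> D k. 0 < b \<and> (a, b - 1) \<in> D k}"

definition bor :: "nat \<Rightarrow> nat" where
  "bor k = card {(a, b) \<in> D k. b = 0} + card {(a, b) \<in> D k. b + 1 = M * 2 ^ k}"

lemma hs_range: "hs k i j \<Longrightarrow> i < N * 2 ^ k \<and> j \<le> M * 2 ^ k"
proof -
  interpret S: dyadic M N n "swp D" by (rule dyadic_swp)
  show "hs k i j \<Longrightarrow> i < N * 2 ^ k \<and> j \<le> M * 2 ^ k" using S.vs_range by blast
qed

lemma vtx_range: "vtx k i j \<Longrightarrow> i \<le> N * 2 ^ k \<and> j \<le> M * 2 ^ k"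
  using vs_range[of k i j] vs_range[of k i "j - 1"] by (auto simp: vtx_def)

lemma finite_sets: "finite (bnd k)" "finite (crs k)" "finite (sts k)" "finite (adj k)"
proof -
  have fin: "finite ({..N * 2 ^ k} \<times> {..M * 2 ^ k})" by simp
  show "finite (bnd k)" by (rule finite_subset[OF _ fin]) (use vtx_range in \<open>auto simp: bnd_def\<close>)
  show "finite (crs k)" by (rule finite_subset[OF _ fin]) (auto simp: crs_def)
  show "finite (sts k)" by (rule finite_subset[OF _ fin]) (use vs_range[of k] in \<open>auto simp: sts_def less_imp_le\<close>)
  show "finite (adj k)" by (rule finite_subset[OF _ finite_D[of k]]) (auto simp: adj_def)
qed

lemma swp_sets:
  "dyadic.vtx M N (swp D) k j i = vtx k i j" "dyadic.bnd M N (swp D) k = prod.swap ` bnd k"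
proof -
  interpret S: dyadic M N n "swp D" by (rule dyadic_swp)
  show v: "S.vtx k j i = vtx k i j" for i j by (auto simp: S.vtx_def vtx_def)
  show "S.bnd k = prod.swap ` bnd k" unfolding S.bnd_def bnd_def v by force
qed

lemma mult2_eq: "2 * i = P * 2 ^ Suc k \<longleftrightarrow> i = P * 2 ^ k" "2 * i < P * 2 ^ Suc k \<longleftrightarrow> i < P * 2 ^ k"
  "2 * i + 1 \<noteq> P * 2 ^ Suc k" "2 * i + 1 < P * 2 ^ Suc k \<longleftrightarrow> i < P * 2 ^ k" for i P :: nat
proof -
  have e: "P * 2 ^ Suc k = 2 * (P * 2 ^ k)" by simp
  show "2 * i = P * 2 ^ Suc k \<longleftrightarrow> i = P * 2 ^ k" "2 * i < P * 2 ^ Suc k \<longleftrightarrow> i < P * 2 ^ k"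
    "2 * i + 1 \<noteq> P * 2 ^ Suc k" "2 * i + 1 < P * 2 ^ Suc k \<longleftrightarrow> i < P * 2 ^ k"
    unfolding e by presburger+
qed

lemma M_pow: "0 < M * 2 ^ k"
  using M by simp

lemma bnd_odd_even: "card {(i, j). (2 * i + 1, 2 * j) \<in> bnd (Suc k)} = bor k"
proof -
  define f where "f = (\<lambda>(a :: nat, b :: nat). (a, b + 1))"
  let ?A = "{(a, b) \<in> D k. b = 0}" and ?B = "{(a, b) \<in> D k. b + 1 = M * 2 ^ k}"
  have "{(i, j). (2 * i + 1, 2 * j) \<in> bnd (Suc k)} = ?A \<union> f ` ?B"
  proof (intro equalityI subsetI)
    fix q
    assume "q \<in> {(i, j). (2 * i + 1, 2 * j) \<in> bnd (Suc k)}"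
    then obtain i j where q: "q = (i, j)" "(i, j) \<in> D k \<or> (0 < j \<and> (i, j - 1) \<in> D k)" "j = 0 \<or> j = M * 2 ^ k"
      unfolding bnd_def using vtx_rec(3)[of k] mult2_eq[of _ N k] mult2_eq[of _ M k] by auto
    show "q \<in> ?A \<union> f ` ?B"
    proof (cases "j = 0")
      case True
      then show ?thesis using q by simp
    next
      case False
      then have "j = M * 2 ^ k" using q by simp
      moreover have "(i, M * 2 ^ k) \<notin> D k" using D_range by blast
      ultimately have "(i, j - 1) \<in> ?B" "q = f (i, j - 1)" using q False by (auto simp: f_def)
      then show ?thesis by blast
    qed
  next
    fix q
    assume "q \<in> ?A \<union> f ` ?B"
    then obtain i j where q: "q = (i, j)" "(i, j) \<in> D k \<or> (0 < j \<and> (i, j - 1) \<in> D k)" "j = 0 \<or> j = M * 2 ^ k"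
    proof
      assume "q \<in> f ` ?B"
      then obtain a b where ab: "q = (a, b + 1)" "(a, b) \<in> D k" "b + 1 = M * 2 ^ k" by (auto simp: f_def)
      show thesis by (rule that[of a "b + 1"]) (use ab(1) in blast, use ab(2) in simp, use ab(3) in blast)
    qed auto
    then have "vtx (Suc k) (2 * i + 1) (2 * j)" "2 * j = 0 \<or> 2 * j = M * 2 ^ Suc k" using vtx_rec(3) mult2_eq(1)[of j M k] by auto
    then show "q \<in> {(i, j). (2 * i + 1, 2 * j) \<in> bnd (Suc k)}" unfolding bnd_def q(1) by blast
  qed
  moreover have "finite ?A" "finite ?B" using finite_D by (auto intro: finite_subset[OF _ finite_D[of k]])
  moreover have "?A \<inter> f ` ?B = {}" by (auto simp: f_def)
  moreover have "card (f ` ?B) = card ?B" by (rule card_image) (auto simp: inj_on_def f_def)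
  ultimately show ?thesis by (simp add: card_Un_disjoint bor_def)
qed

lemma bnd_even: "{(i, j). (2 * i, 2 * j) \<in> bnd (Suc k)} = bnd k"
  unfolding bnd_def using vtx_rec(1)[of k] mult2_eq(1)[of _ N k] mult2_eq(1)[of _ M k] by auto

lemma bnd_odd: "{(i, j). (2 * i + 1, 2 * j + 1) \<in> bnd (Suc k)} = {}"
  unfolding bnd_def using mult2_eq(3)[of _ N k] mult2_eq(3)[of _ M k] by auto

text \<open>The new boundary vertices are the midpoints of those sides of divided cells that lie on
  the domain boundary.\<close>

lemma card_bnd_Suc: "card (bnd (Suc k)) = card (bnd k) + bor k + dyadic.bor N (swp D) k"
proof -
  interpret S: dyadic M N n "swp D" by (rule dyadic_swp)
  have "{(j, i). (2 * j + 1, 2 * i) \<in> S.bnd (Suc k)} = prod.swap ` {(i, j). (2 * i, 2 * j + 1) \<in> bnd (Suc k)}"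
    unfolding swp_sets(2) swap_Collect by auto
  then have "card {(i, j). (2 * i, 2 * j + 1) \<in> bnd (Suc k)} = S.bor k"
    using S.bnd_odd_even[of k] by (simp only: card_swap)
  then show ?thesis
    using card_parity[OF finite_sets(1)[of "Suc k"]] bnd_even bnd_odd bnd_odd_even by simp
qed

text \<open>The new crossing-vertices are the centres of the divided cells and the midpoints of the
  sides between two divided cells; old vertices keep their type.\<close>

lemma crs_parts:
  "{(i, j). (2 * i, 2 * j) \<in> crs (Suc k)} = crs k"
  "{(i, j). (2 * i + 1, 2 * j) \<in> crs (Suc k)} = adj k"
  "{(i, j). (2 * i, 2 * j + 1) \<in> crs (Suc k)} = prod.swap ` dyadic.adj (swp D) k"
  "{(i, j). (2 * i + 1, 2 * j + 1) \<in> crs (Suc k)} = D k"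
proof -
  interpret S: dyadic M N n "swp D" by (rule dyadic_swp)
  have "(2 * i, 2 * j) \<in> crs (Suc k) \<longleftrightarrow> (i, j) \<in> crs k" for i j
    by (simp only: crs_def mem_Collect_eq prod.case vseg_even parity_div mult2_eq) auto
  then show "{(i, j). (2 * i, 2 * j) \<in> crs (Suc k)} = crs k" by auto
  have "(2 * i + 1, 2 * j) \<in> crs (Suc k) \<longleftrightarrow> (i, j) \<in> adj k" for i j
  proof -
    have "(i, j) \<in> D k \<Longrightarrow> hs k i j \<and> i < N * 2 ^ k \<and> j < M * 2 ^ k" using hs_sides D_L D_range by blast
    then show ?thesis
      by (simp only: crs_def adj_def mem_Collect_eq prod.case vseg_even vseg_odd parity_div mult2_eq) auto
  qed
  then show "{(i, j). (2 * i + 1, 2 * j) \<in> crs (Suc k)} = adj k" by auto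
  have "(2 * i, 2 * j + 1) \<in> crs (Suc k) \<longleftrightarrow> (j, i) \<in> S.adj k" for i j
  proof -
    have "(i, j) \<in> D k \<Longrightarrow> vs k i j \<and> i < N * 2 ^ k \<and> j < M * 2 ^ k" using vs_sides D_L D_range by blast
    then show ?thesis
      by (simp only: crs_def S.adj_def mem_Collect_eq prod.case vseg_even vseg_odd parity_div mult2_eq swp_iff) auto
  qed
  then show "{(i, j). (2 * i, 2 * j + 1) \<in> crs (Suc k)} = prod.swap ` S.adj k" by force
  have "(2 * i + 1, 2 * j + 1) \<in> crs (Suc k) \<longleftrightarrow> (i, j) \<in> D k" for i j
    using D_range[of i j k]
    by (simp only: crs_def mem_Collect_eq prod.case vseg_even vseg_odd parity_div mult2_eq swp_iff add_diff_cancel_right') auto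
  then show "{(i, j). (2 * i + 1, 2 * j + 1) \<in> crs (Suc k)} = D k" by auto
qed

lemma card_crs_Suc: "card (crs (Suc k)) = card (crs k) + card (D k) + card (adj k) + card (dyadic.adj (swp D) k)"
  using card_parity[OF finite_sets(2)[of "Suc k"]] by (simp only: crs_parts card_swap)

text \<open>A divided cell starts a new vertical l-edge unless the cell below is divided too, whose
  l-edge then continues. Stated with a sum to avoid subtraction of naturals.\<close>

lemma card_sts_Suc: "card (sts (Suc k)) + card (adj k) = card (sts k) + card (D k)"
proof -
  have "(2 * i, 2 * j) \<in> sts (Suc k) \<longleftrightarrow> (i, j) \<in> sts k" for i j
    by (simp only: sts_def mem_Collect_eq prod.case vseg_even parity_div mult2_eq) auto
  then have 1: "{(i, j). (2 * i, 2 * j) \<in> sts (Suc k)} = sts k" by auto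
  have "(2 * i + 1, 2 * j) \<in> sts (Suc k) \<longleftrightarrow> (i, j) \<in> D k - adj k" for i j
    using D_range[of i j k]
    by (simp only: sts_def adj_def Diff_iff mem_Collect_eq prod.case vseg_odd parity_div mult2_eq) auto
  then have 2: "{(i, j). (2 * i + 1, 2 * j) \<in> sts (Suc k)} = D k - adj k" by auto
  have "(2 * i, 2 * j + 1) \<notin> sts (Suc k)" "(2 * i + 1, 2 * j + 1) \<notin> sts (Suc k)" for i j
    by (simp_all only: sts_def mem_Collect_eq prod.case vseg_even vseg_odd parity_div add_diff_cancel_right') auto
  then have 3: "{(i, j). (2 * i, 2 * j + 1) \<in> sts (Suc k)} = {}" "{(i, j). (2 * i + 1, 2 * j + 1) \<in> sts (Suc k)} = {}" by auto
  have sub: "adj k \<subseteq> D k" by (auto simp: adj_def)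
  have "card (D k - adj k) + card (adj k) = card (D k)"
    using card_Diff_subset[OF finite_sets(4) sub] card_mono[OF finite_D sub] by simp
  then show ?thesis using card_parity[OF finite_sets(3)[of "Suc k"]] unfolding 1 2 3 by simp
qed

text \<open>An active point either joins the midlines of two divided cells, one above the other, or
  is the end of a midline on the domain boundary.\<close>

lemma card_act: "card (act M D k) = card (adj k) + bor k"
proof -
  define f where "f = (\<lambda>(a :: nat, b :: nat). (a, b + 1))"
  let ?A = "{(a, b) \<in> D k. b = 0}" and ?B = "{(a, b) \<in> D k. b + 1 = M * 2 ^ k}"
  have act: "(a, b) \<in> act M D k \<longleftrightarrow> (a, b) \<in> adj k \<or> (a, b) \<in> ?A \<or> (a, b) \<in> f ` ?B" for a b
  proof -
    have fB: "(a, b) \<in> f ` ?B \<longleftrightarrow> 0 < b \<and> (a, b - 1) \<in> D k \<and> b = M * 2 ^ k"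
      by (cases b) (force simp: f_def)+
    have "(a, b) \<in> D k \<Longrightarrow> b < M * 2 ^ k" using D_range by blast
    then show ?thesis using M_pow[of k] unfolding fB by (auto simp: act_def adj_def)
  qed
  have "act M D k = adj k \<union> (?A \<union> f ` ?B)" using act by auto
  moreover have "finite ?A" "finite ?B" using finite_D by (auto intro: finite_subset[OF _ finite_D[of k]])
  moreover have "?A \<inter> f ` ?B = {}" by (auto simp: f_def)
  moreover have "adj k \<inter> (?A \<union> f ` ?B) = {}" using D_range by (fastforce simp: adj_def f_def)
  moreover have "card (f ` ?B) = card ?B" by (rule card_image) (auto simp: inj_on_def f_def)
  ultimately show ?thesis using finite_sets(4)[of k] by (simp add: card_Un_disjoint bor_def)
qed

lemma vtx_0: "vtx 0 i j \<longleftrightarrow> i \<le> N \<and> j \<le> M"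
  using N M by (auto simp: vtx_def le_less)

lemma card_0: "card (bnd 0) = 2 * N + 2 * M" "card (crs 0) = (N - 1) * (M - 1)" "card (sts 0) = N - 1"
proof -
  have "bnd 0 = {..N} \<times> {..M} - {1..<N} \<times> {1..<M}" unfolding bnd_def vtx_0 by auto
  then have "card (bnd 0) = (N + 1) * (M + 1) - (N - 1) * (M - 1)"
    by (simp add: card_Diff_subset subset_iff)
  also have "\<dots> = 2 * N + 2 * M" using N M by (cases N; cases M) auto
  finally show "card (bnd 0) = 2 * N + 2 * M" .
  have "crs 0 = {1..<N} \<times> {1..<M}" by (auto simp: crs_def)
  then show "card (crs 0) = (N - 1) * (M - 1)" by simp
  have "sts 0 = {1..<N} \<times> {0}" using M by (auto simp: sts_def)
  then show "card (sts 0) = N - 1" by simp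
qed

lemma card_levels:
  "int (card (bnd k)) = 2 * int N + 2 * int M + (\<Sum>j<k. int (bor j) + int (dyadic.bor N (swp D) j))"
  "int (card (crs k)) = int ((N - 1) * (M - 1)) + (\<Sum>j<k. int (card (D j)) + int (card (adj j)) + int (card (dyadic.adj (swp D) j)))"
  "int (card (sts k)) = int (N - 1) + (\<Sum>j<k. int (card (D j)) - int (card (adj j)))"
proof -
  show "int (card (bnd k)) = 2 * int N + 2 * int M + (\<Sum>j<k. int (bor j) + int (dyadic.bor N (swp D) j))"
    by (induction k) (simp_all add: card_0 card_bnd_Suc)
  show "int (card (crs k)) = int ((N - 1) * (M - 1)) + (\<Sum>j<k. int (card (D j)) + int (card (adj j)) + int (card (dyadic.adj (swp D) j)))"
    by (induction k) (simp_all add: card_0 card_crs_Suc)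
  show "int (card (sts k)) = int (N - 1) + (\<Sum>j<k. int (card (D j)) - int (card (adj j)))"
  proof (induction k)
    case (Suc k)
    then show ?case using card_sts_Suc[of k] by simp
  qed (simp add: card_0)
qed

lemma card_D_swp: "card (swp D k) = card (D k)"
proof -
  have "swp D k = prod.swap ` D k" unfolding swap_Collect swp_def ..
  then show ?thesis by (simp only: card_swap)
qed

end

context hmesh
begin

lemma card_boundary_vertices: "card (boundary_vertices (mesh n)) = card (bnd n)"
  and card_crossing_vertices: "card (crossing_vertices (mesh n)) = card (crs n)"
  and card_interior_ledges: "card (interior_ledges (mesh n)) = card (sts n) + card (dyadic.sts M N (swp D) n)"
proof -
  interpret S: dyadic M N n "swp D" by (rule dyadic_swp)
  interpret G: grid "dy xs n" "dy ys n" "N * 2 ^ n" "M * 2 ^ n" "vs n" "hs n" by (rule grid_level)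
  interpret GS: grid "dy ys n" "dy xs n" "M * 2 ^ n" "N * 2 ^ n" "\<lambda>j i. hs n i j" "\<lambda>j i. vs n i j" by (rule G.grid_swp)
  define h where "h = (\<lambda>(i, j). (dy xs n i, dy ys n j))"
  have E: "mesh_edges (mesh n) = Eg" using skeleton_mesh vertices_mesh by (simp add: mesh_edges_Edg)
  have Vx: "mesh_vertices (mesh n) = Vert n" using vertices_mesh by simp
  have dom: "mesh_domain (mesh n) = G.bx" using domain_mesh Bx by simp
  have vtx: "vtx n i j = G.vertex i j" for i j by (simp add: vtx_def G.vertex_def)
  have V: "Vert n = h ` {(i, j). vtx n i j}" unfolding vtx G.Vx_def h_def by auto
  have injh: "inj_on h {(i, j). vtx n i j}"
    using vtx_range by (auto simp: inj_on_def h_def dm.X.t_eq_iff dm.Y.t_eq_iff)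
  have P0: "0 \<le> N * 2 ^ n" "0 \<le> M * 2 ^ n" by simp_all
  have bd: "h (i, j) \<in> frontier G.bx \<longleftrightarrow> (i, j) \<in> bnd n" if "vtx n i j" for i j
  proof -
    have r: "i \<le> N * 2 ^ n" "j \<le> M * 2 ^ n" using vtx_range[OF that] by auto
    then show ?thesis using that dm.X.t_mono[of 0 i] dm.X.t_mono[of i "N * 2 ^ n"] dm.Y.t_mono[of 0 j] dm.Y.t_mono[of j "M * 2 ^ n"]
        dm.X.t_eq_iff[OF r(1) P0(1)] dm.X.t_eq_iff[OF r(1) order.refl] dm.Y.t_eq_iff[OF r(2) P0(2)] dm.Y.t_eq_iff[OF r(2) order.refl]
      unfolding G.frontier_bx h_def bnd_def by auto
  qed
  have B: "boundary_vertices (mesh n) = h ` bnd n"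
    unfolding boundary_vertices_def Vx V dom using bd by (auto simp: bnd_def)
  moreover have "inj_on h (bnd n)" by (rule inj_on_subset[OF injh]) (auto simp: bnd_def)
  ultimately show "card (boundary_vertices (mesh n)) = card (bnd n)" by (simp add: card_image)
  have val: "valence (mesh n) (h (i, j)) = 4 \<longleftrightarrow> vs n i j \<and> 0 < j \<and> vs n i (j - 1) \<and> hs n i j \<and> 0 < i \<and> hs n (i - 1) j"
    if "vtx n i j" for i j
    using G.card_edges_at[OF that[unfolded vtx]] unfolding valence_def E h_def by (simp add: of_bool_def)
  have crs: "(i, j) \<in> crs n \<longleftrightarrow> vtx n i j \<and> (i, j) \<notin> bnd n \<and> valence (mesh n) (h (i, j)) = 4" for i j
  proof (cases "vtx n i j")
    case True
    then show ?thesis using val[OF True] vtx_range[OF True] by (auto simp: crs_def bnd_def)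
  next
    case False
    then show ?thesis by (auto simp: crs_def vtx_def)
  qed
  have "crossing_vertices (mesh n) = h ` crs n"
  proof (intro equalityI subsetI)
    fix p
    assume p: "p \<in> crossing_vertices (mesh n)"
    then obtain i j where ij: "p = h (i, j)" "vtx n i j" unfolding crossing_vertices_def interior_vertices_def Vx V by auto
    then have "(i, j) \<in> crs n" unfolding crs using p B by (auto simp: crossing_vertices_def interior_vertices_def)
    then show "p \<in> h ` crs n" using ij by blast
  next
    fix p
    assume "p \<in> h ` crs n"
    then obtain i j where ij: "p = h (i, j)" "(i, j) \<in> crs n" by auto
    then have c: "vtx n i j" "(i, j) \<notin> bnd n" "valence (mesh n) p = 4" unfolding crs by auto
    then have "p \<notin> boundary_vertices (mesh n)" using bd[OF c(1)] unfolding boundary_vertices_def dom ij(1) by simp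
    then show "p \<in> crossing_vertices (mesh n)" using c ij unfolding crossing_vertices_def interior_vertices_def Vx V by auto
  qed
  moreover have "inj_on h (crs n)" by (rule inj_on_subset[OF injh]) (use crs in auto)
  ultimately show "card (crossing_vertices (mesh n)) = card (crs n)" by (simp add: card_image)
  have "G.vstarts = sts n" unfolding G.vstarts_def sts_def ..
  moreover have "GS.vstarts = S.sts n" unfolding GS.vstarts_def S.sts_def by simp
  ultimately show "card (interior_ledges (mesh n)) = card (sts n) + card (S.sts n)"
    unfolding interior_ledges_LE E dom using G.card_LE by simp
qed

text \<open>Both sides start with \<open>N * M + 2 * N + 2 * M + 4\<close> for the initial mesh.
  Each level then adds twice the numbers of active points of both directions, minus
  \<open>card (D k)\<close>, plus \<open>card (iso k)\<close>; on the right, \<open>card_act\<close>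
  splits the active points into \<open>adj\<close> and \<open>bor\<close>.\<close>

theorem dim_hmesh:
  assumes T: "\<And>j. j \<le> n \<Longrightarrow> T j = mesh j"
  shows "int (fun_space.dim (spline_space 2 (T n))) =
    2 * int (card (boundary_vertices (T n))) + int (card (crossing_vertices (T n)))
      - int (card (interior_ledges (T n))) + int (delta1 T n) + 1"
proof -
  interpret S: hmesh M N n "swp D" ys xs by (rule hmesh_swp)
  have Tn: "T n = mesh n" using T by simp
  have delta: "int (delta1 T n) = (\<Sum>k<n. int (card (iso k)))"
  proof -
    have "delta1 T n = (\<Sum>k<n. delta1_level T n (Suc k))"
      unfolding delta1_def by (rule sum.reindex_bij_witness[of _ Suc "\<lambda>i. i - 1"]) auto
    then show ?thesis using delta1_level_iso[OF T] by simp
  qed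
  have NM: "int ((N - 1) * (M - 1)) = int N * int M - int N - int M + 1" "int (N - 1) = int N - 1" "int (M - 1) = int M - 1"
    using N M by (cases N; cases M; simp add: algebra_simps)+
  have dim: "int (fun_space.dim (spline_space 2 (T n))) = int N * int M + 2 * int N + 2 * int M + 4
    + (\<Sum>k<n. 2 * int (card (act M D k)) + 2 * int (card (act N (swp D) k)) - int (card (D k)) + int (card (iso k)))"
    unfolding Tn spline_space_mesh by (rule dm.dim_splines_count)
  show ?thesis
    unfolding dim delta unfolding Tn card_boundary_vertices card_crossing_vertices card_interior_ledges of_nat_add card_levels S.card_levels
      card_act S.card_act NM swp_swp card_D_swp
    by (simp add: sum.distrib sum_subtractf sum_distrib_left[symmetric])
qed

end

theorem theorem5p7:
  fixes T :: "nat \<Rightarrow> cell set" and n :: nat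
  assumes "hierarchical_mesh T n"
  shows "int (fun_space.dim (spline_space 2 (T n))) =
    2 * int (card (boundary_vertices (T n))) + int (card (crossing_vertices (T n)))
      - int (card (interior_ledges (T n))) + int (delta1 T n) + 1"
proof -
  obtain N M D xs ys where h: "hmesh N M n D xs ys" "\<forall>k\<le>n. T k = meshof N M D xs ys k"
    using hierarchical_mesh_index[OF assms] by blast
  show ?thesis by (rule hmesh.dim_hmesh[OF h(1)]) (use h(2) in blast)
qed

end
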